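(* Let $\mathfrak F=(\mathcal V,\mathcal F,\imath)$ be a Feynman category or a non-$\Sigma$ Feynman category. If $\mathfrak F$ is almost connected with respect to a given definite integer degree function, then $\mathfrak F$ is Hopf.
   Context: Comma categories: for functors $f:\mathcal F'\to\mathcal F$, $g:\mathcal F''\to\mathcal F$, the category $(f\downarrow g)$ has objects the triples $(X,Y,\phi:f(X)\to g(Y))$ and morphisms the pairs $(\psi:X\to X',\psi':Y\to Y')$ with $g(\psi')\circ\phi=\phi'\circ f(\psi)$. $Iso(\mathcal C)$ is the maximal subgroupoid of $\mathcal C$. For a groupoid $\mathcal V$, $\mathcal V^\otimes$ is the free symmetric monoidal category on $\mathcal V$ (in the non-$\Sigma$ case: the free monoidal category); a functor $\imath:\mathcal V\to\mathcal F$ extends to a (symmetric) monoidal functor $\imath^\otimes$. Write $(\mathcal F\downarrow\mathcal F)=(id_{\mathcal F}\downarrow id_{\mathcal F})$, $(\mathcal F\downarrow\mathcal V)=(id_{\mathcal F}\downarrow\imath)$. A Feynman category is a triple $(\mathcal V,\mathcal F,\imath)$ with $\mathcal V$ a groupoid, $(\mathcal F,\otimes,\mathbb 1)$ a symmetric monoidal category, $\imath:\mathcal V\to\mathcal F$ a functor, such that (i) $\imath^\otimes$ induces an equivalence of symmetric monoidal groupoids $\mathcal V^\otimes\simeq Iso(\mathcal F)$; (ii) $\imath$ and $\imath^\otimes$ induce (via $(\phi_v)_v\mapsto\bigotimes_v\phi_v$) an equivalence of symmetric monoidal groupoids $Iso(\mathcal F\downarrow\mathcal V)^\otimes\simeq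 Iso(\mathcal F\downarrow\mathcal F)$; (iii) for every object $*_v$ of $\mathcal V$, $(\mathcal F\downarrow *_v)$ is essentially small. Non-$\Sigma$: replace "symmetric monoidal" by "monoidal" throughout. Morphisms $f:X\to Y$, $g:X'\to Y'$ satisfy $f\sim g$ if there are isomorphisms $\sigma:X\to X'$, $\sigma':Y\to Y'$ with $f=\sigma'^{-1}\circ g\circ\sigma$; $[f]$ is the class. $\mathcal B^{iso}$ is the free Abelian group on isomorphism classes of morphisms, with product $[\phi][\psi]=[\phi\otimes\psi]$ and unit $[id_{\mathbb 1}]$. Factorizations $\phi=\phi_0\circ\phi_1$ through $Y$ and $\phi=\phi'_0\circ\phi'_1$ through $Y'$ are equivalent if $\phi_0'=\phi_0\sigma^{-1}$, $\phi_1'=\sigma\phi_1$ for an isomorphism $\sigma:Y\to Y'$. $\mathcal F$ (or $\mathfrak F$) is factorization finite if for every $\phi$ only finitely many isomorphism classes of intermediate objects occur and for each fixed $Y$ there are finitely many equivalence classes of factorizations through $Y$. Then $\Delta^{iso}([\phi])=\sum_{[(\phi_0,\phi_1)]}[\phi_0]\otimes[\phi_1]$ (sum over equivalence classes of factorizations of a fixed representative), and $\epsilon^{iso}([\phi])=1$ if $[\phi]=[id_X]$ for some $X$, else $0$. This makes $\mathcal B^{iso}$ a bi-algebra. $\mathfrak F$ has almost group-like identities if for every factorization $id_X=\phi_L\circ\phi_R$ of an identity both $\phi_L$ and $\phi_R$ are isomorphisms. $\mathcal I=\langle[id_X]-[id_Y]\rangle$ is the two-sided ideal of $\mathcal B^{iso}$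 generated by these differences for all objects $X,Y$; for factorization finite $\mathfrak F$ with almost group-like identities $\mathcal H=\mathcal B^{iso}/\mathcal I$ is a bi-algebra. $\mathfrak F$ is Hopf if it is factorization finite, has almost group-like identities, and $\mathcal H$ has an antipode. An integer degree function is a function $\deg:\mathrm{Mor}(\mathcal F)\to\mathbb Z$ with $\deg(\phi\circ\psi)=\deg(\phi)+\deg(\psi)$ (when composable), $\deg(\phi\otimes\psi)=\deg(\phi)+\deg(\psi)$, and $\deg=0$ on isomorphisms. It is definite if all degrees are $\ge0$ or all degrees are $\le 0$. For definite $\deg$, let $\mathcal B_0^{iso}\subset\mathcal B^{iso}$ be the span of the classes of degree-$0$ morphisms (a sub-bi-algebra), $\mathcal I_0=\mathcal I\cap\mathcal B_0^{iso}$ and $\mathcal H_0^{iso}=\mathcal B_0^{iso}/\mathcal I_0$. $\mathfrak F$ is almost connected with respect to a definite degree function $\deg$ if (i) $\mathfrak F$ is factorization finite, (ii) $\mathfrak F$ has almost group-like identities, and (iii) $(\mathcal H_0^{iso},\Delta^{iso},\epsilon,\eta)$ is connected as a pointed co-algebra. Here a co-algebra $C$ with co-unit $\epsilon$, pointed by a group-like element $1=\eta(1)$, is connected (co-nilpotent) if every element of $\ker\epsilon$ is annihilated by some iterate of the reduced co-product $\bar\Delta(x)=\Delta(x)-1\otimes x-x\otimes 1$.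
   Formalization: Co-associativity of Δ^iso on B^iso is added as a hypothesis: the asserted bi-algebra structure can fail when automorphisms of intermediate objects fix factors, and then an almost connected Feynman category may have no antipode. *)

theory Defs
  imports
    "HOL-Algebra.QuotRing"
    "HOL-Algebra.Free_Abelian_Groups"
    "HOL-Combinatorics.Permutations"
begin

section \<open>Categories, functors, equivalences\<close>

record ('o, 'm) cat =
  Obj :: "'o set"
  Arr :: "'m set"
  Dom :: "'m \<Rightarrow> 'o"
  Cod :: "'m \<Rightarrow> 'o"
  Ide :: "'o \<Rightarrow> 'm"
  Comp :: "'m \<Rightarrow> 'm \<Rightarrow> 'm"  (infixr \<open>\<bullet>\<index>\<close> 70)

definition Hom :: "('o, 'm, 'z) cat_scheme \<Rightarrow> 'o \<Rightarrow> 'o \<Rightarrow> 'm set" where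
  "Hom C X Y = {f \<in> Arr C. Dom C f = X \<and> Cod C f = Y}"

locale category =
  fixes C :: "('o, 'm, 'z) cat_scheme" (structure)
  assumes dom_obj: "f \<in> Arr C \<Longrightarrow> Dom C f \<in> Obj C"
    and cod_obj: "f \<in> Arr C \<Longrightarrow> Cod C f \<in> Obj C"
    and ide_hom: "X \<in> Obj C \<Longrightarrow> Ide C X \<in> Hom C X X"
    and comp_hom: "f \<in> Hom C X Y \<Longrightarrow> g \<in> Hom C Y Z \<Longrightarrow> g \<bullet> f \<in> Hom C X Z"
    and comp_ide_left: "f \<in> Hom C X Y \<Longrightarrow> Ide C Y \<bullet> f = f"
    and comp_ide_right: "f \<in> Hom C X Y \<Longrightarrow> f \<bullet> Ide C X = f"
    and comp_assoc: "f \<in> Hom C W X \<Longrightarrow> g \<in> Hom C X Y \<Longrightarrow> h \<in> Hom C Y Z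
      \<Longrightarrow> (h \<bullet> g) \<bullet> f = h \<bullet> (g \<bullet> f)"

definition inverse_arrows :: "('o, 'm, 'z) cat_scheme \<Rightarrow> 'm \<Rightarrow> 'm \<Rightarrow> bool" where
  "inverse_arrows C f g \<longleftrightarrow> f \<in> Arr C \<and> g \<in> Hom C (Cod C f) (Dom C f) \<and>
     g \<bullet>\<^bsub>C\<^esub> f = Ide C (Dom C f) \<and> f \<bullet>\<^bsub>C\<^esub> g = Ide C (Cod C f)"

definition is_iso :: "('o, 'm, 'z) cat_scheme \<Rightarrow> 'm \<Rightarrow> bool" where
  "is_iso C f \<longleftrightarrow> (\<exists>g. inverse_arrows C f g)"

definition inv_arr :: "('o, 'm, 'z) cat_scheme \<Rightarrow> 'm \<Rightarrow> 'm" where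
  "inv_arr C f = (THE g. inverse_arrows C f g)"

definition iso_hom :: "('o, 'm, 'z) cat_scheme \<Rightarrow> 'o \<Rightarrow> 'o \<Rightarrow> 'm set" where
  "iso_hom C X Y = {f \<in> Hom C X Y. is_iso C f}"

definition groupoid :: "('o, 'm, 'z) cat_scheme \<Rightarrow> bool" where
  "groupoid C \<longleftrightarrow> category C \<and> (\<forall>f \<in> Arr C. is_iso C f)"

text \<open>The maximal subgroupoid; a monoidal structure on \<open>C\<close> is kept.\<close>

definition Iso :: "('o, 'm, 'z) cat_scheme \<Rightarrow> ('o, 'm, 'z) cat_scheme" where
  "Iso C = C\<lparr>Arr := {f. is_iso C f}\<rparr>"

record ('o, 'm, 'p, 'n) ftor =
  fobj :: "'o \<Rightarrow> 'p"
  farr :: "'m \<Rightarrow> 'n"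

locale cfunctor = A: category A + B: category B
  for A :: "('o, 'm, 'y) cat_scheme" and B :: "('p, 'n, 'z) cat_scheme" +
  fixes T :: "('o, 'm, 'p, 'n) ftor"
  assumes map_obj: "X \<in> Obj A \<Longrightarrow> fobj T X \<in> Obj B"
    and map_hom: "f \<in> Hom A X Y \<Longrightarrow> farr T f \<in> Hom B (fobj T X) (fobj T Y)"
    and map_ide: "X \<in> Obj A \<Longrightarrow> farr T (Ide A X) = Ide B (fobj T X)"
    and map_comp: "f \<in> Hom A X Y \<Longrightarrow> g \<in> Hom A Y Z
      \<Longrightarrow> farr T (g \<bullet>\<^bsub>A\<^esub> f) = farr T g \<bullet>\<^bsub>B\<^esub> farr T f"

definition id_ftor :: "('o, 'm, 'o, 'm) ftor" where
  "id_ftor = \<lparr>fobj = (\<lambda>X. X), farr = (\<lambda>f. f)\<rparr>"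

definition comp_ftor ::
  "('p, 'n, 'q, 'k) ftor \<Rightarrow> ('o, 'm, 'p, 'n) ftor \<Rightarrow> ('o, 'm, 'q, 'k) ftor" where
  "comp_ftor S T = \<lparr>fobj = (\<lambda>X. fobj S (fobj T X)), farr = (\<lambda>f. farr S (farr T f))\<rparr>"

definition nat_iso :: "('o, 'm, 'y) cat_scheme \<Rightarrow> ('p, 'n, 'z) cat_scheme \<Rightarrow>
    ('o, 'm, 'p, 'n) ftor \<Rightarrow> ('o, 'm, 'p, 'n) ftor \<Rightarrow> ('o \<Rightarrow> 'n) \<Rightarrow> bool" where
  "nat_iso A B S T \<theta> \<longleftrightarrow>
     (\<forall>X \<in> Obj A. \<theta> X \<in> iso_hom B (fobj S X) (fobj T X)) \<and>
     (\<forall>X \<in> Obj A. \<forall>Y \<in> Obj A. \<forall>f \<in> Hom A X Y.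
        farr T f \<bullet>\<^bsub>B\<^esub> \<theta> X = \<theta> Y \<bullet>\<^bsub>B\<^esub> farr S f)"

definition equivalence_ftor :: "('o, 'm, 'y) cat_scheme \<Rightarrow> ('p, 'n, 'z) cat_scheme \<Rightarrow>
    ('o, 'm, 'p, 'n) ftor \<Rightarrow> bool" where
  "equivalence_ftor A B T \<longleftrightarrow> cfunctor A B T \<and>
     (\<exists>S \<eta> \<theta>. cfunctor B A S \<and> nat_iso A A id_ftor (comp_ftor S T) \<eta> \<and>
        nat_iso B B (comp_ftor T S) id_ftor \<theta>)"

text \<open>
  A category carried by HOL types is always a set.  Smallness is therefore taken relative to a
  universe, given by a type \<open>'u\<close>: a category is small if its objects and arrows are elements
  of \<open>'u\<close>, and essentially small if it is equivalent to a small one.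
\<close>

definition essentially_small :: "'u itself \<Rightarrow> ('o, 'm, 'z) cat_scheme \<Rightarrow> bool" where
  "essentially_small U C \<longleftrightarrow>
     (\<exists>(D :: ('u, 'u) cat) T. category D \<and> equivalence_ftor C D T)"


section \<open>Monoidal categories\<close>

record ('o, 'm) moncat = "('o, 'm) cat" +
  tenO :: "'o \<Rightarrow> 'o \<Rightarrow> 'o"  (infixr \<open>\<odot>\<index>\<close> 75)
  tenA :: "'m \<Rightarrow> 'm \<Rightarrow> 'm"  (infixr \<open>\<boxtimes>\<index>\<close> 75)
  unitO :: "'o"
  assoc :: "'o \<Rightarrow> 'o \<Rightarrow> 'o \<Rightarrow> 'm"
  lunit :: "'o \<Rightarrow> 'm"
  runit :: "'o \<Rightarrow> 'm"

locale monoidal_category = category C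
  for C :: "('o, 'm, 'z) moncat_scheme" (structure) +
  assumes unit_obj: "unitO C \<in> Obj C"
    and ten_obj: "X \<in> Obj C \<Longrightarrow> Y \<in> Obj C \<Longrightarrow> X \<odot> Y \<in> Obj C"
    and ten_hom: "f \<in> Hom C X Y \<Longrightarrow> g \<in> Hom C X' Y'
      \<Longrightarrow> f \<boxtimes> g \<in> Hom C (X \<odot> X') (Y \<odot> Y')"
    and ten_ide: "X \<in> Obj C \<Longrightarrow> Y \<in> Obj C \<Longrightarrow> Ide C X \<boxtimes> Ide C Y = Ide C (X \<odot> Y)"
    and ten_comp: "f \<in> Hom C X Y \<Longrightarrow> g \<in> Hom C Y Z \<Longrightarrow> f' \<in> Hom C X' Y' \<Longrightarrow> g' \<in> Hom C Y' Z'
      \<Longrightarrow> (g \<bullet> f) \<boxtimes> (g' \<bullet> f') = (g \<boxtimes> g') \<bullet> (f \<boxtimes> f')"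
    and assoc_iso: "X \<in> Obj C \<Longrightarrow> Y \<in> Obj C \<Longrightarrow> Z \<in> Obj C
      \<Longrightarrow> assoc C X Y Z \<in> iso_hom C ((X \<odot> Y) \<odot> Z) (X \<odot> (Y \<odot> Z))"
    and assoc_nat: "f \<in> Hom C X X' \<Longrightarrow> g \<in> Hom C Y Y' \<Longrightarrow> h \<in> Hom C Z Z'
      \<Longrightarrow> assoc C X' Y' Z' \<bullet> ((f \<boxtimes> g) \<boxtimes> h) = (f \<boxtimes> (g \<boxtimes> h)) \<bullet> assoc C X Y Z"
    and lunit_iso: "X \<in> Obj C \<Longrightarrow> lunit C X \<in> iso_hom C (unitO C \<odot> X) X"
    and lunit_nat: "f \<in> Hom C X Y \<Longrightarrow> lunit C Y \<bullet> (Ide C (unitO C) \<boxtimes> f) = f \<bullet> lunit C X"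
    and runit_iso: "X \<in> Obj C \<Longrightarrow> runit C X \<in> iso_hom C (X \<odot> unitO C) X"
    and runit_nat: "f \<in> Hom C X Y \<Longrightarrow> runit C Y \<bullet> (f \<boxtimes> Ide C (unitO C)) = f \<bullet> runit C X"
    and triangle: "X \<in> Obj C \<Longrightarrow> Y \<in> Obj C
      \<Longrightarrow> (Ide C X \<boxtimes> lunit C Y) \<bullet> assoc C X (unitO C) Y = runit C X \<boxtimes> Ide C Y"
    and pentagon: "W \<in> Obj C \<Longrightarrow> X \<in> Obj C \<Longrightarrow> Y \<in> Obj C \<Longrightarrow> Z \<in> Obj C
      \<Longrightarrow> assoc C W X (Y \<odot> Z) \<bullet> assoc C (W \<odot> X) Y Z
        = (Ide C W \<boxtimes> assoc C X Y Z) \<bullet> assoc C W (X \<odot> Y) Z \<bullet> (assoc C W X Y \<boxtimes> Ide C Z)"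

locale symmetric_monoidal_category = monoidal_category C
  for C :: "('o, 'm, 'z) moncat_scheme" (structure) +
  fixes \<beta> :: "'o \<Rightarrow> 'o \<Rightarrow> 'm"
  assumes braid_hom: "X \<in> Obj C \<Longrightarrow> Y \<in> Obj C \<Longrightarrow> \<beta> X Y \<in> Hom C (X \<odot> Y) (Y \<odot> X)"
    and braid_nat: "f \<in> Hom C X X' \<Longrightarrow> g \<in> Hom C Y Y'
      \<Longrightarrow> \<beta> X' Y' \<bullet> (f \<boxtimes> g) = (g \<boxtimes> f) \<bullet> \<beta> X Y"
    and braid_sym: "X \<in> Obj C \<Longrightarrow> Y \<in> Obj C \<Longrightarrow> \<beta> Y X \<bullet> \<beta> X Y = Ide C (X \<odot> Y)"
    and hexagon: "X \<in> Obj C \<Longrightarrow> Y \<in> Obj C \<Longrightarrow> Z \<in> Obj C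
      \<Longrightarrow> assoc C Y Z X \<bullet> \<beta> X (Y \<odot> Z) \<bullet> assoc C X Y Z
        = (Ide C Y \<boxtimes> \<beta> X Z) \<bullet> assoc C Y X Z \<bullet> (\<beta> X Y \<boxtimes> Ide C Z)"

locale monoidal_ftor = cfunctor A B T + A: monoidal_category A + B: monoidal_category B
  for A :: "('o, 'm, 'y) moncat_scheme" and B :: "('p, 'n, 'z) moncat_scheme"
    and T :: "('o, 'm, 'p, 'n) ftor" +
  fixes \<mu> :: "'o \<Rightarrow> 'o \<Rightarrow> 'n" and u :: "'n"
  assumes mu_iso: "X \<in> Obj A \<Longrightarrow> Y \<in> Obj A
      \<Longrightarrow> \<mu> X Y \<in> iso_hom B (fobj T X \<odot>\<^bsub>B\<^esub> fobj T Y) (fobj T (X \<odot>\<^bsub>A\<^esub> Y))"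
    and mu_nat: "f \<in> Hom A X X' \<Longrightarrow> g \<in> Hom A Y Y'
      \<Longrightarrow> farr T (f \<boxtimes>\<^bsub>A\<^esub> g) \<bullet>\<^bsub>B\<^esub> \<mu> X Y = \<mu> X' Y' \<bullet>\<^bsub>B\<^esub> (farr T f \<boxtimes>\<^bsub>B\<^esub> farr T g)"
    and u_iso: "u \<in> iso_hom B (unitO B) (fobj T (unitO A))"
    and mu_assoc: "X \<in> Obj A \<Longrightarrow> Y \<in> Obj A \<Longrightarrow> Z \<in> Obj A
      \<Longrightarrow> farr T (assoc A X Y Z) \<bullet>\<^bsub>B\<^esub> \<mu> (X \<odot>\<^bsub>A\<^esub> Y) Z \<bullet>\<^bsub>B\<^esub> (\<mu> X Y \<boxtimes>\<^bsub>B\<^esub> Ide B (fobj T Z))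
        = \<mu> X (Y \<odot>\<^bsub>A\<^esub> Z) \<bullet>\<^bsub>B\<^esub> (Ide B (fobj T X) \<boxtimes>\<^bsub>B\<^esub> \<mu> Y Z)
            \<bullet>\<^bsub>B\<^esub> assoc B (fobj T X) (fobj T Y) (fobj T Z)"
    and mu_lunit: "X \<in> Obj A
      \<Longrightarrow> farr T (lunit A X) \<bullet>\<^bsub>B\<^esub> \<mu> (unitO A) X \<bullet>\<^bsub>B\<^esub> (u \<boxtimes>\<^bsub>B\<^esub> Ide B (fobj T X))
        = lunit B (fobj T X)"
    and mu_runit: "X \<in> Obj A
      \<Longrightarrow> farr T (runit A X) \<bullet>\<^bsub>B\<^esub> \<mu> X (unitO A) \<bullet>\<^bsub>B\<^esub> (Ide B (fobj T X) \<boxtimes>\<^bsub>B\<^esub> u)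
        = runit B (fobj T X)"

locale symmetric_monoidal_ftor = monoidal_ftor A B T \<mu> u +
    A: symmetric_monoidal_category A \<beta>A + B: symmetric_monoidal_category B \<beta>B
  for A :: "('o, 'm, 'y) moncat_scheme" and \<beta>A
    and B :: "('p, 'n, 'z) moncat_scheme" and \<beta>B
    and T :: "('o, 'm, 'p, 'n) ftor" and \<mu> and u +
  assumes mu_braid: "X \<in> Obj A \<Longrightarrow> Y \<in> Obj A
      \<Longrightarrow> farr T (\<beta>A X Y) \<bullet>\<^bsub>B\<^esub> \<mu> X Y = \<mu> Y X \<bullet>\<^bsub>B\<^esub> \<beta>B (fobj T X) (fobj T Y)"


section \<open>Free (symmetric) monoidal categories\<close>

text \<open>
  The objects of the free symmetric monoidal category on \<open>C\<close> are words of objects of \<open>C\<close>.  An arrow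
  \<open>(fs, p)\<close> consists of a permutation \<open>p\<close> of the \<open>n = length fs\<close> positions and arrows
  \<open>fs ! i\<close> from the \<open>i\<close>-th letter of the source to the \<open>p i\<close>-th letter of the target.
  The arrows of the free monoidal category are those with trivial permutation.
\<close>

definition block_perm :: "nat \<Rightarrow> (nat \<Rightarrow> nat) \<Rightarrow> (nat \<Rightarrow> nat) \<Rightarrow> nat \<Rightarrow> nat" where
  "block_perm n p q i = (if i < n then p i else n + q (i - n))"

definition block_swap :: "nat \<Rightarrow> nat \<Rightarrow> nat \<Rightarrow> nat" where
  "block_swap m n i = (if i < m then n + i else if i < m + n then i - m else i)"

definition free_ide :: "('o, 'm, 'z) cat_scheme \<Rightarrow> 'o list \<Rightarrow> 'm list \<times> (nat \<Rightarrow> nat)" where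
  "free_ide C xs = (map (Ide C) xs, id)"

definition free_smc ::
  "('o, 'm, 'z) cat_scheme \<Rightarrow> ('o list, 'm list \<times> (nat \<Rightarrow> nat)) moncat" where
  "free_smc C = \<lparr>
     Obj = lists (Obj C),
     Arr = {(fs, p). fs \<in> lists (Arr C) \<and> p permutes {..<length fs}},
     Dom = (\<lambda>(fs, p). map (Dom C) fs),
     Cod = (\<lambda>(fs, p). map (\<lambda>j. Cod C (fs ! inv_into UNIV p j)) [0..<length fs]),
     Ide = free_ide C,
     Comp = (\<lambda>(gs, q) (fs, p). (map (\<lambda>i. (gs ! p i) \<bullet>\<^bsub>C\<^esub> (fs ! i)) [0..<length fs], q \<circ> p)),
     tenO = (@),
     tenA = (\<lambda>(fs, p) (gs, q). (fs @ gs, block_perm (length fs) p q)),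
     unitO = [],
     assoc = (\<lambda>xs ys zs. free_ide C (xs @ ys @ zs)),
     lunit = free_ide C,
     runit = free_ide C\<rparr>"

definition free_braid ::
  "('o, 'm, 'z) cat_scheme \<Rightarrow> 'o list \<Rightarrow> 'o list \<Rightarrow> 'm list \<times> (nat \<Rightarrow> nat)" where
  "free_braid C xs ys = (map (Ide C) (xs @ ys), block_swap (length xs) (length ys))"

definition free_mc ::
  "('o, 'm, 'z) cat_scheme \<Rightarrow> ('o list, 'm list \<times> (nat \<Rightarrow> nat)) moncat" where
  "free_mc C = (free_smc C)\<lparr>Arr := {(fs, p). fs \<in> lists (Arr C) \<and> p = id}\<rparr>"

definition extends_ftor :: "('o, 'm, 'z) cat_scheme \<Rightarrow>
    ('o list, 'm list \<times> (nat \<Rightarrow> nat), 'p, 'n) ftor \<Rightarrow> ('o, 'm, 'p, 'n) ftor \<Rightarrow> bool" where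
  "extends_ftor C J T \<longleftrightarrow> (\<forall>X \<in> Obj C. fobj J [X] = fobj T X) \<and>
     (\<forall>f \<in> Arr C. farr J ([f], id) = farr T f)"

text \<open>
  The extension \<open>J\<close> of a functor to the free (symmetric) monoidal category is determined up to a
  unique (symmetric) monoidal isomorphism that is trivial on the letters, so asking for some
  extension that is an equivalence is the same as asking for any.  A (symmetric) monoidal functor
  is an equivalence of (symmetric) monoidal categories if the underlying functor is an equivalence;
  a quasi-inverse is then (symmetric) monoidal in a canonical way.
\<close>

definition induces_sym_equivalence :: "('o, 'm, 'y) cat_scheme \<Rightarrow>
    ('p, 'n, 'z) moncat_scheme \<Rightarrow> ('p \<Rightarrow> 'p \<Rightarrow> 'n) \<Rightarrow> ('o, 'm, 'p, 'n) ftor \<Rightarrow> bool" where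
  "induces_sym_equivalence C M \<beta> T \<longleftrightarrow>
     (\<exists>J \<mu> u. symmetric_monoidal_ftor (free_smc C) (free_braid C) M \<beta> J \<mu> u \<and>
        extends_ftor C J T \<and> equivalence_ftor (free_smc C) M J)"

definition induces_mon_equivalence :: "('o, 'm, 'y) cat_scheme \<Rightarrow>
    ('p, 'n, 'z) moncat_scheme \<Rightarrow> ('o, 'm, 'p, 'n) ftor \<Rightarrow> bool" where
  "induces_mon_equivalence C M T \<longleftrightarrow>
     (\<exists>J \<mu> u. monoidal_ftor (free_mc C) M J \<mu> u \<and>
        extends_ftor C J T \<and> equivalence_ftor (free_mc C) M J)"


section \<open>Comma categories\<close>

type_synonym ('x, 'y, 'm) comma_obj = "'x \<times> 'y \<times> 'm"

text \<open>An arrow records its source and its target besides the pair of arrows.\<close>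

type_synonym ('x, 'y, 'm, 'f, 'g) comma_arr =
  "('x, 'y, 'm) comma_obj \<times> ('x, 'y, 'm) comma_obj \<times> ('f \<times> 'g)"

definition comma_objs :: "('x, 'f, 'a) cat_scheme \<Rightarrow> ('y, 'g, 'b) cat_scheme \<Rightarrow>
    ('o, 'm, 'c) cat_scheme \<Rightarrow> ('x, 'f, 'o, 'm) ftor \<Rightarrow> ('y, 'g, 'o, 'm) ftor \<Rightarrow>
    ('x, 'y, 'm) comma_obj set" where
  "comma_objs A B C S T =
     {(X, Y, \<phi>). X \<in> Obj A \<and> Y \<in> Obj B \<and> \<phi> \<in> Hom C (fobj S X) (fobj T Y)}"

definition comma_arrs :: "('x, 'f, 'a) cat_scheme \<Rightarrow> ('y, 'g, 'b) cat_scheme \<Rightarrow>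
    ('o, 'm, 'c) cat_scheme \<Rightarrow> ('x, 'f, 'o, 'm) ftor \<Rightarrow> ('y, 'g, 'o, 'm) ftor \<Rightarrow>
    ('x, 'y, 'm, 'f, 'g) comma_arr set" where
  "comma_arrs A B C S T =
     {((X, Y, \<phi>), (X', Y', \<phi>'), (\<psi>, \<psi>')) | X Y \<phi> X' Y' \<phi>' \<psi> \<psi>'.
        (X, Y, \<phi>) \<in> comma_objs A B C S T \<and> (X', Y', \<phi>') \<in> comma_objs A B C S T \<and>
        \<psi> \<in> Hom A X X' \<and> \<psi>' \<in> Hom B Y Y' \<and>
        farr T \<psi>' \<bullet>\<^bsub>C\<^esub> \<phi> = \<phi>' \<bullet>\<^bsub>C\<^esub> farr S \<psi>}"

definition comma :: "('x, 'f, 'a) cat_scheme \<Rightarrow> ('y, 'g, 'b) cat_scheme \<Rightarrow>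
    ('o, 'm, 'c) cat_scheme \<Rightarrow> ('x, 'f, 'o, 'm) ftor \<Rightarrow> ('y, 'g, 'o, 'm) ftor \<Rightarrow>
    (('x, 'y, 'm) comma_obj, ('x, 'y, 'm, 'f, 'g) comma_arr) cat" where
  "comma A B C S T = \<lparr>
     Obj = comma_objs A B C S T,
     Arr = comma_arrs A B C S T,
     Dom = (\<lambda>(s, t, h). s),
     Cod = (\<lambda>(s, t, h). t),
     Ide = (\<lambda>(X, Y, \<phi>). ((X, Y, \<phi>), (X, Y, \<phi>), (Ide A X, Ide B Y))),
     Comp = (\<lambda>(s', t', (\<chi>, \<chi>')) (s, t, (\<psi>, \<psi>')). (s, t', (\<chi> \<bullet>\<^bsub>A\<^esub> \<psi>, \<chi>' \<bullet>\<^bsub>B\<^esub> \<psi>')))\<rparr>"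

definition arrow_ten :: "('o, 'm, 'z) moncat_scheme \<Rightarrow>
    ('o, 'o, 'm) comma_obj \<Rightarrow> ('o, 'o, 'm) comma_obj \<Rightarrow> ('o, 'o, 'm) comma_obj" where
  "arrow_ten F = (\<lambda>(X, Y, \<phi>) (X', Y', \<phi>'). (X \<odot>\<^bsub>F\<^esub> X', Y \<odot>\<^bsub>F\<^esub> Y', \<phi> \<boxtimes>\<^bsub>F\<^esub> \<phi>'))"

definition arrow_unit :: "('o, 'm, 'z) moncat_scheme \<Rightarrow> ('o, 'o, 'm) comma_obj" where
  "arrow_unit F = (unitO F, unitO F, Ide F (unitO F))"

text \<open>The monoidal category \<open>(F \<down> F)\<close>, with the tensor product taken componentwise.\<close>

definition arrow_moncat :: "('o, 'm, 'z) moncat_scheme \<Rightarrow>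
    (('o, 'o, 'm) comma_obj, ('o, 'o, 'm, 'm, 'm) comma_arr) moncat" where
  "arrow_moncat F = cat.extend (comma F F F id_ftor id_ftor) (moncat.fields
     (arrow_ten F)
     (\<lambda>(s, t, (\<psi>, \<psi>')) (s', t', (\<chi>, \<chi>')).
        (arrow_ten F s s', arrow_ten F t t', (\<psi> \<boxtimes>\<^bsub>F\<^esub> \<chi>, \<psi>' \<boxtimes>\<^bsub>F\<^esub> \<chi>')))
     (arrow_unit F)
     (\<lambda>a b c. (arrow_ten F (arrow_ten F a b) c, arrow_ten F a (arrow_ten F b c),
        (assoc F (fst a) (fst b) (fst c), assoc F (fst (snd a)) (fst (snd b)) (fst (snd c)))))
     (\<lambda>a. (arrow_ten F (arrow_unit F) a, a, (lunit F (fst a), lunit F (fst (snd a)))))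
     (\<lambda>a. (arrow_ten F a (arrow_unit F), a, (runit F (fst a), runit F (fst (snd a))))))"

definition arrow_braid :: "('o, 'm, 'z) moncat_scheme \<Rightarrow> ('o \<Rightarrow> 'o \<Rightarrow> 'm) \<Rightarrow>
    ('o, 'o, 'm) comma_obj \<Rightarrow> ('o, 'o, 'm) comma_obj \<Rightarrow> ('o, 'o, 'm, 'm, 'm) comma_arr" where
  "arrow_braid F \<beta> a b =
     (arrow_ten F a b, arrow_ten F b a, (\<beta> (fst a) (fst b), \<beta> (fst (snd a)) (fst (snd b))))"

text \<open>The functor \<open>(F \<down> V) \<rightarrow> (F \<down> F)\<close> induced by \<open>\<iota>\<close>.\<close>

definition comma_incl :: "('v, 'a, 'o, 'm) ftor \<Rightarrow>
    (('o, 'v, 'm) comma_obj, ('o, 'v, 'm, 'm, 'a) comma_arr,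
     ('o, 'o, 'm) comma_obj, ('o, 'o, 'm, 'm, 'm) comma_arr) ftor" where
  "comma_incl \<iota> = \<lparr>
     fobj = (\<lambda>(X, v, \<phi>). (X, fobj \<iota> v, \<phi>)),
     farr = (\<lambda>((X, v, \<phi>), (X', v', \<phi>'), (\<psi>, \<psi>')).
       ((X, fobj \<iota> v, \<phi>), (X', fobj \<iota> v', \<phi>'), (\<psi>, farr \<iota> \<psi>')))\<rparr>"

definition terminal_cat :: "(unit, unit) cat" where
  "terminal_cat = \<lparr>Obj = UNIV, Arr = UNIV, Dom = (\<lambda>f. ()), Cod = (\<lambda>f. ()),
     Ide = (\<lambda>X. ()), Comp = (\<lambda>g f. ())\<rparr>"

definition point_ftor :: "('o, 'm, 'z) cat_scheme \<Rightarrow> 'o \<Rightarrow> (unit, unit, 'o, 'm) ftor" where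
  "point_ftor C X = \<lparr>fobj = (\<lambda>_. X), farr = (\<lambda>_. Ide C X)\<rparr>"


section \<open>Feynman categories\<close>

definition feynman_category :: "'u itself \<Rightarrow> ('v, 'a, 'y) cat_scheme \<Rightarrow>
    ('o, 'm, 'z) moncat_scheme \<Rightarrow> ('o \<Rightarrow> 'o \<Rightarrow> 'm) \<Rightarrow> ('v, 'a, 'o, 'm) ftor \<Rightarrow> bool" where
  "feynman_category U V F \<beta> \<iota> \<longleftrightarrow>
     groupoid V \<and> symmetric_monoidal_category F \<beta> \<and> cfunctor V F \<iota> \<and>
     induces_sym_equivalence V (Iso F) \<beta> \<iota> \<and>
     induces_sym_equivalence (Iso (comma F V F id_ftor \<iota>))
       (Iso (arrow_moncat F)) (arrow_braid F \<beta>) (comma_incl \<iota>) \<and>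
     (\<forall>v \<in> Obj V. essentially_small U
        (comma F terminal_cat F id_ftor (point_ftor F (fobj \<iota> v))))"

definition nonsigma_feynman_category :: "'u itself \<Rightarrow> ('v, 'a, 'y) cat_scheme \<Rightarrow>
    ('o, 'm, 'z) moncat_scheme \<Rightarrow> ('v, 'a, 'o, 'm) ftor \<Rightarrow> bool" where
  "nonsigma_feynman_category U V F \<iota> \<longleftrightarrow>
     groupoid V \<and> monoidal_category F \<and> cfunctor V F \<iota> \<and>
     induces_mon_equivalence V (Iso F) \<iota> \<and>
     induces_mon_equivalence (Iso (comma F V F id_ftor \<iota>))
       (Iso (arrow_moncat F)) (comma_incl \<iota>) \<and>
     (\<forall>v \<in> Obj V. essentially_small U
        (comma F terminal_cat F id_ftor (point_ftor F (fobj \<iota> v))))"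


section \<open>Tensor powers, co-algebras and antipodes over the integers\<close>

text \<open>
  The additive group of a ring \<open>A\<close> is regarded as a \<open>\<int>\<close>-module.  An element of its \<open>n\<close>-fold tensor
  power is represented by a formal integral combination of words of length \<open>n\<close> in \<open>A\<close>, the word
  \<open>[x\<^sub>1, \<dots>, x\<^sub>n]\<close> standing for the pure tensor of its letters.  Two such combinations represent the
  same tensor iff their difference lies in the subgroup generated by the multilinearity relations.
\<close>

inductive_set tensor_null :: "('a, 'z) ring_scheme \<Rightarrow> ('a list \<Rightarrow>\<^sub>0 int) set"
  for A :: "('a, 'z) ring_scheme" where
  zero: "0 \<in> tensor_null A"
| diff: "t \<in> tensor_null A \<Longrightarrow> t' \<in> tensor_null A \<Longrightarrow> t - t' \<in> tensor_null A"
| multilinear: "x \<in> carrier A \<Longrightarrow> y \<in> carrier A \<Longrightarrow>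
    xs \<in> lists (carrier A) \<Longrightarrow> ys \<in> lists (carrier A) \<Longrightarrow>
    frag_of (xs @ [x \<oplus>\<^bsub>A\<^esub> y] @ ys) - frag_of (xs @ [x] @ ys) - frag_of (xs @ [y] @ ys)
      \<in> tensor_null A"

definition tensor_eq :: "('a, 'z) ring_scheme \<Rightarrow> ('a list \<Rightarrow>\<^sub>0 int) \<Rightarrow> ('a list \<Rightarrow>\<^sub>0 int) \<Rightarrow> bool" where
  "tensor_eq A t t' \<longleftrightarrow> t - t' \<in> tensor_null A"

text \<open>\<open>D \<otimes> id \<otimes> \<dots> \<otimes> id\<close>, and \<open>id \<otimes> D\<close> on two-fold tensors.\<close>

definition on_first :: "('a \<Rightarrow> 'a list \<Rightarrow>\<^sub>0 int) \<Rightarrow> ('a list \<Rightarrow>\<^sub>0 int) \<Rightarrow> 'a list \<Rightarrow>\<^sub>0 int" where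
  "on_first D = frag_extend (\<lambda>w. frag_extend (\<lambda>d. frag_of (d @ tl w)) (D (hd w)))"

definition on_second :: "('a \<Rightarrow> 'a list \<Rightarrow>\<^sub>0 int) \<Rightarrow> ('a list \<Rightarrow>\<^sub>0 int) \<Rightarrow> 'a list \<Rightarrow>\<^sub>0 int" where
  "on_second D = frag_extend (\<lambda>w. frag_extend (\<lambda>d. frag_of (w ! 0 # d)) (D (w ! 1)))"

text \<open>
  For the co-product \<open>Delta_iso\<close> below, co-associativity can fail: if \<open>\<phi> = \<phi>0 \<bullet> \<phi>1\<close> and an
  automorphism \<open>\<tau>\<close> of the intermediate object satisfies \<open>\<phi>0 \<bullet> \<tau> = \<phi>0\<close> and \<open>\<tau> \<bullet> \<phi>1 = \<phi>1\<close>, then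
  factorizations \<open>(g, f)\<close> and \<open>(g, f \<bullet> \<tau>)\<close> of \<open>\<phi>0\<close> may be inequivalent, whereas the factorizations
  \<open>(f, \<phi>1)\<close> and \<open>(f \<bullet> \<tau>, \<phi>1)\<close> of \<open>f \<bullet> \<phi>1\<close> are equivalent.
\<close>

definition coassociative :: "('a, 'z) ring_scheme \<Rightarrow> ('a \<Rightarrow> 'a list \<Rightarrow>\<^sub>0 int) \<Rightarrow> bool" where
  "coassociative A D \<longleftrightarrow>
     (\<forall>x \<in> carrier A. tensor_eq A (on_first D (D x)) (on_second D (D x)))"

definition reduced :: "('a, 'z) ring_scheme \<Rightarrow> ('a \<Rightarrow> 'a list \<Rightarrow>\<^sub>0 int) \<Rightarrow> 'a \<Rightarrow> 'a list \<Rightarrow>\<^sub>0 int" where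
  "reduced A D x = D x - frag_of [\<one>\<^bsub>A\<^esub>, x] - frag_of [x, \<one>\<^bsub>A\<^esub>]"

primrec reduced_iter ::
  "('a, 'z) ring_scheme \<Rightarrow> ('a \<Rightarrow> 'a list \<Rightarrow>\<^sub>0 int) \<Rightarrow> nat \<Rightarrow> 'a \<Rightarrow> 'a list \<Rightarrow>\<^sub>0 int" where
  "reduced_iter A D 0 x = frag_of [x]"
| "reduced_iter A D (Suc n) x = on_first (reduced A D) (reduced_iter A D n x)"

text \<open>The co-algebra \<open>A\<close> is pointed by the unit of the ring.\<close>

definition connected_coalgebra ::
  "('a, 'z) ring_scheme \<Rightarrow> ('a \<Rightarrow> 'a list \<Rightarrow>\<^sub>0 int) \<Rightarrow> ('a \<Rightarrow> int) \<Rightarrow> bool" where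
  "connected_coalgebra A D \<epsilon> \<longleftrightarrow>
     (\<forall>x \<in> carrier A. \<epsilon> x = 0 \<longrightarrow> (\<exists>n. tensor_eq A (reduced_iter A D n x) 0))"

definition convolution :: "('a, 'z) ring_scheme \<Rightarrow> ('a \<Rightarrow> 'a list \<Rightarrow>\<^sub>0 int) \<Rightarrow>
    ('a \<Rightarrow> 'a) \<Rightarrow> ('a \<Rightarrow> 'a) \<Rightarrow> 'a \<Rightarrow> 'a" where
  "convolution A D f g x =
     (\<Oplus>\<^bsub>A\<^esub> w \<in> Poly_Mapping.keys (D x).
        [Poly_Mapping.lookup (D x) w] \<cdot>\<^bsub>A\<^esub> (f (w ! 0) \<otimes>\<^bsub>A\<^esub> g (w ! 1)))"

definition is_antipode :: "('a, 'z) ring_scheme \<Rightarrow> ('a \<Rightarrow> 'a list \<Rightarrow>\<^sub>0 int) \<Rightarrow> ('a \<Rightarrow> int) \<Rightarrow>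
    ('a \<Rightarrow> 'a) \<Rightarrow> bool" where
  "is_antipode A D \<epsilon> S \<longleftrightarrow> S \<in> hom (add_monoid A) (add_monoid A) \<and>
     (\<forall>x \<in> carrier A.
        convolution A D S (\<lambda>y. y) x = [\<epsilon> x] \<cdot>\<^bsub>A\<^esub> \<one>\<^bsub>A\<^esub> \<and>
        convolution A D (\<lambda>y. y) S x = [\<epsilon> x] \<cdot>\<^bsub>A\<^esub> \<one>\<^bsub>A\<^esub>)"

text \<open>
  The structure maps induced on \<open>R Quot J\<close>.  They are evaluated on a representative; if \<open>J\<close> is a
  co-ideal, another representative gives the same tensor.
\<close>

definition quot_coproduct :: "('a, 'z) ring_scheme \<Rightarrow> 'a set \<Rightarrow> ('a \<Rightarrow> 'a list \<Rightarrow>\<^sub>0 int) \<Rightarrow>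
    'a set \<Rightarrow> 'a set list \<Rightarrow>\<^sub>0 int" where
  "quot_coproduct R J D h =
     frag_extend (\<lambda>w. frag_of (map (\<lambda>a. J +>\<^bsub>R\<^esub> a) w)) (D (SOME b. b \<in> h))"

definition quot_counit :: "('a \<Rightarrow> int) \<Rightarrow> 'a set \<Rightarrow> int" where
  "quot_counit \<epsilon> h = \<epsilon> (SOME b. b \<in> h)"


section \<open>The bi-algebra of isomorphism classes of morphisms\<close>

definition arr_iso :: "('o, 'm, 'z) cat_scheme \<Rightarrow> 'm \<Rightarrow> 'm \<Rightarrow> bool" where
  "arr_iso F f g \<longleftrightarrow>
     (\<exists>\<sigma> \<in> iso_hom F (Dom F f) (Dom F g). \<exists>\<sigma>' \<in> iso_hom F (Cod F f) (Cod F g).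
        f = inv_arr F \<sigma>' \<bullet>\<^bsub>F\<^esub> g \<bullet>\<^bsub>F\<^esub> \<sigma>)"

definition arr_class :: "('o, 'm, 'z) cat_scheme \<Rightarrow> 'm \<Rightarrow> 'm set" where
  "arr_class F f = {g \<in> Arr F. arr_iso F f g}"

definition class_mult :: "('o, 'm, 'z) moncat_scheme \<Rightarrow> 'm set \<Rightarrow> 'm set \<Rightarrow> 'm set" where
  "class_mult F c d = (\<Union>f \<in> c. \<Union>g \<in> d. arr_class F (f \<boxtimes>\<^bsub>F\<^esub> g))"

text \<open>The span of the classes of the morphisms in \<open>M\<close>, with the product of \<open>B_iso\<close>.\<close>

definition class_span :: "('o, 'm, 'z) moncat_scheme \<Rightarrow> 'm set \<Rightarrow> ('m set \<Rightarrow>\<^sub>0 int) ring" where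
  "class_span F M = \<lparr>
     partial_object.carrier = carrier (free_Abelian_group (arr_class F ` M)),
     monoid.mult = (\<lambda>x y. frag_extend (\<lambda>c. frag_extend (\<lambda>d. frag_of (class_mult F c d)) y) x),
     monoid.one = frag_of (arr_class F (Ide F (unitO F))),
     ring.zero = 0,
     ring.add = (+)\<rparr>"

definition B_iso :: "('o, 'm, 'z) moncat_scheme \<Rightarrow> ('m set \<Rightarrow>\<^sub>0 int) ring" where
  "B_iso F = class_span F (Arr F)"

definition factorizations :: "('o, 'm, 'z) cat_scheme \<Rightarrow> 'm \<Rightarrow> ('m \<times> 'm) set" where
  "factorizations F \<phi> =
     {(\<phi>0, \<phi>1). \<phi>0 \<in> Arr F \<and> \<phi>1 \<in> Arr F \<and> Cod F \<phi>1 = Dom F \<phi>0 \<and> \<phi>0 \<bullet>\<^bsub>F\<^esub> \<phi>1 = \<phi>}"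

definition factorization_rel ::
  "('o, 'm, 'z) cat_scheme \<Rightarrow> 'm \<Rightarrow> (('m \<times> 'm) \<times> ('m \<times> 'm)) set" where
  "factorization_rel F \<phi> = {((\<phi>0, \<phi>1), (\<phi>0', \<phi>1')).
     (\<phi>0, \<phi>1) \<in> factorizations F \<phi> \<and> (\<phi>0', \<phi>1') \<in> factorizations F \<phi> \<and>
     (\<exists>\<sigma> \<in> iso_hom F (Cod F \<phi>1) (Cod F \<phi>1').
        \<phi>0' = \<phi>0 \<bullet>\<^bsub>F\<^esub> inv_arr F \<sigma> \<and> \<phi>1' = \<sigma> \<bullet>\<^bsub>F\<^esub> \<phi>1)}"

definition obj_class :: "('o, 'm, 'z) cat_scheme \<Rightarrow> 'o \<Rightarrow> 'o set" where
  "obj_class F X = {Y \<in> Obj F. iso_hom F X Y \<noteq> {}}"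

definition factorization_finite :: "('o, 'm, 'z) cat_scheme \<Rightarrow> bool" where
  "factorization_finite F \<longleftrightarrow> (\<forall>\<phi> \<in> Arr F.
     finite {obj_class F (Cod F \<phi>1) | \<phi>0 \<phi>1. (\<phi>0, \<phi>1) \<in> factorizations F \<phi>} \<and>
     (\<forall>Y \<in> Obj F. finite
        ({(\<phi>0, \<phi>1) \<in> factorizations F \<phi>. Cod F \<phi>1 = Y} // factorization_rel F \<phi>)))"

definition class_coproduct ::
  "('o, 'm, 'z) cat_scheme \<Rightarrow> 'm set \<Rightarrow> ('m set \<Rightarrow>\<^sub>0 int) list \<Rightarrow>\<^sub>0 int" where
  "class_coproduct F c =
     (let \<phi> = (SOME \<phi>. \<phi> \<in> c) in
      \<Sum>K \<in> factorizations F \<phi> // factorization_rel F \<phi>.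
        let (\<phi>0, \<phi>1) = (SOME p. p \<in> K)
        in frag_of [frag_of (arr_class F \<phi>0), frag_of (arr_class F \<phi>1)])"

definition Delta_iso ::
  "('o, 'm, 'z) cat_scheme \<Rightarrow> ('m set \<Rightarrow>\<^sub>0 int) \<Rightarrow> ('m set \<Rightarrow>\<^sub>0 int) list \<Rightarrow>\<^sub>0 int" where
  "Delta_iso F = frag_extend (class_coproduct F)"

definition epsilon_iso :: "('o, 'm, 'z) cat_scheme \<Rightarrow> ('m set \<Rightarrow>\<^sub>0 int) \<Rightarrow> int" where
  "epsilon_iso F x = (\<Sum>c \<in> Poly_Mapping.keys x.
     Poly_Mapping.lookup x c * (if \<exists>X \<in> Obj F. c = arr_class F (Ide F X) then 1 else 0))"

definition almost_group_like_identities :: "('o, 'm, 'z) cat_scheme \<Rightarrow> bool" where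
  "almost_group_like_identities F \<longleftrightarrow>
     (\<forall>X \<in> Obj F. \<forall>(\<phi>L, \<phi>R) \<in> factorizations F (Ide F X). is_iso F \<phi>L \<and> is_iso F \<phi>R)"

definition id_ideal :: "('o, 'm, 'z) moncat_scheme \<Rightarrow> ('m set \<Rightarrow>\<^sub>0 int) set" where
  "id_ideal F = Idl\<^bsub>B_iso F\<^esub>
     {frag_of (arr_class F (Ide F X)) - frag_of (arr_class F (Ide F Y)) | X Y.
        X \<in> Obj F \<and> Y \<in> Obj F}"

definition hopf_feynman :: "('o, 'm, 'z) moncat_scheme \<Rightarrow> bool" where
  "hopf_feynman F \<longleftrightarrow> factorization_finite F \<and> almost_group_like_identities F \<and>
     (\<exists>S. is_antipode (B_iso F Quot id_ideal F)
        (quot_coproduct (B_iso F) (id_ideal F) (Delta_iso F)) (quot_counit (epsilon_iso F)) S)"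


section \<open>Degree functions\<close>

definition degree_function :: "('o, 'm, 'z) moncat_scheme \<Rightarrow> ('m \<Rightarrow> int) \<Rightarrow> bool" where
  "degree_function F deg \<longleftrightarrow>
     (\<forall>\<phi> \<in> Arr F. \<forall>\<psi> \<in> Arr F. Cod F \<psi> = Dom F \<phi> \<longrightarrow> deg (\<phi> \<bullet>\<^bsub>F\<^esub> \<psi>) = deg \<phi> + deg \<psi>) \<and>
     (\<forall>\<phi> \<in> Arr F. \<forall>\<psi> \<in> Arr F. deg (\<phi> \<boxtimes>\<^bsub>F\<^esub> \<psi>) = deg \<phi> + deg \<psi>) \<and>
     (\<forall>\<phi>. is_iso F \<phi> \<longrightarrow> deg \<phi> = 0)"

definition definite_degree :: "('o, 'm, 'z) cat_scheme \<Rightarrow> ('m \<Rightarrow> int) \<Rightarrow> bool" where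
  "definite_degree F deg \<longleftrightarrow> (\<forall>\<phi> \<in> Arr F. deg \<phi> \<ge> 0) \<or> (\<forall>\<phi> \<in> Arr F. deg \<phi> \<le> 0)"

definition B0_iso :: "('o, 'm, 'z) moncat_scheme \<Rightarrow> ('m \<Rightarrow> int) \<Rightarrow> ('m set \<Rightarrow>\<^sub>0 int) ring" where
  "B0_iso F deg = class_span F {\<phi> \<in> Arr F. deg \<phi> = 0}"

definition id_ideal0 :: "('o, 'm, 'z) moncat_scheme \<Rightarrow> ('m \<Rightarrow> int) \<Rightarrow> ('m set \<Rightarrow>\<^sub>0 int) set" where
  "id_ideal0 F deg = id_ideal F \<inter> carrier (B0_iso F deg)"

definition almost_connected :: "('o, 'm, 'z) moncat_scheme \<Rightarrow> ('m \<Rightarrow> int) \<Rightarrow> bool" where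
  "almost_connected F deg \<longleftrightarrow> factorization_finite F \<and> almost_group_like_identities F \<and>
     connected_coalgebra (B0_iso F deg Quot id_ideal0 F deg)
       (quot_coproduct (B0_iso F deg) (id_ideal0 F deg) (Delta_iso F))
       (quot_counit (epsilon_iso F))"

end

theory Submission
  imports Defs
begin

text \<open>
  The antipode is the inverse of the identity under convolution, and that inverse is found as a
  product of two geometric series.  Let \<open>u\<close> be the co-unit followed by the unit.  Up to sign, the
  difference of \<open>u\<close> and the identity is cut into a part \<open>h0\<close> supported in degree \<open>0\<close> and a part \<open>h1\<close>
  supported in the other degrees, so that the identity is \<open>u - h0 - h1\<close>.  Connectedness of the
  degree-\<open>0\<close> part implies that on every class the convolution powers of \<open>h0\<close> are eventually \<open>0\<close> modulo
  the ideal of identities (\<open>locally_nilpotent_h0\<close>); the sum \<open>g\<close> of these powers is then a well-defined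
  convolution inverse of \<open>u - h0\<close>.  Now \<open>u - h0 - h1 = (u - h0) * (u - g * h1)\<close>, and the \<open>n\<close>-th power of
  \<open>g * h1\<close> vanishes on all classes of degree less than \<open>n\<close> because the degree is additive and of one
  sign, so a second geometric series inverts the other factor (\<open>convolution_inverse\<close>).  The
  two parts need separate series because the exponent at which \<open>h0\<close> dies may depend on the class: in a
  long convolution power of \<open>h0 + h1\<close> the degree bounds only the number of factors \<open>h1\<close>.

  All maps are functions on the basis of isomorphism classes with values in the ring spanned by the
  classes, and equations hold modulo the ideal.  Co-associativity makes convolution associative.  That
  convolution preserves the maps which descend to the quotient (\<open>admissible_conv\<close>) needs more: the
  co-product has to be multiplicative, that is, the factorizations of \<open>\<phi> \<otimes> \<psi>\<close> up to equivalence
  correspond to pairs of factorizations of \<open>\<phi>\<close> and of \<open>\<psi>\<close>.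

  This is where the axioms of a Feynman category enter, through three properties
  (\<open>tensor_splitting\<close>): a morphism into \<open>Y \<otimes> Y'\<close> is a tensor product of morphisms into \<open>Y\<close> and \<open>Y'\<close>
  after an isomorphism of its source; two such presentations differ by a tensor product of
  isomorphisms; and a tensor product of automorphisms is an identity only if both factors are.
  By the second axiom a morphism is a word of letters \<open>(X, v, \<phi>)\<close>, and an isomorphism of morphisms is a
  permutation \<open>p\<close> together with isomorphisms of the letters.  To see on \<open>Y \<otimes> Y'\<close> which letters belong
  to which factor, the target of such a word is compared with the image, under the first axiom, of the
  word of the objects \<open>v\<close>: both are monoidal functors on words with the same values on letters, so
  there is a monoidal natural isomorphism between them (\<open>comparison_natural\<close>).  Along it, an
  isomorphism over \<open>Y \<otimes> Y'\<close> that is a tensor product on targets has a block permutation \<open>p\<close>, hence is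
  itself a tensor product (\<open>split_unique_words\<close>).
\<close>

section \<open>Isomorphisms in monoidal categories\<close>

text \<open>
  The laws of a category are restated with conditions on domains and codomains in place of
  hom-sets: the source and target objects then need not be guessed when the laws are used for rewriting.
\<close>

context category
begin

lemma HomI: "f \<in> Arr C \<Longrightarrow> Dom C f = X \<Longrightarrow> Cod C f = Y \<Longrightarrow> f \<in> Hom C X Y"
  by (simp add: Hom_def)

lemma ide_arr [simp]: "X \<in> Obj C \<Longrightarrow> Ide C X \<in> Arr C"
  and dom_ide [simp]: "X \<in> Obj C \<Longrightarrow> Dom C (Ide C X) = X"
  and cod_ide [simp]: "X \<in> Obj C \<Longrightarrow> Cod C (Ide C X) = X"
  using ide_hom by (auto simp: Hom_def)

lemma comp_arr [simp]: "f \<in> Arr C \<Longrightarrow> g \<in> Arr C \<Longrightarrow> Cod C f = Dom C g \<Longrightarrow> g \<bullet> f \<in> Arr C"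
  and dom_comp [simp]: "f \<in> Arr C \<Longrightarrow> g \<in> Arr C \<Longrightarrow> Cod C f = Dom C g \<Longrightarrow> Dom C (g \<bullet> f) = Dom C f"
  and cod_comp [simp]: "f \<in> Arr C \<Longrightarrow> g \<in> Arr C \<Longrightarrow> Cod C f = Dom C g \<Longrightarrow> Cod C (g \<bullet> f) = Cod C g"
  using comp_hom[of f "Dom C f" "Cod C f" g "Cod C g"] by (auto simp: Hom_def)

lemma ide_left [simp]: "f \<in> Arr C \<Longrightarrow> Cod C f = Y \<Longrightarrow> Ide C Y \<bullet> f = f"
  and ide_right [simp]: "f \<in> Arr C \<Longrightarrow> Dom C f = X \<Longrightarrow> f \<bullet> Ide C X = f"
  using comp_ide_left comp_ide_right by (auto simp: Hom_def)

lemma assoc_arr [simp]: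
  "f \<in> Arr C \<Longrightarrow> g \<in> Arr C \<Longrightarrow> h \<in> Arr C \<Longrightarrow> Cod C f = Dom C g \<Longrightarrow> Cod C g = Dom C h
    \<Longrightarrow> (h \<bullet> g) \<bullet> f = h \<bullet> (g \<bullet> f)"
  by (rule comp_assoc) (auto simp: Hom_def)

declare dom_obj [simp] cod_obj [simp]

lemma hom_obj: "f \<in> Hom C X Y \<Longrightarrow> X \<in> Obj C \<and> Y \<in> Obj C"
  by (auto simp: Hom_def)

lemma inverse_unique:
  assumes "inverse_arrows C f g" "inverse_arrows C f h"
  shows "g = h"
proof -
  have a: "f \<in> Arr C" "g \<in> Arr C" "h \<in> Arr C" "Dom C g = Cod C f" "Cod C g = Dom C f"
    "Dom C h = Cod C f" "Cod C h = Dom C f" using assms by (auto simp: inverse_arrows_def Hom_def)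
  have gf: "g \<bullet> f = Ide C (Dom C f)" and fh: "f \<bullet> h = Ide C (Cod C f)"
    using assms by (auto simp: inverse_arrows_def)
  have "g = g \<bullet> (f \<bullet> h)" unfolding fh using a by simp
  also have "\<dots> = (g \<bullet> f) \<bullet> h" using a by simp
  also have "\<dots> = h" unfolding gf using a by simp
  finally show ?thesis .
qed

lemma inverse_inv_arr: "is_iso C f \<Longrightarrow> inverse_arrows C f (inv_arr C f)"
  unfolding is_iso_def inv_arr_def by (elim exE) (rule theI, auto intro: inverse_unique)

lemma iso_homI:
  assumes "f \<in> Hom C X Y" "g \<in> Hom C Y X" "g \<bullet> f = Ide C X" "f \<bullet> g = Ide C Y"
  shows "f \<in> iso_hom C X Y"
proof -
  have "f \<in> Arr C" "Dom C f = X" "Cod C f = Y" using assms(1) by (simp_all add: Hom_def)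
  then have "inverse_arrows C f g" using assms(2-4) by (simp add: inverse_arrows_def)
  then show ?thesis using assms(1) unfolding iso_hom_def is_iso_def by blast
qed

lemma inv_arr_eqI:
  assumes "f \<in> Hom C X Y" "g \<in> Hom C Y X" "g \<bullet> f = Ide C X" "f \<bullet> g = Ide C Y"
  shows "inv_arr C f = g"
proof -
  have "f \<in> Arr C" "Dom C f = X" "Cod C f = Y" using assms(1) by (simp_all add: Hom_def)
  then have "inverse_arrows C f g" using assms(2-4) by (simp add: inverse_arrows_def)
  moreover from this have "is_iso C f" unfolding is_iso_def by blast
  ultimately show ?thesis using inverse_unique[OF inverse_inv_arr] by blast
qed

lemma iso_hom_hom: "f \<in> iso_hom C X Y \<Longrightarrow> f \<in> Hom C X Y"
  by (simp add: iso_hom_def)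

lemma iso_homD:
  assumes "f \<in> iso_hom C X Y"
  shows "f \<in> Arr C" "Dom C f = X" "Cod C f = Y" "X \<in> Obj C" "Y \<in> Obj C"
    "inv_arr C f \<in> Arr C" "Dom C (inv_arr C f) = Y" "Cod C (inv_arr C f) = X"
    "inv_arr C f \<bullet> f = Ide C X" "f \<bullet> inv_arr C f = Ide C Y"
    "inv_arr C f \<in> iso_hom C Y X"
    "\<And>g. g \<in> Arr C \<Longrightarrow> Cod C g = X \<Longrightarrow> inv_arr C f \<bullet> (f \<bullet> g) = g"
    "\<And>g. g \<in> Arr C \<Longrightarrow> Cod C g = Y \<Longrightarrow> f \<bullet> (inv_arr C f \<bullet> g) = g"
proof -
  from assms have f: "f \<in> Arr C" "Dom C f = X" "Cod C f = Y"
    and i: "inverse_arrows C f (inv_arr C f)"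
    using inverse_inv_arr by (auto simp: iso_hom_def Hom_def)
  have g: "inv_arr C f \<in> Arr C" "Dom C (inv_arr C f) = Y" "Cod C (inv_arr C f) = X"
    "inv_arr C f \<bullet> f = Ide C X" "f \<bullet> inv_arr C f = Ide C Y"
    using i f by (auto simp: inverse_arrows_def Hom_def)
  show "f \<in> Arr C" "Dom C f = X" "Cod C f = Y" "X \<in> Obj C" "Y \<in> Obj C"
    "inv_arr C f \<in> Arr C" "Dom C (inv_arr C f) = Y" "Cod C (inv_arr C f) = X"
    "inv_arr C f \<bullet> f = Ide C X" "f \<bullet> inv_arr C f = Ide C Y" using f g by auto
  show "inv_arr C f \<in> iso_hom C Y X"
    by (rule iso_homI[of _ _ _ f]) (use f g in \<open>auto simp: Hom_def\<close>)
  fix h assume h: "h \<in> Arr C"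
  have X: "X \<in> Obj C" "Y \<in> Obj C" using f by auto
  show "Cod C h = X \<Longrightarrow> inv_arr C f \<bullet> (f \<bullet> h) = h"
    using f g X h assoc_arr[of h f "inv_arr C f"] by (simp del: assoc_arr)
  show "Cod C h = Y \<Longrightarrow> f \<bullet> (inv_arr C f \<bullet> h) = h"
    using f g X h assoc_arr[of h "inv_arr C f" f] by (simp del: assoc_arr)
qed

lemma ide_iso_hom: "X \<in> Obj C \<Longrightarrow> Ide C X \<in> iso_hom C X X"
  by (rule iso_homI) (auto intro: ide_hom)

lemma comp_iso_hom:
  assumes "f \<in> iso_hom C X Y" "g \<in> iso_hom C Y Z"
  shows "g \<bullet> f \<in> iso_hom C X Z"
proof (rule iso_homI[of _ _ _ "inv_arr C f \<bullet> inv_arr C g"])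
  note [simp] = iso_homD[OF assms(1)] iso_homD[OF assms(2)]
  show "g \<bullet> f \<in> Hom C X Z" "inv_arr C f \<bullet> inv_arr C g \<in> Hom C Z X" by (auto simp: Hom_def)
  show "(inv_arr C f \<bullet> inv_arr C g) \<bullet> g \<bullet> f = Ide C X" by simp
  show "(g \<bullet> f) \<bullet> inv_arr C f \<bullet> inv_arr C g = Ide C Z" by simp
qed

lemma iso_cancel_right:
  assumes "f \<in> iso_hom C X Y" "g \<in> Arr C" "h \<in> Arr C" "Dom C g = Y" "Dom C h = Y"
    "g \<bullet> f = h \<bullet> f"
  shows "g = h"
proof -
  note [simp] = iso_homD[OF assms(1)]
  have "g = (g \<bullet> f) \<bullet> inv_arr C f" using assms(2,4) by simp
  also have "\<dots> = h" unfolding assms(6) using assms(3,5) by simp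
  finally show ?thesis .
qed

lemma iso_cancel_left:
  assumes "f \<in> iso_hom C X Y" "g \<in> Arr C" "h \<in> Arr C" "Cod C g = X" "Cod C h = X"
    "f \<bullet> g = f \<bullet> h"
  shows "g = h"
  using iso_homD(12)[OF assms(1)] assms by metis

lemma is_iso_iff: "is_iso C f \<longleftrightarrow> f \<in> iso_hom C (Dom C f) (Cod C f)"
  by (auto simp: iso_hom_def Hom_def is_iso_def inverse_arrows_def)

end

context monoidal_category
begin

lemma ten_arr [simp]: "f \<in> Arr C \<Longrightarrow> g \<in> Arr C \<Longrightarrow> f \<boxtimes> g \<in> Arr C"
  and dom_ten [simp]: "f \<in> Arr C \<Longrightarrow> g \<in> Arr C \<Longrightarrow> Dom C (f \<boxtimes> g) = Dom C f \<odot> Dom C g"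
  and cod_ten [simp]: "f \<in> Arr C \<Longrightarrow> g \<in> Arr C \<Longrightarrow> Cod C (f \<boxtimes> g) = Cod C f \<odot> Cod C g"
  using ten_hom[of f "Dom C f" "Cod C f" g "Dom C g" "Cod C g"] by (auto simp: Hom_def)

lemma interchange [simp]:
  "f \<in> Arr C \<Longrightarrow> g \<in> Arr C \<Longrightarrow> f' \<in> Arr C \<Longrightarrow> g' \<in> Arr C \<Longrightarrow> Cod C f = Dom C g
    \<Longrightarrow> Cod C f' = Dom C g' \<Longrightarrow> (g \<boxtimes> g') \<bullet> (f \<boxtimes> f') = (g \<bullet> f) \<boxtimes> (g' \<bullet> f')"
  by (rule ten_comp[symmetric]) (auto simp: Hom_def)

lemma interchange' [simp]:
  "f \<in> Arr C \<Longrightarrow> g \<in> Arr C \<Longrightarrow> f' \<in> Arr C \<Longrightarrow> g' \<in> Arr C \<Longrightarrow> Cod C f = Dom C g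
    \<Longrightarrow> Cod C f' = Dom C g' \<Longrightarrow> h \<in> Arr C \<Longrightarrow> Cod C h = Dom C f \<odot> Dom C f'
    \<Longrightarrow> (g \<boxtimes> g') \<bullet> (f \<boxtimes> f') \<bullet> h = ((g \<bullet> f) \<boxtimes> (g' \<bullet> f')) \<bullet> h"
  using assoc_arr[of h "f \<boxtimes> f'" "g \<boxtimes> g'"] by (simp del: assoc_arr)

declare ten_ide [simp] ten_obj [simp] unit_obj [simp]

lemma ten_iso_hom:
  assumes "f \<in> iso_hom C X Y" "g \<in> iso_hom C X' Y'"
  shows "f \<boxtimes> g \<in> iso_hom C (X \<odot> X') (Y \<odot> Y')"
proof (rule iso_homI[of _ _ _ "inv_arr C f \<boxtimes> inv_arr C g"])
  note [simp] = iso_homD[OF assms(1)] iso_homD[OF assms(2)]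
  show "f \<boxtimes> g \<in> Hom C (X \<odot> X') (Y \<odot> Y')"
    "inv_arr C f \<boxtimes> inv_arr C g \<in> Hom C (Y \<odot> Y') (X \<odot> X')" by (auto simp: Hom_def)
  show "(inv_arr C f \<boxtimes> inv_arr C g) \<bullet> (f \<boxtimes> g) = Ide C (X \<odot> X')" by simp
  show "(f \<boxtimes> g) \<bullet> (inv_arr C f \<boxtimes> inv_arr C g) = Ide C (Y \<odot> Y')" by simp
qed

end

context cfunctor
begin

lemma farr_arr [simp]: "f \<in> Arr A \<Longrightarrow> farr T f \<in> Arr B"
  and dom_farr [simp]: "f \<in> Arr A \<Longrightarrow> Dom B (farr T f) = fobj T (Dom A f)"
  and cod_farr [simp]: "f \<in> Arr A \<Longrightarrow> Cod B (farr T f) = fobj T (Cod A f)"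
  using map_hom[of f "Dom A f" "Cod A f"] by (auto simp: Hom_def)

lemma farr_comp [simp]: "f \<in> Arr A \<Longrightarrow> g \<in> Arr A \<Longrightarrow> Cod A f = Dom A g
    \<Longrightarrow> farr T (g \<bullet>\<^bsub>A\<^esub> f) = farr T g \<bullet>\<^bsub>B\<^esub> farr T f"
  by (rule map_comp) (auto simp: Hom_def)

declare map_obj [simp] map_ide [simp]

end

section \<open>Equivalences of categories\<close>

lemma equivalence_surj:
  assumes "equivalence_ftor A B T" "Y \<in> Obj B"
  obtains X f where "X \<in> Obj A" "f \<in> iso_hom B (fobj T X) Y"
proof -
  from assms(1) obtain S \<theta> where "cfunctor B A S" "nat_iso B B (comp_ftor T S) id_ftor \<theta>"
    by (auto simp: equivalence_ftor_def)
  with assms(2) show ?thesis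
    using that[of "fobj S Y" "\<theta> Y"]
    by (auto simp: nat_iso_def comp_ftor_def id_ftor_def cfunctor.map_obj)
qed

lemma equivalence_faithful:
  assumes "equivalence_ftor A B T" "f \<in> Hom A X Y" "g \<in> Hom A X Y" "farr T f = farr T g"
  shows "f = g"
proof -
  from assms(1) obtain S \<eta> where S: "cfunctor B A S" and n: "nat_iso A A id_ftor (comp_ftor S T) \<eta>"
    and T: "cfunctor A B T"
    by (auto simp: equivalence_ftor_def)
  interpret T: cfunctor A B T by fact
  have XY: "X \<in> Obj A" "Y \<in> Obj A" using T.A.hom_obj[OF assms(2)] by auto
  have i: "\<eta> Y \<in> iso_hom A Y (fobj S (fobj T Y))"
    using n XY by (auto simp: nat_iso_def id_ftor_def comp_ftor_def)
  have "\<eta> Y \<bullet>\<^bsub>A\<^esub> f = farr S (farr T f) \<bullet>\<^bsub>A\<^esub> \<eta> X"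
    using n XY assms(2) by (auto simp: nat_iso_def id_ftor_def comp_ftor_def)
  also have "\<dots> = \<eta> Y \<bullet>\<^bsub>A\<^esub> g"
    unfolding assms(4) using n XY assms(3) by (auto simp: nat_iso_def id_ftor_def comp_ftor_def)
  finally show ?thesis
    using T.A.iso_cancel_left[OF i] assms(2,3) by (auto simp: Hom_def)
qed

lemma equivalence_sym:
  assumes "equivalence_ftor A B T" "cfunctor B A S" "nat_iso A A id_ftor (comp_ftor S T) \<eta>"
    "nat_iso B B (comp_ftor T S) id_ftor \<theta>"
  shows "equivalence_ftor B A S"
proof -
  interpret T: cfunctor A B T using assms(1) by (simp add: equivalence_ftor_def)
  have inv: "nat_iso C C U U' (\<lambda>X. inv_arr C (\<nu> X))"
    if C: "cfunctor C C U" "cfunctor C C U'" and n: "nat_iso C C U' U \<nu>" for C :: "('x, 'y, 'z) cat_scheme" and U U' \<nu>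
  proof -
    interpret U: cfunctor C C U by fact
    interpret U': cfunctor C C U' by fact
    have i: "\<nu> X \<in> iso_hom C (fobj U' X) (fobj U X)" if "X \<in> Obj C" for X
      using n that by (auto simp: nat_iso_def)
    show ?thesis unfolding nat_iso_def
    proof (intro conjI ballI)
      fix X assume "X \<in> Obj C"
      then show "inv_arr C (\<nu> X) \<in> iso_hom C (fobj U X) (fobj U' X)"
        using U.A.iso_homD(11)[OF i] by blast
    next
      fix X Y f assume X: "X \<in> Obj C" and Y: "Y \<in> Obj C" and f: "f \<in> Hom C X Y"
      note [simp] = U.A.iso_homD[OF i[OF X]] U.A.iso_homD[OF i[OF Y]]
      have [simp]: "f \<in> Arr C" "Dom C f = X" "Cod C f = Y" using f by (auto simp: Hom_def)
      have e: "farr U f \<bullet>\<^bsub>C\<^esub> \<nu> X = \<nu> Y \<bullet>\<^bsub>C\<^esub> farr U' f" using n X Y f by (auto simp: nat_iso_def)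
      have "farr U' f \<bullet>\<^bsub>C\<^esub> inv_arr C (\<nu> X)
          = inv_arr C (\<nu> Y) \<bullet>\<^bsub>C\<^esub> (\<nu> Y \<bullet>\<^bsub>C\<^esub> farr U' f) \<bullet>\<^bsub>C\<^esub> inv_arr C (\<nu> X)" by simp
      also have "\<dots> = inv_arr C (\<nu> Y) \<bullet>\<^bsub>C\<^esub> farr U f" unfolding e[symmetric] by simp
      finally show "farr U' f \<bullet>\<^bsub>C\<^esub> inv_arr C (\<nu> X) = inv_arr C (\<nu> Y) \<bullet>\<^bsub>C\<^esub> farr U f" .
    qed
  qed
  interpret S: cfunctor B A S by fact
  have f: "cfunctor A A id_ftor" "cfunctor B B id_ftor" "cfunctor A A (comp_ftor S T)" "cfunctor B B (comp_ftor T S)"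
    by (unfold_locales; auto simp: id_ftor_def comp_ftor_def Hom_def)+
  show ?thesis unfolding equivalence_ftor_def
    using assms(1,2) inv[OF f(3,1) assms(3)] inv[OF f(2,4) assms(4)] by (auto simp: equivalence_ftor_def)
qed

text \<open>
  Naturality of \<open>\<eta>\<close> dictates the preimage \<open>f\<close> of \<open>g\<close>, and gives \<open>S (T f) = S g\<close>.  The quasi-inverse \<open>S\<close>
  is an equivalence as well, hence faithful, so \<open>T f = g\<close>.
\<close>
lemma equivalence_full:
  assumes "equivalence_ftor A B T" "X \<in> Obj A" "Y \<in> Obj A" "g \<in> Hom B (fobj T X) (fobj T Y)"
  obtains f where "f \<in> Hom A X Y" "farr T f = g"
proof -
  from assms(1) obtain S \<eta> \<theta> where S: "cfunctor B A S" and n: "nat_iso A A id_ftor (comp_ftor S T) \<eta>"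
    and T: "cfunctor A B T" and m: "nat_iso B B (comp_ftor T S) id_ftor \<theta>"
    by (auto simp: equivalence_ftor_def)
  interpret T: cfunctor A B T by fact
  interpret S: cfunctor B A S by fact
  have e: "equivalence_ftor B A S" using equivalence_sym[OF assms(1) S n m] .
  have i: "\<eta> Y \<in> iso_hom A Y (fobj S (fobj T Y))" if "Y \<in> Obj A" for Y
    using n that by (auto simp: nat_iso_def id_ftor_def comp_ftor_def)
  note [simp] = T.A.iso_homD[OF i[OF assms(2)]] T.A.iso_homD[OF i[OF assms(3)]]
  have [simp]: "g \<in> Arr B" "Dom B g = fobj T X" "Cod B g = fobj T Y" using assms(4) by (auto simp: Hom_def)
  define f where "f = inv_arr A (\<eta> Y) \<bullet>\<^bsub>A\<^esub> farr S g \<bullet>\<^bsub>A\<^esub> \<eta> X"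
  have f [simp]: "f \<in> Arr A" "Dom A f = X" "Cod A f = Y" by (simp_all add: f_def)
  have "farr S (farr T f) \<bullet>\<^bsub>A\<^esub> \<eta> X = \<eta> Y \<bullet>\<^bsub>A\<^esub> f"
    using n assms(2,3) f by (auto simp: nat_iso_def id_ftor_def comp_ftor_def Hom_def)
  also have "\<dots> = farr S g \<bullet>\<^bsub>A\<^esub> \<eta> X" by (simp add: f_def)
  finally have "farr S (farr T f) = farr S g"
    using T.A.iso_cancel_right[OF i[OF assms(2)], of "farr S (farr T f)" "farr S g"] by simp
  then have "farr T f = g"
    using equivalence_faithful[OF e, of "farr T f" "fobj T X" "fobj T Y" g] by (auto simp: Hom_def)
  then show ?thesis using that[of f] by (simp add: Hom_def)
qed

section \<open>Words and permutations\<close>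

text \<open>
  The free symmetric monoidal category (\<open>s = True\<close>) and the free monoidal category (\<open>s = False\<close>) differ
  only in the permutations that are admitted.  The flag lets every argument below treat both at once.
\<close>
definition free_cat ::
  "bool \<Rightarrow> ('o, 'm, 'z) cat_scheme \<Rightarrow> ('o list, 'm list \<times> (nat \<Rightarrow> nat)) moncat" where
  "free_cat s C = (free_smc C)\<lparr>Arr := {(fs, p). fs \<in> lists (Arr C) \<and> p permutes {..<length fs} \<and> (s \<or> p = id)}\<rparr>"

lemma free_cat_True: "free_cat True C = free_smc C"
  by (simp add: free_cat_def free_smc_def)

lemma free_cat_False: "free_cat False C = free_mc C"
proof -
  have "{(fs, p). fs \<in> lists (Arr C) \<and> p permutes {..<length fs} \<and> (False \<or> p = id)}
      = {(fs, p). fs \<in> lists (Arr C) \<and> p = id}"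
    by auto
  then show ?thesis by (simp add: free_cat_def free_mc_def)
qed

lemma free_cat_simps [simp]:
  "Obj (free_cat s C) = lists (Obj C)"
  "Ide (free_cat s C) = free_ide C"
  "tenO (free_cat s C) = (@)"
  "unitO (free_cat s C) = []"
  "assoc (free_cat s C) xs ys zs = free_ide C (xs @ ys @ zs)"
  "lunit (free_cat s C) = free_ide C"
  "runit (free_cat s C) = free_ide C"
  by (simp_all add: free_cat_def free_smc_def)

lemma free_cat_comp:
  "Comp (free_cat s C) (gs, q) (fs, p) = (map (\<lambda>i. (gs ! p i) \<bullet>\<^bsub>C\<^esub> (fs ! i)) [0..<length fs], q \<circ> p)"
  and free_cat_ten:
  "tenA (free_cat s C) (fs, p) (gs, q) = (fs @ gs, block_perm (length fs) p q)"
  by (simp_all add: free_cat_def free_smc_def)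

text \<open>
  Testing the \<open>p i\<close>-th letter of the codomain in place of the \<open>i\<close>-th one removes the inverse of \<open>p\<close>.
\<close>
lemma free_hom_iff:
  "(fs, p) \<in> Hom (free_cat s C) xs ys \<longleftrightarrow>
     p permutes {..<length xs} \<and> (s \<or> p = id) \<and> length fs = length xs \<and> length ys = length xs \<and>
     (\<forall>i<length xs. fs ! i \<in> Hom C (xs ! i) (ys ! p i))"
proof (cases "p permutes {..<length xs} \<and> (s \<or> p = id) \<and> length fs = length xs \<and> length ys = length xs")
  case True
  then have p: "p permutes {..<length xs}" and l: "length fs = length xs" "length ys = length xs"
    by blast+
  have A: "fs \<in> lists (Arr C) \<longleftrightarrow> (\<forall>i<length xs. fs ! i \<in> Arr C)"
    by (simp add: l in_lists_conv_set all_set_conv_all_nth)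
  have D: "map (Dom C) fs = xs \<longleftrightarrow> (\<forall>i<length xs. Dom C (fs ! i) = xs ! i)"
    by (simp add: l list_eq_iff_nth_eq)
  have "map (\<lambda>j. Cod C (fs ! inv_into UNIV p j)) [0..<length fs] = ys \<longleftrightarrow>
      (\<forall>j<length xs. Cod C (fs ! inv_into UNIV p j) = ys ! j)"
    unfolding list_eq_iff_nth_eq length_map length_upt l by auto
  also have "\<dots> \<longleftrightarrow> (\<forall>i<length xs. Cod C (fs ! i) = ys ! p i)"
  proof safe
    fix i assume a: "\<forall>j<length xs. Cod C (fs ! inv_into UNIV p j) = ys ! j" and i: "i < length xs"
    have "p i < length xs" using permutes_in_image[OF p, of i] i by simp
    with a have "Cod C (fs ! inv_into UNIV p (p i)) = ys ! p i" by blast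
    then show "Cod C (fs ! i) = ys ! p i" by (simp add: permutes_inverses[OF p])
  next
    fix j assume a: "\<forall>i<length xs. Cod C (fs ! i) = ys ! p i" and j: "j < length xs"
    have "inv_into UNIV p j < length xs" using permutes_in_image[OF permutes_inv[OF p], of j] j by simp
    with a have "Cod C (fs ! inv_into UNIV p j) = ys ! p (inv_into UNIV p j)" by blast
    then show "Cod C (fs ! inv_into UNIV p j) = ys ! j" by (simp add: permutes_inverses[OF p])
  qed
  finally have E: "map (\<lambda>j. Cod C (fs ! inv_into UNIV p j)) [0..<length fs] = ys \<longleftrightarrow>
      (\<forall>i<length xs. Cod C (fs ! i) = ys ! p i)" .
  have "p permutes {..<length fs} \<and> (s \<or> p = id)" using True by simp
  then have "(fs, p) \<in> Hom (free_cat s C) xs ys \<longleftrightarrow> fs \<in> lists (Arr C) \<and> map (Dom C) fs = xs \<and>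
      map (\<lambda>j. Cod C (fs ! inv_into UNIV p j)) [0..<length fs] = ys"
    by (simp add: Hom_def free_cat_def free_smc_def)
  also have "\<dots> \<longleftrightarrow> (\<forall>i<length xs. fs ! i \<in> Hom C (xs ! i) (ys ! p i))"
    unfolding A D E Hom_def by blast
  finally show ?thesis using True by blast
next
  case False
  have "(fs, p) \<notin> Hom (free_cat s C) xs ys"
    using False by (auto simp: Hom_def free_cat_def free_smc_def)
  with False show ?thesis by blast
qed

context category
begin

lemma free_ide_hom: "xs \<in> lists (Obj C) \<Longrightarrow> free_ide C xs \<in> Hom (free_cat s C) xs xs"
  unfolding free_ide_def free_hom_iff by (auto simp: ide_hom in_lists_conv_set)

lemma letter_hom: "f \<in> Hom C x y \<Longrightarrow> ([f], id) \<in> Hom (free_cat s C) [x] [y]"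
  unfolding free_hom_iff by auto

lemma free_ten_hom:
  assumes "(fs, p) \<in> Hom (free_cat s C) xs ys" "(gs, q) \<in> Hom (free_cat s C) xs' ys'"
  shows "(fs @ gs, block_perm (length xs) p q) \<in> Hom (free_cat s C) (xs @ xs') (ys @ ys')"
proof -
  let ?n = "length xs" and ?r = "block_perm (length xs) p q"
  from assms have p: "p permutes {..<?n}" and q: "q permutes {..<length xs'}"
    and l: "length fs = ?n" "length ys = ?n" "length gs = length xs'" "length ys' = length xs'"
    by (auto simp: free_hom_iff)
  have pl: "p i < ?n \<longleftrightarrow> i < ?n" for i using permutes_in_image[OF p, of i] by simp
  have ql: "q i < length xs' \<longleftrightarrow> i < length xs'" for i using permutes_in_image[OF q, of i] by simp
  have "?r permutes {..<length (xs @ xs')}"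
  proof (rule inj_imp_permutes)
    show "inj_on ?r {..<length (xs @ xs')}"
    proof (rule inj_onI)
      fix i j assume e: "?r i = ?r j"
      have "i < ?n \<longleftrightarrow> j < ?n"
        using e pl[of i] pl[of j] by (auto simp: block_perm_def split: if_splits)
      with e show "i = j"
        using permutes_inj[OF p] permutes_inj[OF q] by (auto simp: block_perm_def inj_eq split: if_splits)
    qed
    show "i \<in> {..<length (xs @ xs')} \<Longrightarrow> ?r i \<in> {..<length (xs @ xs')}" for i
      using pl[of i] ql[of "i - ?n"] by (auto simp: block_perm_def)
    show "i \<notin> {..<length (xs @ xs')} \<Longrightarrow> ?r i = i" for i
      using permutes_not_in[OF q, of "i - ?n"] by (auto simp: block_perm_def)
  qed simp
  moreover have "s \<or> ?r = id"
  proof (cases s)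
    case False
    then have "p = id" "q = id" using assms by (simp_all add: free_hom_iff)
    then show ?thesis by (auto simp: block_perm_def)
  qed simp
  moreover have "(fs @ gs) ! i \<in> Hom C ((xs @ xs') ! i) ((ys @ ys') ! ?r i)"
    if "i < length (xs @ xs')" for i
    using assms that pl[of i] ql[of "i - ?n"] l by (auto simp: free_hom_iff block_perm_def nth_append)
  ultimately show ?thesis using l by (simp add: free_hom_iff)
qed

lemma free_ten_hom':
  assumes "a \<in> Hom (free_cat s C) xs ys" "b \<in> Hom (free_cat s C) xs' ys'"
  shows "tenA (free_cat s C) a b \<in> Hom (free_cat s C) (xs @ xs') (ys @ ys')"
proof -
  obtain fs p gs q where ab: "a = (fs, p)" "b = (gs, q)" by (cases a, cases b)
  with assms have "length fs = length xs" by (simp add: free_hom_iff)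
  then show ?thesis using free_ten_hom[of fs p s xs ys gs q xs' ys'] assms ab by (simp add: free_cat_ten)
qed

lemma free_braid_hom:
  assumes "s" "xs \<in> lists (Obj C)" "ys \<in> lists (Obj C)"
  shows "free_braid C xs ys \<in> Hom (free_cat s C) (xs @ ys) (ys @ xs)"
proof -
  let ?r = "block_swap (length xs) (length ys)"
  have "?r permutes {..<length (xs @ ys)}"
    by (rule inj_imp_permutes) (auto simp: inj_on_def block_swap_def split: if_splits)
  moreover have "map (Ide C) (xs @ ys) ! i \<in> Hom C ((xs @ ys) ! i) ((ys @ xs) ! ?r i)"
    if i: "i < length (xs @ ys)" for i
  proof -
    have "(ys @ xs) ! ?r i = (xs @ ys) ! i" using i by (auto simp: block_swap_def nth_append)
    moreover have "(xs @ ys) ! i \<in> Obj C" using assms i nth_mem[OF i] by (auto simp: in_lists_conv_set)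
    ultimately show ?thesis using i ide_hom by (metis nth_map)
  qed
  ultimately show ?thesis using assms(1) by (simp add: free_braid_def free_hom_iff)
qed

text \<open>
  Let \<open>p\<close> send the first letter to position \<open>k\<close>.  Moving that letter past the \<open>k\<close> letters that end up
  before it is a braiding, and what remains is the first letter beside an arrow between the words
  without it.  Thus letters, tensor products and braidings generate all arrows.
\<close>
lemma free_arr_cons:
  assumes "(f # fs, p) \<in> Hom (free_cat s C) (x # xs) zs"
  obtains (plain) y ys where "zs = y # ys" "f \<in> Hom C x y" "(fs, id) \<in> Hom (free_cat s C) xs ys"
      "(f # fs, p) = tenA (free_cat s C) ([f], id) (fs, id)"
  | (braided) y ys1 ys2 p' where "s" "zs = ys1 @ y # ys2" "f \<in> Hom C x y"
      "(fs, p') \<in> Hom (free_cat s C) xs (ys1 @ ys2)"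
      "(f # fs, p) = Comp (free_cat s C) (tenA (free_cat s C) (free_braid C [y] ys1) (free_ide C ys2))
         (tenA (free_cat s C) ([f], id) (fs, p'))"
proof (cases s)
  case False
  with assms have p: "p = id" by (simp add: free_hom_iff)
  have "length zs = Suc (length xs)" using assms by (simp add: free_hom_iff)
  then obtain y ys where zs: "zs = y # ys" by (cases zs) auto
  have h: "\<forall>i<Suc (length xs). (f # fs) ! i \<in> Hom C ((x # xs) ! i) ((y # ys) ! i)"
    using assms p zs by (simp add: free_hom_iff)
  have "f \<in> Hom C x y" using h by force
  moreover have "(fs, id) \<in> Hom (free_cat s C) xs ys"
    using assms p zs h by (force simp: free_hom_iff)
  moreover have "(f # fs, p) = tenA (free_cat s C) ([f], id) (fs, id)"
    by (auto simp: free_cat_ten p block_perm_def fun_eq_iff)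
  ultimately show ?thesis using plain zs by blast
next
  case s: True
  define n where "n = length xs"
  from assms have p: "p permutes {..<Suc n}" and l: "length fs = n" "length zs = Suc n"
    and h: "\<And>i. i < Suc n \<Longrightarrow> (f # fs) ! i \<in> Hom C ((x # xs) ! i) (zs ! p i)"
    by (auto simp: free_hom_iff n_def)
  have pl: "p i < Suc n \<longleftrightarrow> i < Suc n" for i using permutes_in_image[OF p, of i] by simp
  have pi: "p i = p j \<longleftrightarrow> i = j" for i j using permutes_inj[OF p] by (simp add: inj_eq)
  define k where "k = p 0"
  have k: "k < Suc n" using pl[of 0] by (simp add: k_def)
  define ys1 where "ys1 = take k zs"
  define ys2 where "ys2 = drop (Suc k) zs"
  define y where "y = zs ! k"
  have zs: "zs = ys1 @ y # ys2" using k l by (simp add: ys1_def ys2_def y_def id_take_nth_drop)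
  have l1: "length ys1 = k" "length ys2 = n - k" using k l by (auto simp: ys1_def ys2_def)
  (* \<open>p'\<close> is \<open>p\<close> without the first letter: positions beyond \<open>k\<close> move down by one. *)
  define p' where "p' i = (if p (Suc i) < k then p (Suc i) else p (Suc i) - 1)" for i
  have ne: "p (Suc i) \<noteq> k" for i using pi[of "Suc i" 0] by (simp add: k_def)
  have p'l: "p' i < n" if "i < n" for i
    using pl[of "Suc i"] that ne[of i] k by (auto simp: p'_def)
  have p': "p' permutes {..<n}"
  proof (rule inj_imp_permutes)
    show "inj_on p' {..<n}"
    proof (rule inj_onI)
      fix i j assume "p' i = p' j"
      then have "p (Suc i) = p (Suc j)"
        using ne[of i] ne[of j] by (auto simp: p'_def split: if_splits)
      then show "i = j" using pi by simp
    qed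
    show "i \<notin> {..<n} \<Longrightarrow> p' i = i" for i
      using permutes_not_in[OF p, of "Suc i"] k by (auto simp: p'_def)
  qed (use p'l in auto)
  have nth: "(ys1 @ ys2) ! p' i = zs ! p (Suc i)" for i
    using ne[of i] l1 unfolding zs by (auto simp: p'_def nth_append Suc_diff_le nth_Cons')
  have fy: "f \<in> Hom C x y" using h[of 0] by (simp add: y_def k_def)
  have fs: "(fs, p') \<in> Hom (free_cat s C) xs (ys1 @ ys2)"
    using p' s l l1 k nth h[of "Suc _"] by (auto simp: free_hom_iff n_def)
  have arr: "fs ! i \<in> Arr C" "Cod C (fs ! i) = (ys1 @ ys2) ! p' i" if "i < n" for i
    using h[of "Suc i"] that nth[of i] by (auto simp: Hom_def)
  have comp: "(map (Ide C) (y # ys1) @ map (Ide C) ys2) ! (block_perm 1 id p' i) \<bullet> (f # fs) ! i = (f # fs) ! i"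
    if i: "i < Suc n" for i
  proof (cases i)
    case 0
    then show ?thesis using fy by (simp add: block_perm_def Hom_def)
  next
    case (Suc j)
    then have j: "j < n" using i by simp
    have "(map (Ide C) (y # ys1) @ map (Ide C) ys2) ! (block_perm 1 id p' i) = Ide C ((ys1 @ ys2) ! p' j)"
      using Suc j p'l[OF j] l1 k by (simp add: block_perm_def flip: map_append)
    then show ?thesis using arr[OF j] Suc by simp
  qed
  have perm: "block_perm (Suc k) (block_swap 1 k) id \<circ> block_perm 1 id p' = p"
  proof
    fix i show "(block_perm (Suc k) (block_swap 1 k) id \<circ> block_perm 1 id p') i = p i"
      using ne[of "i - 1"] by (cases i) (auto simp: block_perm_def block_swap_def p'_def k_def)
  qed
  have "(f # fs, p) = Comp (free_cat s C) (tenA (free_cat s C) (free_braid C [y] ys1) (free_ide C ys2))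
         (tenA (free_cat s C) ([f], id) (fs, p'))"
  proof -
    have "map (\<lambda>i. (map (Ide C) (y # ys1) @ map (Ide C) ys2) ! (block_perm 1 id p' i) \<bullet> (f # fs) ! i)
        [0..<length (f # fs)] = f # fs"
      using comp l by (intro nth_equalityI) (simp_all del: upt_Suc)
    then show ?thesis using perm l l1
      by (simp add: free_cat_comp free_cat_ten free_braid_def free_ide_def del: upt_Suc)
  qed
  then show ?thesis using braided s zs fy fs by blast
qed

lemma free_split:
  assumes h: "(fs, block_perm n p q) \<in> Hom (free_cat s C) (xs @ xs') (ys @ ys')"
    and n: "length xs = n" "length ys = n"
    and p: "p permutes {..<n}" "s \<or> p = id" and q: "q permutes {..<length xs'}" "s \<or> q = id"
  shows "(take n fs, p) \<in> Hom (free_cat s C) xs ys" "(drop n fs, q) \<in> Hom (free_cat s C) xs' ys'"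
    "(fs, block_perm n p q) = tenA (free_cat s C) (take n fs, p) (drop n fs, q)"
proof -
  have pl: "p i < n \<longleftrightarrow> i < n" for i using permutes_in_image[OF p(1), of i] by simp
  have l: "length fs = n + length xs'" "length ys' = length xs'"
    and f: "\<And>i. i < n + length xs' \<Longrightarrow> fs ! i \<in> Hom C ((xs @ xs') ! i) ((ys @ ys') ! block_perm n p q i)"
    using h n by (auto simp: free_hom_iff)
  show "(take n fs, p) \<in> Hom (free_cat s C) xs ys"
    unfolding free_hom_iff using p n l pl
  proof (intro conjI allI impI)
    fix i assume i: "i < length xs"
    then show "take n fs ! i \<in> Hom C (xs ! i) (ys ! p i)"
      using f[of i] n pl[of i] by (simp add: nth_append block_perm_def)
  qed auto
  show "(drop n fs, q) \<in> Hom (free_cat s C) xs' ys'"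
    unfolding free_hom_iff using q n l
  proof (intro conjI allI impI)
    fix i assume i: "i < length xs'"
    then show "drop n fs ! i \<in> Hom C (xs' ! i) (ys' ! q i)"
      using f[of "n + i"] n l by (simp add: nth_append block_perm_def)
  qed auto
  show "(fs, block_perm n p q) = tenA (free_cat s C) (take n fs, p) (drop n fs, q)"
    using l by (simp add: free_cat_ten)
qed

text \<open>
  The sources tell where the first factor of a concatenation ends.
\<close>
lemma free_ten_inject:
  assumes "tenA (free_cat s C) a b = tenA (free_cat s C) a' b'"
    and "a \<in> Hom (free_cat s C) xs ys" "a' \<in> Hom (free_cat s C) xs zs"
    and "b \<in> Hom (free_cat s C) xs' ys'" "b' \<in> Hom (free_cat s C) xs' zs'"
  shows "a = a'" "b = b'"
proof -
  obtain fs p gs q fs' p' gs' q' where ab: "a = (fs, p)" "b = (gs, q)" "a' = (fs', p')" "b' = (gs', q')"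
    by (cases a, cases b, cases a', cases b')
  let ?n = "length xs"
  have l: "length fs = ?n" "length fs' = ?n" and p: "p permutes {..<?n}" "p' permutes {..<?n}"
    using assms(2-) by (auto simp: ab free_hom_iff)
  have e: "fs @ gs = fs' @ gs'" and r: "block_perm ?n p q = block_perm ?n p' q'"
    using assms(1) l by (auto simp: ab free_cat_ten)
  have "p i = p' i" for i
    using fun_cong[OF r, of i] permutes_not_in[OF p(1)] permutes_not_in[OF p(2)]
    by (cases "i < ?n") (auto simp: block_perm_def)
  moreover have "q i = q' i" for i
    using fun_cong[OF r, of "?n + i"] by (auto simp: block_perm_def)
  ultimately show "a = a'" "b = b'" using e l by (auto simp: ab fun_eq_iff)
qed

end

section \<open>Monoidal functors on words are determined by their letters\<close>

text \<open>
  The uniqueness up to isomorphism of the extension of a functor from letters to words.  The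
  isomorphism is needed explicitly, and natural with respect to permutations, because it transports
  the information which letter goes where.
\<close>
locale letterwise_equal =
  C: category C +
  T1: monoidal_ftor "free_cat s C" M T1 \<mu>1 u1 + T2: monoidal_ftor "free_cat s C" M T2 \<mu>2 u2
  for s :: bool and C :: "('o, 'm, 'y) cat_scheme" and M :: "('p, 'n, 'z) moncat_scheme" (structure)
    and T1 T2 :: "('o list, 'm list \<times> (nat \<Rightarrow> nat), 'p, 'n) ftor" and \<mu>1 \<mu>2 u1 u2 +
  fixes \<beta> :: "'p \<Rightarrow> 'p \<Rightarrow> 'n"
  assumes letter_obj: "x \<in> Obj C \<Longrightarrow> fobj T1 [x] = fobj T2 [x]"
    and letter_arr: "f \<in> Arr C \<Longrightarrow> farr T1 ([f], id) = farr T2 ([f], id)"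
    and braid_hom: "s \<Longrightarrow> X \<in> Obj M \<Longrightarrow> Y \<in> Obj M \<Longrightarrow> \<beta> X Y \<in> Hom M (X \<odot> Y) (Y \<odot> X)"
    and braid_nat: "s \<Longrightarrow> h \<in> Hom M X X' \<Longrightarrow> k \<in> Hom M Y Y'
      \<Longrightarrow> \<beta> X' Y' \<bullet> (h \<boxtimes> k) = (k \<boxtimes> h) \<bullet> \<beta> X Y"
    and braid1: "s \<Longrightarrow> xs \<in> lists (Obj C) \<Longrightarrow> ys \<in> lists (Obj C) \<Longrightarrow>
      farr T1 (free_braid C xs ys) \<bullet> \<mu>1 xs ys = \<mu>1 ys xs \<bullet> \<beta> (fobj T1 xs) (fobj T1 ys)"
    and braid2: "s \<Longrightarrow> xs \<in> lists (Obj C) \<Longrightarrow> ys \<in> lists (Obj C) \<Longrightarrow>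
      farr T2 (free_braid C xs ys) \<bullet> \<mu>2 xs ys = \<mu>2 ys xs \<bullet> \<beta> (fobj T2 xs) (fobj T2 ys)"
begin

text \<open>
  Monoidality and being the identity on letters leave no choice: on \<open>x # xs\<close> the comparison is the
  identity on \<open>x\<close> beside the comparison on \<open>xs\<close>, seen through the structure maps of both functors.
\<close>
primrec comparison :: "'o list \<Rightarrow> 'n" where
  "comparison [] = u2 \<bullet> inv_arr M u1"
| "comparison (x # xs) =
    \<mu>2 [x] xs \<bullet> (Ide M (fobj T1 [x]) \<boxtimes> comparison xs) \<bullet> inv_arr M (\<mu>1 [x] xs)"

lemma T_obj [simp]: "xs \<in> lists (Obj C) \<Longrightarrow> fobj T1 xs \<in> Obj M"
  "xs \<in> lists (Obj C) \<Longrightarrow> fobj T2 xs \<in> Obj M"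
  using T1.map_obj T2.map_obj by simp_all

lemma mu1: "xs \<in> lists (Obj C) \<Longrightarrow> ys \<in> lists (Obj C) \<Longrightarrow>
    \<mu>1 xs ys \<in> iso_hom M (fobj T1 xs \<odot> fobj T1 ys) (fobj T1 (xs @ ys))"
  using T1.mu_iso[of xs ys] by simp

lemma mu2: "xs \<in> lists (Obj C) \<Longrightarrow> ys \<in> lists (Obj C) \<Longrightarrow>
    \<mu>2 xs ys \<in> iso_hom M (fobj T2 xs \<odot> fobj T2 ys) (fobj T2 (xs @ ys))"
  using T2.mu_iso[of xs ys] by simp

lemma u1: "u1 \<in> iso_hom M (unitO M) (fobj T1 [])" and u2: "u2 \<in> iso_hom M (unitO M) (fobj T2 [])"
  using T1.u_iso T2.u_iso by simp_all

lemmas mu1D = T1.B.iso_homD[OF mu1]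
lemmas mu2D = T1.B.iso_homD[OF mu2]

lemma ide1: "xs \<in> lists (Obj C) \<Longrightarrow> farr T1 (free_ide C xs) = Ide M (fobj T1 xs)"
  and ide2: "xs \<in> lists (Obj C) \<Longrightarrow> farr T2 (free_ide C xs) = Ide M (fobj T2 xs)"
  using T1.map_ide[of xs] T2.map_ide[of xs] by simp_all

lemma comparison_iso: "xs \<in> lists (Obj C) \<Longrightarrow> comparison xs \<in> iso_hom M (fobj T1 xs) (fobj T2 xs)"
proof (induction xs)
  case Nil
  then show ?case using T1.B.comp_iso_hom[OF T1.B.iso_homD(11)[OF u1] u2] by simp
next
  case (Cons x xs)
  then have x: "[x] \<in> lists (Obj C)" and xs: "xs \<in> lists (Obj C)" by auto
  have "Ide M (fobj T1 [x]) \<boxtimes> comparison xs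
      \<in> iso_hom M (fobj T1 [x] \<odot> fobj T1 xs) (fobj T2 [x] \<odot> fobj T2 xs)"
    using T1.B.ten_iso_hom[OF T1.B.ide_iso_hom Cons.IH[OF xs], of "fobj T1 [x]"] x letter_obj[of x]
    by simp
  from T1.B.comp_iso_hom[OF T1.B.comp_iso_hom[OF mu1D(11)[OF x xs] this] mu2[OF x xs]]
  show ?case by simp
qed

lemmas compD = T1.B.iso_homD[OF comparison_iso]

lemma comparison_cons:
  assumes x: "x \<in> Obj C" and xs: "xs \<in> lists (Obj C)"
  shows "comparison (x # xs) \<bullet> \<mu>1 [x] xs = \<mu>2 [x] xs \<bullet> (Ide M (fobj T1 [x]) \<boxtimes> comparison xs)"
proof -
  have x': "[x] \<in> lists (Obj C)" using x by simp
  note [simp] = mu1D[OF x' xs] mu2D[OF x' xs] compD[OF xs]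
  show ?thesis using x' letter_obj[OF x] by simp
qed

lemma mu_assoc1:
  assumes "xs \<in> lists (Obj C)" "ys \<in> lists (Obj C)" "zs \<in> lists (Obj C)"
  shows "\<mu>1 (xs @ ys) zs \<bullet> (\<mu>1 xs ys \<boxtimes> Ide M (fobj T1 zs))
    = \<mu>1 xs (ys @ zs) \<bullet> (Ide M (fobj T1 xs) \<boxtimes> \<mu>1 ys zs) \<bullet> assoc M (fobj T1 xs) (fobj T1 ys) (fobj T1 zs)"
proof -
  have xy: "xs @ ys \<in> lists (Obj C)" "ys @ zs \<in> lists (Obj C)" "xs @ ys @ zs \<in> lists (Obj C)" using assms by auto
  note [simp] = mu1D[OF assms(1,2)] mu1D[OF xy(1) assms(3)]
  show ?thesis using T1.mu_assoc[of xs ys zs] assms xy by (simp add: ide1)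
qed

lemma mu_assoc2:
  assumes "xs \<in> lists (Obj C)" "ys \<in> lists (Obj C)" "zs \<in> lists (Obj C)"
  shows "\<mu>2 (xs @ ys) zs \<bullet> (\<mu>2 xs ys \<boxtimes> Ide M (fobj T2 zs))
    = \<mu>2 xs (ys @ zs) \<bullet> (Ide M (fobj T2 xs) \<boxtimes> \<mu>2 ys zs) \<bullet> assoc M (fobj T2 xs) (fobj T2 ys) (fobj T2 zs)"
proof -
  have xy: "xs @ ys \<in> lists (Obj C)" "ys @ zs \<in> lists (Obj C)" "xs @ ys @ zs \<in> lists (Obj C)" using assms by auto
  note [simp] = mu2D[OF assms(1,2)] mu2D[OF xy(1) assms(3)]
  show ?thesis using T2.mu_assoc[of xs ys zs] assms xy by (simp add: ide2)
qed

lemma assocD: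
  assumes "X \<in> Obj M" "Y \<in> Obj M" "Z \<in> Obj M"
  shows "assoc M X Y Z \<in> Arr M" "Dom M (assoc M X Y Z) = (X \<odot> Y) \<odot> Z"
    "Cod M (assoc M X Y Z) = X \<odot> (Y \<odot> Z)"
  using T1.B.iso_homD[OF T1.B.assoc_iso[OF assms]] by simp_all

text \<open>
  For the empty word this is unit coherence of both functors.  For a longer word, associativity
  coherence moves the first letter out.  Both sides are compared after composition with an
  isomorphism, so that the structure maps can be cancelled.
\<close>
lemma comparison_monoidal:
  assumes "xs \<in> lists (Obj C)" "ys \<in> lists (Obj C)"
  shows "comparison (xs @ ys) \<bullet> \<mu>1 xs ys = \<mu>2 xs ys \<bullet> (comparison xs \<boxtimes> comparison ys)"
  using assms
proof (induction xs)
  case Nil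
  have n: "[] \<in> lists (Obj C)" by simp
  note ys = Nil(1)
  note [simp] = mu1D[OF n ys] mu2D[OF n ys] compD[OF ys] T1.B.iso_homD[OF u1] T1.B.iso_homD[OF u2]
    ys T1.B.iso_homD[OF T1.B.lunit_iso]
  have l1: "\<mu>1 [] ys \<bullet> (u1 \<boxtimes> Ide M (fobj T1 ys)) = lunit M (fobj T1 ys)"
    using T1.mu_lunit[of ys] by (simp add: ide1)
  have l2: "\<mu>2 [] ys \<bullet> (u2 \<boxtimes> Ide M (fobj T2 ys)) = lunit M (fobj T2 ys)"
    using T2.mu_lunit[of ys] by (simp add: ide2)
  have i: "u1 \<boxtimes> Ide M (fobj T1 ys) \<in> iso_hom M (unitO M \<odot> fobj T1 ys) (fobj T1 [] \<odot> fobj T1 ys)"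
    by (rule T1.B.ten_iso_hom[OF u1 T1.B.ide_iso_hom]) simp
  have "(comparison ys \<bullet> \<mu>1 [] ys) \<bullet> (u1 \<boxtimes> Ide M (fobj T1 ys)) = comparison ys \<bullet> lunit M (fobj T1 ys)"
    by (simp flip: l1)
  also have "\<dots> = lunit M (fobj T2 ys) \<bullet> (Ide M (unitO M) \<boxtimes> comparison ys)"
    by (rule T1.B.lunit_nat[symmetric]) (simp add: T1.B.HomI)
  also have "\<dots> = \<mu>2 [] ys \<bullet> (u2 \<boxtimes> comparison ys)"
    by (simp flip: l2)
  also have "\<dots> = (\<mu>2 [] ys \<bullet> (comparison [] \<boxtimes> comparison ys)) \<bullet> (u1 \<boxtimes> Ide M (fobj T1 ys))"
    by simp
  finally show ?case
    using T1.B.iso_cancel_right[OF i, of "comparison ys \<bullet> \<mu>1 [] ys" "\<mu>2 [] ys \<bullet> (comparison [] \<boxtimes> comparison ys)"]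
    by simp
next
  case (Cons x xs)
  then have x: "x \<in> Obj C" "[x] \<in> lists (Obj C)" and xs: "xs \<in> lists (Obj C)" and ys: "ys \<in> lists (Obj C)"
    and xy: "xs @ ys \<in> lists (Obj C)" and xxs: "x # xs \<in> lists (Obj C)" and xxy: "x # xs @ ys \<in> lists (Obj C)"
    by auto
  note [simp] = mu1D[OF x(2) xs] mu2D[OF x(2) xs] mu1D[OF xxs ys] mu2D[OF xxs ys] mu1D[OF xs ys] mu2D[OF xs ys]
    mu1D[OF x(2) xy] mu2D[OF x(2) xy] compD[OF xs] compD[OF ys] compD[OF xy] compD[OF xxs] compD[OF xxy]
    letter_obj[OF x(1)] assocD
  note [simp] = x xs ys xy xxs xxy
  note [simp del] = comparison.simps
  let ?X = "Ide M (fobj T2 [x])"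
  have m1: "\<mu>1 (x # xs) ys \<bullet> (\<mu>1 [x] xs \<boxtimes> Ide M (fobj T1 ys))
    = \<mu>1 [x] (xs @ ys) \<bullet> (?X \<boxtimes> \<mu>1 xs ys) \<bullet> assoc M (fobj T2 [x]) (fobj T1 xs) (fobj T1 ys)"
    using mu_assoc1[OF x(2) xs ys] by simp
  have m2: "\<mu>2 (x # xs) ys \<bullet> (\<mu>2 [x] xs \<boxtimes> Ide M (fobj T2 ys))
    = \<mu>2 [x] (xs @ ys) \<bullet> (?X \<boxtimes> \<mu>2 xs ys) \<bullet> assoc M (fobj T2 [x]) (fobj T2 xs) (fobj T2 ys)"
    using mu_assoc2[OF x(2) xs ys] by simp
  have c1: "comparison (x # xs @ ys) \<bullet> \<mu>1 [x] (xs @ ys) = \<mu>2 [x] (xs @ ys) \<bullet> (?X \<boxtimes> comparison (xs @ ys))"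
    using comparison_cons[OF x(1) xy] by simp
  have c2: "comparison (x # xs) \<bullet> \<mu>1 [x] xs = \<mu>2 [x] xs \<bullet> (?X \<boxtimes> comparison xs)"
    using comparison_cons[OF x(1) xs] by simp
  have an: "assoc M (fobj T2 [x]) (fobj T2 xs) (fobj T2 ys) \<bullet> ((?X \<boxtimes> comparison xs) \<boxtimes> comparison ys)
      = (?X \<boxtimes> (comparison xs \<boxtimes> comparison ys)) \<bullet> assoc M (fobj T2 [x]) (fobj T1 xs) (fobj T1 ys)"
    by (rule T1.B.assoc_nat) (auto intro!: T1.B.HomI)
  have i: "\<mu>1 [x] xs \<boxtimes> Ide M (fobj T1 ys) \<in> iso_hom M ((fobj T1 [x] \<odot> fobj T1 xs) \<odot> fobj T1 ys)
      (fobj T1 (x # xs) \<odot> fobj T1 ys)"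
    using T1.B.ten_iso_hom[OF mu1[OF x(2) xs] T1.B.ide_iso_hom] by simp
  let ?a1 = "assoc M (fobj T2 [x]) (fobj T1 xs) (fobj T1 ys)"
  let ?a2 = "assoc M (fobj T2 [x]) (fobj T2 xs) (fobj T2 ys)"
  have "(comparison (x # xs @ ys) \<bullet> \<mu>1 (x # xs) ys) \<bullet> (\<mu>1 [x] xs \<boxtimes> Ide M (fobj T1 ys))
      = comparison (x # xs @ ys) \<bullet> (\<mu>1 (x # xs) ys \<bullet> (\<mu>1 [x] xs \<boxtimes> Ide M (fobj T1 ys)))"
    by simp
  also have "\<dots> = (comparison (x # xs @ ys) \<bullet> \<mu>1 [x] (xs @ ys)) \<bullet> (?X \<boxtimes> \<mu>1 xs ys) \<bullet> ?a1"
    unfolding m1 by simp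
  also have "\<dots> = \<mu>2 [x] (xs @ ys) \<bullet> (?X \<boxtimes> (comparison (xs @ ys) \<bullet> \<mu>1 xs ys)) \<bullet> ?a1"
    unfolding c1 by simp
  also have "\<dots> = \<mu>2 [x] (xs @ ys) \<bullet> (?X \<boxtimes> \<mu>2 xs ys) \<bullet>
      (?X \<boxtimes> (comparison xs \<boxtimes> comparison ys)) \<bullet> ?a1"
    unfolding Cons.IH[OF ys] by simp
  also have "\<dots> = (\<mu>2 [x] (xs @ ys) \<bullet> (?X \<boxtimes> \<mu>2 xs ys) \<bullet> ?a2) \<bullet>
      ((?X \<boxtimes> comparison xs) \<boxtimes> comparison ys)"
    unfolding an[symmetric] by simp
  also have "\<dots> = \<mu>2 (x # xs) ys \<bullet> ((\<mu>2 [x] xs \<bullet> (?X \<boxtimes> comparison xs)) \<boxtimes> comparison ys)"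
    unfolding m2[symmetric] by simp
  also have "\<dots> = (\<mu>2 (x # xs) ys \<bullet> (comparison (x # xs) \<boxtimes> comparison ys)) \<bullet>
      (\<mu>1 [x] xs \<boxtimes> Ide M (fobj T1 ys))"
    unfolding c2[symmetric] by simp
  finally show ?case
    using T1.B.iso_cancel_right[OF i, of "comparison (x # xs @ ys) \<bullet> \<mu>1 (x # xs) ys"
        "\<mu>2 (x # xs) ys \<bullet> (comparison (x # xs) \<boxtimes> comparison ys)"]
    by simp
qed

lemma comparison_letter:
  assumes "x \<in> Obj C"
  shows "comparison [x] = Ide M (fobj T1 [x])"
proof -
  have n: "[] \<in> lists (Obj C)" and x: "[x] \<in> lists (Obj C)" using assms by auto
  note [simp] = mu1D[OF x n] mu2D[OF x n] compD[OF x] compD[OF n] T1.B.iso_homD[OF u1] T1.B.iso_homD[OF u2]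
    T1.B.iso_homD[OF T1.B.runit_iso] assms
  have r1: "\<mu>1 [x] [] \<bullet> (Ide M (fobj T1 [x]) \<boxtimes> u1) = runit M (fobj T1 [x])"
    using T1.mu_runit[of "[x]"] by (simp add: ide1)
  have r2: "\<mu>2 [x] [] \<bullet> (Ide M (fobj T2 [x]) \<boxtimes> u2) = runit M (fobj T2 [x])"
    using T2.mu_runit[of "[x]"] by (simp add: ide2)
  have "(comparison [x] \<bullet> \<mu>1 [x] []) \<bullet> (Ide M (fobj T1 [x]) \<boxtimes> u1) = runit M (fobj T1 [x])"
    unfolding comparison_cons[OF assms n] using r2 letter_obj[OF assms] by simp
  then have e: "comparison [x] \<bullet> runit M (fobj T1 [x]) = Ide M (fobj T1 [x]) \<bullet> runit M (fobj T1 [x])"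
    unfolding r1[symmetric] by (simp del: comparison.simps)
  show ?thesis
    by (rule T1.B.iso_cancel_right[OF T1.B.runit_iso[of "fobj T1 [x]"] _ _ _ _ e])
      (simp_all del: comparison.simps)
qed

definition natural_at :: "'m list \<times> (nat \<Rightarrow> nat) \<Rightarrow> 'o list \<Rightarrow> 'o list \<Rightarrow> bool" where
  "natural_at a xs ys \<longleftrightarrow> farr T2 a \<bullet> comparison xs = comparison ys \<bullet> farr T1 a"

lemma natural_ide: "xs \<in> lists (Obj C) \<Longrightarrow> natural_at (free_ide C xs) xs xs"
  using compD[of xs] by (simp add: natural_at_def ide1 ide2)

lemma free_objs: "a \<in> Hom (free_cat s C) xs ys \<Longrightarrow> xs \<in> lists (Obj C) \<and> ys \<in> lists (Obj C)"
  using T1.A.hom_obj[of a xs ys] by simp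

lemma farr_hom:
  assumes "a \<in> Hom (free_cat s C) xs ys"
  shows "farr T1 a \<in> Arr M" "Dom M (farr T1 a) = fobj T1 xs" "Cod M (farr T1 a) = fobj T1 ys"
    "farr T2 a \<in> Arr M" "Dom M (farr T2 a) = fobj T2 xs" "Cod M (farr T2 a) = fobj T2 ys"
  using T1.map_hom[OF assms] T2.map_hom[OF assms] by (auto simp: Hom_def)

lemma natural_comp:
  assumes a: "a \<in> Hom (free_cat s C) xs ys" and b: "b \<in> Hom (free_cat s C) ys zs"
    and n: "natural_at a xs ys" "natural_at b ys zs"
  shows "natural_at (Comp (free_cat s C) b a) xs zs"
proof -
  have o: "xs \<in> lists (Obj C)" "ys \<in> lists (Obj C)" "zs \<in> lists (Obj C)" using free_objs a b by auto
  note [simp] = farr_hom[OF a] farr_hom[OF b] compD[OF o(1)] compD[OF o(2)] compD[OF o(3)]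
  have "farr T2 b \<bullet> farr T2 a \<bullet> comparison xs = (farr T2 b \<bullet> comparison ys) \<bullet> farr T1 a"
    using n(1) by (simp add: natural_at_def)
  also have "\<dots> = comparison zs \<bullet> farr T1 b \<bullet> farr T1 a"
    using n(2) by (simp add: natural_at_def)
  finally show ?thesis
    using T1.map_comp[OF a b] T2.map_comp[OF a b] by (simp add: natural_at_def)
qed

lemma natural_ten:
  assumes a: "a \<in> Hom (free_cat s C) xs ys" and b: "b \<in> Hom (free_cat s C) xs' ys'"
    and n: "natural_at a xs ys" "natural_at b xs' ys'"
  shows "natural_at (tenA (free_cat s C) a b) (xs @ xs') (ys @ ys')"
proof -
  have o: "xs \<in> lists (Obj C)" "ys \<in> lists (Obj C)" "xs' \<in> lists (Obj C)" "ys' \<in> lists (Obj C)"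
    and o2: "xs @ xs' \<in> lists (Obj C)" "ys @ ys' \<in> lists (Obj C)" using free_objs a b by auto
  note ab = C.free_ten_hom'[OF a b]
  let ?t = "tenA (free_cat s C) a b"
  note [simp] = farr_hom[OF a] farr_hom[OF b] farr_hom[OF ab] compD[OF o(1)] compD[OF o(2)] compD[OF o(3)] compD[OF o(4)]
    compD[OF o2(1)] compD[OF o2(2)] mu1D[OF o(1,3)] mu2D[OF o(1,3)] mu1D[OF o(2,4)] mu2D[OF o(2,4)]
  note mon = comparison_monoidal[OF o(1,3)] comparison_monoidal[OF o(2,4)]
  have n1: "farr T2 ?t \<bullet> \<mu>2 xs xs' = \<mu>2 ys ys' \<bullet> (farr T2 a \<boxtimes> farr T2 b)"
    and n2: "farr T1 ?t \<bullet> \<mu>1 xs xs' = \<mu>1 ys ys' \<bullet> (farr T1 a \<boxtimes> farr T1 b)"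
    using T1.mu_nat[OF a b] T2.mu_nat[OF a b] by simp_all
  have "(farr T2 ?t \<bullet> comparison (xs @ xs')) \<bullet> \<mu>1 xs xs'
      = (farr T2 ?t \<bullet> \<mu>2 xs xs') \<bullet> (comparison xs \<boxtimes> comparison xs')"
    using mon by simp
  also have "\<dots> = \<mu>2 ys ys' \<bullet> ((farr T2 a \<bullet> comparison xs) \<boxtimes> (farr T2 b \<bullet> comparison xs'))"
    unfolding n1 by simp
  also have "\<dots> = (\<mu>2 ys ys' \<bullet> (comparison ys \<boxtimes> comparison ys')) \<bullet> (farr T1 a \<boxtimes> farr T1 b)"
    using n by (simp add: natural_at_def)
  also have "\<dots> = comparison (ys @ ys') \<bullet> \<mu>1 ys ys' \<bullet> (farr T1 a \<boxtimes> farr T1 b)"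
    unfolding mon(2)[symmetric] by simp
  also have "\<dots> = (comparison (ys @ ys') \<bullet> farr T1 ?t) \<bullet> \<mu>1 xs xs'"
    unfolding n2[symmetric] by simp
  finally show ?thesis unfolding natural_at_def
    by (rule T1.B.iso_cancel_right[OF mu1[OF o(1,3)], rotated 4]) simp_all
qed

lemma natural_braid:
  assumes s and xs: "xs \<in> lists (Obj C)" and ys: "ys \<in> lists (Obj C)"
  shows "natural_at (free_braid C xs ys) (xs @ ys) (ys @ xs)"
proof -
  have o2: "xs @ ys \<in> lists (Obj C)" "ys @ xs \<in> lists (Obj C)" using xs ys by auto
  have b1: "\<beta> (fobj T1 xs) (fobj T1 ys) \<in> Hom M (fobj T1 xs \<odot> fobj T1 ys) (fobj T1 ys \<odot> fobj T1 xs)"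
    and b2: "\<beta> (fobj T2 xs) (fobj T2 ys) \<in> Hom M (fobj T2 xs \<odot> fobj T2 ys) (fobj T2 ys \<odot> fobj T2 xs)"
    using braid_hom assms by auto
  note [simp] = farr_hom[OF C.free_braid_hom[OF assms]] compD[OF xs] compD[OF ys]
    compD[OF o2(1)] compD[OF o2(2)] mu1D[OF xs ys] mu2D[OF xs ys] mu1D[OF ys xs] mu2D[OF ys xs]
    b1[unfolded Hom_def, simplified] b2[unfolded Hom_def, simplified]
  let ?b = "free_braid C xs ys"
  have "(farr T2 ?b \<bullet> comparison (xs @ ys)) \<bullet> \<mu>1 xs ys
      = (farr T2 ?b \<bullet> \<mu>2 xs ys) \<bullet> (comparison xs \<boxtimes> comparison ys)"
    using comparison_monoidal[OF xs ys] by simp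
  also have "\<dots> = \<mu>2 ys xs \<bullet> \<beta> (fobj T2 xs) (fobj T2 ys) \<bullet> (comparison xs \<boxtimes> comparison ys)"
    unfolding braid2[OF assms] by simp
  also have "\<dots> = (\<mu>2 ys xs \<bullet> (comparison ys \<boxtimes> comparison xs)) \<bullet> \<beta> (fobj T1 xs) (fobj T1 ys)"
    using braid_nat[OF assms(1) T1.B.iso_hom_hom[OF comparison_iso[OF xs]] T1.B.iso_hom_hom[OF comparison_iso[OF ys]]]
    by simp
  also have "\<dots> = comparison (ys @ xs) \<bullet> \<mu>1 ys xs \<bullet> \<beta> (fobj T1 xs) (fobj T1 ys)"
    unfolding comparison_monoidal[OF ys xs, symmetric] by simp
  also have "\<dots> = (comparison (ys @ xs) \<bullet> farr T1 ?b) \<bullet> \<mu>1 xs ys"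
    unfolding braid1[OF assms, symmetric] by simp
  finally show ?thesis unfolding natural_at_def
    by (rule T1.B.iso_cancel_right[OF mu1[OF xs ys], rotated 4]) simp_all
qed

lemma natural_letter:
  assumes "f \<in> Hom C x y"
  shows "natural_at ([f], id) [x] [y]"
proof -
  have o: "x \<in> Obj C" "y \<in> Obj C" using C.hom_obj[OF assms] by auto
  have f: "f \<in> Arr C" using assms by (simp add: Hom_def)
  show ?thesis
    unfolding natural_at_def comparison_letter[OF o(1)] comparison_letter[OF o(2)]
    using letter_arr[OF f] farr_hom[OF C.letter_hom[OF assms]] letter_obj o by simp
qed

text \<open>
  By \<open>free_arr_cons\<close>, naturality on letters, tensor products and braidings is enough.
\<close>
lemma comparison_natural:
  assumes "a \<in> Hom (free_cat s C) xs ys"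
  shows "farr T2 a \<bullet> comparison xs = comparison ys \<bullet> farr T1 a"
proof -
  have "(fs, p) \<in> Hom (free_cat s C) xs ys \<Longrightarrow> natural_at (fs, p) xs ys" for fs p
  proof (induction xs arbitrary: fs p ys)
    case Nil
    then have "(fs, p) = free_ide C []" "ys = []" by (auto simp: free_hom_iff free_ide_def)
    then show ?case using natural_ide[of "[]"] by simp
  next
    case (Cons x xs)
    then obtain f fs' where fs: "fs = f # fs'" by (cases fs) (auto simp: free_hom_iff)
    from Cons.prems[unfolded fs] show ?case
    proof (cases rule: C.free_arr_cons)
      case (plain y zs)
      then show ?thesis
        using natural_ten[OF C.letter_hom[OF plain(2)] plain(3) natural_letter[OF plain(2)] Cons.IH[OF plain(3)]] fs
        by (simp add: id_def)
    next
      case (braided y ys1 ys2 p')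
      have "ys \<in> lists (Obj C)" using free_objs[OF Cons.prems] by simp
      then have o: "[y] \<in> lists (Obj C)" "ys1 \<in> lists (Obj C)" "ys2 \<in> lists (Obj C)" using braided(2) by auto
      have h1: "tenA (free_cat s C) ([f], id) (fs', p') \<in> Hom (free_cat s C) (x # xs) (([y] @ ys1) @ ys2)"
        using C.free_ten_hom'[OF C.letter_hom[OF braided(3)] braided(4)] by simp
      have n1: "natural_at (tenA (free_cat s C) ([f], id) (fs', p')) (x # xs) (([y] @ ys1) @ ys2)"
        using natural_ten[OF C.letter_hom[OF braided(3)] braided(4) natural_letter[OF braided(3)] Cons.IH[OF braided(4)]]
        by simp
      note b = C.free_braid_hom[of s, OF braided(1) o(1,2)] and i = C.free_ide_hom[OF o(3), of s]
      show ?thesis unfolding fs braided(5) braided(2)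
        using natural_comp[OF h1 C.free_ten_hom'[OF b i] n1
            natural_ten[OF b i natural_braid[OF braided(1) o(1,2)] natural_ide[OF o(3)]]]
        by simp
    qed
  qed
  then show ?thesis using assms by (cases a) (simp add: natural_at_def)
qed

end

section \<open>Groupoids of isomorphisms and comma categories\<close>

lemma Iso_simps [simp]:
  "Obj (Iso C) = Obj C" "Dom (Iso C) = Dom C" "Cod (Iso C) = Cod C" "Ide (Iso C) = Ide C" "Comp (Iso C) = Comp C"
  "Arr (Iso C) = {f. is_iso C f}"
  by (simp_all add: Iso_def)

lemma Iso_moncat_simps [simp]:
  "tenO (Iso M) = tenO M" "tenA (Iso M) = tenA M" "unitO (Iso M) = unitO M"
  "assoc (Iso M) = assoc M" "lunit (Iso M) = lunit M" "runit (Iso M) = runit M"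
  by (simp_all add: Iso_def)

lemma inverse_arrows_sym: "inverse_arrows C f g \<Longrightarrow> inverse_arrows C g f"
  by (simp add: inverse_arrows_def Hom_def)

lemma is_iso_arr: "is_iso C f \<Longrightarrow> f \<in> Arr C"
  unfolding is_iso_def inverse_arrows_def by blast

lemma inverse_arrows_Iso [simp]: "inverse_arrows (Iso C) f g \<longleftrightarrow> inverse_arrows C f g"
proof
  assume "inverse_arrows (Iso C) f g"
  then show "inverse_arrows C f g"
    unfolding inverse_arrows_def Hom_def Iso_simps mem_Collect_eq
    by (metis is_iso_arr)
next
  assume i: "inverse_arrows C f g"
  have "is_iso C f" unfolding is_iso_def using i by (rule exI)
  moreover have "is_iso C g" unfolding is_iso_def using inverse_arrows_sym[OF i] by (rule exI)
  ultimately show "inverse_arrows (Iso C) f g"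
    using i by (simp add: inverse_arrows_def Hom_def)
qed

lemma is_iso_Iso [simp]: "is_iso (Iso C) f \<longleftrightarrow> is_iso C f"
  by (simp add: is_iso_def)

lemma inv_arr_Iso [simp]: "inv_arr (Iso C) f = inv_arr C f"
  by (simp add: inv_arr_def)

lemma Hom_Iso [simp]: "Hom (Iso C) X Y = iso_hom C X Y"
  unfolding Hom_def iso_hom_def Iso_simps by (auto dest: is_iso_arr)

lemma iso_hom_Iso [simp]: "iso_hom (Iso C) X Y = iso_hom C X Y"
  unfolding iso_hom_def[of "Iso C"] Hom_Iso is_iso_Iso by (auto simp: iso_hom_def)

lemma category_Iso:
  assumes "category C"
  shows "category (Iso C)"
proof -
  interpret category C by fact
  show ?thesis
  proof
    show "f \<in> Arr (Iso C) \<Longrightarrow> Dom (Iso C) f \<in> Obj (Iso C)" "f \<in> Arr (Iso C) \<Longrightarrow> Cod (Iso C) f \<in> Obj (Iso C)" for f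
      by (auto simp: is_iso_iff dest: iso_homD(4,5))
  qed (auto simp: ide_iso_hom comp_iso_hom dest: iso_hom_hom intro: comp_ide_left comp_ide_right comp_assoc)
qed

text \<open>
  The two components of an arrow of a comma category.  Composites and tensor products are computed
  componentwise for arbitrary arguments, so equations of arrows project to both components.
\<close>
definition src :: "('a \<times> 'b \<times> 'c \<times> 'd) \<Rightarrow> 'c" where "src a = fst (snd (snd a))"
definition tgt :: "('a \<times> 'b \<times> 'c \<times> 'd) \<Rightarrow> 'd" where "tgt a = snd (snd (snd a))"

lemma comma_simps [simp]:
  "Obj (comma A B C S T) = comma_objs A B C S T"
  "Arr (comma A B C S T) = comma_arrs A B C S T"
  "Dom (comma A B C S T) a = fst a" "Cod (comma A B C S T) a = fst (snd a)"
  "Ide (comma A B C S T) x = (x, x, (Ide A (fst x), Ide B (fst (snd x))))"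
  "Comp (comma A B C S T) b a = (fst a, fst (snd b), (src b \<bullet>\<^bsub>A\<^esub> src a, tgt b \<bullet>\<^bsub>B\<^esub> tgt a))"
  by (auto simp: comma_def src_def tgt_def split: prod.splits)

lemma comma_hom_iff:
  "(a1, a2, \<psi>, \<psi>') \<in> Hom (comma A B C S T) (X, Y, \<phi>) (X', Y', \<phi>') \<longleftrightarrow>
    a1 = (X, Y, \<phi>) \<and> a2 = (X', Y', \<phi>') \<and>
    (X, Y, \<phi>) \<in> comma_objs A B C S T \<and> (X', Y', \<phi>') \<in> comma_objs A B C S T \<and>
    \<psi> \<in> Hom A X X' \<and> \<psi>' \<in> Hom B Y Y' \<and> farr T \<psi>' \<bullet>\<^bsub>C\<^esub> \<phi> = \<phi>' \<bullet>\<^bsub>C\<^esub> farr S \<psi>"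
  unfolding Hom_def[of "comma A B C S T"] by (auto simp: comma_arrs_def)

lemma category_comma:
  assumes "cfunctor A C S" "cfunctor B C T"
  shows "category (comma A B C S T)"
proof -
  interpret S: cfunctor A C S by fact
  interpret T: cfunctor B C T by fact
  let ?K = "comma A B C S T"
  have H: "\<exists>X Y \<phi> X' Y' \<phi>' \<psi> \<psi>'. f = ((X, Y, \<phi>), (X', Y', \<phi>'), (\<psi>, \<psi>')) \<and> x = (X, Y, \<phi>) \<and> y = (X', Y', \<phi>')"
    if "f \<in> Hom ?K x y" for f x y
    using that by (auto simp: Hom_def[of ?K] comma_arrs_def)
  show ?thesis
  proof
    show "f \<in> Arr ?K \<Longrightarrow> Dom ?K f \<in> Obj ?K" "f \<in> Arr ?K \<Longrightarrow> Cod ?K f \<in> Obj ?K" for f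
      by (auto simp: comma_arrs_def)
    show "x \<in> Obj ?K \<Longrightarrow> Ide ?K x \<in> Hom ?K x x" for x
      by (cases x) (auto simp: comma_hom_iff comma_objs_def S.A.ide_hom T.A.ide_hom Hom_def[of C])
    show "g \<bullet>\<^bsub>?K\<^esub> f \<in> Hom ?K x z" if f: "f \<in> Hom ?K x y" and g: "g \<in> Hom ?K y z" for f g x y z
    proof -
      obtain X Y \<phi> X' Y' \<phi>' \<psi> \<psi>' X'' Y'' \<phi>'' \<chi> \<chi>' where
        e: "f = ((X, Y, \<phi>), (X', Y', \<phi>'), (\<psi>, \<psi>'))" "x = (X, Y, \<phi>)" "y = (X', Y', \<phi>')"
          "g = ((X', Y', \<phi>'), (X'', Y'', \<phi>''), (\<chi>, \<chi>'))" "z = (X'', Y'', \<phi>'')"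
        using H[OF f] H[OF g] by auto
      have h: "\<psi> \<in> Hom A X X'" "\<chi> \<in> Hom A X' X''" "\<psi>' \<in> Hom B Y Y'" "\<chi>' \<in> Hom B Y' Y''"
        and o: "(X, Y, \<phi>) \<in> comma_objs A B C S T" "(X', Y', \<phi>') \<in> comma_objs A B C S T" "(X'', Y'', \<phi>'') \<in> comma_objs A B C S T"
        and q: "farr T \<psi>' \<bullet>\<^bsub>C\<^esub> \<phi> = \<phi>' \<bullet>\<^bsub>C\<^esub> farr S \<psi>" "farr T \<chi>' \<bullet>\<^bsub>C\<^esub> \<phi>' = \<phi>'' \<bullet>\<^bsub>C\<^esub> farr S \<chi>"
        using f g unfolding e comma_hom_iff by auto
      have p: "\<phi> \<in> Hom C (fobj S X) (fobj T Y)" "\<phi>' \<in> Hom C (fobj S X') (fobj T Y')" "\<phi>'' \<in> Hom C (fobj S X'') (fobj T Y'')"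
        using o by (auto simp: comma_objs_def)
      note [simp] = h[unfolded Hom_def, simplified] p[unfolded Hom_def, simplified]
      have "farr T (\<chi>' \<bullet>\<^bsub>B\<^esub> \<psi>') \<bullet>\<^bsub>C\<^esub> \<phi> = farr T \<chi>' \<bullet>\<^bsub>C\<^esub> \<phi>' \<bullet>\<^bsub>C\<^esub> farr S \<psi>" by (simp flip: q)
      also have "\<dots> = (farr T \<chi>' \<bullet>\<^bsub>C\<^esub> \<phi>') \<bullet>\<^bsub>C\<^esub> farr S \<psi>" by simp
      also have "\<dots> = \<phi>'' \<bullet>\<^bsub>C\<^esub> farr S (\<chi> \<bullet>\<^bsub>A\<^esub> \<psi>)" unfolding q by simp
      finally show ?thesis
        using o S.A.comp_hom[OF h(1,2)] T.A.comp_hom[OF h(3,4)]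
        by (simp add: e src_def tgt_def comma_hom_iff)
    qed
    show "Ide ?K y \<bullet>\<^bsub>?K\<^esub> f = f" "f \<bullet>\<^bsub>?K\<^esub> Ide ?K x = f" if f: "f \<in> Hom ?K x y" for f x y
    proof -
      obtain X Y \<phi> X' Y' \<phi>' \<psi> \<psi>' where
        e: "f = ((X, Y, \<phi>), (X', Y', \<phi>'), (\<psi>, \<psi>'))" "x = (X, Y, \<phi>)" "y = (X', Y', \<phi>')"
        using H[OF f] by auto
      have "\<psi> \<in> Hom A X X'" "\<psi>' \<in> Hom B Y Y'" using f unfolding e comma_hom_iff by auto
      then show "Ide ?K y \<bullet>\<^bsub>?K\<^esub> f = f" "f \<bullet>\<^bsub>?K\<^esub> Ide ?K x = f" unfolding e
        by (auto simp: src_def tgt_def S.A.comp_ide_left S.A.comp_ide_right T.A.comp_ide_left T.A.comp_ide_right)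
    qed
    show "(h \<bullet>\<^bsub>?K\<^esub> g) \<bullet>\<^bsub>?K\<^esub> f = h \<bullet>\<^bsub>?K\<^esub> g \<bullet>\<^bsub>?K\<^esub> f"
      if f: "f \<in> Hom ?K w x" and g: "g \<in> Hom ?K x y" and h: "h \<in> Hom ?K y z" for f g h w x y z
    proof -
      obtain f1 f2 \<psi> \<psi>' g1 g2 \<chi> \<chi>' h1 h2 \<omega> \<omega>' where
        e: "f = (f1, f2, (\<psi>, \<psi>'))" "g = (g1, g2, (\<chi>, \<chi>'))" "h = (h1, h2, (\<omega>, \<omega>'))"
        by (cases f, cases g, cases h) auto
      have "\<psi> \<in> Hom A (fst w) (fst x)" "\<chi> \<in> Hom A (fst x) (fst y)" "\<omega> \<in> Hom A (fst y) (fst z)"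
        "\<psi>' \<in> Hom B (fst (snd w)) (fst (snd x))" "\<chi>' \<in> Hom B (fst (snd x)) (fst (snd y))" "\<omega>' \<in> Hom B (fst (snd y)) (fst (snd z))"
        using f g h H[OF f] H[OF g] H[OF h] unfolding e by (auto simp: comma_hom_iff)
      then show ?thesis unfolding e
        by (auto simp: src_def tgt_def intro: S.A.comp_assoc T.A.comp_assoc)
    qed
  qed
qed

lemma arrow_moncat_simps [simp]:
  "Obj (arrow_moncat F) = comma_objs F F F id_ftor id_ftor"
  "Arr (arrow_moncat F) = comma_arrs F F F id_ftor id_ftor"
  "Dom (arrow_moncat F) a = fst a" "Cod (arrow_moncat F) a = fst (snd a)"
  "Ide (arrow_moncat F) x = (x, x, (Ide F (fst x), Ide F (fst (snd x))))"
  "Comp (arrow_moncat F) b a = (fst a, fst (snd b), (src b \<bullet>\<^bsub>F\<^esub> src a, tgt b \<bullet>\<^bsub>F\<^esub> tgt a))"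
  "tenO (arrow_moncat F) x y = (fst x \<odot>\<^bsub>F\<^esub> fst y, fst (snd x) \<odot>\<^bsub>F\<^esub> fst (snd y), snd (snd x) \<boxtimes>\<^bsub>F\<^esub> snd (snd y))"
  "tenA (arrow_moncat F) a b = (arrow_ten F (fst a) (fst b), arrow_ten F (fst (snd a)) (fst (snd b)),
     (src a \<boxtimes>\<^bsub>F\<^esub> src b, tgt a \<boxtimes>\<^bsub>F\<^esub> tgt b))"
  "unitO (arrow_moncat F) = (unitO F, unitO F, Ide F (unitO F))"
  by (auto simp: arrow_moncat_def cat.defs moncat.defs comma_def src_def tgt_def arrow_ten_def arrow_unit_def
      split: prod.splits)

lemma arrow_moncat_coherence [simp]:
  "tgt (assoc (arrow_moncat F) x y z) = assoc F (fst (snd x)) (fst (snd y)) (fst (snd z))"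
  "tgt (lunit (arrow_moncat F) x) = lunit F (fst (snd x))"
  "tgt (runit (arrow_moncat F) x) = runit F (fst (snd x))"
  by (simp_all add: arrow_moncat_def cat.defs moncat.defs comma_def tgt_def)

lemma arrow_hom_iff:
  "(a1, a2, \<psi>, \<psi>') \<in> Hom (arrow_moncat F) (X, Y, \<phi>) (X', Y', \<phi>') \<longleftrightarrow>
    a1 = (X, Y, \<phi>) \<and> a2 = (X', Y', \<phi>') \<and>
    X \<in> Obj F \<and> Y \<in> Obj F \<and> \<phi> \<in> Hom F X Y \<and> X' \<in> Obj F \<and> Y' \<in> Obj F \<and> \<phi>' \<in> Hom F X' Y' \<and>
    \<psi> \<in> Hom F X X' \<and> \<psi>' \<in> Hom F Y Y' \<and> \<psi>' \<bullet>\<^bsub>F\<^esub> \<phi> = \<phi>' \<bullet>\<^bsub>F\<^esub> \<psi>"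
  unfolding Hom_def[of "arrow_moncat F"] by (auto simp: comma_arrs_def comma_objs_def id_ftor_def)

lemma arrow_homD:
  assumes "a \<in> Hom (arrow_moncat F) x y"
  shows "src a \<in> Hom F (fst x) (fst y)" "tgt a \<in> Hom F (fst (snd x)) (fst (snd y))"
    "tgt a \<bullet>\<^bsub>F\<^esub> snd (snd x) = snd (snd y) \<bullet>\<^bsub>F\<^esub> src a" "fst a = x" "fst (snd a) = y"
  using assms by (cases a; cases x; cases y; auto simp: arrow_hom_iff src_def tgt_def)+

lemma arrow_isoD:
  assumes "a \<in> iso_hom (arrow_moncat F) x y"
  shows "src a \<in> iso_hom F (fst x) (fst y)" "tgt a \<in> iso_hom F (fst (snd x)) (fst (snd y))"
    "tgt a \<bullet>\<^bsub>F\<^esub> snd (snd x) = snd (snd y) \<bullet>\<^bsub>F\<^esub> src a"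
proof -
  let ?A = "arrow_moncat F"
  from assms obtain b where a: "a \<in> Hom ?A x y" and i: "inverse_arrows ?A a b"
    by (auto simp: iso_hom_def is_iso_def)
  have xy: "fst a = x" "fst (snd a) = y" using arrow_homD[OF a] by auto
  have b: "b \<in> Hom ?A y x" using i xy by (simp add: inverse_arrows_def)
  have h: "src b \<bullet>\<^bsub>F\<^esub> src a = Ide F (fst x)" "tgt b \<bullet>\<^bsub>F\<^esub> tgt a = Ide F (fst (snd x))"
    "src a \<bullet>\<^bsub>F\<^esub> src b = Ide F (fst y)" "tgt a \<bullet>\<^bsub>F\<^esub> tgt b = Ide F (fst (snd y))"
    using i xy by (simp_all add: inverse_arrows_def)
  have "inverse_arrows F (src a) (src b)" "inverse_arrows F (tgt a) (tgt b)"
    using h arrow_homD(1,2)[OF a] arrow_homD(1,2)[OF b] unfolding inverse_arrows_def Hom_def by auto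
  then show "src a \<in> iso_hom F (fst x) (fst y)" "tgt a \<in> iso_hom F (fst (snd x)) (fst (snd y))"
    using arrow_homD(1,2)[OF a] unfolding iso_hom_def is_iso_def by blast+
  show "tgt a \<bullet>\<^bsub>F\<^esub> snd (snd x) = snd (snd y) \<bullet>\<^bsub>F\<^esub> src a" using arrow_homD(3)[OF a] .
qed

lemma (in monoidal_category) arrow_isoI:
  assumes "fst x \<in> Obj C" "fst (snd x) \<in> Obj C" "snd (snd x) \<in> Hom C (fst x) (fst (snd x))"
    "fst y \<in> Obj C" "fst (snd y) \<in> Obj C" "snd (snd y) \<in> Hom C (fst y) (fst (snd y))"
    and f: "f \<in> iso_hom C (fst x) (fst y)" and g: "g \<in> iso_hom C (fst (snd x)) (fst (snd y))"
    and e: "g \<bullet> snd (snd x) = snd (snd y) \<bullet> f"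
  shows "(x, y, f, g) \<in> iso_hom (arrow_moncat C) x y"
proof -
  obtain X Y \<phi> X' Y' \<phi>' where xy: "x = (X, Y, \<phi>)" "y = (X', Y', \<phi>')" by (cases x, cases y)
  note [simp] = iso_homD[OF f[unfolded xy, simplified]] iso_homD[OF g[unfolded xy, simplified]]
    assms(3,6)[unfolded xy Hom_def, simplified]
  have e': "g \<bullet> \<phi> = \<phi>' \<bullet> f" using e by (simp add: xy)
  have h: "(x, y, f, g) \<in> Hom (arrow_moncat C) x y"
    using e' unfolding xy arrow_hom_iff by (auto simp: Hom_def)
  have "inv_arr C g \<bullet> \<phi>' = inv_arr C g \<bullet> (\<phi>' \<bullet> f) \<bullet> inv_arr C f" by simp
  also have "\<dots> = \<phi> \<bullet> inv_arr C f" unfolding e'[symmetric] by simp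
  finally have "inv_arr C g \<bullet> \<phi>' = \<phi> \<bullet> inv_arr C f" .
  then have h': "(y, x, inv_arr C f, inv_arr C g) \<in> Hom (arrow_moncat C) y x"
    unfolding xy arrow_hom_iff by (auto simp: Hom_def)
  have "inverse_arrows (arrow_moncat C) (x, y, f, g) (y, x, inv_arr C f, inv_arr C g)"
    using h h' unfolding inverse_arrows_def by (simp add: Hom_def[of "arrow_moncat C"] src_def tgt_def xy)
  with h show ?thesis unfolding iso_hom_def is_iso_def by blast
qed

section \<open>Splitting morphisms along tensor products\<close>

text \<open>
  The letters of the word of a morphism are triples \<open>(X, v, \<phi>)\<close> with \<open>\<phi>\<close> a morphism from \<open>X\<close> to the image
  of the vertex \<open>v\<close>.
\<close>
abbreviation vtx :: "('x, 'y, 'm) comma_obj \<Rightarrow> 'y" where "vtx x \<equiv> fst (snd x)"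

definition vtx_arr :: "('x, 'y, 'm, 'f, 'g) comma_arr list \<times> (nat \<Rightarrow> nat) \<Rightarrow> 'g list \<times> (nat \<Rightarrow> nat)" where
  "vtx_arr a = (map tgt (fst a), snd a)"

text \<open>
  The first two axioms of a Feynman category, with or without symmetries: \<open>J1\<close> assembles objects from
  words of vertices, \<open>J2\<close> assembles morphisms from words of morphisms to single vertices.
\<close>
locale feynman_words =
  V: category V + F: monoidal_category F + \<iota>: cfunctor V F \<iota> +
  J1: monoidal_ftor "free_cat s V" "Iso F" J1 \<mu>1 u1 +
  J2: monoidal_ftor "free_cat s (Iso (comma F V F id_ftor \<iota>))" "Iso (arrow_moncat F)" J2 \<mu>2 u2
  for s :: bool and V :: "('v, 'a, 'y) cat_scheme" and F :: "('o, 'm, 'z) moncat_scheme" (structure) and \<iota>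
    and J1 \<mu>1 u1 J2 \<mu>2 u2 +
  fixes \<beta> :: "'o \<Rightarrow> 'o \<Rightarrow> 'm"
  assumes ext1: "extends_ftor V J1 \<iota>"
    and ext2: "extends_ftor (Iso (comma F V F id_ftor \<iota>)) J2 (comma_incl \<iota>)"
    and eq1: "equivalence_ftor (free_cat s V) (Iso F) J1"
    and eq2: "equivalence_ftor (free_cat s (Iso (comma F V F id_ftor \<iota>))) (Iso (arrow_moncat F)) J2"
    and braid_hom: "s \<Longrightarrow> X \<in> Obj F \<Longrightarrow> Y \<in> Obj F \<Longrightarrow> \<beta> X Y \<in> iso_hom F (X \<odot> Y) (Y \<odot> X)"
    and braid_nat: "s \<Longrightarrow> h \<in> Hom F X X' \<Longrightarrow> k \<in> Hom F Y Y'
      \<Longrightarrow> \<beta> X' Y' \<bullet> (h \<boxtimes> k) = (k \<boxtimes> h) \<bullet> \<beta> X Y"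
    and braid1: "s \<Longrightarrow> xs \<in> lists (Obj V) \<Longrightarrow> ys \<in> lists (Obj V) \<Longrightarrow>
      farr J1 (free_braid V xs ys) \<bullet> \<mu>1 xs ys = \<mu>1 ys xs \<bullet> \<beta> (fobj J1 xs) (fobj J1 ys)"
    and braid2: "s \<Longrightarrow> ws \<in> lists (comma_objs F V F id_ftor \<iota>) \<Longrightarrow> ws' \<in> lists (comma_objs F V F id_ftor \<iota>) \<Longrightarrow>
      farr J2 (free_braid (Iso (comma F V F id_ftor \<iota>)) ws ws') \<bullet>\<^bsub>arrow_moncat F\<^esub> \<mu>2 ws ws'
        = \<mu>2 ws' ws \<bullet>\<^bsub>arrow_moncat F\<^esub> arrow_braid F \<beta> (fobj J2 ws) (fobj J2 ws')"
begin

abbreviation "P \<equiv> Iso (comma F V F id_ftor \<iota>)"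
abbreviation "W \<equiv> lists (comma_objs F V F id_ftor \<iota>)"

lemma category_P: "category P"
proof -
  have "cfunctor F F id_ftor" by unfold_locales (auto simp: id_ftor_def)
  then show ?thesis using category_Iso[OF category_comma] \<iota>.cfunctor_axioms by blast
qed

sublocale P: category P by (rule category_P)

lemma vtx_obj: "x \<in> comma_objs F V F id_ftor \<iota> \<Longrightarrow> vtx x \<in> Obj V"
  by (auto simp: comma_objs_def)

lemma vtx_word: "w \<in> W \<Longrightarrow> map vtx w \<in> lists (Obj V)"
  using vtx_obj by (auto simp: in_lists_conv_set)

lemma tgt_letter:
  assumes "f \<in> iso_hom (comma F V F id_ftor \<iota>) x y"
  shows "tgt f \<in> Hom V (vtx x) (vtx y)"
proof -
  have "f \<in> Hom (comma F V F id_ftor \<iota>) x y" using assms by (simp add: iso_hom_def)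
  then show ?thesis by (cases f; cases x; cases y) (auto simp: comma_hom_iff tgt_def)
qed

lemma vtx_arr_hom:
  assumes "a \<in> Hom (free_cat s P) w w'"
  shows "vtx_arr a \<in> Hom (free_cat s V) (map vtx w) (map vtx w')"
proof -
  obtain fs p where a: "a = (fs, p)" by (cases a)
  have "p i < length w' " if "i < length w" for i
    using assms that permutes_in_image[of p "{..<length w}" i] by (auto simp: a free_hom_iff)
  then show ?thesis using assms tgt_letter by (auto simp: a vtx_arr_def free_hom_iff)
qed

text \<open>
  Two ways to the target of the morphism \<open>J2 w\<close>: \<open>T1\<close> assembles the vertices of \<open>w\<close> by \<open>J1\<close>, and \<open>T2\<close>
  assembles \<open>w\<close> by \<open>J2\<close> and then takes the target.  They agree on letters.
\<close>
definition T1 :: "((('o, 'v, 'm) comma_obj) list, ('o, 'v, 'm, 'm, 'a) comma_arr list \<times> (nat \<Rightarrow> nat), 'o, 'm) ftor" where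
  "T1 = \<lparr>fobj = (\<lambda>w. fobj J1 (map vtx w)), farr = (\<lambda>a. farr J1 (vtx_arr a))\<rparr>"

definition T2 :: "((('o, 'v, 'm) comma_obj) list, ('o, 'v, 'm, 'm, 'a) comma_arr list \<times> (nat \<Rightarrow> nat), 'o, 'm) ftor" where
  "T2 = \<lparr>fobj = (\<lambda>w. vtx (fobj J2 w)), farr = (\<lambda>a. tgt (farr J2 a))\<rparr>"

lemma vtx_arr_ide: "w \<in> W \<Longrightarrow> vtx_arr (free_ide P w) = free_ide V (map vtx w)"
  by (auto simp: vtx_arr_def free_ide_def tgt_def)

lemma vtx_arr_comp: "a \<in> Hom (free_cat s P) w w' \<Longrightarrow> b \<in> Hom (free_cat s P) w' w'' \<Longrightarrow>
    vtx_arr (b \<bullet>\<^bsub>free_cat s P\<^esub> a) = vtx_arr b \<bullet>\<^bsub>free_cat s V\<^esub> vtx_arr a"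
proof -
  assume h: "a \<in> Hom (free_cat s P) w w'" "b \<in> Hom (free_cat s P) w' w''"
  obtain fs p gs q where ab: "a = (fs, p)" "b = (gs, q)" by (cases a, cases b)
  have "p i < length gs" if "i < length fs" for i
    using h that permutes_in_image[of p "{..<length w}" i] by (auto simp: ab free_hom_iff)
  then show ?thesis by (auto simp: ab free_cat_comp vtx_arr_def tgt_def)
qed

lemma vtx_arr_ten: "vtx_arr (a \<boxtimes>\<^bsub>free_cat s P\<^esub> b) = vtx_arr a \<boxtimes>\<^bsub>free_cat s V\<^esub> vtx_arr b"
  by (cases a; cases b) (simp add: free_cat_ten vtx_arr_def)

lemma monoidal_T1: "monoidal_ftor (free_cat s P) (Iso F) T1 (\<lambda>x y. \<mu>1 (map vtx x) (map vtx y)) u1"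
proof (intro monoidal_ftor.intro monoidal_ftor_axioms.intro cfunctor.intro cfunctor_axioms.intro)
  show "category (free_cat s P)" "category (Iso F)" "monoidal_category (free_cat s P)" "monoidal_category (Iso F)"
    by unfold_locales
  note vw = vtx_word
  show "f \<in> Hom (free_cat s P) X Y \<Longrightarrow> farr T1 f \<in> Hom (Iso F) (fobj T1 X) (fobj T1 Y)" for f X Y
    using J1.map_hom[OF vtx_arr_hom] by (simp add: T1_def)
  show "f \<in> Hom (free_cat s P) X Y \<Longrightarrow> g \<in> Hom (free_cat s P) Y Z \<Longrightarrow>
      farr T1 (g \<bullet>\<^bsub>free_cat s P\<^esub> f) = farr T1 g \<bullet>\<^bsub>Iso F\<^esub> farr T1 f" for f g X Y Z
    using J1.map_comp[OF vtx_arr_hom vtx_arr_hom] by (simp add: T1_def vtx_arr_comp)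
  show "f \<in> Hom (free_cat s P) X X' \<Longrightarrow> g \<in> Hom (free_cat s P) Y Y' \<Longrightarrow>
      farr T1 (f \<boxtimes>\<^bsub>free_cat s P\<^esub> g) \<bullet>\<^bsub>Iso F\<^esub> \<mu>1 (map vtx X) (map vtx Y) =
      \<mu>1 (map vtx X') (map vtx Y') \<bullet>\<^bsub>Iso F\<^esub> (farr T1 f \<boxtimes>\<^bsub>Iso F\<^esub> farr T1 g)" for f g X X' Y Y'
    using J1.mu_nat[OF vtx_arr_hom vtx_arr_hom] by (simp add: T1_def vtx_arr_ten)
  show "X \<in> Obj (free_cat s P) \<Longrightarrow> fobj T1 X \<in> Obj (Iso F)" for X
    using J1.map_obj[of "map vtx X"] vw[of X] by (simp add: T1_def)
  show "X \<in> Obj (free_cat s P) \<Longrightarrow> farr T1 (Ide (free_cat s P) X) = Ide (Iso F) (fobj T1 X)" for X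
    using J1.map_ide[of "map vtx X"] vw[of X] by (simp add: T1_def vtx_arr_ide)
  show "X \<in> Obj (free_cat s P) \<Longrightarrow> Y \<in> Obj (free_cat s P) \<Longrightarrow>
    \<mu>1 (map vtx X) (map vtx Y) \<in> iso_hom (Iso F) (fobj T1 X \<odot>\<^bsub>Iso F\<^esub> fobj T1 Y) (fobj T1 (X \<odot>\<^bsub>free_cat s P\<^esub> Y))" for X Y
    using J1.mu_iso[of "map vtx X" "map vtx Y"] vw[of X] vw[of Y] by (simp add: T1_def)
  show "u1 \<in> iso_hom (Iso F) (unitO (Iso F)) (fobj T1 (unitO (free_cat s P)))"
    using J1.u_iso by (simp add: T1_def)
  show "X \<in> Obj (free_cat s P) \<Longrightarrow> Y \<in> Obj (free_cat s P) \<Longrightarrow> Z \<in> Obj (free_cat s P) \<Longrightarrow>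
    farr T1 (assoc (free_cat s P) X Y Z) \<bullet>\<^bsub>Iso F\<^esub> \<mu>1 (map vtx (X \<odot>\<^bsub>free_cat s P\<^esub> Y)) (map vtx Z) \<bullet>\<^bsub>Iso F\<^esub>
      (\<mu>1 (map vtx X) (map vtx Y) \<boxtimes>\<^bsub>Iso F\<^esub> Ide (Iso F) (fobj T1 Z)) =
    \<mu>1 (map vtx X) (map vtx (Y \<odot>\<^bsub>free_cat s P\<^esub> Z)) \<bullet>\<^bsub>Iso F\<^esub> (Ide (Iso F) (fobj T1 X) \<boxtimes>\<^bsub>Iso F\<^esub> \<mu>1 (map vtx Y) (map vtx Z)) \<bullet>\<^bsub>Iso F\<^esub>
      assoc (Iso F) (fobj T1 X) (fobj T1 Y) (fobj T1 Z)" for X Y Z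
    using J1.mu_assoc[of "map vtx X" "map vtx Y" "map vtx Z"] vw[of X] vw[of Y] vw[of Z]
    by (simp add: T1_def vtx_arr_ide)
  show "X \<in> Obj (free_cat s P) \<Longrightarrow>
    farr T1 (lunit (free_cat s P) X) \<bullet>\<^bsub>Iso F\<^esub> \<mu>1 (map vtx (unitO (free_cat s P))) (map vtx X) \<bullet>\<^bsub>Iso F\<^esub>
      (u1 \<boxtimes>\<^bsub>Iso F\<^esub> Ide (Iso F) (fobj T1 X)) = lunit (Iso F) (fobj T1 X)" for X
    using J1.mu_lunit[of "map vtx X"] vw[of X] by (simp add: T1_def vtx_arr_ide)
  show "X \<in> Obj (free_cat s P) \<Longrightarrow>
    farr T1 (runit (free_cat s P) X) \<bullet>\<^bsub>Iso F\<^esub> \<mu>1 (map vtx X) (map vtx (unitO (free_cat s P))) \<bullet>\<^bsub>Iso F\<^esub>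
      (Ide (Iso F) (fobj T1 X) \<boxtimes>\<^bsub>Iso F\<^esub> u1) = runit (Iso F) (fobj T1 X)" for X
    using J1.mu_runit[of "map vtx X"] vw[of X] by (simp add: T1_def vtx_arr_ide)
qed

lemma tgt_simps [simp]: "tgt (a, b, c, d) = d" "src (a, b, c, d) = c"
  by (simp_all add: tgt_def src_def)

lemma arrow_obj: "x \<in> comma_objs F F F id_ftor id_ftor \<longleftrightarrow>
    fst x \<in> Obj F \<and> vtx x \<in> Obj F \<and> snd (snd x) \<in> Hom F (fst x) (vtx x)"
  by (auto simp: comma_objs_def id_ftor_def)

lemma monoidal_T2: "monoidal_ftor (free_cat s P) (Iso F) T2 (\<lambda>x y. tgt (\<mu>2 x y)) (tgt u2)"
proof (intro monoidal_ftor.intro monoidal_ftor_axioms.intro cfunctor.intro cfunctor_axioms.intro)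
  show "category (free_cat s P)" "category (Iso F)" "monoidal_category (free_cat s P)" "monoidal_category (Iso F)"
    by unfold_locales
  show "f \<in> Hom (free_cat s P) X Y \<Longrightarrow> farr T2 f \<in> Hom (Iso F) (fobj T2 X) (fobj T2 Y)" for f X Y
    using arrow_isoD(2)[of "farr J2 f" F "fobj J2 X" "fobj J2 Y"] J2.map_hom[of f X Y] by (simp add: T2_def)
  show "f \<in> Hom (free_cat s P) X Y \<Longrightarrow> g \<in> Hom (free_cat s P) Y Z \<Longrightarrow>
      farr T2 (g \<bullet>\<^bsub>free_cat s P\<^esub> f) = farr T2 g \<bullet>\<^bsub>Iso F\<^esub> farr T2 f" for f g X Y Z
    using J2.map_comp[of f X Y g Z] by (simp add: T2_def)
  show "f \<in> Hom (free_cat s P) X X' \<Longrightarrow> g \<in> Hom (free_cat s P) Y Y' \<Longrightarrow>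
      farr T2 (f \<boxtimes>\<^bsub>free_cat s P\<^esub> g) \<bullet>\<^bsub>Iso F\<^esub> tgt (\<mu>2 X Y) =
      tgt (\<mu>2 X' Y') \<bullet>\<^bsub>Iso F\<^esub> (farr T2 f \<boxtimes>\<^bsub>Iso F\<^esub> farr T2 g)" for f g X X' Y Y'
    using arg_cong[OF J2.mu_nat[of f X X' g Y Y'], of tgt] by (simp add: T2_def)
  show "X \<in> Obj (free_cat s P) \<Longrightarrow> fobj T2 X \<in> Obj (Iso F)" for X
    using J2.map_obj[of X] by (simp add: T2_def arrow_obj)
  show "X \<in> Obj (free_cat s P) \<Longrightarrow> farr T2 (Ide (free_cat s P) X) = Ide (Iso F) (fobj T2 X)" for X
    using J2.map_ide[of X] by (simp add: T2_def)
  show "X \<in> Obj (free_cat s P) \<Longrightarrow> Y \<in> Obj (free_cat s P) \<Longrightarrow>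
    tgt (\<mu>2 X Y) \<in> iso_hom (Iso F) (fobj T2 X \<odot>\<^bsub>Iso F\<^esub> fobj T2 Y) (fobj T2 (X \<odot>\<^bsub>free_cat s P\<^esub> Y))" for X Y
    using arrow_isoD(2)[OF J2.mu_iso[of X Y, unfolded iso_hom_Iso]] by (simp add: T2_def)
  show "tgt u2 \<in> iso_hom (Iso F) (unitO (Iso F)) (fobj T2 (unitO (free_cat s P)))"
    using arrow_isoD(2)[OF J2.u_iso[unfolded iso_hom_Iso]] by (simp add: T2_def)
  show "X \<in> Obj (free_cat s P) \<Longrightarrow> Y \<in> Obj (free_cat s P) \<Longrightarrow> Z \<in> Obj (free_cat s P) \<Longrightarrow>
    farr T2 (assoc (free_cat s P) X Y Z) \<bullet>\<^bsub>Iso F\<^esub> tgt (\<mu>2 (X \<odot>\<^bsub>free_cat s P\<^esub> Y) Z) \<bullet>\<^bsub>Iso F\<^esub>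
      (tgt (\<mu>2 X Y) \<boxtimes>\<^bsub>Iso F\<^esub> Ide (Iso F) (fobj T2 Z)) =
    tgt (\<mu>2 X (Y \<odot>\<^bsub>free_cat s P\<^esub> Z)) \<bullet>\<^bsub>Iso F\<^esub> (Ide (Iso F) (fobj T2 X) \<boxtimes>\<^bsub>Iso F\<^esub> tgt (\<mu>2 Y Z)) \<bullet>\<^bsub>Iso F\<^esub>
      assoc (Iso F) (fobj T2 X) (fobj T2 Y) (fobj T2 Z)" for X Y Z
    using arg_cong[OF J2.mu_assoc[of X Y Z], of tgt] by (simp add: T2_def)
  show "X \<in> Obj (free_cat s P) \<Longrightarrow>
    farr T2 (lunit (free_cat s P) X) \<bullet>\<^bsub>Iso F\<^esub> tgt (\<mu>2 (unitO (free_cat s P)) X) \<bullet>\<^bsub>Iso F\<^esub>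
      (tgt u2 \<boxtimes>\<^bsub>Iso F\<^esub> Ide (Iso F) (fobj T2 X)) = lunit (Iso F) (fobj T2 X)" for X
    using arg_cong[OF J2.mu_lunit[of X], of tgt] by (simp add: T2_def)
  show "X \<in> Obj (free_cat s P) \<Longrightarrow>
    farr T2 (runit (free_cat s P) X) \<bullet>\<^bsub>Iso F\<^esub> tgt (\<mu>2 X (unitO (free_cat s P))) \<bullet>\<^bsub>Iso F\<^esub>
      (Ide (Iso F) (fobj T2 X) \<boxtimes>\<^bsub>Iso F\<^esub> tgt u2) = runit (Iso F) (fobj T2 X)" for X
    using arg_cong[OF J2.mu_runit[of X], of tgt] by (simp add: T2_def)
qed

lemma letters_agree:
  "x \<in> comma_objs F V F id_ftor \<iota> \<Longrightarrow> fobj T1 [x] = fobj T2 [x]"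
  "f \<in> Arr P \<Longrightarrow> farr T1 ([f], id) = farr T2 ([f], id)"
proof -
  assume x: "x \<in> comma_objs F V F id_ftor \<iota>"
  then have "fobj J2 [x] = fobj (comma_incl \<iota>) x" "fobj J1 [vtx x] = fobj \<iota> (vtx x)"
    using ext1 ext2 vtx_obj[OF x] by (auto simp: extends_ftor_def)
  then show "fobj T1 [x] = fobj T2 [x]" by (cases x) (simp add: T1_def T2_def comma_incl_def)
next
  assume f: "f \<in> Arr P"
  then have f': "f \<in> iso_hom (comma F V F id_ftor \<iota>) (Dom P f) (Cod P f)"
    using P.HomI[OF f] by simp
  have "tgt f \<in> Arr V" using tgt_letter[OF f'] by (simp add: Hom_def)
  then have "farr J1 ([tgt f], id) = farr \<iota> (tgt f)" "farr J2 ([f], id) = farr (comma_incl \<iota>) f"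
    using ext1 ext2 f unfolding extends_ftor_def by blast+
  then show "farr T1 ([f], id) = farr T2 ([f], id)"
    by (cases f) (simp add: T1_def T2_def comma_incl_def vtx_arr_def split: prod.splits)
qed

sublocale letterwise_equal s P "Iso F" T1 T2 "\<lambda>x y. \<mu>1 (map vtx x) (map vtx y)" "\<lambda>x y. tgt (\<mu>2 x y)" u1 "tgt u2" \<beta>
proof (intro letterwise_equal.intro monoidal_T1 monoidal_T2 category_P letterwise_equal_axioms.intro)
  show "x \<in> Obj P \<Longrightarrow> fobj T1 [x] = fobj T2 [x]" for x using letters_agree by simp
  show "f \<in> Arr P \<Longrightarrow> farr T1 ([f], id) = farr T2 ([f], id)" for f using letters_agree by simp
  show "s \<Longrightarrow> X \<in> Obj (Iso F) \<Longrightarrow> Y \<in> Obj (Iso F) \<Longrightarrow> \<beta> X Y \<in> Hom (Iso F) (X \<odot>\<^bsub>Iso F\<^esub> Y) (Y \<odot>\<^bsub>Iso F\<^esub> X)" for X Y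
    using braid_hom by simp
  show "s \<Longrightarrow> h \<in> Hom (Iso F) X X' \<Longrightarrow> k \<in> Hom (Iso F) Y Y'
      \<Longrightarrow> \<beta> X' Y' \<bullet>\<^bsub>Iso F\<^esub> (h \<boxtimes>\<^bsub>Iso F\<^esub> k) = (k \<boxtimes>\<^bsub>Iso F\<^esub> h) \<bullet>\<^bsub>Iso F\<^esub> \<beta> X Y" for h k X X' Y Y'
    using braid_nat F.iso_hom_hom by simp
  show "s \<Longrightarrow> xs \<in> lists (Obj P) \<Longrightarrow> ys \<in> lists (Obj P) \<Longrightarrow>
      farr T1 (free_braid P xs ys) \<bullet>\<^bsub>Iso F\<^esub> \<mu>1 (map vtx xs) (map vtx ys) = \<mu>1 (map vtx ys) (map vtx xs) \<bullet>\<^bsub>Iso F\<^esub> \<beta> (fobj T1 xs) (fobj T1 ys)" for xs ys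
    using braid1[of "map vtx xs" "map vtx ys"] vtx_word[of xs] vtx_word[of ys]
    by (simp add: T1_def vtx_arr_def free_braid_def comp_def)
  show "s \<Longrightarrow> xs \<in> lists (Obj P) \<Longrightarrow> ys \<in> lists (Obj P) \<Longrightarrow>
      farr T2 (free_braid P xs ys) \<bullet>\<^bsub>Iso F\<^esub> tgt (\<mu>2 xs ys) = tgt (\<mu>2 ys xs) \<bullet>\<^bsub>Iso F\<^esub> \<beta> (fobj T2 xs) (fobj T2 ys)" for xs ys
    using arg_cong[OF braid2[of xs ys], of tgt] by (simp add: T2_def arrow_braid_def)
qed

end

text \<open>
  Over a tensor product of objects, morphisms decompose into tensor products, uniquely up to
  isomorphisms of the factors.
\<close>
locale tensor_splitting = monoidal_category F for F :: "('o, 'm, 'z) moncat_scheme" (structure) +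
  assumes split: "\<Phi> \<in> Hom F Z (Y \<odot> Y') \<Longrightarrow> Y \<in> Obj F \<Longrightarrow> Y' \<in> Obj F \<Longrightarrow>
      \<exists>Z1 Z2 \<alpha> \<beta> \<sigma>. \<alpha> \<in> Hom F Z1 Y \<and> \<beta> \<in> Hom F Z2 Y' \<and> \<sigma> \<in> iso_hom F Z (Z1 \<odot> Z2) \<and> \<Phi> = (\<alpha> \<boxtimes> \<beta>) \<bullet> \<sigma>"
    and split_unique: "\<alpha> \<in> Hom F A Y \<Longrightarrow> \<beta> \<in> Hom F B Y' \<Longrightarrow> \<alpha>' \<in> Hom F A' Y \<Longrightarrow> \<beta>' \<in> Hom F B' Y' \<Longrightarrow>
      \<sigma> \<in> iso_hom F (A \<odot> B) (A' \<odot> B') \<Longrightarrow> (\<alpha>' \<boxtimes> \<beta>') \<bullet> \<sigma> = \<alpha> \<boxtimes> \<beta> \<Longrightarrow>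
      \<exists>\<sigma>1 \<in> iso_hom F A A'. \<exists>\<sigma>2 \<in> iso_hom F B B'. \<sigma> = \<sigma>1 \<boxtimes> \<sigma>2 \<and> \<alpha>' \<bullet> \<sigma>1 = \<alpha> \<and> \<beta>' \<bullet> \<sigma>2 = \<beta>"
    and ten_ide_cancel: "\<tau> \<in> iso_hom F X X \<Longrightarrow> \<tau>' \<in> iso_hom F Y Y \<Longrightarrow> \<tau> \<boxtimes> \<tau>' = Ide F (X \<odot> Y) \<Longrightarrow>
      \<tau> = Ide F X \<and> \<tau>' = Ide F Y"

context feynman_words
begin

text \<open>
  \<open>mor w\<close>, from \<open>dm w\<close> to \<open>cd w\<close>, is the morphism assembled from the word \<open>w\<close>, and \<open>\<theta>\<close> identifies the
  object assembled from its vertices with \<open>cd w\<close>.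
\<close>
abbreviation "dm w \<equiv> fst (fobj J2 w)"
abbreviation "cd w \<equiv> fobj T2 w"
abbreviation "mor w \<equiv> snd (snd (fobj J2 w))"
abbreviation "\<theta> \<equiv> comparison"

lemma T1_simps: "fobj T1 w = fobj J1 (map vtx w)" "farr T1 a = farr J1 (vtx_arr a)"
  by (simp_all add: T1_def)

lemma T2_arr: "farr T2 a = tgt (farr J2 a)"
  by (simp add: T2_def)

lemma cd: "vtx (fobj J2 w) = cd w"
  by (simp add: T2_def)

lemma J1_hom: "a \<in> Hom (free_cat s V) xs ys \<Longrightarrow> farr J1 a \<in> iso_hom F (fobj J1 xs) (fobj J1 ys)"
  using J1.map_hom[of a xs ys] by simp

lemma J1_mu: "xs \<in> lists (Obj V) \<Longrightarrow> ys \<in> lists (Obj V) \<Longrightarrow>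
    \<mu>1 xs ys \<in> iso_hom F (fobj J1 xs \<odot> fobj J1 ys) (fobj J1 (xs @ ys))"
  using J1.mu_iso[of xs ys] by simp

lemma J1_nat: "a \<in> Hom (free_cat s V) xs ys \<Longrightarrow> b \<in> Hom (free_cat s V) xs' ys' \<Longrightarrow>
    farr J1 (a \<boxtimes>\<^bsub>free_cat s V\<^esub> b) \<bullet> \<mu>1 xs xs' = \<mu>1 ys ys' \<bullet> (farr J1 a \<boxtimes> farr J1 b)"
  using J1.mu_nat[of a xs ys b xs' ys'] by simp

lemma J1_full:
  assumes "xs \<in> lists (Obj V)" "ys \<in> lists (Obj V)" "g \<in> iso_hom F (fobj J1 xs) (fobj J1 ys)"
  obtains a where "a \<in> Hom (free_cat s V) xs ys" "farr J1 a = g"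
  using equivalence_full[OF eq1, of xs ys g] assms by auto

lemma J1_faithful: "a \<in> Hom (free_cat s V) xs ys \<Longrightarrow> b \<in> Hom (free_cat s V) xs ys \<Longrightarrow> farr J1 a = farr J1 b \<Longrightarrow> a = b"
  using equivalence_faithful[OF eq1] .

lemma J1_surj:
  assumes "X \<in> Obj F"
  obtains xs a where "xs \<in> lists (Obj V)" "a \<in> iso_hom F (fobj J1 xs) X"
  using equivalence_surj[OF eq1, of X] assms by auto

lemma mor_hom: "w \<in> W \<Longrightarrow> mor w \<in> Hom F (dm w) (cd w)"
  using J2.map_obj[of w] by (simp add: arrow_obj cd)

lemma J2_hom:
  assumes "a \<in> Hom (free_cat s P) w w'"
  shows "src (farr J2 a) \<in> iso_hom F (dm w) (dm w')" "tgt (farr J2 a) \<in> iso_hom F (cd w) (cd w')"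
    "tgt (farr J2 a) \<bullet> mor w = mor w' \<bullet> src (farr J2 a)"
  using arrow_isoD[of "farr J2 a" F "fobj J2 w" "fobj J2 w'"] J2.map_hom[OF assms] by (simp_all add: cd)

lemma J2_mu:
  assumes "w \<in> W" "w' \<in> W"
  shows "src (\<mu>2 w w') \<in> iso_hom F (dm w \<odot> dm w') (dm (w @ w'))"
    "tgt (\<mu>2 w w') \<in> iso_hom F (cd w \<odot> cd w') (cd (w @ w'))"
    "tgt (\<mu>2 w w') \<bullet> (mor w \<boxtimes> mor w') = mor (w @ w') \<bullet> src (\<mu>2 w w')"
  using arrow_isoD[OF J2.mu_iso[of w w', unfolded iso_hom_Iso]] assms by (simp_all add: cd)

lemma J2_nat:
  assumes "a \<in> Hom (free_cat s P) w w'" "b \<in> Hom (free_cat s P) v v'"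
  shows "src (farr J2 (a \<boxtimes>\<^bsub>free_cat s P\<^esub> b)) \<bullet> src (\<mu>2 w v)
    = src (\<mu>2 w' v') \<bullet> (src (farr J2 a) \<boxtimes> src (farr J2 b))"
  using arg_cong[OF J2.mu_nat[OF assms], of src] by simp

lemma J2_full:
  assumes "w \<in> W" "w' \<in> W" "f \<in> iso_hom F (dm w) (dm w')" "g \<in> iso_hom F (cd w) (cd w')"
    "g \<bullet> mor w = mor w' \<bullet> f"
  obtains a where "a \<in> Hom (free_cat s P) w w'" "src (farr J2 a) = f" "tgt (farr J2 a) = g"
proof -
  have "(fobj J2 w, fobj J2 w', f, g) \<in> iso_hom (arrow_moncat F) (fobj J2 w) (fobj J2 w')"
    using F.arrow_isoI[of "fobj J2 w" "fobj J2 w'" f g] assms mor_hom[OF assms(1)] mor_hom[OF assms(2)]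
      F.hom_obj by (auto simp: cd)
  then obtain a where "a \<in> Hom (free_cat s P) w w'" "farr J2 a = (fobj J2 w, fobj J2 w', f, g)"
    using equivalence_full[OF eq2, of w w' "(fobj J2 w, fobj J2 w', f, g)"] assms(1,2)
    unfolding Hom_Iso free_cat_simps Iso_simps comma_simps by blast
  then show ?thesis using that by simp
qed

lemma J2_surj:
  assumes "\<phi> \<in> Hom F X Y"
  obtains w f g where "w \<in> W" "f \<in> iso_hom F (dm w) X" "g \<in> iso_hom F (cd w) Y" "g \<bullet> mor w = \<phi> \<bullet> f"
proof -
  have "(X, Y, \<phi>) \<in> Obj (Iso (arrow_moncat F))" using assms F.hom_obj[OF assms] by (simp add: arrow_obj)
  then obtain w a where "w \<in> Obj (free_cat s P)" "a \<in> iso_hom (Iso (arrow_moncat F)) (fobj J2 w) (X, Y, \<phi>)"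
    using equivalence_surj[OF eq2] by blast
  then show ?thesis
    using that[of w "src a" "tgt a"] arrow_isoD[of a F "fobj J2 w" "(X, Y, \<phi>)"] by (simp add: cd)
qed

lemma theta_iso: "w \<in> W \<Longrightarrow> \<theta> w \<in> iso_hom F (fobj J1 (map vtx w)) (cd w)"
  using comparison_iso[of w] by (simp add: T1_simps)

lemma theta_monoidal: "w \<in> W \<Longrightarrow> w' \<in> W \<Longrightarrow>
    \<theta> (w @ w') \<bullet> \<mu>1 (map vtx w) (map vtx w') = tgt (\<mu>2 w w') \<bullet> (\<theta> w \<boxtimes> \<theta> w')"
  using comparison_monoidal[of w w'] by simp

lemma theta_natural: "a \<in> Hom (free_cat s P) w w' \<Longrightarrow>
    tgt (farr J2 a) \<bullet> \<theta> w = \<theta> w' \<bullet> farr J1 (vtx_arr a)"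
  using comparison_natural[of a w w'] by (simp add: T1_simps T2_arr)

text \<open>
  The automorphisms come from arrows of words under \<open>J1\<close>.  Their concatenation is mapped to the
  identity, so it is an identity arrow, and so are the two pieces.
\<close>
lemma iso_tensor_cancel:
  assumes t: "\<tau> \<in> iso_hom F X X" "\<tau>' \<in> iso_hom F Y Y" and e: "\<tau> \<boxtimes> \<tau>' = Ide F (X \<odot> Y)"
  shows "\<tau> = Ide F X" "\<tau>' = Ide F Y"
proof -
  note tD [simp] = F.iso_homD[OF t(1)] F.iso_homD[OF t(2)]
  obtain xs a where xs: "xs \<in> lists (Obj V)" and a: "a \<in> iso_hom F (fobj J1 xs) X" using J1_surj[of X] by auto
  obtain ys b where ys: "ys \<in> lists (Obj V)" and b: "b \<in> iso_hom F (fobj J1 ys) Y" using J1_surj[of Y] by auto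
  note [simp] = F.iso_homD[OF a] F.iso_homD[OF b] F.iso_homD[OF J1_mu[OF xs ys]]
  let ?g = "inv_arr F a \<bullet> \<tau> \<bullet> a" and ?h = "inv_arr F b \<bullet> \<tau>' \<bullet> b"
  have "?g \<in> iso_hom F (fobj J1 xs) (fobj J1 xs)" "?h \<in> iso_hom F (fobj J1 ys) (fobj J1 ys)"
    using F.comp_iso_hom[OF F.comp_iso_hom[OF a t(1)] F.iso_homD(11)[OF a]]
      F.comp_iso_hom[OF F.comp_iso_hom[OF b t(2)] F.iso_homD(11)[OF b]] by simp_all
  then obtain g h where g: "g \<in> Hom (free_cat s V) xs xs" "farr J1 g = ?g"
    and h: "h \<in> Hom (free_cat s V) ys ys" "farr J1 h = ?h"
    using J1_full[OF xs xs] J1_full[OF ys ys] by metis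
  note gh = V.free_ten_hom'[OF g(1) h(1)]
  note [simp] = F.iso_homD[OF J1_hom[OF gh]]
  have "farr J1 (g \<boxtimes>\<^bsub>free_cat s V\<^esub> h) \<bullet> \<mu>1 xs ys = \<mu>1 xs ys \<bullet> (?g \<boxtimes> ?h)"
    using J1_nat[OF g(1) h(1)] g h by simp
  also have "?g \<boxtimes> ?h = (inv_arr F a \<boxtimes> inv_arr F b) \<bullet> (\<tau> \<boxtimes> \<tau>') \<bullet> (a \<boxtimes> b)"
    by simp
  also have "\<dots> = Ide F (fobj J1 xs \<odot> fobj J1 ys)" unfolding e by simp
  finally have "farr J1 (g \<boxtimes>\<^bsub>free_cat s V\<^esub> h) \<bullet> \<mu>1 xs ys = Ide F (fobj J1 (xs @ ys)) \<bullet> \<mu>1 xs ys"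
    by simp
  then have "farr J1 (g \<boxtimes>\<^bsub>free_cat s V\<^esub> h) = Ide F (fobj J1 (xs @ ys))"
    by (rule F.iso_cancel_right[OF J1_mu[OF xs ys], rotated 4]) simp_all
  also have "\<dots> = farr J1 (free_ide V xs \<boxtimes>\<^bsub>free_cat s V\<^esub> free_ide V ys)"
    using J1.A.ten_ide[of xs ys] J1.map_ide[of "xs @ ys"] xs ys by simp
  finally have gi: "g \<boxtimes>\<^bsub>free_cat s V\<^esub> h = free_ide V xs \<boxtimes>\<^bsub>free_cat s V\<^esub> free_ide V ys"
    by (rule J1_faithful[OF gh V.free_ten_hom'[OF V.free_ide_hom[OF xs] V.free_ide_hom[OF ys]]])
  have "g = free_ide V xs" "h = free_ide V ys"
    using V.free_ten_inject[OF gi g(1) V.free_ide_hom[OF xs] h(1) V.free_ide_hom[OF ys]] by auto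
  then have "?g = Ide F (fobj J1 xs)" "?h = Ide F (fobj J1 ys)"
    using g(2) h(2) J1.map_ide[of xs] J1.map_ide[of ys] xs ys by simp_all
  then have "a \<bullet> ?g \<bullet> inv_arr F a = Ide F X" "b \<bullet> ?h \<bullet> inv_arr F b = Ide F Y"
    by (simp_all del: F.assoc_arr)
  then show "\<tau> = Ide F X" "\<tau>' = Ide F Y" by simp_all
qed

text \<open>
  Write \<open>\<Phi>\<close> as a word \<open>w\<close>, and \<open>Y\<close>, \<open>Y'\<close> as words \<open>y\<close>, \<open>y'\<close> of vertices.  The identification of targets comes
  from an arrow between \<open>y @ y'\<close> and the vertices of \<open>w\<close>.  Its permutation is used to reorder the
  letters of \<open>w\<close> into \<open>w' = w1 @ w2\<close>; after that the arrow is a concatenation \<open>h1\<close>, \<open>h2\<close>, and the two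
  parts of \<open>w'\<close> have targets identified with \<open>Y\<close> and \<open>Y'\<close>.
\<close>
lemma split_exists:
  assumes \<Phi>: "\<Phi> \<in> Hom F Z (Y \<odot> Y')" and YY: "Y \<in> Obj F" "Y' \<in> Obj F"
  shows "\<exists>Z1 Z2 \<alpha> \<gamma> \<sigma>. \<alpha> \<in> Hom F Z1 Y \<and> \<gamma> \<in> Hom F Z2 Y' \<and> \<sigma> \<in> iso_hom F Z (Z1 \<odot> Z2) \<and> \<Phi> = (\<alpha> \<boxtimes> \<gamma>) \<bullet> \<sigma>"
proof -
  obtain w \<psi> \<rho> where w: "w \<in> W" and \<psi>: "\<psi> \<in> iso_hom F (dm w) Z" and \<rho>: "\<rho> \<in> iso_hom F (cd w) (Y \<odot> Y')"
    and q: "\<rho> \<bullet> mor w = \<Phi> \<bullet> \<psi>" using J2_surj[OF \<Phi>] by blast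
  obtain y a where y: "y \<in> lists (Obj V)" and a: "a \<in> iso_hom F (fobj J1 y) Y" using J1_surj[OF YY(1)] by blast
  obtain y' a' where y': "y' \<in> lists (Obj V)" and a': "a' \<in> iso_hom F (fobj J1 y') Y'" using J1_surj[OF YY(2)] by blast
  have yy: "y @ y' \<in> lists (Obj V)" using y y' by simp
  let ?vw = "map vtx w"
  note vw = vtx_word[OF w]
  note [simp] = F.iso_homD[OF \<psi>] F.iso_homD[OF \<rho>] F.iso_homD[OF a] F.iso_homD[OF a']
    F.iso_homD[OF J1_mu[OF y y']] F.iso_homD[OF theta_iso[OF w]]
  note [simp] = mor_hom[OF w, unfolded Hom_def, simplified] \<Phi>[unfolded Hom_def, simplified]
  define g where "g = inv_arr F (\<theta> w) \<bullet> inv_arr F \<rho> \<bullet> (a \<boxtimes> a') \<bullet> inv_arr F (\<mu>1 y y')"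
  have "g \<in> iso_hom F (fobj J1 (y @ y')) (fobj J1 ?vw)"
    using F.comp_iso_hom[OF F.comp_iso_hom[OF F.comp_iso_hom[OF F.iso_homD(11)[OF J1_mu[OF y y']] F.ten_iso_hom[OF a a']]
      F.iso_homD(11)[OF \<rho>]] F.iso_homD(11)[OF theta_iso[OF w]]]
    by (simp add: g_def)
  then obtain fs p where fsp: "(fs, p) \<in> Hom (free_cat s V) (y @ y') ?vw" and Jg: "farr J1 (fs, p) = g"
    using J1_full[OF yy vw] by (metis surj_pair)
  define n where "n = length w"
  have p: "p permutes {..<n}" "s \<or> p = id" and l: "length fs = n" "length (y @ y') = n"
    using fsp by (auto simp: free_hom_iff n_def)
  have pl: "p i < n" if "i < n" for i using permutes_in_image[OF p(1), of i] that by simp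
  (* The \<open>i\<close>-th letter of \<open>y @ y'\<close> corresponds to the \<open>p i\<close>-th letter of \<open>w\<close>. *)
  define w' where "w' = map (\<lambda>i. w ! p i) [0..<n]"
  have lw': "length w' = n" and w'n: "\<And>i. i < n \<Longrightarrow> w' ! i = w ! p i" by (auto simp: w'_def)
  have w'P: "w' ! i \<in> Obj P" if "i < n" for i
    using w pl[OF that] w'n[OF that] by (auto simp: n_def in_lists_conv_set)
  have w': "w' \<in> W" using w'P lw' by (simp add: in_lists_conv_set all_set_conv_all_nth)
  define b where "b = (map (Ide P) w', p)"
  have b: "b \<in> Hom (free_cat s P) w' w"
    unfolding b_def free_hom_iff
  proof (intro conjI allI impI)
    fix i assume "i < length w'"
    then have "i < n" by (simp add: lw')
    then show "map (Ide P) w' ! i \<in> Hom P (w' ! i) (w ! p i)"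
      using P.ide_hom[OF w'P] w'n lw' by (metis nth_map)
  qed (use p lw' n_def in auto)
  define w1 where "w1 = take (length y) w'"
  define w2 where "w2 = drop (length y) w'"
  have ww: "w' = w1 @ w2" by (simp add: w1_def w2_def)
  have w12: "w1 \<in> W" "w2 \<in> W" using w' by (auto simp: ww)
  have l12: "length w1 = length y" "length w2 = length y'" using l lw' by (auto simp: w1_def w2_def)
  have "(fs, id) \<in> Hom (free_cat s V) (y @ y') (map vtx w')"
    using fsp lw' w'n pl l by (auto simp: free_hom_iff n_def)
  moreover have bp: "block_perm (length y) id id = id" by (auto simp: block_perm_def)
  ultimately have fs: "(fs, block_perm (length y) id id) \<in> Hom (free_cat s V) (y @ y') (map vtx w1 @ map vtx w2)"
    by (simp add: ww bp)
  define h1 where "h1 = (take (length y) fs, id :: nat \<Rightarrow> nat)"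
  define h2 where "h2 = (drop (length y) fs, id :: nat \<Rightarrow> nat)"
  note sp = V.free_split[OF fs refl _ permutes_id _ permutes_id, unfolded length_map l12, OF refl disjI2[OF refl] disjI2[OF refl]]
  have h1: "h1 \<in> Hom (free_cat s V) y (map vtx w1)" and h2: "h2 \<in> Hom (free_cat s V) y' (map vtx w2)"
    using sp(1,2) by (simp_all add: h1_def h2_def)
  have fsE: "(fs, p) = vtx_arr b \<bullet>\<^bsub>free_cat s V\<^esub> (h1 \<boxtimes>\<^bsub>free_cat s V\<^esub> h2)"
  proof -
    have "fs ! i \<in> Hom V ((y @ y') ! i) (vtx (w' ! i))" if "i < n" for i
      using fsp that w'n[OF that] pl[OF that] l by (auto simp: free_hom_iff n_def)
    then have "tgt (Ide P (w' ! i)) \<bullet>\<^bsub>V\<^esub> fs ! i = fs ! i" if "i < n" for i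
      using that by (auto simp: Hom_def)
    then have "map (\<lambda>i. map (\<lambda>x. tgt (Ide P x)) w' ! i \<bullet>\<^bsub>V\<^esub> fs ! i) [0..<n] = fs"
      using l lw' by (intro nth_equalityI) auto
    then show ?thesis
      using l bp by (simp add: h1_def h2_def b_def vtx_arr_def free_cat_ten free_cat_comp comp_def)
  qed
  have h12: "h1 \<boxtimes>\<^bsub>free_cat s V\<^esub> h2 \<in> Hom (free_cat s V) (y @ y') (map vtx w')"
    using V.free_ten_hom'[OF h1 h2] by (simp add: ww)
  note [simp] = F.iso_homD[OF theta_iso[OF w12(1)]] F.iso_homD[OF theta_iso[OF w12(2)]] F.iso_homD[OF theta_iso[OF w']]
    F.iso_homD[OF J1_hom[OF h1]] F.iso_homD[OF J1_hom[OF h2]] F.iso_homD[OF J1_hom[OF h12]]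
    F.iso_homD[OF J1_mu[OF vtx_word[OF w12(1)] vtx_word[OF w12(2)]], folded map_append ww]
    F.iso_homD[OF J2_mu(1)[OF w12], folded ww] F.iso_homD[OF J2_mu(2)[OF w12], folded ww]
    F.iso_homD[OF J2_hom(1)[OF b]] F.iso_homD[OF J2_hom(2)[OF b]] F.iso_homD[OF J1_hom[OF vtx_arr_hom[OF b]]]
  note [simp] = mor_hom[OF w', unfolded Hom_def, simplified] mor_hom[OF w12(1), unfolded Hom_def, simplified]
    mor_hom[OF w12(2), unfolded Hom_def, simplified]
  let ?tb = "tgt (farr J2 b)" and ?sb = "src (farr J2 b)" and ?tm = "tgt (\<mu>2 w1 w2)" and ?sm = "src (\<mu>2 w1 w2)"
  have gE: "g = farr J1 (vtx_arr b) \<bullet> farr J1 (h1 \<boxtimes>\<^bsub>free_cat s V\<^esub> h2)"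
    unfolding Jg[symmetric] fsE using J1.map_comp[OF h12 vtx_arr_hom[OF b]] by simp
  define t1 where "t1 = \<theta> w1 \<bullet> farr J1 h1 \<bullet> inv_arr F a"
  define t2 where "t2 = \<theta> w2 \<bullet> farr J1 h2 \<bullet> inv_arr F a'"
  have t1: "t1 \<in> iso_hom F Y (cd w1)"
    using F.comp_iso_hom[OF F.comp_iso_hom[OF F.iso_homD(11)[OF a] J1_hom[OF h1]] theta_iso[OF w12(1)]]
    by (simp add: t1_def)
  have t2: "t2 \<in> iso_hom F Y' (cd w2)"
    using F.comp_iso_hom[OF F.comp_iso_hom[OF F.iso_homD(11)[OF a'] J1_hom[OF h2]] theta_iso[OF w12(2)]]
    by (simp add: t2_def)
  note [simp] = F.iso_homD[OF t1] F.iso_homD[OF t2]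
  have ia: "inv_arr F a \<boxtimes> inv_arr F a' \<in> Arr F" by simp
  (* The reordering and \<open>t1\<close>, \<open>t2\<close> together recover the given identification \<open>\<rho>\<close> of the targets. *)
  have "?tb \<bullet> ?tm \<bullet> (t1 \<boxtimes> t2)
      = ?tb \<bullet> (?tm \<bullet> (\<theta> w1 \<boxtimes> \<theta> w2)) \<bullet> (farr J1 h1 \<boxtimes> farr J1 h2) \<bullet> (inv_arr F a \<boxtimes> inv_arr F a')"
    by (simp add: t1_def t2_def)
  also have "\<dots> = (?tb \<bullet> \<theta> w') \<bullet> (\<mu>1 (map vtx w1) (map vtx w2) \<bullet> (farr J1 h1 \<boxtimes> farr J1 h2)) \<bullet> (inv_arr F a \<boxtimes> inv_arr F a')"
    using theta_monoidal[OF w12, symmetric] by (simp add: ww[symmetric])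
  also have "\<dots> = \<theta> w \<bullet> g \<bullet> \<mu>1 y y' \<bullet> (inv_arr F a \<boxtimes> inv_arr F a')"
    unfolding theta_natural[OF b] J1_nat[OF h1 h2, symmetric] gE by simp
  also have "\<dots> = inv_arr F \<rho>"
    unfolding g_def by simp
  finally have key: "?tb \<bullet> ?tm \<bullet> (t1 \<boxtimes> t2) = inv_arr F \<rho>" .
  define \<alpha> where "\<alpha> = inv_arr F t1 \<bullet> mor w1"
  define \<gamma> where "\<gamma> = inv_arr F t2 \<bullet> mor w2"
  define \<sigma> where "\<sigma> = inv_arr F ?sm \<bullet> inv_arr F ?sb \<bullet> inv_arr F \<psi>"
  have \<alpha>\<gamma>: "\<alpha> \<in> Hom F (dm w1) Y" "\<gamma> \<in> Hom F (dm w2) Y'" by (auto simp: \<alpha>_def \<gamma>_def Hom_def)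
  have \<sigma>: "\<sigma> \<in> iso_hom F Z (dm w1 \<odot> dm w2)"
    using F.comp_iso_hom[OF F.comp_iso_hom[OF F.iso_homD(11)[OF \<psi>] F.iso_homD(11)[OF J2_hom(1)[OF b]]]
      F.iso_homD(11)[OF J2_mu(1)[OF w12, folded ww]]]
    by (simp add: \<sigma>_def)
  have "inv_arr F \<rho> \<bullet> (\<alpha> \<boxtimes> \<gamma>) \<bullet> \<sigma> = ?tb \<bullet> (?tm \<bullet> (mor w1 \<boxtimes> mor w2)) \<bullet> \<sigma>"
    unfolding key[symmetric] by (simp add: \<alpha>_def \<gamma>_def \<sigma>_def)
  also have "\<dots> = (?tb \<bullet> mor w') \<bullet> inv_arr F ?sb \<bullet> inv_arr F \<psi>"
    unfolding J2_mu(3)[OF w12] by (simp add: \<sigma>_def ww[symmetric])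
  also have "\<dots> = mor w \<bullet> inv_arr F \<psi>"
    unfolding J2_hom(3)[OF b] by simp
  finally have e: "inv_arr F \<rho> \<bullet> (\<alpha> \<boxtimes> \<gamma>) \<bullet> \<sigma> = mor w \<bullet> inv_arr F \<psi>" .
  note [simp] = \<alpha>\<gamma>[unfolded Hom_def, simplified] F.iso_homD[OF \<sigma>]
  have "(\<alpha> \<boxtimes> \<gamma>) \<bullet> \<sigma> = \<rho> \<bullet> inv_arr F \<rho> \<bullet> (\<alpha> \<boxtimes> \<gamma>) \<bullet> \<sigma>" by simp
  also have "\<dots> = (\<rho> \<bullet> mor w) \<bullet> inv_arr F \<psi>" unfolding e by simp
  also have "\<dots> = \<Phi>" unfolding q by simp
  finally show ?thesis using \<alpha>\<gamma> \<sigma> by blast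
qed

text \<open>
  Write the four morphisms as words.  Since \<open>\<sigma>\<close> lies over the identity of \<open>Y \<otimes> Y'\<close>, it comes from an
  arrow \<open>a\<close> of words whose image on vertices, by naturality of \<open>\<theta>\<close>, is the concatenation of arrows
  for \<open>Y\<close> and for \<open>Y'\<close>.  So its permutation preserves the two blocks, and \<open>a\<close> is itself a concatenation.
\<close>
lemma split_unique_words:
  assumes \<alpha>: "\<alpha> \<in> Hom F A Y" and \<gamma>: "\<gamma> \<in> Hom F B Y'" and \<alpha>': "\<alpha>' \<in> Hom F A' Y" and \<gamma>': "\<gamma>' \<in> Hom F B' Y'"
    and \<sigma>: "\<sigma> \<in> iso_hom F (A \<odot> B) (A' \<odot> B')" and e: "(\<alpha>' \<boxtimes> \<gamma>') \<bullet> \<sigma> = \<alpha> \<boxtimes> \<gamma>"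
  shows "\<exists>\<sigma>1 \<in> iso_hom F A A'. \<exists>\<sigma>2 \<in> iso_hom F B B'. \<sigma> = \<sigma>1 \<boxtimes> \<sigma>2 \<and> \<alpha>' \<bullet> \<sigma>1 = \<alpha> \<and> \<gamma>' \<bullet> \<sigma>2 = \<gamma>"
proof -
  obtain w1 \<psi>1 \<rho>1 where w1: "w1 \<in> W" and \<psi>1: "\<psi>1 \<in> iso_hom F (dm w1) A" and \<rho>1: "\<rho>1 \<in> iso_hom F (cd w1) Y"
    and q1: "\<rho>1 \<bullet> mor w1 = \<alpha> \<bullet> \<psi>1" using J2_surj[OF \<alpha>] by blast
  obtain w2 \<psi>2 \<rho>2 where w2: "w2 \<in> W" and \<psi>2: "\<psi>2 \<in> iso_hom F (dm w2) B" and \<rho>2: "\<rho>2 \<in> iso_hom F (cd w2) Y'"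
    and q2: "\<rho>2 \<bullet> mor w2 = \<gamma> \<bullet> \<psi>2" using J2_surj[OF \<gamma>] by blast
  obtain w1' \<psi>1' \<rho>1' where w1': "w1' \<in> W" and \<psi>1': "\<psi>1' \<in> iso_hom F (dm w1') A'" and \<rho>1': "\<rho>1' \<in> iso_hom F (cd w1') Y"
    and q1': "\<rho>1' \<bullet> mor w1' = \<alpha>' \<bullet> \<psi>1'" using J2_surj[OF \<alpha>'] by blast
  obtain w2' \<psi>2' \<rho>2' where w2': "w2' \<in> W" and \<psi>2': "\<psi>2' \<in> iso_hom F (dm w2') B'" and \<rho>2': "\<rho>2' \<in> iso_hom F (cd w2') Y'"
    and q2': "\<rho>2' \<bullet> mor w2' = \<gamma>' \<bullet> \<psi>2'" using J2_surj[OF \<gamma>'] by blast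
  have ww: "w1 @ w2 \<in> W" "w1' @ w2' \<in> W" using w1 w2 w1' w2' by auto
  note [simp] = F.iso_homD[OF \<psi>1] F.iso_homD[OF \<psi>2] F.iso_homD[OF \<psi>1'] F.iso_homD[OF \<psi>2']
    F.iso_homD[OF \<rho>1] F.iso_homD[OF \<rho>2] F.iso_homD[OF \<rho>1'] F.iso_homD[OF \<rho>2'] F.iso_homD[OF \<sigma>]
    F.iso_homD[OF theta_iso[OF w1]] F.iso_homD[OF theta_iso[OF w2]] F.iso_homD[OF theta_iso[OF w1']] F.iso_homD[OF theta_iso[OF w2']]
    F.iso_homD[OF theta_iso[OF ww(1)]] F.iso_homD[OF theta_iso[OF ww(2)]]
    F.iso_homD[OF J2_mu(1)[OF w1 w2]] F.iso_homD[OF J2_mu(2)[OF w1 w2]]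
    F.iso_homD[OF J2_mu(1)[OF w1' w2']] F.iso_homD[OF J2_mu(2)[OF w1' w2']]
    F.iso_homD[OF J1_mu[OF vtx_word[OF w1] vtx_word[OF w2]]] F.iso_homD[OF J1_mu[OF vtx_word[OF w1'] vtx_word[OF w2']]]
  note [simp] = \<alpha>[unfolded Hom_def, simplified] \<gamma>[unfolded Hom_def, simplified]
    \<alpha>'[unfolded Hom_def, simplified] \<gamma>'[unfolded Hom_def, simplified]
    mor_hom[OF w1, unfolded Hom_def, simplified] mor_hom[OF w2, unfolded Hom_def, simplified]
    mor_hom[OF w1', unfolded Hom_def, simplified] mor_hom[OF w2', unfolded Hom_def, simplified]
    mor_hom[OF ww(1), unfolded Hom_def, simplified] mor_hom[OF ww(2), unfolded Hom_def, simplified]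
  let ?sm = "src (\<mu>2 w1 w2)" and ?tm = "tgt (\<mu>2 w1 w2)" and ?sm' = "src (\<mu>2 w1' w2')" and ?tm' = "tgt (\<mu>2 w1' w2')"
  let ?i\<psi> = "inv_arr F \<psi>1' \<boxtimes> inv_arr F \<psi>2'"
  define k1 where "k1 = inv_arr F \<rho>1' \<bullet> \<rho>1"
  define k2 where "k2 = inv_arr F \<rho>2' \<bullet> \<rho>2"
  have k1: "k1 \<in> iso_hom F (cd w1) (cd w1')" unfolding k1_def using F.comp_iso_hom[OF \<rho>1 F.iso_homD(11)[OF \<rho>1']] .
  have k2: "k2 \<in> iso_hom F (cd w2) (cd w2')" unfolding k2_def using F.comp_iso_hom[OF \<rho>2 F.iso_homD(11)[OF \<rho>2']] .
  note [simp] = F.iso_homD[OF k1] F.iso_homD[OF k2]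
  define \<kappa> where "\<kappa> = ?i\<psi> \<bullet> \<sigma> \<bullet> (\<psi>1 \<boxtimes> \<psi>2)"
  have \<kappa>: "\<kappa> \<in> iso_hom F (dm w1 \<odot> dm w2) (dm w1' \<odot> dm w2')"
    unfolding \<kappa>_def using F.comp_iso_hom[OF F.comp_iso_hom[OF F.ten_iso_hom[OF \<psi>1 \<psi>2] \<sigma>]
      F.ten_iso_hom[OF F.iso_homD(11)[OF \<psi>1'] F.iso_homD(11)[OF \<psi>2']]] by simp
  note [simp] = F.iso_homD[OF \<kappa>]
  define S where "S = ?sm' \<bullet> \<kappa> \<bullet> inv_arr F ?sm"
  define T where "T = ?tm' \<bullet> (k1 \<boxtimes> k2) \<bullet> inv_arr F ?tm"
  have S: "S \<in> iso_hom F (dm (w1 @ w2)) (dm (w1' @ w2'))"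
    unfolding S_def using F.comp_iso_hom[OF F.comp_iso_hom[OF F.iso_homD(11)[OF J2_mu(1)[OF w1 w2]] \<kappa>] J2_mu(1)[OF w1' w2']] by simp
  have T: "T \<in> iso_hom F (cd (w1 @ w2)) (cd (w1' @ w2'))"
    unfolding T_def using F.comp_iso_hom[OF F.comp_iso_hom[OF F.iso_homD(11)[OF J2_mu(2)[OF w1 w2]] F.ten_iso_hom[OF k1 k2]] J2_mu(2)[OF w1' w2']] by simp
  note [simp] = F.iso_homD[OF S] F.iso_homD[OF T]
  have m1: "k1 \<bullet> mor w1 = inv_arr F \<rho>1' \<bullet> \<alpha> \<bullet> \<psi>1" unfolding k1_def using q1 by simp
  have m2: "k2 \<bullet> mor w2 = inv_arr F \<rho>2' \<bullet> \<gamma> \<bullet> \<psi>2" unfolding k2_def using q2 by simp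
  have n1: "mor w1' \<bullet> inv_arr F \<psi>1' = inv_arr F \<rho>1' \<bullet> \<alpha>'"
  proof -
    have "mor w1' \<bullet> inv_arr F \<psi>1' = inv_arr F \<rho>1' \<bullet> (\<rho>1' \<bullet> mor w1') \<bullet> inv_arr F \<psi>1'" by simp
    then show ?thesis unfolding q1' by simp
  qed
  have n2: "mor w2' \<bullet> inv_arr F \<psi>2' = inv_arr F \<rho>2' \<bullet> \<gamma>'"
  proof -
    have "mor w2' \<bullet> inv_arr F \<psi>2' = inv_arr F \<rho>2' \<bullet> (\<rho>2' \<bullet> mor w2') \<bullet> inv_arr F \<psi>2'" by simp
    then show ?thesis unfolding q2' by simp
  qed
  (* \<open>\<kappa>\<close> is \<open>\<sigma>\<close> seen on the words, \<open>k1\<close> and \<open>k2\<close> are the identities of \<open>Y\<close> and \<open>Y'\<close> seen there. *)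
  have sq: "(k1 \<boxtimes> k2) \<bullet> (mor w1 \<boxtimes> mor w2) = (mor w1' \<boxtimes> mor w2') \<bullet> \<kappa>"
  proof -
    have "(mor w1' \<boxtimes> mor w2') \<bullet> \<kappa>
        = ((mor w1' \<bullet> inv_arr F \<psi>1') \<boxtimes> (mor w2' \<bullet> inv_arr F \<psi>2')) \<bullet> \<sigma> \<bullet> (\<psi>1 \<boxtimes> \<psi>2)"
      by (simp add: \<kappa>_def)
    also have "\<dots> = (inv_arr F \<rho>1' \<boxtimes> inv_arr F \<rho>2') \<bullet> ((\<alpha>' \<boxtimes> \<gamma>') \<bullet> \<sigma>) \<bullet> (\<psi>1 \<boxtimes> \<psi>2)"
      unfolding n1 n2 by simp
    also have "\<dots> = (k1 \<boxtimes> k2) \<bullet> (mor w1 \<boxtimes> mor w2)"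
      unfolding e by (simp add: m1 m2)
    finally show ?thesis by simp
  qed
  have "T \<bullet> mor (w1 @ w2) = T \<bullet> (mor (w1 @ w2) \<bullet> ?sm) \<bullet> inv_arr F ?sm" by simp
  also have "\<dots> = ?tm' \<bullet> ((k1 \<boxtimes> k2) \<bullet> (mor w1 \<boxtimes> mor w2)) \<bullet> inv_arr F ?sm"
    unfolding J2_mu(3)[OF w1 w2, symmetric] by (simp add: T_def)
  also have "\<dots> = (?tm' \<bullet> (mor w1' \<boxtimes> mor w2')) \<bullet> \<kappa> \<bullet> inv_arr F ?sm"
    unfolding sq by simp
  also have "\<dots> = mor (w1' @ w2') \<bullet> S"
    unfolding J2_mu(3)[OF w1' w2'] by (simp add: S_def)
  finally obtain a where a: "a \<in> Hom (free_cat s P) (w1 @ w2) (w1' @ w2')" "src (farr J2 a) = S" "tgt (farr J2 a) = T"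
    using J2_full[OF ww S T] by blast
  obtain fs p where fsp: "a = (fs, p)" by (cases a)
  note vw = vtx_word[OF w1] vtx_word[OF w2] vtx_word[OF w1'] vtx_word[OF w2']
  have "inv_arr F (\<theta> w1') \<bullet> k1 \<bullet> \<theta> w1 \<in> iso_hom F (fobj J1 (map vtx w1)) (fobj J1 (map vtx w1'))"
    using F.comp_iso_hom[OF F.comp_iso_hom[OF theta_iso[OF w1] k1] F.iso_homD(11)[OF theta_iso[OF w1']]] by simp
  then obtain gs1 p1 where h1: "(gs1, p1) \<in> Hom (free_cat s V) (map vtx w1) (map vtx w1')"
    and J1h1: "farr J1 (gs1, p1) = inv_arr F (\<theta> w1') \<bullet> k1 \<bullet> \<theta> w1"
    using J1_full[OF vw(1,3)] by (metis surj_pair)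
  have "inv_arr F (\<theta> w2') \<bullet> k2 \<bullet> \<theta> w2 \<in> iso_hom F (fobj J1 (map vtx w2)) (fobj J1 (map vtx w2'))"
    using F.comp_iso_hom[OF F.comp_iso_hom[OF theta_iso[OF w2] k2] F.iso_homD(11)[OF theta_iso[OF w2']]] by simp
  then obtain gs2 p2 where h2: "(gs2, p2) \<in> Hom (free_cat s V) (map vtx w2) (map vtx w2')"
    and J1h2: "farr J1 (gs2, p2) = inv_arr F (\<theta> w2') \<bullet> k2 \<bullet> \<theta> w2"
    using J1_full[OF vw(2,4)] by (metis surj_pair)
  have va: "vtx_arr a \<in> Hom (free_cat s V) (map vtx w1 @ map vtx w2) (map vtx w1' @ map vtx w2')"
    using vtx_arr_hom[OF a(1)] by simp
  note h12 = V.free_ten_hom'[OF h1 h2]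
  let ?h = "(gs1, p1) \<boxtimes>\<^bsub>free_cat s V\<^esub> (gs2, p2)"
  note [simp] = F.iso_homD[OF J1_hom[OF h12]] F.iso_homD[OF J1_hom[OF va]] F.iso_homD[OF J1_hom[OF h1]] F.iso_homD[OF J1_hom[OF h2]]
  have "farr J1 (vtx_arr a) = farr J1 ?h"
  proof (rule F.iso_cancel_right[OF J1_mu[OF vw(1,2)]])
    let ?m = "\<mu>1 (map vtx w1) (map vtx w2)" and ?m' = "\<mu>1 (map vtx w1') (map vtx w2')"
    have "\<theta> (w1' @ w2') \<bullet> farr J1 (vtx_arr a) \<bullet> ?m = (\<theta> (w1' @ w2') \<bullet> farr J1 (vtx_arr a)) \<bullet> ?m"
      by simp
    also have "\<dots> = T \<bullet> (\<theta> (w1 @ w2) \<bullet> ?m)"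
      unfolding theta_natural[OF a(1), symmetric] a(3) by simp
    also have "\<dots> = ?tm' \<bullet> ((k1 \<bullet> \<theta> w1) \<boxtimes> (k2 \<bullet> \<theta> w2))"
      unfolding theta_monoidal[OF w1 w2] by (simp add: T_def)
    also have "\<dots> = (?tm' \<bullet> (\<theta> w1' \<boxtimes> \<theta> w2')) \<bullet> (farr J1 (gs1, p1) \<boxtimes> farr J1 (gs2, p2))"
      by (simp add: J1h1 J1h2 del: F.interchange)
        (simp add: J1h1 J1h2)
    also have "\<dots> = \<theta> (w1' @ w2') \<bullet> (?m' \<bullet> (farr J1 (gs1, p1) \<boxtimes> farr J1 (gs2, p2)))"
      unfolding theta_monoidal[OF w1' w2', symmetric] by simp
    also have "\<dots> = \<theta> (w1' @ w2') \<bullet> farr J1 ?h \<bullet> ?m"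
      unfolding J1_nat[OF h1 h2, symmetric] ..
    finally show "farr J1 (vtx_arr a) \<bullet> ?m = farr J1 ?h \<bullet> ?m"
      by (rule F.iso_cancel_left[OF theta_iso[OF ww(2)], rotated 4]) simp_all
  qed simp_all
  then have vh: "vtx_arr a = ?h" by (rule J1_faithful[OF va h12])
  have l: "length w1' = length w1" "length w2' = length w2" "length gs1 = length w1"
    and p: "p1 permutes {..<length w1}" "s \<or> p1 = id" "p2 permutes {..<length w2}" "s \<or> p2 = id"
    using h1 h2 by (auto simp: free_hom_iff)
  have pE: "p = block_perm (length w1) p1 p2" and gsE: "map tgt fs = gs1 @ gs2"
    using vh l by (auto simp: fsp vtx_arr_def free_cat_ten)
  define a1 where "a1 = (take (length w1) fs, p1)"
  define a2 where "a2 = (drop (length w1) fs, p2)"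
  note sp = P.free_split[OF a(1)[unfolded fsp pE] refl l(1) p, folded a1_def a2_def]
  have va1: "vtx_arr a1 = (gs1, p1)"
    using gsE l by (simp add: a1_def vtx_arr_def flip: take_map)
  have va2: "vtx_arr a2 = (gs2, p2)"
    using gsE l by (simp add: a2_def vtx_arr_def flip: drop_map)
  have aE: "a = a1 \<boxtimes>\<^bsub>free_cat s P\<^esub> a2" using sp(3) by (simp add: fsp pE)
  let ?s1 = "src (farr J2 a1)" and ?s2 = "src (farr J2 a2)"
  note [simp] = F.iso_homD[OF J2_hom(1)[OF sp(1)]] F.iso_homD[OF J2_hom(1)[OF sp(2)]]
    F.iso_homD[OF J2_hom(2)[OF sp(1)]] F.iso_homD[OF J2_hom(2)[OF sp(2)]]
  have "?sm' \<bullet> (?s1 \<boxtimes> ?s2) = S \<bullet> ?sm"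
    using J2_nat[OF sp(1,2)] a(2) by (simp add: aE)
  also have "\<dots> = ?sm' \<bullet> \<kappa>" by (simp add: S_def)
  finally have s12: "?s1 \<boxtimes> ?s2 = \<kappa>"
    by (rule F.iso_cancel_left[OF J2_mu(1)[OF w1' w2'], rotated 4]) simp_all
  have "tgt (farr J2 a1) \<bullet> \<theta> w1 = k1 \<bullet> \<theta> w1"
    using theta_natural[OF sp(1)] by (simp add: va1 J1h1)
  then have t1: "tgt (farr J2 a1) = k1" by (rule F.iso_cancel_right[OF theta_iso[OF w1], rotated 4]) simp_all
  have "tgt (farr J2 a2) \<bullet> \<theta> w2 = k2 \<bullet> \<theta> w2"
    using theta_natural[OF sp(2)] by (simp add: va2 J1h2)
  then have t2: "tgt (farr J2 a2) = k2" by (rule F.iso_cancel_right[OF theta_iso[OF w2], rotated 4]) simp_all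
  define \<sigma>1 where "\<sigma>1 = \<psi>1' \<bullet> ?s1 \<bullet> inv_arr F \<psi>1"
  define \<sigma>2 where "\<sigma>2 = \<psi>2' \<bullet> ?s2 \<bullet> inv_arr F \<psi>2"
  have i1: "\<sigma>1 \<in> iso_hom F A A'" unfolding \<sigma>1_def
    using F.comp_iso_hom[OF F.comp_iso_hom[OF F.iso_homD(11)[OF \<psi>1] J2_hom(1)[OF sp(1)]] \<psi>1'] by simp
  have i2: "\<sigma>2 \<in> iso_hom F B B'" unfolding \<sigma>2_def
    using F.comp_iso_hom[OF F.comp_iso_hom[OF F.iso_homD(11)[OF \<psi>2] J2_hom(1)[OF sp(2)]] \<psi>2'] by simp
  have "\<sigma>1 \<boxtimes> \<sigma>2 = (\<psi>1' \<boxtimes> \<psi>2') \<bullet> (?s1 \<boxtimes> ?s2) \<bullet> (inv_arr F \<psi>1 \<boxtimes> inv_arr F \<psi>2)"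
    by (simp add: \<sigma>1_def \<sigma>2_def)
  also have "\<dots> = \<sigma>" unfolding s12 by (simp add: \<kappa>_def)
  finally have "\<sigma> = \<sigma>1 \<boxtimes> \<sigma>2" ..
  moreover have "\<alpha>' \<bullet> \<sigma>1 = \<alpha>"
  proof -
    have "\<alpha>' \<bullet> \<sigma>1 = (\<alpha>' \<bullet> \<psi>1') \<bullet> ?s1 \<bullet> inv_arr F \<psi>1" by (simp add: \<sigma>1_def)
    also have "\<dots> = \<rho>1' \<bullet> (mor w1' \<bullet> ?s1) \<bullet> inv_arr F \<psi>1" unfolding q1'[symmetric] by simp
    also have "\<dots> = \<rho>1' \<bullet> (k1 \<bullet> mor w1) \<bullet> inv_arr F \<psi>1" unfolding J2_hom(3)[OF sp(1), symmetric] t1 ..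
    also have "\<dots> = \<alpha>" unfolding m1 by simp
    finally show ?thesis .
  qed
  moreover have "\<gamma>' \<bullet> \<sigma>2 = \<gamma>"
  proof -
    have "\<gamma>' \<bullet> \<sigma>2 = (\<gamma>' \<bullet> \<psi>2') \<bullet> ?s2 \<bullet> inv_arr F \<psi>2" by (simp add: \<sigma>2_def)
    also have "\<dots> = \<rho>2' \<bullet> (mor w2' \<bullet> ?s2) \<bullet> inv_arr F \<psi>2" unfolding q2'[symmetric] by simp
    also have "\<dots> = \<rho>2' \<bullet> (k2 \<bullet> mor w2) \<bullet> inv_arr F \<psi>2" unfolding J2_hom(3)[OF sp(2), symmetric] t2 ..
    also have "\<dots> = \<gamma>" unfolding m2 by simp
    finally show ?thesis .
  qed
  ultimately show ?thesis using i1 i2 by blast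
qed

lemma splitting: "tensor_splitting F"
proof
  show "\<Phi> \<in> Hom F Z (Y \<odot> Y') \<Longrightarrow> Y \<in> Obj F \<Longrightarrow> Y' \<in> Obj F \<Longrightarrow>
      \<exists>Z1 Z2 \<alpha> \<gamma> \<sigma>. \<alpha> \<in> Hom F Z1 Y \<and> \<gamma> \<in> Hom F Z2 Y' \<and> \<sigma> \<in> iso_hom F Z (Z1 \<odot> Z2) \<and> \<Phi> = (\<alpha> \<boxtimes> \<gamma>) \<bullet> \<sigma>" for \<Phi> Z Y Y'
    by (rule split_exists)
  show "\<alpha> \<in> Hom F A Y \<Longrightarrow> \<gamma> \<in> Hom F B Y' \<Longrightarrow> \<alpha>' \<in> Hom F A' Y \<Longrightarrow> \<gamma>' \<in> Hom F B' Y' \<Longrightarrow>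
      \<sigma> \<in> iso_hom F (A \<odot> B) (A' \<odot> B') \<Longrightarrow> (\<alpha>' \<boxtimes> \<gamma>') \<bullet> \<sigma> = \<alpha> \<boxtimes> \<gamma> \<Longrightarrow>
      \<exists>\<sigma>1 \<in> iso_hom F A A'. \<exists>\<sigma>2 \<in> iso_hom F B B'. \<sigma> = \<sigma>1 \<boxtimes> \<sigma>2 \<and> \<alpha>' \<bullet> \<sigma>1 = \<alpha> \<and> \<gamma>' \<bullet> \<sigma>2 = \<gamma>"
    for \<alpha> \<gamma> \<alpha>' \<gamma>' \<sigma> A B A' B' Y Y'
    by (rule split_unique_words)
  show "\<tau> \<in> iso_hom F X X \<Longrightarrow> \<tau>' \<in> iso_hom F Y Y \<Longrightarrow> \<tau> \<boxtimes> \<tau>' = Ide F (X \<odot> Y) \<Longrightarrow>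
      \<tau> = Ide F X \<and> \<tau>' = Ide F Y" for \<tau> \<tau>' X Y
    using iso_tensor_cancel by (intro conjI)
qed

end

text \<open>
  In the symmetric case the braidings make the comparison natural with respect to permutations; in
  the other case an arrow of words is just a list of arrows.
\<close>
theorem feynman_splitting:
  assumes "(\<exists>\<beta>. feynman_category U V F \<beta> \<iota>) \<or> nonsigma_feynman_category U V F \<iota>"
  shows "tensor_splitting F"
  using assms
proof
  assume "\<exists>\<beta>. feynman_category U V F \<beta> \<iota>"
  then obtain \<beta> where f: "feynman_category U V F \<beta> \<iota>" ..
  from f obtain J1 \<mu>1 u1 where J1: "symmetric_monoidal_ftor (free_smc V) (free_braid V) (Iso F) \<beta> J1 \<mu>1 u1"
      "extends_ftor V J1 \<iota>" "equivalence_ftor (free_smc V) (Iso F) J1"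
    unfolding feynman_category_def induces_sym_equivalence_def by blast
  from f obtain J2 \<mu>2 u2 where J2: "symmetric_monoidal_ftor (free_smc (Iso (comma F V F id_ftor \<iota>)))
        (free_braid (Iso (comma F V F id_ftor \<iota>))) (Iso (arrow_moncat F)) (arrow_braid F \<beta>) J2 \<mu>2 u2"
      "extends_ftor (Iso (comma F V F id_ftor \<iota>)) J2 (comma_incl \<iota>)"
      "equivalence_ftor (free_smc (Iso (comma F V F id_ftor \<iota>))) (Iso (arrow_moncat F)) J2"
    unfolding feynman_category_def induces_sym_equivalence_def by blast
  interpret F: symmetric_monoidal_category F \<beta> using f by (simp add: feynman_category_def)
  interpret \<iota>: cfunctor V F \<iota> using f by (simp add: feynman_category_def)
  interpret J1: symmetric_monoidal_ftor "free_smc V" "free_braid V" "Iso F" \<beta> J1 \<mu>1 u1 by (fact J1)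
  interpret J2: symmetric_monoidal_ftor "free_smc (Iso (comma F V F id_ftor \<iota>))" "free_braid (Iso (comma F V F id_ftor \<iota>))"
    "Iso (arrow_moncat F)" "arrow_braid F \<beta>" J2 \<mu>2 u2 by (fact J2)
  have "feynman_words True V F \<iota> J1 \<mu>1 u1 J2 \<mu>2 u2 \<beta>"
  proof (intro feynman_words.intro feynman_words_axioms.intro)
    show "\<beta> X Y \<in> iso_hom F (X \<odot>\<^bsub>F\<^esub> Y) (Y \<odot>\<^bsub>F\<^esub> X)" if "X \<in> Obj F" "Y \<in> Obj F" for X Y
      using J1.B.braid_hom[of X Y] that by simp
    show "farr J1 (free_braid V xs ys) \<bullet>\<^bsub>F\<^esub> \<mu>1 xs ys = \<mu>1 ys xs \<bullet>\<^bsub>F\<^esub> \<beta> (fobj J1 xs) (fobj J1 ys)"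
      if "xs \<in> lists (Obj V)" "ys \<in> lists (Obj V)" for xs ys
      using J1.mu_braid[of xs ys] that by (simp flip: free_cat_True)
    show "farr J2 (free_braid (Iso (comma F V F id_ftor \<iota>)) ws ws') \<bullet>\<^bsub>arrow_moncat F\<^esub> \<mu>2 ws ws'
        = \<mu>2 ws' ws \<bullet>\<^bsub>arrow_moncat F\<^esub> arrow_braid F \<beta> (fobj J2 ws) (fobj J2 ws')"
      if "ws \<in> lists (comma_objs F V F id_ftor \<iota>)" "ws' \<in> lists (comma_objs F V F id_ftor \<iota>)" for ws ws'
      using J2.mu_braid[of ws ws'] that by (simp flip: free_cat_True)
    show "\<beta> X' Y' \<bullet>\<^bsub>F\<^esub> (h \<boxtimes>\<^bsub>F\<^esub> k) = (k \<boxtimes>\<^bsub>F\<^esub> h) \<bullet>\<^bsub>F\<^esub> \<beta> X Y"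
      if "h \<in> Hom F X X'" "k \<in> Hom F Y Y'" for h k X X' Y Y'
      using F.braid_nat[OF that] .
  qed (unfold free_cat_True, (rule J1 J2 F.monoidal_category_axioms \<iota>.cfunctor_axioms
      \<iota>.A.category_axioms J1.monoidal_ftor_axioms J2.monoidal_ftor_axioms)+)
  then show ?thesis by (rule feynman_words.splitting)
next
  assume f: "nonsigma_feynman_category U V F \<iota>"
  from f obtain J1 \<mu>1 u1 where J1: "monoidal_ftor (free_mc V) (Iso F) J1 \<mu>1 u1"
      "extends_ftor V J1 \<iota>" "equivalence_ftor (free_mc V) (Iso F) J1"
    unfolding nonsigma_feynman_category_def induces_mon_equivalence_def by blast
  from f obtain J2 \<mu>2 u2 where J2: "monoidal_ftor (free_mc (Iso (comma F V F id_ftor \<iota>))) (Iso (arrow_moncat F)) J2 \<mu>2 u2"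
      "extends_ftor (Iso (comma F V F id_ftor \<iota>)) J2 (comma_incl \<iota>)"
      "equivalence_ftor (free_mc (Iso (comma F V F id_ftor \<iota>))) (Iso (arrow_moncat F)) J2"
    unfolding nonsigma_feynman_category_def induces_mon_equivalence_def by blast
  interpret F: monoidal_category F using f by (simp add: nonsigma_feynman_category_def)
  interpret \<iota>: cfunctor V F \<iota> using f by (simp add: nonsigma_feynman_category_def)
  have "feynman_words False V F \<iota> J1 \<mu>1 u1 J2 \<mu>2 u2 undefined"
    by (intro feynman_words.intro feynman_words_axioms.intro)
      (unfold free_cat_False, (rule J1 J2 F.monoidal_category_axioms \<iota>.cfunctor_axioms
        \<iota>.A.category_axioms | simp)+)
  then show ?thesis by (rule feynman_words.splitting)
qed

section \<open>Formal integral combinations and sums over multisets\<close>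

lemma frag_extend_fun_add: "frag_extend (\<lambda>c. f c + g c) x = frag_extend f x + frag_extend g x"
  by (simp add: frag_extend_def frag_cmul_distrib2 sum.distrib)

lemma frag_extend_fun_diff: "frag_extend (\<lambda>c. f c - g c) x = frag_extend f x - frag_extend g x"
proof -
  have "frag_extend (\<lambda>c. f c - g c) x + frag_extend g x = frag_extend f x"
    unfolding frag_extend_fun_add[symmetric] by simp
  then show ?thesis by (simp add: algebra_simps)
qed

lemma frag_extend_fun_0 [simp]: "frag_extend (\<lambda>c. 0) x = 0"
  by (rule frag_extend_eq_0) simp

lemma frag_extend_frag_extend:
  "frag_extend f (frag_extend g x) = frag_extend (\<lambda>c. frag_extend f (g c)) x"
  by (rule frag_induction[of x UNIV "\<lambda>x. frag_extend f (frag_extend g x) = frag_extend (\<lambda>c. frag_extend f (g c)) x"])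
    (simp_all add: frag_extend_diff)

lemma frag_extend_sum_mset: "frag_extend f (\<Sum>x\<in>#M. g x) = (\<Sum>x\<in>#M. frag_extend f (g x))"
  by (induction M) (simp_all add: frag_extend_add)

lemma sum_mset_concat: "(\<Sum>x\<in>#(\<Sum>p\<in>#M. N p). G x) = (\<Sum>p\<in>#M. \<Sum>x\<in>#N p. G x)"
  by (induction M) simp_all

lemma sum_mset_diff: "(\<Sum>x\<in>#M. f x - g x) = (\<Sum>x\<in>#M. f x) - (\<Sum>x\<in>#M. g x :: 'a :: ab_group_add)"
  by (induction M) (simp_all add: algebra_simps)

lemma sum_mset_filter: "(\<Sum>x\<in>#M. if Q x then f x else 0) = (\<Sum>x\<in>#filter_mset Q M. f x :: 'a :: comm_monoid_add)"
  by (induction M) simp_all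

section \<open>Bialgebras spanned by a monoid of classes\<close>

text \<open>
  What the bialgebra of isomorphism classes retains of the category: \<open>K\<close> is the monoid of classes of
  morphisms, \<open>E\<close> the set of classes of identities, \<open>\<Delta> c\<close> collects the pairs of classes of the factors in
  the factorizations of \<open>c\<close>, and \<open>dg\<close> is the size of the degree.
\<close>
locale class_bialgebra =
  fixes K :: "'c set" and cm :: "'c \<Rightarrow> 'c \<Rightarrow> 'c" (infixl "\<star>" 70) and e :: 'c and E :: "'c set"
    and \<Delta> :: "'c \<Rightarrow> ('c \<times> 'c) multiset" and dg :: "'c \<Rightarrow> nat"
  assumes cm_closed [simp]: "c \<in> K \<Longrightarrow> d \<in> K \<Longrightarrow> c \<star> d \<in> K"
    and cm_assoc: "c \<in> K \<Longrightarrow> d \<in> K \<Longrightarrow> k \<in> K \<Longrightarrow> (c \<star> d) \<star> k = c \<star> (d \<star> k)"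
    and cm_left [simp]: "c \<in> K \<Longrightarrow> e \<star> c = c"
    and cm_right [simp]: "c \<in> K \<Longrightarrow> c \<star> e = c"
    and E_K: "E \<subseteq> K" and e_E [simp]: "e \<in> E"
    and E_cancel: "c \<in> K \<Longrightarrow> d \<in> K \<Longrightarrow> x \<in> E \<Longrightarrow> c \<star> (x \<star> d) \<in> E \<longleftrightarrow> c \<star> d \<in> E"
    and \<Delta>_closed: "c \<in> K \<Longrightarrow> p \<in># \<Delta> c \<Longrightarrow> fst p \<in> K \<and> snd p \<in> K"
    and \<Delta>_mult: "c \<in> K \<Longrightarrow> d \<in> K \<Longrightarrow>
      \<Delta> (c \<star> d) = (\<Sum>p\<in>#\<Delta> c. image_mset (\<lambda>q. (fst p \<star> fst q, snd p \<star> snd q)) (\<Delta> d))"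
    and \<Delta>_E: "x \<in> E \<Longrightarrow> \<Delta> x = {#(x, x)#}"
    and counit_right: "c \<in> K \<Longrightarrow> image_mset fst (filter_mset (\<lambda>p. snd p \<in> E) (\<Delta> c)) = {#c#}"
    and counit_left: "c \<in> K \<Longrightarrow> image_mset snd (filter_mset (\<lambda>p. fst p \<in> E) (\<Delta> c)) = {#c#}"
    and dg_\<Delta>: "c \<in> K \<Longrightarrow> p \<in># \<Delta> c \<Longrightarrow> dg c = dg (fst p) + dg (snd p)"
    and dg_cm: "c \<in> K \<Longrightarrow> d \<in> K \<Longrightarrow> dg (c \<star> d) = dg c + dg d"
    and dg_E: "x \<in> E \<Longrightarrow> dg x = 0"
begin

lemma E_in [simp]: "x \<in> E \<Longrightarrow> x \<in> K" using E_K by blast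
lemma e_K [simp]: "e \<in> K" by simp

definition mul :: "('c \<Rightarrow>\<^sub>0 int) \<Rightarrow> ('c \<Rightarrow>\<^sub>0 int) \<Rightarrow> 'c \<Rightarrow>\<^sub>0 int" (infixl "\<odot>\<^sub>B" 70) where
  "mul x y = frag_extend (\<lambda>c. frag_extend (\<lambda>d. frag_of (c \<star> d)) y) x"

text \<open>
  The span of the classes in \<open>S\<close>; the rings \<open>B_iso\<close> and \<open>B0_iso\<close> are of this form.
\<close>
definition BR :: "'c set \<Rightarrow> ('c \<Rightarrow>\<^sub>0 int) ring" where
  "BR S = \<lparr>partial_object.carrier = carrier (free_Abelian_group S), monoid.mult = mul,
     monoid.one = frag_of e, ring.zero = 0, ring.add = (+)\<rparr>"

abbreviation Bc :: "('c \<Rightarrow>\<^sub>0 int) set" where "Bc \<equiv> {x. Poly_Mapping.keys x \<subseteq> K}"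

lemma mul_of [simp]: "frag_of c \<odot>\<^sub>B frag_of d = frag_of (c \<star> d)"
  by (simp add: mul_def)

lemma mul_add_left: "(x + y) \<odot>\<^sub>B z = x \<odot>\<^sub>B z + y \<odot>\<^sub>B z"
  and mul_diff_left: "(x - y) \<odot>\<^sub>B z = x \<odot>\<^sub>B z - y \<odot>\<^sub>B z"
  and mul_add_right: "z \<odot>\<^sub>B (x + y) = z \<odot>\<^sub>B x + z \<odot>\<^sub>B y"
  and mul_diff_right: "z \<odot>\<^sub>B (x - y) = z \<odot>\<^sub>B x - z \<odot>\<^sub>B y"
  and mul_0_left [simp]: "0 \<odot>\<^sub>B z = 0" and mul_0_right [simp]: "z \<odot>\<^sub>B 0 = 0"
  by (simp_all add: mul_def frag_extend_add frag_extend_diff frag_extend_fun_add frag_extend_fun_diff)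

lemma Bc_of [simp]: "c \<in> K \<Longrightarrow> frag_of c \<in> Bc"
  and Bc_0 [simp]: "0 \<in> Bc"
  by simp_all

lemma Bc_add [simp]: "x \<in> Bc \<Longrightarrow> y \<in> Bc \<Longrightarrow> x + y \<in> Bc"
  using keys_add[of x y] by auto

lemma Bc_diff [simp]: "x \<in> Bc \<Longrightarrow> y \<in> Bc \<Longrightarrow> x - y \<in> Bc"
  using keys_diff[of x y] by auto

lemma Bc_induct [consumes 1, case_names zero one diff]:
  assumes "x \<in> Bc" "Q 0" "\<And>c. c \<in> K \<Longrightarrow> Q (frag_of c)"
    "\<And>a b. a \<in> Bc \<Longrightarrow> b \<in> Bc \<Longrightarrow> Q a \<Longrightarrow> Q b \<Longrightarrow> Q (a - b)"
  shows "Q x"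
  using free_Abelian_group_induct[of x K Q] assms by auto

lemma Bc_sum_mset: "(\<And>p. p \<in># M \<Longrightarrow> f p \<in> Bc) \<Longrightarrow> (\<Sum>p\<in>#M. f p) \<in> Bc"
proof (induction M)
  case (add x M)
  then have "f x \<in> Bc" "(\<Sum>p\<in>#M. f p) \<in> Bc" by auto
  from Bc_add[OF this] show ?case by simp
qed simp

lemma Bc_extend:
  assumes "x \<in> Bc" "\<And>c. c \<in> K \<Longrightarrow> f c \<in> Bc"
  shows "frag_extend f x \<in> Bc"
  using keys_frag_extend[of f x] assms by blast

lemma mul_closed [simp]: "x \<in> Bc \<Longrightarrow> y \<in> Bc \<Longrightarrow> x \<odot>\<^sub>B y \<in> Bc"
  unfolding mul_def by (intro Bc_extend) simp_all

lemma mul_assoc: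
  assumes "x \<in> Bc" "y \<in> Bc" "z \<in> Bc"
  shows "(x \<odot>\<^sub>B y) \<odot>\<^sub>B z = x \<odot>\<^sub>B (y \<odot>\<^sub>B z)"
  using assms(1)
proof (induction x rule: Bc_induct)
  case (one c)
  show ?case using assms(2)
  proof (induction y rule: Bc_induct)
    case (one d)
    show ?case using assms(3)
    proof (induction z rule: Bc_induct)
      case (one k)
      then show ?case using \<open>c \<in> K\<close> \<open>d \<in> K\<close> by (simp add: cm_assoc)
    qed (simp_all add: mul_diff_right)
  qed (simp_all add: mul_diff_left mul_diff_right)
qed (simp_all add: mul_diff_left)

lemma mul_one_left [simp]: "x \<in> Bc \<Longrightarrow> frag_of e \<odot>\<^sub>B x = x"
  by (induction x rule: Bc_induct) (simp_all add: mul_diff_right)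

lemma mul_one_right [simp]: "x \<in> Bc \<Longrightarrow> x \<odot>\<^sub>B frag_of e = x"
  by (induction x rule: Bc_induct) (simp_all add: mul_diff_left)

lemma mul_sum_left: "(\<Sum>p\<in>#M. f p) \<odot>\<^sub>B y = (\<Sum>p\<in>#M. f p \<odot>\<^sub>B y)"
  by (induction M) (simp_all add: mul_add_left)

lemma mul_sum_right: "y \<odot>\<^sub>B (\<Sum>p\<in>#M. f p) = (\<Sum>p\<in>#M. y \<odot>\<^sub>B f p)"
  by (induction M) (simp_all add: mul_add_right)

lemma BR_simps [simp]:
  "carrier (BR S) = {x. Poly_Mapping.keys x \<subseteq> S}" "monoid.mult (BR S) = mul" "monoid.one (BR S) = frag_of e"
  "ring.zero (BR S) = 0" "ring.add (BR S) = (+)"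
  by (simp_all add: BR_def set_eq_iff)

lemma ring_BR: "ring (BR K)"
proof (rule ringI)
  show "abelian_group (BR K)"
  proof (rule abelian_groupI)
    fix x assume "x \<in> carrier (BR K)"
    then have "- x \<in> carrier (BR K)" "- x \<oplus>\<^bsub>BR K\<^esub> x = \<zero>\<^bsub>BR K\<^esub>" by simp_all
    then show "\<exists>y\<in>carrier (BR K). y \<oplus>\<^bsub>BR K\<^esub> x = \<zero>\<^bsub>BR K\<^esub>" by blast
  qed (simp_all add: algebra_simps Bc_add[simplified])
  show "monoid (BR K)"
    by (rule monoidI) (use mul_closed mul_assoc mul_one_left mul_one_right in simp_all)
qed (simp_all add: mul_add_left mul_add_right)

subsection \<open>The ideal identifying all identities\<close>

text \<open>
  As an additive group the ideal is spanned by the differences that arise when one identity is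
  erased from a product of classes.  A linear map can be tested for compatibility on these.
\<close>
inductive_set I :: "('c \<Rightarrow>\<^sub>0 int) set" where
  zero: "0 \<in> I"
| gen: "c \<in> K \<Longrightarrow> d \<in> K \<Longrightarrow> x \<in> E \<Longrightarrow> frag_of (c \<star> (x \<star> d)) - frag_of (c \<star> d) \<in> I"
| diff: "a \<in> I \<Longrightarrow> b \<in> I \<Longrightarrow> a - b \<in> I"

lemma I_Bc: "a \<in> I \<Longrightarrow> a \<in> Bc"
proof (induction rule: I.induct)
  case (gen c d x)
  then show ?case by (intro Bc_diff Bc_of) simp_all
qed (auto intro: Bc_diff simp del: mem_Collect_eq)

lemma I_uminus: "a \<in> I \<Longrightarrow> - a \<in> I"
  using I.diff[OF I.zero] by simp

lemma I_add: "a \<in> I \<Longrightarrow> b \<in> I \<Longrightarrow> a + b \<in> I"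
  using I.diff[of a "- b"] I_uminus[of b] by simp

lemma I_mul_left: "a \<in> Bc \<Longrightarrow> b \<in> I \<Longrightarrow> a \<odot>\<^sub>B b \<in> I"
proof (induction a rule: Bc_induct)
  case (one k)
  from one(2,1) show ?case
  proof (induction b rule: I.induct)
    case (gen c d x)
    then have "k \<star> (c \<star> (x \<star> d)) = (k \<star> c) \<star> (x \<star> d)" "k \<star> (c \<star> d) = (k \<star> c) \<star> d"
      by (simp_all add: cm_assoc)
    then show ?case using I.gen[of "k \<star> c" d x] gen by (simp add: mul_diff_right)
  qed (simp_all add: mul_diff_right I.zero I.diff)
qed (simp_all add: mul_diff_left I.zero I.diff)

lemma I_mul_right: "a \<in> Bc \<Longrightarrow> b \<in> I \<Longrightarrow> b \<odot>\<^sub>B a \<in> I"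
proof (induction a rule: Bc_induct)
  case (one k)
  from one(2,1) show ?case
  proof (induction b rule: I.induct)
    case (gen c d x)
    then have "(c \<star> (x \<star> d)) \<star> k = c \<star> (x \<star> (d \<star> k))" "(c \<star> d) \<star> k = c \<star> (d \<star> k)"
      by (simp_all add: cm_assoc)
    then show ?case using I.gen[of c "d \<star> k" x] gen by (simp add: mul_diff_left)
  qed (simp_all add: mul_diff_left I.zero I.diff)
qed (simp_all add: mul_diff_right I.zero I.diff)

lemma ideal_I: "ideal I (BR K)"
proof (rule idealI[OF ring_BR])
  interpret ring "BR K" by (rule ring_BR)
  show "subgroup I (add_monoid (BR K))"
  proof (rule add.subgroupI)
    fix a assume a: "a \<in> I"
    have "\<ominus>\<^bsub>BR K\<^esub> a = - a"
      using I_Bc[OF a] by (intro minus_equality) simp_all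
    then show "\<ominus>\<^bsub>BR K\<^esub> a \<in> I" using I_uminus[OF a] by simp
  qed (use I_Bc I.zero I_add in auto)
qed (use I_mul_left I_mul_right in auto)

lemma I_eq_genideal: "Idl\<^bsub>BR K\<^esub> {frag_of x - frag_of y | x y. x \<in> E \<and> y \<in> E} = I" (is "Idl\<^bsub>_\<^esub> ?G = I")
proof
  interpret ring "BR K" by (rule ring_BR)
  have x: "frag_of x - frag_of e \<in> I" if "x \<in> E" for x using I.gen[of e e x] that by simp
  have "?G \<subseteq> I"
  proof
    fix z assume "z \<in> ?G"
    then obtain x y where "z = (frag_of x - frag_of e) - (frag_of y - frag_of e)" "x \<in> E" "y \<in> E" by auto
    then show "z \<in> I" using I.diff[OF x x] by simp
  qed
  then show "Idl\<^bsub>BR K\<^esub> ?G \<subseteq> I" by (rule genideal_minimal[OF ideal_I])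
  have G: "?G \<subseteq> carrier (BR K)"
  proof
    fix z assume "z \<in> ?G"
    then obtain x y where "z = frag_of x - frag_of y" "x \<in> E" "y \<in> E" by auto
    then show "z \<in> carrier (BR K)" using Bc_diff[OF Bc_of Bc_of, of x y] by simp
  qed
  interpret J: ideal "Idl\<^bsub>BR K\<^esub> ?G" "BR K" by (rule genideal_ideal[OF G])
  have minus: "a - b \<in> Idl\<^bsub>BR K\<^esub> ?G" if "a \<in> Idl\<^bsub>BR K\<^esub> ?G" "b \<in> Idl\<^bsub>BR K\<^esub> ?G" for a b
  proof -
    have bc: "b \<in> carrier (BR K)" using J.a_Hcarr that(2) by blast
    have "\<ominus>\<^bsub>BR K\<^esub> b = - b" by (rule minus_equality) (use bc in simp_all)
    moreover have "\<ominus>\<^bsub>BR K\<^esub> b \<in> Idl\<^bsub>BR K\<^esub> ?G" using J.a_inv_closed[OF that(2)] .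
    ultimately show ?thesis using J.a_closed[OF that(1), of "\<ominus>\<^bsub>BR K\<^esub> b"] by simp
  qed
  show "I \<subseteq> Idl\<^bsub>BR K\<^esub> ?G"
  proof
    fix z assume "z \<in> I"
    then show "z \<in> Idl\<^bsub>BR K\<^esub> ?G"
    proof (induction rule: I.induct)
      case zero
      then show ?case using J.zero_closed by simp
    next
      case (gen c d x)
      have "frag_of x - frag_of e \<in> ?G" using gen e_E by blast
      then have "frag_of x - frag_of e \<in> Idl\<^bsub>BR K\<^esub> ?G" using genideal_self[OF G] by blast
      then have "frag_of c \<otimes>\<^bsub>BR K\<^esub> ((frag_of x - frag_of e) \<otimes>\<^bsub>BR K\<^esub> frag_of d) \<in> Idl\<^bsub>BR K\<^esub> ?G"
        using gen by (intro J.I_l_closed J.I_r_closed) auto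
      then show ?case using gen by (simp add: mul_diff_left mul_diff_right)
    next
      case (diff a b)
      then show ?case using minus by blast
    qed
  qed
qed

definition eqv :: "('c \<Rightarrow>\<^sub>0 int) \<Rightarrow> ('c \<Rightarrow>\<^sub>0 int) \<Rightarrow> bool" (infix "\<doteq>" 50) where
  "x \<doteq> y \<longleftrightarrow> x - y \<in> I"

lemma eqv_refl [simp]: "x \<doteq> x" by (simp add: eqv_def I.zero)
lemma eqv_sym: "x \<doteq> y \<Longrightarrow> y \<doteq> x" using I_uminus[of "x - y"] by (simp add: eqv_def)
lemma eqv_trans [trans]: "x \<doteq> y \<Longrightarrow> y \<doteq> z \<Longrightarrow> x \<doteq> z"
  using I_add[of "x - y" "y - z"] by (simp add: eqv_def)
lemma eqv_add: "x \<doteq> y \<Longrightarrow> x' \<doteq> y' \<Longrightarrow> x + x' \<doteq> y + y'"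
  using I_add[of "x - y" "x' - y'"] by (simp add: eqv_def algebra_simps)
lemma eqv_diff: "x \<doteq> y \<Longrightarrow> x' \<doteq> y' \<Longrightarrow> x - x' \<doteq> y - y'"
  using I.diff[of "x - y" "x' - y'"] by (simp add: eqv_def algebra_simps)
lemma eqv_0: "x \<doteq> 0 \<longleftrightarrow> x \<in> I" by (simp add: eqv_def)

lemma eqv_mul:
  assumes "x \<doteq> x'" "y \<doteq> y'" "x' \<in> Bc" "y \<in> Bc"
  shows "x \<odot>\<^sub>B y \<doteq> x' \<odot>\<^sub>B y'"
proof -
  have "x \<odot>\<^sub>B y - x' \<odot>\<^sub>B y' = (x - x') \<odot>\<^sub>B y + x' \<odot>\<^sub>B (y - y')"
    by (simp add: mul_diff_left mul_diff_right)
  then show ?thesis using assms I_mul_left I_mul_right I_add unfolding eqv_def by metis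
qed

lemma eqv_sum_mset: "(\<And>p. p \<in># M \<Longrightarrow> f p \<doteq> g p) \<Longrightarrow> (\<Sum>p\<in>#M. f p) \<doteq> (\<Sum>p\<in>#M. g p)"
  by (induction M) (simp_all add: eqv_add)

lemma eqv_extend:
  assumes "Poly_Mapping.keys x \<subseteq> S" "\<And>c. c \<in> S \<Longrightarrow> f c \<doteq> g c"
  shows "frag_extend f x \<doteq> frag_extend g x"
  using assms(1) by (induction x rule: frag_induction) (simp_all add: assms(2) frag_extend_diff eqv_diff)

subsection \<open>Admissible maps and their convolution\<close>

text \<open>
  The functions on the basis whose linear extension maps the ideal \<open>I\<close> into itself.
\<close>
definition admissible :: "('c \<Rightarrow> 'c \<Rightarrow>\<^sub>0 int) \<Rightarrow> bool" where
  "admissible f \<longleftrightarrow> (\<forall>c \<in> K. f c \<in> Bc) \<and>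
     (\<forall>c \<in> K. \<forall>d \<in> K. \<forall>x \<in> E. f (c \<star> (x \<star> d)) \<doteq> f (c \<star> d))"

lemma admissible_Bc: "admissible f \<Longrightarrow> c \<in> K \<Longrightarrow> f c \<in> Bc"
  unfolding admissible_def by blast

lemma admissible_eqv: "admissible f \<Longrightarrow> c \<in> K \<Longrightarrow> d \<in> K \<Longrightarrow> x \<in> E \<Longrightarrow> f (c \<star> (x \<star> d)) \<doteq> f (c \<star> d)"
  by (simp add: admissible_def)

lemma admissible_extend_I: "admissible f \<Longrightarrow> a \<in> I \<Longrightarrow> frag_extend f a \<in> I"
proof (rotate_tac, induction rule: I.induct)
  case (gen c d x)
  then show ?case by (simp add: frag_extend_diff admissible_def eqv_def)
qed (simp_all add: frag_extend_diff I.zero I.diff)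

lemma admissible_extend: "admissible f \<Longrightarrow> a \<doteq> b \<Longrightarrow> frag_extend f a \<doteq> frag_extend f b"
  using admissible_extend_I[of f "a - b"] by (simp add: eqv_def frag_extend_diff)

definition conv :: "('c \<Rightarrow> 'c \<Rightarrow>\<^sub>0 int) \<Rightarrow> ('c \<Rightarrow> 'c \<Rightarrow>\<^sub>0 int) \<Rightarrow> 'c \<Rightarrow> 'c \<Rightarrow>\<^sub>0 int" where
  "conv f g c = (\<Sum>p\<in>#\<Delta> c. f (fst p) \<odot>\<^sub>B g (snd p))"

lemma conv_diff_left: "conv (\<lambda>c. f c - f' c) g c = conv f g c - conv f' g c"
  by (simp add: conv_def mul_diff_left sum_mset_diff)

lemma conv_diff_right: "conv f (\<lambda>c. g c - g' c) c = conv f g c - conv f g' c"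
  by (simp add: conv_def mul_diff_right sum_mset_diff)

lemma conv_add_left: "conv (\<lambda>c. f c + f' c) g c = conv f g c + conv f' g c"
  by (simp add: conv_def mul_add_left sum_mset.distrib)

lemma conv_add_right: "conv f (\<lambda>c. g c + g' c) c = conv f g c + conv f g' c"
  by (simp add: conv_def mul_add_right sum_mset.distrib)

lemma conv_cong:
  assumes "c \<in> K" "\<And>c. c \<in> K \<Longrightarrow> f c = f' c" "\<And>c. c \<in> K \<Longrightarrow> g c = g' c"
  shows "conv f g c = conv f' g' c"
  unfolding conv_def using \<Delta>_closed[OF assms(1)] assms(2,3)
  by (intro arg_cong[of _ _ sum_mset] image_mset_cong) simp

lemma conv_eqv:
  assumes "c \<in> K" "\<And>p. p \<in># \<Delta> c \<Longrightarrow> f (fst p) \<doteq> f' (fst p)" "\<And>p. p \<in># \<Delta> c \<Longrightarrow> g (snd p) \<doteq> g' (snd p)"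
    "\<And>c. c \<in> K \<Longrightarrow> f' c \<in> Bc" "\<And>c. c \<in> K \<Longrightarrow> g c \<in> Bc"
  shows "conv f g c \<doteq> conv f' g' c"
  unfolding conv_def
proof (rule eqv_sum_mset, rule eqv_mul)
  fix p assume p: "p \<in># \<Delta> c"
  show "f (fst p) \<doteq> f' (fst p)" "g (snd p) \<doteq> g' (snd p)" using assms(2,3) p by simp_all
  show "f' (fst p) \<in> Bc" "g (snd p) \<in> Bc" using \<Delta>_closed[OF assms(1) p] assms(4,5) by blast+
qed

lemma conv_Bc:
  assumes "c \<in> K" "\<And>c. c \<in> K \<Longrightarrow> f c \<in> Bc" "\<And>c. c \<in> K \<Longrightarrow> g c \<in> Bc"
  shows "conv f g c \<in> Bc"
  unfolding conv_def
proof (rule Bc_sum_mset, rule mul_closed)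
  fix p assume p: "p \<in># \<Delta> c"
  show "f (fst p) \<in> Bc" "g (snd p) \<in> Bc" using \<Delta>_closed[OF assms(1) p] assms(2,3) by blast+
qed

text \<open>
  As \<open>\<Delta>\<close> is multiplicative and identities are group-like, inserting an identity into a class inserts
  it into both components of every term of \<open>\<Delta>\<close>.
\<close>
lemma admissible_conv:
  assumes f: "admissible f" and g: "admissible g"
  shows "admissible (conv f g)"
  unfolding admissible_def
proof (intro conjI ballI)
  show "c \<in> K \<Longrightarrow> conv f g c \<in> Bc" for c
    by (rule conv_Bc) (simp_all only: admissible_Bc[OF f] admissible_Bc[OF g])
  fix c d x assume c: "c \<in> K" and d: "d \<in> K" and x: "x \<in> E"
  have 1: "conv f g (c \<star> (x \<star> d)) = (\<Sum>p\<in>#\<Delta> c. \<Sum>q\<in>#\<Delta> d. f (fst p \<star> (x \<star> fst q)) \<odot>\<^sub>B g (snd p \<star> (x \<star> snd q)))"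
    using c d x by (simp add: conv_def \<Delta>_mult \<Delta>_E sum_mset_concat image_mset.compositionality comp_def)
  have 2: "conv f g (c \<star> d) = (\<Sum>p\<in>#\<Delta> c. \<Sum>q\<in>#\<Delta> d. f (fst p \<star> fst q) \<odot>\<^sub>B g (snd p \<star> snd q))"
    using c d by (simp add: conv_def \<Delta>_mult sum_mset_concat image_mset.compositionality comp_def)
  show "conv f g (c \<star> (x \<star> d)) \<doteq> conv f g (c \<star> d)" unfolding 1 2
  proof (intro eqv_sum_mset eqv_mul)
    fix p q assume "p \<in># \<Delta> c" "q \<in># \<Delta> d"
    then have pq: "fst p \<in> K" "snd p \<in> K" "fst q \<in> K" "snd q \<in> K"
      using \<Delta>_closed[OF c] \<Delta>_closed[OF d] by auto
    show "f (fst p \<star> (x \<star> fst q)) \<doteq> f (fst p \<star> fst q)" "g (snd p \<star> (x \<star> snd q)) \<doteq> g (snd p \<star> snd q)"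
      using admissible_eqv[OF f] admissible_eqv[OF g] pq x by simp_all
    show "f (fst p \<star> fst q) \<in> Bc" "g (snd p \<star> (x \<star> snd q)) \<in> Bc"
      by (rule admissible_Bc[OF f] admissible_Bc[OF g], use pq x in simp)+
  qed
qed

lemma admissible_diff:
  assumes "admissible f" "admissible g"
  shows "admissible (\<lambda>c. f c - g c)"
  unfolding admissible_def
proof (intro conjI ballI)
  show "c \<in> K \<Longrightarrow> f c - g c \<in> Bc" for c using Bc_diff[OF admissible_Bc[OF assms(1)] admissible_Bc[OF assms(2)]] .
qed (intro eqv_diff admissible_eqv assms)

lemma admissible_add:
  assumes "admissible f" "admissible g"
  shows "admissible (\<lambda>c. f c + g c)"
  unfolding admissible_def
proof (intro conjI ballI)
  show "c \<in> K \<Longrightarrow> f c + g c \<in> Bc" for c using Bc_add[OF admissible_Bc[OF assms(1)] admissible_Bc[OF assms(2)]] .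
qed (intro eqv_add admissible_eqv assms)

text \<open>
  The co-unit followed by the unit, which is neutral for convolution.
\<close>
definition u :: "'c \<Rightarrow> 'c \<Rightarrow>\<^sub>0 int" where "u c = (if c \<in> E then frag_of e else 0)"

lemma u_Bc: "u c \<in> Bc" by (simp add: u_def)

lemma admissible_u: "admissible u"
  unfolding admissible_def by (simp add: u_def E_cancel)

lemma admissible_id: "admissible frag_of"
  unfolding admissible_def by (auto simp: eqv_def intro: I.gen)

lemma conv_u_right:
  assumes "c \<in> K" "\<And>c. c \<in> K \<Longrightarrow> f c \<in> Bc"
  shows "conv f u c = f c"
proof -
  have "conv f u c = (\<Sum>p\<in>#\<Delta> c. if snd p \<in> E then f (fst p) else 0)"
    unfolding conv_def
  proof (intro arg_cong[of _ _ sum_mset] image_mset_cong)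
    fix p assume "p \<in># \<Delta> c"
    then have "f (fst p) \<in> Bc" using \<Delta>_closed[OF assms(1)] assms(2) by blast
    then show "f (fst p) \<odot>\<^sub>B u (snd p) = (if snd p \<in> E then f (fst p) else 0)"
      using mul_one_right by (simp add: u_def del: mem_Collect_eq)
  qed
  also have "\<dots> = (\<Sum>a\<in>#image_mset fst (filter_mset (\<lambda>p. snd p \<in> E) (\<Delta> c)). f a)"
    by (simp add: sum_mset_filter image_mset.compositionality comp_def)
  also have "\<dots> = f c" unfolding counit_right[OF assms(1)] by simp
  finally show ?thesis .
qed

lemma conv_u_left:
  assumes "c \<in> K" "\<And>c. c \<in> K \<Longrightarrow> f c \<in> Bc"
  shows "conv u f c = f c"
proof -
  have "conv u f c = (\<Sum>p\<in>#\<Delta> c. if fst p \<in> E then f (snd p) else 0)"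
    unfolding conv_def
  proof (intro arg_cong[of _ _ sum_mset] image_mset_cong)
    fix p assume "p \<in># \<Delta> c"
    then have "f (snd p) \<in> Bc" using \<Delta>_closed[OF assms(1)] assms(2) by blast
    then show "u (fst p) \<odot>\<^sub>B f (snd p) = (if fst p \<in> E then f (snd p) else 0)"
      using mul_one_left by (simp add: u_def del: mem_Collect_eq)
  qed
  also have "\<dots> = (\<Sum>a\<in>#image_mset snd (filter_mset (\<lambda>p. fst p \<in> E) (\<Delta> c)). f a)"
    by (simp add: sum_mset_filter image_mset.compositionality comp_def)
  also have "\<dots> = f c" unfolding counit_left[OF assms(1)] by simp
  finally show ?thesis .
qed

primrec cpow :: "('c \<Rightarrow> 'c \<Rightarrow>\<^sub>0 int) \<Rightarrow> nat \<Rightarrow> 'c \<Rightarrow> 'c \<Rightarrow>\<^sub>0 int" where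
  "cpow f 0 = u"
| "cpow f (Suc n) = conv (cpow f n) f"

lemma admissible_cpow: "admissible f \<Longrightarrow> admissible (cpow f n)"
  by (induction n) (simp_all add: admissible_u admissible_conv)

text \<open>
  The negatives of the parts of \<open>id - u\<close> in degree \<open>0\<close> and in positive degree, as \<open>u\<close> is supported in
  degree \<open>0\<close>.  With this sign geometric series have no signs.
\<close>
definition h0 :: "'c \<Rightarrow> 'c \<Rightarrow>\<^sub>0 int" where "h0 c = (if dg c = 0 then u c - frag_of c else 0)"
definition h1 :: "'c \<Rightarrow> 'c \<Rightarrow>\<^sub>0 int" where "h1 c = (if dg c = 0 then 0 else - frag_of c)"

lemma h0_h1: "u c - h0 c - h1 c = frag_of c"
  using dg_E[of c] by (auto simp: h0_def h1_def u_def)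

lemma admissible_h0: "admissible h0"
  unfolding admissible_def
proof (intro conjI ballI)
  show "c \<in> K \<Longrightarrow> h0 c \<in> Bc" for c using Bc_diff[OF u_Bc Bc_of] by (simp add: h0_def)
next
  fix c d x assume *: "c \<in> K" "d \<in> K" "x \<in> E"
  have "dg (c \<star> (x \<star> d)) = dg (c \<star> d)" using * by (simp add: dg_cm dg_E)
  moreover have "u (c \<star> (x \<star> d)) - frag_of (c \<star> (x \<star> d)) \<doteq> u (c \<star> d) - frag_of (c \<star> d)"
    using admissible_eqv[OF admissible_u] admissible_eqv[OF admissible_id] * by (intro eqv_diff) simp_all
  ultimately show "h0 (c \<star> (x \<star> d)) \<doteq> h0 (c \<star> d)" by (simp add: h0_def)
qed

lemma admissible_h1: "admissible h1"
proof -
  have "h1 = (\<lambda>c. (u c - h0 c) - frag_of c)" using h0_h1 by (auto simp: fun_eq_iff algebra_simps)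
  then show ?thesis using admissible_diff[OF admissible_diff[OF admissible_u admissible_h0] admissible_id] by simp
qed

end

section \<open>Convolution inverses by geometric series\<close>

locale coassociative_class_bialgebra = class_bialgebra +
  assumes \<Delta>_coassoc: "\<And>c G :: 'a \<Rightarrow> 'a \<Rightarrow> 'a \<Rightarrow> 'a \<Rightarrow>\<^sub>0 int. c \<in> K \<Longrightarrow>
    (\<Sum>p\<in>#\<Delta> c. \<Sum>q\<in>#\<Delta> (fst p). G (fst q) (snd q) (snd p)) =
    (\<Sum>p\<in>#\<Delta> c. \<Sum>q\<in>#\<Delta> (snd p). G (fst p) (fst q) (snd q))"
begin

lemma conv_assoc:
  assumes c: "c \<in> K" and f: "admissible f" and g: "admissible g" and h: "admissible h"
  shows "conv (conv f g) h c = conv f (conv g h) c"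
proof -
  have "conv (conv f g) h c = (\<Sum>p\<in>#\<Delta> c. \<Sum>q\<in>#\<Delta> (fst p). (f (fst q) \<odot>\<^sub>B g (snd q)) \<odot>\<^sub>B h (snd p))"
    by (simp add: conv_def mul_sum_left)
  also have "\<dots> = (\<Sum>p\<in>#\<Delta> c. \<Sum>q\<in>#\<Delta> (snd p). (f (fst p) \<odot>\<^sub>B g (fst q)) \<odot>\<^sub>B h (snd q))"
    by (rule \<Delta>_coassoc[OF c])
  also have "\<dots> = (\<Sum>p\<in>#\<Delta> c. \<Sum>q\<in>#\<Delta> (snd p). f (fst p) \<odot>\<^sub>B (g (fst q) \<odot>\<^sub>B h (snd q)))"
  proof (intro arg_cong[of _ _ sum_mset] image_mset_cong)
    fix p q assume p: "p \<in># \<Delta> c" and q: "q \<in># \<Delta> (snd p)"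
    have pq: "fst p \<in> K" "snd p \<in> K" using \<Delta>_closed[OF c p] by auto
    then have "fst q \<in> K" "snd q \<in> K" using \<Delta>_closed[OF _ q] by auto
    then show "(f (fst p) \<odot>\<^sub>B g (fst q)) \<odot>\<^sub>B h (snd q) = f (fst p) \<odot>\<^sub>B (g (fst q) \<odot>\<^sub>B h (snd q))"
      by (intro mul_assoc admissible_Bc[OF f] admissible_Bc[OF g] admissible_Bc[OF h] pq)
  qed
  also have "\<dots> = conv f (conv g h) c" by (simp add: conv_def mul_sum_right)
  finally show ?thesis .
qed

lemma conv_eqv_left:
  assumes "c \<in> K" "\<And>a. a \<in> K \<Longrightarrow> f a \<doteq> f' a" "admissible f'" "admissible g"
  shows "conv f g c \<doteq> conv f' g c"
  by (rule conv_eqv[OF assms(1)]) (use \<Delta>_closed[OF assms(1)] assms(2) admissible_Bc[OF assms(3)] admissible_Bc[OF assms(4)]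
    in \<open>simp_all del: mem_Collect_eq\<close>)

lemma conv_eqv_right:
  assumes "c \<in> K" "\<And>a. a \<in> K \<Longrightarrow> g a \<doteq> g' a" "admissible f" "admissible g"
  shows "conv f g c \<doteq> conv f g' c"
  by (rule conv_eqv[OF assms(1)]) (use \<Delta>_closed[OF assms(1)] assms(2) admissible_Bc[OF assms(3)] admissible_Bc[OF assms(4)]
    in \<open>simp_all del: mem_Collect_eq\<close>)

lemma admissible_0: "admissible (\<lambda>c. 0)"
  by (simp add: admissible_def)

text \<open>
  The partial sums of the geometric series, in the form of Horner's scheme.
\<close>
primrec geo :: "('a \<Rightarrow> 'a \<Rightarrow>\<^sub>0 int) \<Rightarrow> nat \<Rightarrow> 'a \<Rightarrow> 'a \<Rightarrow>\<^sub>0 int" where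
  "geo m 0 = (\<lambda>c. 0)"
| "geo m (Suc k) = (\<lambda>c. u c + conv (geo m k) m c)"

lemma admissible_geo: "admissible m \<Longrightarrow> admissible (geo m k)"
  by (induction k) (simp_all add: admissible_0 admissible_add admissible_u admissible_conv)

lemma geo_step:
  assumes "c \<in> K"
  shows "geo m (Suc k) c - geo m k c = cpow m k c"
  using assms
proof (induction k arbitrary: c)
  case 0
  then show ?case by (simp add: conv_def)
next
  case (Suc k)
  have "geo m (Suc (Suc k)) c - geo m (Suc k) c = conv (\<lambda>c. geo m (Suc k) c - geo m k c) m c"
    by (simp add: conv_diff_left)
  also have "\<dots> = conv (cpow m k) m c" by (rule conv_cong[OF Suc.prems Suc.IH]) simp_all
  finally show ?case by simp
qed

lemma geo_commute:
  assumes m: "admissible m" and c: "c \<in> K"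
  shows "conv m (geo m k) c = conv (geo m k) m c"
  using c
proof (induction k arbitrary: c)
  case 0
  then show ?case by (simp add: conv_def)
next
  case (Suc k)
  have "conv m (geo m (Suc k)) c = conv m u c + conv m (conv (geo m k) m) c" by (simp add: conv_add_right)
  also have "\<dots> = m c + conv (conv m (geo m k)) m c"
    using Suc.prems conv_u_right[of c m] admissible_Bc[OF m] conv_assoc m admissible_geo[OF m] by simp
  also have "conv (conv m (geo m k)) m c = conv (conv (geo m k) m) m c"
    by (rule conv_cong[OF Suc.prems Suc.IH]) simp_all
  also have "m c + \<dots> = conv u m c + conv (conv (geo m k) m) m c"
    using Suc.prems conv_u_left[of c m] admissible_Bc[OF m] by simp
  also have "\<dots> = conv (geo m (Suc k)) m c" by (simp add: conv_add_left)
  finally show ?case .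
qed

definition locally_nilpotent :: "('a \<Rightarrow> 'a \<Rightarrow>\<^sub>0 int) \<Rightarrow> bool" where
  "locally_nilpotent m \<longleftrightarrow> (\<forall>c \<in> K. \<exists>N. \<forall>n\<ge>N. cpow m n c \<in> I)"

text \<open>
  On each class the partial sums are eventually constant modulo \<open>I\<close>, which defines the limit \<open>g\<close>.  Only
  finitely many classes occur in \<open>\<Delta> c\<close>, so in an equation evaluated at \<open>c\<close> the limit can be replaced by
  one sufficiently long partial sum.
\<close>
lemma geometric_inverse:
  assumes m: "admissible m" and nil: "locally_nilpotent m"
  obtains g where "admissible g" "\<And>c. c \<in> K \<Longrightarrow> conv g (\<lambda>c. u c - m c) c \<doteq> u c"
    "\<And>c. c \<in> K \<Longrightarrow> conv (\<lambda>c. u c - m c) g c \<doteq> u c"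
proof -
  from nil obtain N where N: "\<And>c n. c \<in> K \<Longrightarrow> n \<ge> N c \<Longrightarrow> cpow m n c \<in> I"
    unfolding locally_nilpotent_def by metis
  define g where "g c = geo m (N c) c" for c
  have um: "admissible (\<lambda>c. u c - m c)" by (rule admissible_diff[OF admissible_u m])
  note ag = admissible_geo[OF m]
  have stable: "g c \<doteq> geo m k c" if c: "c \<in> K" and k: "k \<ge> N c" for c k
    using k
  proof (induction k rule: dec_induct)
    case base
    then show ?case by (simp add: g_def)
  next
    case (step k)
    have "geo m (Suc k) c \<doteq> geo m k c" unfolding eqv_def geo_step[OF c] using N[OF c step.hyps(1)] .
    then show ?case using step.IH eqv_sym eqv_trans by blast
  qed
  have g: "admissible g"
    unfolding admissible_def
  proof (intro conjI ballI)
    show "c \<in> K \<Longrightarrow> g c \<in> Bc" for c unfolding g_def by (rule admissible_Bc[OF ag])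
    fix c d x assume *: "c \<in> K" "d \<in> K" "x \<in> E"
    define k where "k = max (N (c \<star> (x \<star> d))) (N (c \<star> d))"
    have "g (c \<star> (x \<star> d)) \<doteq> geo m k (c \<star> (x \<star> d))" by (rule stable) (use * in \<open>simp_all add: k_def\<close>)
    also have "\<dots> \<doteq> geo m k (c \<star> d)" by (rule admissible_eqv[OF ag *])
    also have "\<dots> \<doteq> g (c \<star> d)" by (rule eqv_sym[OF stable]) (use * in \<open>simp_all add: k_def\<close>)
    finally show "g (c \<star> (x \<star> d)) \<doteq> g (c \<star> d)" .
  qed
  have bound: "\<exists>k. k \<ge> N c \<and> (\<forall>p\<in>#\<Delta> c. k \<ge> N (fst p) \<and> k \<ge> N (snd p))" for c
  proof -
    define k where "k = N c + (\<Sum>p\<in>#\<Delta> c. N (fst p) + N (snd p))"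
    have "N (fst p) + N (snd p) \<le> (\<Sum>p\<in>#\<Delta> c. N (fst p) + N (snd p))" if "p \<in># \<Delta> c" for p
      using that by (auto dest: multi_member_split)
    then show ?thesis by (intro exI[of _ k]) (fastforce simp: k_def)
  qed
  have inv: "conv (geo m k) (\<lambda>c. u c - m c) c \<doteq> u c" if c: "c \<in> K" and k: "k \<ge> N c" for c k
  proof -
    have "conv (geo m k) (\<lambda>c. u c - m c) c = geo m k c - conv (geo m k) m c"
      using conv_u_right[OF c, of "geo m k"] admissible_Bc[OF ag] by (simp add: conv_diff_right)
    also have "\<dots> = u c - cpow m k c" unfolding geo_step[OF c, symmetric] by simp
    finally show ?thesis using I_uminus[OF N[OF c k]] by (simp add: eqv_def)
  qed
  have comm: "conv (\<lambda>c. u c - m c) (geo m k) c = conv (geo m k) (\<lambda>c. u c - m c) c" if c: "c \<in> K" for c k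
    using conv_u_right[OF c, of "geo m k"] conv_u_left[OF c, of "geo m k"] admissible_Bc[OF ag] geo_commute[OF m c]
    by (simp add: conv_diff_right conv_diff_left)
  show ?thesis
  proof (rule that[OF g])
    fix c assume c: "c \<in> K"
    obtain k where k: "k \<ge> N c" "\<And>p. p \<in># \<Delta> c \<Longrightarrow> k \<ge> N (fst p) \<and> k \<ge> N (snd p)" using bound by blast
    have "conv g (\<lambda>c. u c - m c) c \<doteq> conv (geo m k) (\<lambda>c. u c - m c) c"
    proof (rule conv_eqv[OF c])
      show "p \<in># \<Delta> c \<Longrightarrow> g (fst p) \<doteq> geo m k (fst p)" for p
        using stable \<Delta>_closed[OF c] k(2) by blast
    qed (use admissible_Bc[OF ag] admissible_Bc[OF um] in \<open>simp_all del: mem_Collect_eq\<close>)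
    also note inv[OF c k(1)]
    finally show "conv g (\<lambda>c. u c - m c) c \<doteq> u c" .
    have "conv (\<lambda>c. u c - m c) g c \<doteq> conv (\<lambda>c. u c - m c) (geo m k) c"
    proof (rule conv_eqv[OF c])
      show "p \<in># \<Delta> c \<Longrightarrow> g (snd p) \<doteq> geo m k (snd p)" for p
        using stable \<Delta>_closed[OF c] k(2) by blast
    qed (use admissible_Bc[OF g] admissible_Bc[OF um] in \<open>simp_all del: mem_Collect_eq\<close>)
    also note inv[OF c k(1), folded comm[OF c]]
    finally show "conv (\<lambda>c. u c - m c) g c \<doteq> u c" .
  qed
qed

text \<open>
  Each convolution factor uses up at least one unit of degree.
\<close>
lemma nilpotent_by_degree:
  assumes "\<And>c. c \<in> K \<Longrightarrow> dg c = 0 \<Longrightarrow> m c = 0"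
  shows "locally_nilpotent m"
proof -
  have "cpow m n c = 0" if "c \<in> K" "dg c < n" for n c
    using that
  proof (induction n arbitrary: c)
    case (Suc n)
    have "cpow m n (fst p) \<odot>\<^sub>B m (snd p) = 0" if p: "p \<in># \<Delta> c" for p
    proof (cases "dg (snd p) = 0")
      case True
      then show ?thesis using assms[of "snd p"] \<Delta>_closed[OF Suc.prems(1) p] by simp
    next
      case False
      then have "dg (fst p) < n" using dg_\<Delta>[OF Suc.prems(1) p] Suc.prems(2) by linarith
      then show ?thesis using Suc.IH[of "fst p"] \<Delta>_closed[OF Suc.prems(1) p] by simp
    qed
    then show ?case by (simp add: conv_def cong: image_mset_cong)
  qed simp
  then show ?thesis unfolding locally_nilpotent_def using I.zero by (metis Suc_le_lessD)
qed

text \<open>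
  The identity is \<open>u - h0 - h1 = (u - h0) * (u - g * h1)\<close> with \<open>g\<close> the inverse of \<open>u - h0\<close>, and
  \<open>g * h1\<close> vanishes in degree \<open>0\<close>.
\<close>
theorem convolution_inverse:
  assumes nil: "locally_nilpotent h0"
  obtains s where "admissible s" "\<And>c. c \<in> K \<Longrightarrow> conv s frag_of c \<doteq> u c" "\<And>c. c \<in> K \<Longrightarrow> conv frag_of s c \<doteq> u c"
proof -
  let ?a = "\<lambda>c. u c - h0 c"
  obtain g where g: "admissible g" and g1: "\<And>c. c \<in> K \<Longrightarrow> conv g ?a c \<doteq> u c"
    and g2: "\<And>c. c \<in> K \<Longrightarrow> conv ?a g c \<doteq> u c"
    using geometric_inverse[OF admissible_h0 nil] by blast
  define k where "k = conv g h1"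
  have k: "admissible k" unfolding k_def by (rule admissible_conv[OF g admissible_h1])
  have "k c = 0" if c: "c \<in> K" "dg c = 0" for c
  proof -
    have "h1 (snd p) = 0" if "p \<in># \<Delta> c" for p using dg_\<Delta>[OF c(1) that] c(2) by (simp add: h1_def)
    then show ?thesis by (simp add: k_def conv_def cong: image_mset_cong)
  qed
  then have "locally_nilpotent k" by (rule nilpotent_by_degree)
  let ?b = "\<lambda>c. u c - k c"
  obtain j where j: "admissible j" and j1: "\<And>c. c \<in> K \<Longrightarrow> conv j ?b c \<doteq> u c"
    and j2: "\<And>c. c \<in> K \<Longrightarrow> conv ?b j c \<doteq> u c"
    using geometric_inverse[OF k \<open>locally_nilpotent k\<close>] by blast
  have a: "admissible ?a" by (rule admissible_diff[OF admissible_u admissible_h0])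
  have b: "admissible ?b" by (rule admissible_diff[OF admissible_u k])
  note adm = a b g j k admissible_u admissible_h0 admissible_h1 admissible_id admissible_conv
  have fac: "conv ?a ?b c \<doteq> frag_of c" if c: "c \<in> K" for c
  proof -
    have 1: "conv ?a ?b c = ?a c - conv (conv ?a g) h1 c"
      using conv_u_right[OF c, of ?a] admissible_Bc[OF a] conv_assoc[OF c a g admissible_h1]
      by (simp add: conv_diff_right k_def)
    have 2: "?a c - conv (conv ?a g) h1 c \<doteq> ?a c - conv u h1 c"
      by (intro eqv_diff eqv_refl conv_eqv_left[OF c g2] adm)
    have 3: "?a c - conv u h1 c = frag_of c"
      using conv_u_left[OF c admissible_Bc[OF admissible_h1]] h0_h1 by simp
    show ?thesis using 2 unfolding 1 3 .
  qed
  define s where "s = conv j g"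
  have s: "admissible s" unfolding s_def by (rule admissible_conv[OF j g])
  have left: "conv g (conv ?a ?b) d \<doteq> ?b d" if d: "d \<in> K" for d
  proof -
    have 1: "conv g (conv ?a ?b) d = conv (conv g ?a) ?b d"
      by (rule conv_assoc[OF d, symmetric]) (intro adm)+
    have 2: "conv (conv g ?a) ?b d \<doteq> conv u ?b d" by (rule conv_eqv_left[OF d], erule g1) (intro adm)+
    have 3: "conv u ?b d = ?b d" by (rule conv_u_left[OF d admissible_Bc[OF b]])
    show ?thesis using 2 unfolding 1 3 .
  qed
  have right: "conv ?b s d \<doteq> g d" if d: "d \<in> K" for d
  proof -
    have 1: "conv ?b s d = conv (conv ?b j) g d"
      unfolding s_def by (rule conv_assoc[OF d, symmetric]) (intro adm)+
    have 2: "conv (conv ?b j) g d \<doteq> conv u g d" by (rule conv_eqv_left[OF d], erule j2) (intro adm)+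
    have 3: "conv u g d = g d" by (rule conv_u_left[OF d admissible_Bc[OF g]])
    show ?thesis using 2 unfolding 1 3 .
  qed
  show ?thesis
  proof (rule that[OF s])
    fix c assume c: "c \<in> K"
    have 1: "conv s frag_of c \<doteq> conv s (conv ?a ?b) c"
      by (rule conv_eqv_right[OF c eqv_sym[OF fac]]) (assumption | intro adm s)+
    have 2: "conv s (conv ?a ?b) c = conv j (conv g (conv ?a ?b)) c"
      unfolding s_def by (rule conv_assoc[OF c]) (intro adm)+
    have 3: "conv j (conv g (conv ?a ?b)) c \<doteq> conv j ?b c"
      by (rule conv_eqv_right[OF c left]) (assumption | intro adm)+
    show "conv s frag_of c \<doteq> u c"
      using eqv_trans[OF 1[unfolded 2] eqv_trans[OF 3 j1[OF c]]] .
    have 1: "conv frag_of s c \<doteq> conv (conv ?a ?b) s c"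
      by (rule conv_eqv_left[OF c eqv_sym[OF fac]]) (assumption | intro adm s)+
    have 2: "conv (conv ?a ?b) s c = conv ?a (conv ?b s) c"
      by (rule conv_assoc[OF c]) (intro adm s)+
    have 3: "conv ?a (conv ?b s) c \<doteq> conv ?a g c"
      by (rule conv_eqv_right[OF c right]) (assumption | intro adm s)+
    show "conv frag_of s c \<doteq> u c"
      using eqv_trans[OF 1[unfolded 2] eqv_trans[OF 3 g2[OF c]]] .
  qed
qed

end

section \<open>Cosets and integral combinations\<close>

text \<open>
  The form of the sum that defines the convolution product on the quotient.
\<close>
definition int_combination :: "('a, 'z) ring_scheme \<Rightarrow> ('w \<Rightarrow> 'a) \<Rightarrow> ('w \<Rightarrow>\<^sub>0 int) \<Rightarrow> 'a" where
  "int_combination R g t = (\<Oplus>\<^bsub>R\<^esub> w \<in> Poly_Mapping.keys t. [Poly_Mapping.lookup t w] \<cdot>\<^bsub>R\<^esub> g w)"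

context abelian_group
begin

lemma int_pow_closed [simp]: "x \<in> carrier G \<Longrightarrow> [(n :: int)] \<cdot> x \<in> carrier G"
  using add.int_pow_closed by simp

lemma int_combination_superset:
  assumes "finite A" "Poly_Mapping.keys t \<subseteq> A" "g \<in> A \<rightarrow> carrier G"
  shows "int_combination G g t = (\<Oplus> w \<in> A. [Poly_Mapping.lookup t w] \<cdot> g w)"
  unfolding int_combination_def
proof (rule add.finprod_mono_neutral_cong_left[OF assms(1,2)])
  fix w assume w: "w \<in> A - Poly_Mapping.keys t"
  then have "g w \<in> carrier G" "Poly_Mapping.lookup t w = 0" using assms(3) by (auto simp: in_keys_iff)
  then show "[Poly_Mapping.lookup t w] \<cdot> g w = \<zero>" by (simp add: add_pow_def)
qed (use assms in auto)

lemma int_combination_of: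
  assumes "g w \<in> carrier G"
  shows "int_combination G g (frag_of w) = g w"
  using assms add.int_pow_1 by (simp add: int_combination_def)

lemma int_combination_closed:
  assumes "g \<in> Poly_Mapping.keys t \<rightarrow> carrier G"
  shows "int_combination G g t \<in> carrier G"
  unfolding int_combination_def using assms by (intro finsum_closed) auto

lemma int_combination_add:
  assumes "Poly_Mapping.keys t \<subseteq> Q" "Poly_Mapping.keys t' \<subseteq> Q" "g \<in> Q \<rightarrow> carrier G"
  shows "int_combination G g (t + t') = int_combination G g t \<oplus> int_combination G g t'"
proof -
  let ?A = "Poly_Mapping.keys t \<union> Poly_Mapping.keys t'"
  have A: "finite ?A" "g \<in> ?A \<rightarrow> carrier G" using assms by auto
  have gA: "g w \<in> carrier G" if "w \<in> ?A" for w using A(2) that by (rule funcset_mem)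
  have "int_combination G g (t + t') = (\<Oplus> w \<in> ?A. [Poly_Mapping.lookup (t + t') w] \<cdot> g w)"
    by (rule int_combination_superset[OF A(1) _ A(2)]) (rule keys_add)
  also have "\<dots> = (\<Oplus> w \<in> ?A. [Poly_Mapping.lookup t w] \<cdot> g w \<oplus> [Poly_Mapping.lookup t' w] \<cdot> g w)"
    using gA add.int_pow_mult by (intro finsum_cong') (simp_all add: lookup_add)
  also have "\<dots> = (\<Oplus> w \<in> ?A. [Poly_Mapping.lookup t w] \<cdot> g w) \<oplus> (\<Oplus> w \<in> ?A. [Poly_Mapping.lookup t' w] \<cdot> g w)"
    using gA by (intro finsum_addf) simp_all
  also have "\<dots> = int_combination G g t \<oplus> int_combination G g t'"
    using int_combination_superset[OF A(1) _ A(2)] by simp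
  finally show ?thesis .
qed

end

context class_bialgebra
begin

lemma coset_mem: "x \<in> J +>\<^bsub>BR S\<^esub> a \<longleftrightarrow> (\<exists>j\<in>J. x = j + a)"
  by (auto simp: a_r_coset_def r_coset_def)

text \<open>
  The representative at which the structure maps of a quotient are evaluated.
\<close>
definition rep :: "('a \<Rightarrow>\<^sub>0 int) set \<Rightarrow> 'a \<Rightarrow>\<^sub>0 int" where "rep h = (SOME b. b \<in> h)"

lemma rep_coset:
  assumes "J \<subseteq> I" "0 \<in> J"
  shows "rep (J +>\<^bsub>BR S\<^esub> a) \<in> J +>\<^bsub>BR S\<^esub> a" "rep (J +>\<^bsub>BR S\<^esub> a) \<doteq> a"
proof -
  have "a \<in> J +>\<^bsub>BR S\<^esub> a" using assms(2) by (auto simp: coset_mem)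
  then show r: "rep (J +>\<^bsub>BR S\<^esub> a) \<in> J +>\<^bsub>BR S\<^esub> a" unfolding rep_def by (rule someI)
  then show "rep (J +>\<^bsub>BR S\<^esub> a) \<doteq> a" using assms(1) by (auto simp: coset_mem eqv_def)
qed

lemma carrier_quot: "carrier (BR S Quot J) = {J +>\<^bsub>BR S\<^esub> a | a. Poly_Mapping.keys a \<subseteq> S}"
  by (auto simp: FactRing_def A_RCOSETS_def RCOSETS_def a_r_coset_def)

end

section \<open>Co-associativity and connectedness on classes\<close>

text \<open>
  The co-product with values in words, which stand for pure tensors.
\<close>
locale class_bialgebra_tensor = class_bialgebra +
  fixes CP :: "'a \<Rightarrow> ('a \<Rightarrow>\<^sub>0 int) list \<Rightarrow>\<^sub>0 int"
  assumes CP: "c \<in> K \<Longrightarrow> CP c = (\<Sum>p\<in>#\<Delta> c. frag_of [frag_of (fst p), frag_of (snd p)])"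
begin

abbreviation "D \<equiv> frag_extend CP"

text \<open>
  A trilinear map factors through the threefold tensor power.  The relations also involve words of
  other lengths, which are sent to \<open>0\<close>.
\<close>
lemma tensor_null_trilinear:
  fixes G :: "'a \<Rightarrow> 'a \<Rightarrow> 'a \<Rightarrow> 'd \<Rightarrow>\<^sub>0 int"
  assumes "t \<in> tensor_null (BR S)"
  defines "L \<equiv> \<lambda>w. if length w = 3
      then frag_extend (\<lambda>a. frag_extend (\<lambda>b. frag_extend (G a b) (w ! 2)) (w ! 1)) (w ! 0) else 0"
  shows "frag_extend L t = 0"
  using assms(1)
proof (induction rule: tensor_null.induct)
  case (multilinear x y xs ys)
  have "L (xs @ [x + y] @ ys) = L (xs @ [x] @ ys) + L (xs @ [y] @ ys)"
  proof (cases "length xs + length ys = 2")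
    case True
    then consider "length xs = 0" "length ys = 2" | "length xs = 1" "length ys = 1" | "length xs = 2" "length ys = 0"
      by linarith
    then show ?thesis
      by cases (simp_all add: L_def nth_append nth_Cons' frag_extend_add frag_extend_fun_add)
  next
    case False
    then show ?thesis by (simp add: L_def)
  qed
  then show ?case by (simp add: frag_extend_diff)
qed (simp_all add: frag_extend_diff)

lemma \<Delta>_coassoc_from_tensor:
  fixes G :: "'a \<Rightarrow> 'a \<Rightarrow> 'a \<Rightarrow> 'd \<Rightarrow>\<^sub>0 int"
  assumes co: "coassociative (BR K) D" and c: "c \<in> K"
  shows "(\<Sum>p\<in>#\<Delta> c. \<Sum>q\<in>#\<Delta> (fst p). G (fst q) (snd q) (snd p)) =
    (\<Sum>p\<in>#\<Delta> c. \<Sum>q\<in>#\<Delta> (snd p). G (fst p) (fst q) (snd q))"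
proof -
  define L where "L = (\<lambda>w :: ('a \<Rightarrow>\<^sub>0 int) list. if length w = 3
      then frag_extend (\<lambda>a. frag_extend (\<lambda>b. frag_extend (G a b) (w ! 2)) (w ! 1)) (w ! 0) else 0)"
  have null: "frag_extend L t = 0" if "t \<in> tensor_null (BR K)" for t
    unfolding L_def using that by (rule tensor_null_trilinear)
  have Dc: "D (frag_of c) = (\<Sum>p\<in>#\<Delta> c. frag_of [frag_of (fst p), frag_of (snd p)])" using CP[OF c] by simp
  have L: "L [frag_of a, frag_of b, frag_of k] = G a b k" for a b k
    by (simp add: L_def numeral_2_eq_2)
  have 1: "frag_extend L (on_first D (D (frag_of c))) = (\<Sum>p\<in>#\<Delta> c. \<Sum>q\<in>#\<Delta> (fst p). G (fst q) (snd q) (snd p))"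
    unfolding Dc on_first_def frag_extend_sum_mset
  proof (intro arg_cong[of _ _ sum_mset] image_mset_cong)
    fix p assume p: "p \<in># \<Delta> c"
    then have "fst p \<in> K" using \<Delta>_closed[OF c p] by blast
    then show "frag_extend L (frag_extend (\<lambda>w. frag_extend (\<lambda>d. frag_of (d @ tl w)) (D (hd w))) (frag_of [frag_of (fst p), frag_of (snd p)]))
        = (\<Sum>q\<in>#\<Delta> (fst p). G (fst q) (snd q) (snd p))"
      by (simp add: CP frag_extend_sum_mset L)
  qed
  have 2: "frag_extend L (on_second D (D (frag_of c))) = (\<Sum>p\<in>#\<Delta> c. \<Sum>q\<in>#\<Delta> (snd p). G (fst p) (fst q) (snd q))"
    unfolding Dc on_second_def frag_extend_sum_mset
  proof (intro arg_cong[of _ _ sum_mset] image_mset_cong)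
    fix p assume p: "p \<in># \<Delta> c"
    then have "snd p \<in> K" using \<Delta>_closed[OF c p] by blast
    then show "frag_extend L (frag_extend (\<lambda>w. frag_extend (\<lambda>d. frag_of (w ! 0 # d)) (D (w ! 1))) (frag_of [frag_of (fst p), frag_of (snd p)]))
        = (\<Sum>q\<in>#\<Delta> (snd p). G (fst p) (fst q) (snd q))"
      by (simp add: CP frag_extend_sum_mset L)
  qed
  have "frag_of c \<in> carrier (BR K)" using c by simp
  then have "on_first D (D (frag_of c)) - on_second D (D (frag_of c)) \<in> tensor_null (BR K)"
    using co unfolding coassociative_def tensor_eq_def by blast
  from null[OF this] show ?thesis unfolding frag_extend_diff 1 2 by simp
qed

definition eps :: "('a \<Rightarrow>\<^sub>0 int) \<Rightarrow> int" where
  "eps x = (\<Sum>c \<in> Poly_Mapping.keys x. Poly_Mapping.lookup x c * (if c \<in> E then 1 else 0))"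

text \<open>
  Hence \<open>eps\<close> is additive, being a coefficient of an additive map.
\<close>
lemma u_eps: "frag_extend u x = frag_cmul (eps x) (frag_of e)"
proof -
  have *: "(\<Sum>c\<in>A. frag_cmul (f c) (frag_of e)) = frag_cmul (sum f A) (frag_of e)" for f :: "'a \<Rightarrow> int" and A
    by (induction A rule: infinite_finite_induct) (simp_all add: frag_cmul_distrib)
  have "frag_extend u x = (\<Sum>c \<in> Poly_Mapping.keys x. frag_cmul (Poly_Mapping.lookup x c * (if c \<in> E then 1 else 0)) (frag_of e))"
    unfolding frag_extend_def by (intro sum.cong) (auto simp: u_def)
  then show ?thesis unfolding * eps_def .
qed

lemma eps_diff: "eps (a - b) = eps a - eps b"
proof -
  have lk: "eps x = Poly_Mapping.lookup (frag_extend u x) e" for x by (simp add: u_eps)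
  show ?thesis unfolding lk by (simp add: frag_extend_diff lookup_minus)
qed

lemma eps_I: "a \<in> I \<Longrightarrow> eps a = 0"
proof (induction rule: I.induct)
  case (gen c d x)
  then show ?case by (simp add: eps_diff E_cancel) (simp add: eps_def E_cancel)
next
  case zero
  show ?case by (simp add: eps_def)
qed (simp add: eps_diff)

lemma eps_eqv: "a \<doteq> b \<Longrightarrow> eps a = eps b"
  using eps_I[of "a - b"] by (simp add: eqv_def eps_diff)

abbreviation K0 where "K0 \<equiv> {c \<in> K. dg c = 0}"
definition I0 where "I0 = I \<inter> carrier (BR K0)"
abbreviation H0 where "H0 \<equiv> BR K0 Quot I0"
abbreviation D0 where "D0 \<equiv> quot_coproduct (BR K0) I0 D"

lemma I0: "I0 \<subseteq> I" "0 \<in> I0" using I.zero by (auto simp: I0_def)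

lemma carrier_H0: "h \<in> carrier H0 \<Longrightarrow> rep h \<in> h \<and> Poly_Mapping.keys (rep h) \<subseteq> K0"
proof -
  assume "h \<in> carrier H0"
  then obtain a where h: "h = I0 +>\<^bsub>BR K0\<^esub> a" and a: "Poly_Mapping.keys a \<subseteq> K0" unfolding carrier_quot by blast
  have r: "rep h \<in> h" unfolding h using rep_coset(1)[OF I0] by blast
  then obtain j where "j \<in> I0" "rep h = j + a" unfolding h coset_mem by blast
  then show ?thesis using r a keys_add[of j a] by (auto simp: I0_def)
qed

lemma rep_Bc: "h \<in> carrier H0 \<Longrightarrow> rep h \<in> Bc"
  using carrier_H0 by blast

lemma coset_H0: "c \<in> K0 \<Longrightarrow> I0 +>\<^bsub>BR K0\<^esub> frag_of c \<in> carrier H0"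
  unfolding carrier_quot by auto

lemma coset_mem_eqv:
  assumes "h \<in> carrier H0" "a \<in> h" "b \<in> h"
  shows "a \<doteq> b"
proof -
  from assms obtain k i j where "i \<in> I" "a = i + k" "j \<in> I" "b = j + k"
    unfolding carrier_quot by (auto simp: coset_mem I0_def)
  then show ?thesis using I.diff[of i j] by (simp add: eqv_def)
qed

lemma rep_add:
  assumes "x \<in> carrier H0" "y \<in> carrier H0"
  shows "rep (x \<oplus>\<^bsub>H0\<^esub> y) \<doteq> rep x + rep y"
proof -
  have mem: "z \<in> x \<oplus>\<^bsub>H0\<^esub> y \<longleftrightarrow> (\<exists>a\<in>x. \<exists>b\<in>y. z = a + b)" for z
    by (auto simp: FactRing_def set_add_def set_mult_def)
  have "rep x + rep y \<in> x \<oplus>\<^bsub>H0\<^esub> y" using mem carrier_H0 assms by blast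
  then have "rep (x \<oplus>\<^bsub>H0\<^esub> y) \<in> x \<oplus>\<^bsub>H0\<^esub> y" unfolding rep_def[of "x \<oplus>\<^bsub>H0\<^esub> y"] by (rule someI)
  then obtain a b where "a \<in> x" "b \<in> y" "rep (x \<oplus>\<^bsub>H0\<^esub> y) = a + b" using mem by blast
  then show ?thesis using coset_mem_eqv[OF assms(1)] coset_mem_eqv[OF assms(2)] carrier_H0 assms
    by (auto intro!: eqv_add)
qed

text \<open>
  A word \<open>[x1, \<dots>, xn]\<close> of cosets is evaluated, modulo \<open>I\<close>, to the product of the \<open>k\<close>-th convolution power
  of \<open>h0\<close> at \<open>x1\<close> with the values of \<open>h0\<close> at \<open>x2, \<dots>, xn\<close>.  The first letter is treated differently
  because the iterated reduced co-product expands the first letter.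
\<close>
primrec tail_value :: "('a \<Rightarrow>\<^sub>0 int) set list \<Rightarrow> 'a \<Rightarrow>\<^sub>0 int" where
  "tail_value [] = frag_of e"
| "tail_value (h # w) = frag_extend h0 (rep h) \<odot>\<^sub>B tail_value w"

primrec word_value :: "nat \<Rightarrow> ('a \<Rightarrow>\<^sub>0 int) set list \<Rightarrow> 'a \<Rightarrow>\<^sub>0 int" where
  "word_value k [] = 0"
| "word_value k (h # w) = frag_extend (cpow h0 k) (rep h) \<odot>\<^sub>B tail_value w"

lemma extend_Bc: "admissible f \<Longrightarrow> x \<in> Bc \<Longrightarrow> frag_extend f x \<in> Bc"
  by (rule Bc_extend) (simp_all only: admissible_Bc)

lemma tail_value_Bc: "set w \<subseteq> carrier H0 \<Longrightarrow> tail_value w \<in> Bc"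
proof (induction w)
  case (Cons h w)
  then have "frag_extend h0 (rep h) \<in> Bc" "tail_value w \<in> Bc"
    using extend_Bc[OF admissible_h0 rep_Bc] by auto
  then show ?case using mul_closed by simp
qed simp

lemma eqv_mul_left: "x \<doteq> y \<Longrightarrow> z \<in> Bc \<Longrightarrow> z \<odot>\<^sub>B x \<doteq> z \<odot>\<^sub>B y"
  using I_mul_left[of z "x - y"] by (simp add: eqv_def mul_diff_right)

lemma eqv_mul_right: "x \<doteq> y \<Longrightarrow> z \<in> Bc \<Longrightarrow> x \<odot>\<^sub>B z \<doteq> y \<odot>\<^sub>B z"
  using I_mul_right[of z "x - y"] by (simp add: eqv_def mul_diff_left)

lemma extend_rep_add:
  assumes "admissible f" "x \<in> carrier H0" "y \<in> carrier H0"
  shows "frag_extend f (rep (x \<oplus>\<^bsub>H0\<^esub> y)) \<doteq> frag_extend f (rep x) + frag_extend f (rep y)"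
  using admissible_extend[OF assms(1) rep_add[OF assms(2,3)]] by (simp add: frag_extend_add)

lemma tail_value_add:
  assumes "x \<in> carrier H0" "y \<in> carrier H0" "set w \<subseteq> carrier H0" "set v \<subseteq> carrier H0"
  shows "tail_value (w @ (x \<oplus>\<^bsub>H0\<^esub> y) # v) \<doteq> tail_value (w @ x # v) + tail_value (w @ y # v)"
  using assms(3)
proof (induction w)
  case Nil
  show ?case using eqv_mul_right[OF extend_rep_add[OF admissible_h0 assms(1,2)] tail_value_Bc[OF assms(4)]]
    by (simp add: mul_add_left)
next
  case (Cons h w)
  then have IH: "tail_value (w @ (x \<oplus>\<^bsub>H0\<^esub> y) # v) \<doteq> tail_value (w @ x # v) + tail_value (w @ y # v)" by simp
  have "frag_extend h0 (rep h) \<in> Bc" using extend_Bc[OF admissible_h0 rep_Bc] Cons.prems by simp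
  from eqv_mul_left[OF IH this] show ?case by (simp add: mul_add_right)
qed

lemma word_value_null:
  assumes "t \<in> tensor_null H0"
  shows "frag_extend (word_value k) t \<in> I"
  using assms
proof (induction rule: tensor_null.induct)
  case (multilinear x y xs ys)
  have "word_value k (xs @ [x \<oplus>\<^bsub>H0\<^esub> y] @ ys) \<doteq> word_value k (xs @ [x] @ ys) + word_value k (xs @ [y] @ ys)"
  proof (cases xs)
    case Nil
    have "set ys \<subseteq> carrier H0" using multilinear by auto
    from eqv_mul_right[OF extend_rep_add[OF admissible_cpow[OF admissible_h0] multilinear(1,2)] tail_value_Bc[OF this]]
    show ?thesis using Nil by (simp add: mul_add_left)
  next
    case (Cons h w)
    have hw: "h \<in> carrier H0" "set w \<subseteq> carrier H0" "set ys \<subseteq> carrier H0" using multilinear Cons by auto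
    have "frag_extend (cpow h0 k) (rep h) \<in> Bc"
      by (rule extend_Bc[OF admissible_cpow[OF admissible_h0] rep_Bc[OF hw(1)]])
    from eqv_mul_left[OF tail_value_add[OF multilinear(1,2) hw(2,3)] this]
    show ?thesis using Cons by (simp add: mul_add_right)
  qed
  then show ?case by (simp add: frag_extend_diff frag_extend_add eqv_def algebra_simps)
qed (simp_all add: frag_extend_diff I.zero I.diff)

lemma h0_e: "h0 e = 0" by (simp add: h0_def u_def dg_E)

lemma cpow_h0_e: "k \<ge> 1 \<Longrightarrow> cpow h0 k e = 0"
  by (cases k) (simp_all add: conv_def \<Delta>_E h0_e)

abbreviation one0 where "one0 \<equiv> \<one>\<^bsub>H0\<^esub>"

lemma one0: "one0 = I0 +>\<^bsub>BR K0\<^esub> frag_of e" "one0 \<in> carrier H0"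
  using coset_H0[of e] by (simp_all add: FactRing_def dg_E)

lemma extend_one0: "admissible f \<Longrightarrow> f e = 0 \<Longrightarrow> frag_extend f (rep one0) \<in> I"
  using admissible_extend[OF _ rep_coset(2)[OF I0], of f K0 "frag_of e"] unfolding one0 by (simp add: eqv_0)

lemma D0_eq: "D0 h = frag_extend (\<lambda>w. frag_of (map (\<lambda>a. I0 +>\<^bsub>BR K0\<^esub> a) w)) (D (rep h))"
  by (simp add: quot_coproduct_def rep_def)

lemma \<Delta>_K0: "c \<in> K0 \<Longrightarrow> p \<in># \<Delta> c \<Longrightarrow> fst p \<in> K0 \<and> snd p \<in> K0"
  using \<Delta>_closed[of c p] dg_\<Delta>[of c p] by auto

lemma keys_D0:
  assumes "h \<in> carrier H0"
  shows "Poly_Mapping.keys (D0 h) \<subseteq> {w. set w \<subseteq> carrier H0 \<and> w \<noteq> []}"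
proof -
  have CPk: "Poly_Mapping.keys (CP c) \<subseteq> {w. \<exists>a\<in>K0. \<exists>b\<in>K0. w = [frag_of a, frag_of b]}" if c: "c \<in> K0" for c
  proof -
    have *: "Poly_Mapping.keys (\<Sum>p\<in>#M. f p) \<subseteq> (\<Union>p\<in>set_mset M. Poly_Mapping.keys (f p))"
      for M :: "('a \<times> 'a) multiset" and f :: "'a \<times> 'a \<Rightarrow> ('a \<Rightarrow>\<^sub>0 int) list \<Rightarrow>\<^sub>0 int"
    proof (induction M)
      case (add x M)
      then show ?case using keys_add[of "f x" "\<Sum>p\<in>#M. f p"] by auto
    qed simp
    have "c \<in> K" using c by simp
    from CP[OF this] *[of "\<lambda>p. frag_of [frag_of (fst p), frag_of (snd p)]" "\<Delta> c"] show ?thesis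
      using \<Delta>_K0[OF c] by fastforce
  qed
  have "Poly_Mapping.keys (D (rep h)) \<subseteq> {w. \<exists>a\<in>K0. \<exists>b\<in>K0. w = [frag_of a, frag_of b]}"
    using keys_frag_extend[of CP "rep h"] carrier_H0[OF assms] CPk by fast
  then show ?thesis unfolding D0_eq
    using keys_frag_extend[of "\<lambda>w. frag_of (map (\<lambda>a. I0 +>\<^bsub>BR K0\<^esub> a) w)" "D (rep h)"] coset_H0 by fastforce
qed

abbreviation red0 where "red0 \<equiv> reduced H0 D0"

text \<open>
  Since \<open>h0\<close> and its powers vanish at the unit, the two terms by which the reduced co-product differs
  from the co-product contribute nothing.  The rest is the convolution of the \<open>k\<close>-th power with \<open>h0\<close>.
\<close>
lemma word_value_reduced:
  assumes k: "k \<ge> 1" and h: "h \<in> carrier H0" and w: "set w \<subseteq> carrier H0"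
  shows "frag_extend (word_value k) (on_first red0 (frag_of (h # w))) \<doteq> word_value (Suc k) (h # w)"
proof -
  note tv = tail_value_Bc[OF w]
  have ac: "admissible (cpow h0 k)" "admissible (cpow h0 (Suc k))" by (rule admissible_cpow[OF admissible_h0])+
  have "frag_extend (word_value k) (on_first red0 (frag_of (h # w))) = frag_extend (\<lambda>d. word_value k (d @ w)) (red0 h)"
    by (simp add: on_first_def frag_extend_frag_extend)
  also have "\<dots> = frag_extend (\<lambda>d. word_value k (d @ w)) (D0 h) - word_value k ([one0, h] @ w) - word_value k ([h, one0] @ w)"
    by (simp add: reduced_def frag_extend_diff)
  also have "frag_extend (\<lambda>d. word_value k (d @ w)) (D0 h)
      = frag_extend (\<lambda>c. frag_extend (\<lambda>v. word_value k (map (\<lambda>a. I0 +>\<^bsub>BR K0\<^esub> a) v @ w)) (CP c)) (rep h)"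
    by (simp add: D0_eq frag_extend_frag_extend)
  finally have 1: "frag_extend (word_value k) (on_first red0 (frag_of (h # w))) =
      frag_extend (\<lambda>c. frag_extend (\<lambda>v. word_value k (map (\<lambda>a. I0 +>\<^bsub>BR K0\<^esub> a) v @ w)) (CP c)) (rep h)
      - word_value k ([one0, h] @ w) - word_value k ([h, one0] @ w)" .
  have R: "frag_extend (\<lambda>c. frag_extend (\<lambda>v. word_value k (map (\<lambda>a. I0 +>\<^bsub>BR K0\<^esub> a) v @ w)) (CP c)) (rep h)
      \<doteq> frag_extend (\<lambda>c. cpow h0 (Suc k) c \<odot>\<^sub>B tail_value w) (rep h)"
  proof (rule eqv_extend[of _ K0])
    show "Poly_Mapping.keys (rep h) \<subseteq> K0" using carrier_H0[OF h] by blast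
    fix c assume c: "c \<in> K0"
    let ?c = "\<lambda>a. I0 +>\<^bsub>BR K0\<^esub> frag_of a"
    have cK: "c \<in> K" using c by simp
    have A: "frag_extend (\<lambda>v. word_value k (map (\<lambda>a. I0 +>\<^bsub>BR K0\<^esub> a) v @ w)) (CP c)
        = (\<Sum>p\<in>#\<Delta> c. frag_extend (cpow h0 k) (rep (?c (fst p))) \<odot>\<^sub>B (frag_extend h0 (rep (?c (snd p))) \<odot>\<^sub>B tail_value w))"
      unfolding CP[OF cK] by (simp add: frag_extend_sum_mset)
    have B: "(\<Sum>p\<in>#\<Delta> c. frag_extend (cpow h0 k) (rep (?c (fst p))) \<odot>\<^sub>B (frag_extend h0 (rep (?c (snd p))) \<odot>\<^sub>B tail_value w))
        \<doteq> (\<Sum>p\<in>#\<Delta> c. cpow h0 k (fst p) \<odot>\<^sub>B (h0 (snd p) \<odot>\<^sub>B tail_value w))"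
    proof (rule eqv_sum_mset, rule eqv_mul)
      fix p assume p: "p \<in># \<Delta> c"
      have pK: "fst p \<in> K0" "snd p \<in> K0" using \<Delta>_K0[OF c p] by auto
      show "frag_extend (cpow h0 k) (rep (?c (fst p))) \<doteq> cpow h0 k (fst p)"
        using admissible_extend[OF ac(1) rep_coset(2)[OF I0], of K0 "frag_of (fst p)"] by simp
      have "frag_extend h0 (rep (?c (snd p))) \<doteq> h0 (snd p)"
        using admissible_extend[OF admissible_h0 rep_coset(2)[OF I0], of K0 "frag_of (snd p)"] by simp
      from eqv_mul_right[OF this tv]
      show "frag_extend h0 (rep (?c (snd p))) \<odot>\<^sub>B tail_value w \<doteq> h0 (snd p) \<odot>\<^sub>B tail_value w" .
      show "cpow h0 k (fst p) \<in> Bc" using pK admissible_Bc[OF ac(1)] by blast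
      show "frag_extend h0 (rep (?c (snd p))) \<odot>\<^sub>B tail_value w \<in> Bc"
        by (rule mul_closed[OF extend_Bc[OF admissible_h0 rep_Bc[OF coset_H0[OF pK(2)]]] tv])
    qed
    have C: "(\<Sum>p\<in>#\<Delta> c. cpow h0 k (fst p) \<odot>\<^sub>B (h0 (snd p) \<odot>\<^sub>B tail_value w)) = cpow h0 (Suc k) c \<odot>\<^sub>B tail_value w"
    proof -
      have "cpow h0 k (fst p) \<odot>\<^sub>B (h0 (snd p) \<odot>\<^sub>B tail_value w) = (cpow h0 k (fst p) \<odot>\<^sub>B h0 (snd p)) \<odot>\<^sub>B tail_value w"
        if p: "p \<in># \<Delta> c" for p
        using \<Delta>_closed[OF cK p] by (intro mul_assoc[symmetric] admissible_Bc[OF ac(1)] admissible_Bc[OF admissible_h0] tv) auto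
      then show ?thesis by (simp add: conv_def mul_sum_left cong: image_mset_cong)
    qed
    show "frag_extend (\<lambda>v. word_value k (map (\<lambda>a. I0 +>\<^bsub>BR K0\<^esub> a) v @ w)) (CP c) \<doteq> cpow h0 (Suc k) c \<odot>\<^sub>B tail_value w"
      using B unfolding A C .
  qed
  have Q: "frag_extend (\<lambda>c. cpow h0 (Suc k) c \<odot>\<^sub>B tail_value w) (rep h) = word_value (Suc k) (h # w)"
  proof -
    have "frag_extend (\<lambda>c. g c \<odot>\<^sub>B y) x = frag_extend g x \<odot>\<^sub>B y" for g :: "'a \<Rightarrow> 'a \<Rightarrow>\<^sub>0 int" and x y
      by (rule frag_induction[of x UNIV "\<lambda>x. frag_extend (\<lambda>c. g c \<odot>\<^sub>B y) x = frag_extend g x \<odot>\<^sub>B y"])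
        (simp_all add: frag_extend_diff mul_diff_left)
    then show ?thesis by simp
  qed
  have 2: "frag_extend (\<lambda>c. frag_extend (\<lambda>v. word_value k (map (\<lambda>a. I0 +>\<^bsub>BR K0\<^esub> a) v @ w)) (CP c)) (rep h)
      \<doteq> word_value (Suc k) (h # w)"
    using R unfolding Q .
  have 3: "word_value k ([one0, h] @ w) \<in> I"
    using I_mul_right[OF tail_value_Bc[of "h # w"] extend_one0[OF ac(1) cpow_h0_e[OF k]]] h w by simp
  have "tail_value (one0 # w) \<in> I"
    using I_mul_right[OF tv extend_one0[OF admissible_h0 h0_e]] by simp
  then have 4: "word_value k ([h, one0] @ w) \<in> I"
    using I_mul_left[OF extend_Bc[OF ac(1) rep_Bc[OF h]]] by simp
  show ?thesis unfolding 1 using eqv_diff[OF eqv_diff[OF 2 3[folded eqv_0]] 4[folded eqv_0]] by simp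
qed

lemma word_value_on_first:
  assumes k: "k \<ge> 1" and t: "Poly_Mapping.keys t \<subseteq> {w. set w \<subseteq> carrier H0 \<and> w \<noteq> []}"
  shows "frag_extend (word_value k) (on_first red0 t) \<doteq> frag_extend (word_value (Suc k)) t"
  using t
proof (induction t rule: frag_induction)
  case (one w)
  then obtain h v where "w = h # v" "h \<in> carrier H0" "set v \<subseteq> carrier H0" by (cases w) auto
  then show ?case using word_value_reduced[OF k] by (simp del: word_value.simps)
next
  case (diff a b)
  then show ?case by (simp add: on_first_def frag_extend_diff eqv_diff)
qed (simp add: on_first_def)

lemma keys_on_first:
  assumes "Poly_Mapping.keys t \<subseteq> {w. set w \<subseteq> carrier H0 \<and> w \<noteq> []}"
  shows "Poly_Mapping.keys (on_first red0 t) \<subseteq> {w. set w \<subseteq> carrier H0 \<and> w \<noteq> []}"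
proof -
  have r: "Poly_Mapping.keys (red0 h) \<subseteq> {w. set w \<subseteq> carrier H0 \<and> w \<noteq> []}" if h: "h \<in> carrier H0" for h
    unfolding reduced_def
    using keys_diff[of "D0 h - frag_of [one0, h]" "frag_of [h, one0]"] keys_diff[of "D0 h" "frag_of [one0, h]"]
      keys_D0[OF h] one0(2) h by fastforce
  have "Poly_Mapping.keys (frag_extend (\<lambda>d. frag_of (d @ tl w)) (red0 (hd w))) \<subseteq> {w. set w \<subseteq> carrier H0 \<and> w \<noteq> []}"
    if "w \<in> Poly_Mapping.keys t" for w
  proof -
    have wt: "set w \<subseteq> carrier H0" "w \<noteq> []" using that assms by blast+
    then have w: "hd w \<in> carrier H0" "set (tl w) \<subseteq> carrier H0"
      by (cases w; simp)+
    show ?thesis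
    proof
      fix v assume "v \<in> Poly_Mapping.keys (frag_extend (\<lambda>d. frag_of (d @ tl w)) (red0 (hd w)))"
      then obtain d where "d \<in> Poly_Mapping.keys (red0 (hd w))" "v = d @ tl w"
        using keys_frag_extend[of "\<lambda>d. frag_of (d @ tl w)" "red0 (hd w)"] by auto
      then show "v \<in> {w. set w \<subseteq> carrier H0 \<and> w \<noteq> []}" using r[OF w(1)] w(2) by auto
    qed
  qed
  then show ?thesis unfolding on_first_def
    using keys_frag_extend[of "\<lambda>w. frag_extend (\<lambda>d. frag_of (d @ tl w)) (red0 (hd w))" t] by blast
qed

lemma word_value_iter:
  assumes h: "h \<in> carrier H0"
  shows "Poly_Mapping.keys (reduced_iter H0 D0 n h) \<subseteq> {w. set w \<subseteq> carrier H0 \<and> w \<noteq> []} \<and>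
    (\<forall>k\<ge>1. frag_extend (word_value k) (reduced_iter H0 D0 n h) \<doteq> frag_extend (cpow h0 (n + k)) (rep h))"
proof (induction n)
  case 0
  have "frag_extend (cpow h0 k) (rep h) \<odot>\<^sub>B frag_of e = frag_extend (cpow h0 k) (rep h)" for k
    by (rule mul_one_right[OF extend_Bc[OF admissible_cpow[OF admissible_h0] rep_Bc[OF h]]])
  then show ?case using h by simp
next
  case (Suc n)
  have "frag_extend (word_value k) (reduced_iter H0 D0 (Suc n) h) \<doteq> frag_extend (cpow h0 (Suc n + k)) (rep h)" if k: "k \<ge> 1" for k
  proof -
    have "frag_extend (word_value k) (reduced_iter H0 D0 (Suc n) h) \<doteq> frag_extend (word_value (Suc k)) (reduced_iter H0 D0 n h)"
      using word_value_on_first[OF k] Suc by simp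
    also have "\<dots> \<doteq> frag_extend (cpow h0 (n + Suc k)) (rep h)"
      using Suc[THEN conjunct2, rule_format, of "Suc k"] by (simp del: cpow.simps)
    finally show ?thesis by (simp del: cpow.simps)
  qed
  then show ?case using Suc keys_on_first by simp
qed

text \<open>
  In degree \<open>0\<close> and outside the classes of identities, evaluating a vanishing iterate of the reduced
  co-product with \<open>word_value\<close> shows that all higher powers of \<open>h0\<close> vanish modulo \<open>I\<close>.  On the class of an
  identity \<open>h0\<close> already takes values in \<open>I\<close>, and in positive degree \<open>h0\<close> and hence its powers are \<open>0\<close>.
\<close>
theorem locally_nilpotent_h0:
  assumes con: "connected_coalgebra H0 D0 (quot_counit eps)"
  shows "\<exists>N. \<forall>n\<ge>N. c \<in> K \<longrightarrow> cpow h0 n c \<in> I"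
proof (cases "c \<in> K")
  case c: True
  consider (pos) "dg c > 0" | (ide) "c \<in> E" | (red) "dg c = 0" "c \<notin> E" by blast
  then show ?thesis
  proof cases
    case pos
    have "cpow h0 (Suc n) d = 0" if "d \<in> K" "dg d > 0" for n d
      using that
    proof (induction n arbitrary: d)
      case 0
      have "conv u h0 d = h0 d" by (rule conv_u_left[OF 0(1) admissible_Bc[OF admissible_h0]])
      moreover have "h0 d = 0" using 0 by (simp add: h0_def)
      ultimately show ?case by simp
    next
      case (Suc n)
      have "cpow h0 (Suc n) (fst p) \<odot>\<^sub>B h0 (snd p) = 0" if p: "p \<in># \<Delta> d" for p
      proof (cases "dg (snd p) = 0")
        case True
        then show ?thesis using Suc.IH[of "fst p"] \<Delta>_closed[OF Suc.prems(1) p] dg_\<Delta>[OF Suc.prems(1) p] Suc.prems(2)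
          by (simp del: cpow.simps)
      qed (simp add: h0_def)
      then show ?case unfolding cpow.simps(2)[of h0 "Suc n"] conv_def[of "cpow h0 (Suc n)"]
        by (simp del: cpow.simps cong: image_mset_cong)
    qed
    then have "cpow h0 (Suc n) c \<in> I" for n using c pos I.zero by (simp del: cpow.simps)
    then show ?thesis by (intro exI[of _ 1]) (auto dest: Suc_le_D simp del: cpow.simps)
  next
    case ide
    have "cpow h0 (Suc n) c \<in> I" for n
    proof -
      have "h0 c = - (frag_of (e \<star> (c \<star> e)) - frag_of (e \<star> e))" using ide by (simp add: h0_def u_def dg_E)
      also have "\<dots> \<in> I" using ide by (intro I_uminus I.gen) simp_all
      finally have "cpow h0 n c \<odot>\<^sub>B h0 c \<in> I"
        by (rule I_mul_left[OF admissible_Bc[OF admissible_cpow[OF admissible_h0] c]])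
      then show ?thesis using ide by (simp add: conv_def \<Delta>_E)
    qed
    then show ?thesis by (intro exI[of _ 1]) (auto dest: Suc_le_D simp del: cpow.simps)
  next
    case red
    define h where "h = I0 +>\<^bsub>BR K0\<^esub> frag_of c"
    have h: "h \<in> carrier H0" unfolding h_def using c red by (intro coset_H0) simp
    have r: "rep h \<doteq> frag_of c" unfolding h_def by (rule rep_coset(2)[OF I0])
    have "quot_counit eps h = eps (rep h)" by (simp add: quot_counit_def rep_def)
    also have "\<dots> = 0" using eps_eqv[OF r] red by (simp add: eps_def)
    finally obtain n where "tensor_eq H0 (reduced_iter H0 D0 n h) 0"
      using con h unfolding connected_coalgebra_def by blast
    then have n: "reduced_iter H0 D0 n h \<in> tensor_null H0" by (simp add: tensor_eq_def)
    have "cpow h0 m c \<in> I" if "m \<ge> Suc n" for m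
    proof -
      have ge: "m - n \<ge> 1" and eq: "n + (m - n) = m" using that by auto
      have 1: "frag_extend (word_value (m - n)) (reduced_iter H0 D0 n h) \<doteq> frag_extend (cpow h0 m) (rep h)"
        using word_value_iter[OF h, of n, THEN conjunct2, rule_format, OF ge] unfolding eq .
      have 2: "frag_extend (cpow h0 m) (rep h) \<doteq> cpow h0 m c"
        using admissible_extend[OF admissible_cpow[OF admissible_h0] r] by simp
      have 3: "frag_extend (word_value (m - n)) (reduced_iter H0 D0 n h) \<doteq> 0"
        using word_value_null[OF n] by (simp add: eqv_0)
      have "cpow h0 m c \<doteq> 0" using eqv_trans[OF eqv_sym[OF eqv_trans[OF 1 2]] 3] .
      then show ?thesis by (simp add: eqv_0)
    qed
    then show ?thesis by blast
  qed
qed simp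

section \<open>The antipode on the quotient\<close>

abbreviation "H \<equiv> BR K Quot I"

lemma coset_eq:
  assumes "a \<doteq> b" "a \<in> Bc" "b \<in> Bc"
  shows "I +>\<^bsub>BR K\<^esub> a = I +>\<^bsub>BR K\<^esub> b"
proof -
  have "x \<in> I +>\<^bsub>BR K\<^esub> b" if "x \<in> I +>\<^bsub>BR K\<^esub> a" "a \<doteq> b" for x a b
  proof -
    from that(1) obtain i where "i \<in> I" "x = i + a" by (auto simp: coset_mem)
    then have "i + (a - b) \<in> I" "x = (i + (a - b)) + b" using I_add that(2) by (auto simp: eqv_def)
    then show ?thesis unfolding coset_mem by blast
  qed
  then show ?thesis using assms(1) eqv_sym by blast
qed

lemma coset_int_multiple:
  assumes "a \<in> Bc"
  shows "[n] \<cdot>\<^bsub>H\<^esub> (I +>\<^bsub>BR K\<^esub> a) = I +>\<^bsub>BR K\<^esub> (frag_cmul n a)"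
proof -
  interpret ideal I "BR K" by (rule ideal_I)
  interpret Q: ring H by (rule quotient_is_ring)
  interpret h: ring_hom_ring "BR K" H "(+>\<^bsub>BR K\<^esub>) I" by (rule rcos_ring_hom_ring)
  have nat: "[m] \<cdot>\<^bsub>H\<^esub> (I +>\<^bsub>BR K\<^esub> a) = I +>\<^bsub>BR K\<^esub> (frag_cmul (int m) a)" for m :: nat
  proof (induction m)
    case 0
    then show ?case using h.hom_zero by (simp add: add_pow_def)
  next
    case (Suc m)
    have k: "frag_cmul (int m) a \<in> carrier (BR K)" "a \<in> carrier (BR K)" using assms keys_cmul[of "int m" a] by auto
    have "[Suc m] \<cdot>\<^bsub>H\<^esub> (I +>\<^bsub>BR K\<^esub> a) = [m] \<cdot>\<^bsub>H\<^esub> (I +>\<^bsub>BR K\<^esub> a) \<oplus>\<^bsub>H\<^esub> (I +>\<^bsub>BR K\<^esub> a)"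
      by (simp add: add_pow_def)
    also have "\<dots> = I +>\<^bsub>BR K\<^esub> (frag_cmul (int m) a + a)" unfolding Suc using h.hom_add[OF k] by simp
    also have "frag_cmul (int m) a + a = frag_cmul (int (Suc m)) a"
      using frag_cmul_distrib[of "int m" 1 a] by (simp add: add.commute)
    finally show ?case .
  qed
  show ?thesis
  proof (cases "n \<ge> 0")
    case True
    then show ?thesis using nat[of "nat n"] by (simp add: add_pow_int_ge)
  next
    case False
    have k: "frag_cmul (- n) a \<in> carrier (BR K)" using assms keys_cmul[of "- n" a] by auto
    have "[n] \<cdot>\<^bsub>H\<^esub> (I +>\<^bsub>BR K\<^esub> a) = \<ominus>\<^bsub>H\<^esub> (I +>\<^bsub>BR K\<^esub> (frag_cmul (- n) a))"
      using False nat[of "nat (- n)"] by (simp add: add_pow_int_lt)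
    also have "\<dots> = I +>\<^bsub>BR K\<^esub> (\<ominus>\<^bsub>BR K\<^esub> frag_cmul (- n) a)" using h.hom_a_inv[OF k] by simp
    also have "\<ominus>\<^bsub>BR K\<^esub> frag_cmul (- n) a = frag_cmul n a"
    proof (rule minus_equality)
      show "frag_cmul n a \<oplus>\<^bsub>BR K\<^esub> frag_cmul (- n) a = \<zero>\<^bsub>BR K\<^esub>" using frag_cmul_distrib[of n "- n" a] by simp
    qed (use assms keys_cmul[of n a] keys_cmul[of "- n" a] in auto)
    finally show ?thesis .
  qed
qed

text \<open>
  Both sides are additive in \<open>b\<close>, so it suffices to compare them on the basis.
\<close>
lemma convolution_on_cosets:
  assumes f: "admissible f" and g: "admissible g" and b: "b \<in> Bc"
    and F: "\<And>a. a \<in> Bc \<Longrightarrow> F (I +>\<^bsub>BR K\<^esub> a) = I +>\<^bsub>BR K\<^esub> frag_extend f a"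
    and G: "\<And>a. a \<in> Bc \<Longrightarrow> G (I +>\<^bsub>BR K\<^esub> a) = I +>\<^bsub>BR K\<^esub> frag_extend g a"
  shows "int_combination H (\<lambda>w. F (w ! 0) \<otimes>\<^bsub>H\<^esub> G (w ! 1))
      (frag_extend (\<lambda>w. frag_of (map (\<lambda>a. I +>\<^bsub>BR K\<^esub> a) w)) (D b)) = I +>\<^bsub>BR K\<^esub> frag_extend (conv f g) b"
proof -
  interpret ideal I "BR K" by (rule ideal_I)
  interpret Q: ring H by (rule quotient_is_ring)
  interpret h: ring_hom_ring "BR K" H "(+>\<^bsub>BR K\<^esub>) I" by (rule rcos_ring_hom_ring)
  let ?c = "\<lambda>a. I +>\<^bsub>BR K\<^esub> a"
  define L where "L w = F (w ! 0) \<otimes>\<^bsub>H\<^esub> G (w ! 1)" for w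
  define Q where "Q = {[?c (frag_of a), ?c (frag_of b)] | a b. a \<in> K \<and> b \<in> K}"
  define A where "A t = int_combination H L t" for t
  have Lc: "L [?c (frag_of a), ?c (frag_of b)] = ?c (f a \<odot>\<^sub>B g b)" if "a \<in> K" "b \<in> K" for a b
  proof -
    have "f a \<in> carrier (BR K)" "g b \<in> carrier (BR K)" using admissible_Bc[OF f that(1)] admissible_Bc[OF g that(2)] by simp_all
    then show ?thesis using h.hom_mult[of "f a" "g b"] F[of "frag_of a"] G[of "frag_of b"] that by (simp add: L_def)
  qed
  have cc: "?c a \<in> carrier H" if "a \<in> Bc" for a using h.hom_closed[of a] that by simp
  have LQ: "L \<in> Q \<rightarrow> carrier H"
    using Lc cc[OF mul_closed[OF admissible_Bc[OF f] admissible_Bc[OF g]]] by (auto simp: Q_def)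
  have Aadd: "A (t + t') = A t \<oplus>\<^bsub>H\<^esub> A t'" if "Poly_Mapping.keys t \<subseteq> Q" "Poly_Mapping.keys t' \<subseteq> Q" for t t'
    unfolding A_def by (rule Q.int_combination_add[OF that LQ])
  have Acl: "A t \<in> carrier H" if "Poly_Mapping.keys t \<subseteq> Q" for t
    unfolding A_def using LQ that by (intro Q.int_combination_closed) blast
  have A0: "A 0 = ?c 0"
    using h.hom_zero by (simp add: A_def int_combination_def)
  have Asum: "Poly_Mapping.keys (\<Sum>p\<in>#M. frag_of [?c (frag_of (fst p)), ?c (frag_of (snd p))]) \<subseteq> Q \<and>
      A (\<Sum>p\<in>#M. frag_of [?c (frag_of (fst p)), ?c (frag_of (snd p))]) = ?c (\<Sum>p\<in>#M. f (fst p) \<odot>\<^sub>B g (snd p))"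
    if "\<And>p. p \<in># M \<Longrightarrow> fst p \<in> K \<and> snd p \<in> K" for M
    using that
  proof (induction M)
    case empty
    then show ?case by (simp add: A0)
  next
    case (add p M)
    let ?w = "[?c (frag_of (fst p)), ?c (frag_of (snd p))]"
    let ?s = "\<Sum>p\<in>#M. frag_of [?c (frag_of (fst p)), ?c (frag_of (snd p))]"
    have p: "fst p \<in> K" "snd p \<in> K" and IH: "Poly_Mapping.keys ?s \<subseteq> Q" "A ?s = ?c (\<Sum>p\<in>#M. f (fst p) \<odot>\<^sub>B g (snd p))"
      using add by auto
    have wQ: "?w \<in> Q" using p by (auto simp: Q_def)
    then have k: "Poly_Mapping.keys (frag_of ?w) \<subseteq> Q" by simp
    have Lw: "L ?w = ?c (f (fst p) \<odot>\<^sub>B g (snd p))" by (rule Lc[OF p])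
    have c1: "f (fst p) \<odot>\<^sub>B g (snd p) \<in> Bc" using mul_closed[OF admissible_Bc[OF f p(1)] admissible_Bc[OF g p(2)]] .
    have c2: "(\<Sum>p\<in>#M. f (fst p) \<odot>\<^sub>B g (snd p)) \<in> Bc"
      using add.prems by (intro Bc_sum_mset mul_closed admissible_Bc[OF f] admissible_Bc[OF g]) auto
    have "A (frag_of ?w + ?s) = A (frag_of ?w) \<oplus>\<^bsub>H\<^esub> A ?s" by (rule Aadd[OF k IH(1)])
    also have "A (frag_of ?w) = ?c (f (fst p) \<odot>\<^sub>B g (snd p))"
      unfolding A_def Lw[symmetric] by (rule Q.int_combination_of) (use LQ wQ in blast)
    also have "?c (f (fst p) \<odot>\<^sub>B g (snd p)) \<oplus>\<^bsub>H\<^esub> A ?s = ?c (f (fst p) \<odot>\<^sub>B g (snd p) + (\<Sum>p\<in>#M. f (fst p) \<odot>\<^sub>B g (snd p)))"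
      unfolding IH(2) using h.hom_add[of "f (fst p) \<odot>\<^sub>B g (snd p)" "\<Sum>p\<in>#M. f (fst p) \<odot>\<^sub>B g (snd p)"] c1 c2 by simp
    finally show ?case using k IH(1) keys_add[of "frag_of ?w" ?s] by auto
  qed
  let ?T = "\<lambda>b. frag_extend (\<lambda>w. frag_of (map ?c w)) (D b)"
  have T_of: "?T (frag_of c) = (\<Sum>p\<in>#\<Delta> c. frag_of [?c (frag_of (fst p)), ?c (frag_of (snd p))])" if "c \<in> K" for c
    by (simp add: CP[OF that] frag_extend_sum_mset)
  have "Poly_Mapping.keys (?T b) \<subseteq> Q \<and> A (?T b) = ?c (frag_extend (conv f g) b)"
    using b
  proof (induction b rule: Bc_induct)
    case zero
    then show ?case by (simp add: A0)
  next
    case (one c)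
    have "\<And>p. p \<in># \<Delta> c \<Longrightarrow> fst p \<in> K \<and> snd p \<in> K" using \<Delta>_closed[OF one] by blast
    from Asum[OF this] show ?case unfolding T_of[OF one] by (simp add: conv_def)
  next
    case (diff a b)
    have k: "Poly_Mapping.keys (?T a - ?T b) \<subseteq> Q" using diff keys_diff[of "?T a" "?T b"] by blast
    have "A (?T a) = A (?T a - ?T b + ?T b)" by simp
    also have "\<dots> = A (?T a - ?T b) \<oplus>\<^bsub>H\<^esub> A (?T b)" using k diff by (intro Aadd) simp_all
    finally have 1: "A (?T a - ?T b) \<oplus>\<^bsub>H\<^esub> A (?T b) = A (?T a)" ..
    have cl: "frag_extend (conv f g) x \<in> Bc" if "x \<in> Bc" for x
      by (rule extend_Bc[OF admissible_conv[OF f g] that])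
    have c: "frag_extend (conv f g) a \<in> Bc" "frag_extend (conv f g) b \<in> Bc" by (rule cl, fact)+
    have "?c (frag_extend (conv f g) a - frag_extend (conv f g) b) \<oplus>\<^bsub>H\<^esub> ?c (frag_extend (conv f g) b) = ?c (frag_extend (conv f g) a)"
      using h.hom_add[of "frag_extend (conv f g) a - frag_extend (conv f g) b" "frag_extend (conv f g) b"] c Bc_diff[OF c] by simp
    then have "A (?T a - ?T b) = ?c (frag_extend (conv f g) a - frag_extend (conv f g) b)"
      using 1 diff Acl[OF k] cc[OF Bc_diff[OF c]] cc[OF c(2)] Q.add.right_cancel by metis
    then show ?case using k by (simp add: frag_extend_diff)
  qed
  then show ?thesis unfolding A_def L_def by blast
qed

theorem antipode_exists:
  assumes co: "coassociative (BR K) D" and con: "connected_coalgebra H0 D0 (quot_counit eps)"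
  shows "\<exists>S. is_antipode H (quot_coproduct (BR K) I D) (quot_counit eps) S"
proof -
  interpret co: coassociative_class_bialgebra K "(\<star>)" e E \<Delta> dg
    by unfold_locales (rule \<Delta>_coassoc_from_tensor[OF co])
  have "co.locally_nilpotent h0"
    unfolding co.locally_nilpotent_def using locally_nilpotent_h0[OF con] by blast
  then obtain s where s: "admissible s" and l: "\<And>c. c \<in> K \<Longrightarrow> conv s frag_of c \<doteq> u c"
    and r: "\<And>c. c \<in> K \<Longrightarrow> conv frag_of s c \<doteq> u c"
    using co.convolution_inverse by blast
  interpret ideal I "BR K" by (rule ideal_I)
  interpret Q: ring H by (rule quotient_is_ring)
  interpret h: ring_hom_ring "BR K" H "(+>\<^bsub>BR K\<^esub>) I" by (rule rcos_ring_hom_ring)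
  let ?c = "\<lambda>a. I +>\<^bsub>BR K\<^esub> a"
  have rp: "rep (?c a) \<doteq> a" "rep (?c a) \<in> ?c a" for a using rep_coset[OF order_refl I.zero] by blast+
  have rB: "rep (?c a) \<in> Bc" if "a \<in> Bc" for a
  proof -
    from rp(2)[of a] obtain j where "j \<in> I" "rep (?c a) = j + a" unfolding coset_mem by blast
    then show ?thesis using Bc_add[OF I_Bc that] by simp
  qed
  define S where "S x = ?c (frag_extend s (rep x))" for x
  have S: "S (?c a) = ?c (frag_extend s a)" if a: "a \<in> Bc" for a
    unfolding S_def by (rule coset_eq[OF admissible_extend[OF s rp(1)] extend_Bc[OF s rB[OF a]] extend_Bc[OF s a]])
  have id: "?c a = ?c (frag_extend frag_of a)" for a
    by (simp flip: frag_expansion)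
  have carrier: "\<exists>a. a \<in> Bc \<and> x = ?c a" if "x \<in> carrier H" for x
    using that unfolding carrier_quot by auto
  have hom: "S \<in> hom (add_monoid H) (add_monoid H)"
  proof (rule homI)
    fix x assume "x \<in> carrier (add_monoid H)"
    then obtain a where a: "a \<in> Bc" "x = ?c a" using carrier by auto
    show "S x \<in> carrier (add_monoid H)"
      using h.hom_closed[of "frag_extend s a"] extend_Bc[OF s a(1)] unfolding a(2) S[OF a(1)] by simp
  next
    fix x y assume "x \<in> carrier (add_monoid H)" "y \<in> carrier (add_monoid H)"
    then obtain a b where a: "a \<in> Bc" "x = ?c a" and b: "b \<in> Bc" "y = ?c b" using carrier by (metis partial_object.simps(1) monoid.simps)
    have 1: "x \<oplus>\<^bsub>H\<^esub> y = ?c (a + b)" unfolding a(2) b(2) using h.hom_add[of a b] a(1) b(1) by simp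
    have 2: "?c (frag_extend s a) \<oplus>\<^bsub>H\<^esub> ?c (frag_extend s b) = ?c (frag_extend s a + frag_extend s b)"
      using h.hom_add[of "frag_extend s a" "frag_extend s b"] extend_Bc[OF s a(1)] extend_Bc[OF s b(1)] by simp
    have "S (x \<oplus>\<^bsub>H\<^esub> y) = S x \<oplus>\<^bsub>H\<^esub> S y"
      unfolding 1 S[OF Bc_add[OF a(1) b(1)]] frag_extend_add unfolding a(2) b(2) S[OF a(1)] S[OF b(1)] 2 ..
    then show "S (x \<otimes>\<^bsub>add_monoid H\<^esub> y) = S x \<otimes>\<^bsub>add_monoid H\<^esub> S y" by simp
  qed
  have unit: "?c (frag_extend f (rep x)) = [quot_counit eps x] \<cdot>\<^bsub>H\<^esub> \<one>\<^bsub>H\<^esub>"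
    if f: "\<And>c. c \<in> K \<Longrightarrow> f c \<doteq> u c" "\<And>c. c \<in> K \<Longrightarrow> f c \<in> Bc" and x: "rep x \<in> Bc" for f x
  proof -
    have "frag_extend f (rep x) \<doteq> frag_extend u (rep x)" using x f(1) by (intro eqv_extend[of _ K]) auto
    then have "?c (frag_extend f (rep x)) = ?c (frag_extend u (rep x))"
      by (rule coset_eq) (rule Bc_extend[OF x], use f u_Bc in blast)+
    also have "\<dots> = [eps (rep x)] \<cdot>\<^bsub>H\<^esub> (?c (frag_of e))"
      unfolding u_eps by (rule coset_int_multiple[symmetric]) simp
    also have "?c (frag_of e) = \<one>\<^bsub>H\<^esub>" by (simp add: FactRing_def)
    finally show ?thesis by (simp add: quot_counit_def rep_def)
  qed
  have conv_eq: "convolution H (quot_coproduct (BR K) I D) f g x =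
      int_combination H (\<lambda>w. f (w ! 0) \<otimes>\<^bsub>H\<^esub> g (w ! 1))
        (frag_extend (\<lambda>w. frag_of (map ?c w)) (D (rep x)))" for f g x
    by (simp add: convolution_def int_combination_def quot_coproduct_def rep_def)
  have "is_antipode H (quot_coproduct (BR K) I D) (quot_counit eps) S"
    unfolding is_antipode_def
  proof (intro conjI ballI hom)
    fix x assume "x \<in> carrier H"
    then obtain a where a: "a \<in> Bc" "x = ?c a" using carrier by blast
    have x: "rep x \<in> Bc" unfolding a(2) by (rule rB[OF a(1)])
    show "convolution H (quot_coproduct (BR K) I D) S (\<lambda>y. y) x = [quot_counit eps x] \<cdot>\<^bsub>H\<^esub> \<one>\<^bsub>H\<^esub>"
      unfolding conv_eq
      by (subst convolution_on_cosets[where F=S and G="\<lambda>y. y" and f=s and g=frag_of, OF s admissible_id x],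
        erule S, rule id) (rule unit[OF l admissible_Bc[OF admissible_conv[OF s admissible_id]] x])
    show "convolution H (quot_coproduct (BR K) I D) (\<lambda>y. y) S x = [quot_counit eps x] \<cdot>\<^bsub>H\<^esub> \<one>\<^bsub>H\<^esub>"
      unfolding conv_eq
      by (subst convolution_on_cosets[where F="\<lambda>y. y" and G=S and f=frag_of and g=s, OF admissible_id s x],
        rule id, erule S) (rule unit[OF r admissible_Bc[OF admissible_conv[OF admissible_id s]] x])
  qed
  then show ?thesis by (rule exI[of _ S])
qed

end

section \<open>Isomorphism classes of morphisms\<close>

text \<open>
  A multiset indexed by equivalence classes can be computed from any transversal.  All statements
  about the co-product below are proved by exhibiting a transversal of the factorizations.
\<close>
lemma image_quotient_transversal:
  assumes eq: "equiv A r" and fin: "finite Ix" and x: "\<And>i. i \<in> Ix \<Longrightarrow> x i \<in> A"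
    and ex: "\<And>a. a \<in> A \<Longrightarrow> \<exists>i\<in>Ix. (x i, a) \<in> r"
    and un: "\<And>i j. i \<in> Ix \<Longrightarrow> j \<in> Ix \<Longrightarrow> (x i, x j) \<in> r \<Longrightarrow> i = j"
    and P: "\<And>a b. (a, b) \<in> r \<Longrightarrow> P a = P b"
  shows "image_mset (\<lambda>k. P (SOME p. p \<in> k)) (mset_set (A // r)) = image_mset (\<lambda>i. P (x i)) (mset_set Ix)"
proof -
  let ?h = "\<lambda>i. r `` {x i}"
  have inj: "inj_on ?h Ix"
  proof (rule inj_onI)
    fix i j assume ij: "i \<in> Ix" "j \<in> Ix" and e: "?h i = ?h j"
    have "(x i, x j) \<in> r" using eq_equiv_class[OF e eq x[OF ij(2)]] .
    then show "i = j" using un ij by blast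
  qed
  have im: "A // r = ?h ` Ix"
  proof
    show "A // r \<subseteq> ?h ` Ix"
    proof
      fix k assume "k \<in> A // r"
      then obtain a where a: "a \<in> A" "k = r `` {a}" by (auto elim: quotientE)
      then obtain i where "i \<in> Ix" "(x i, a) \<in> r" using ex by blast
      then show "k \<in> ?h ` Ix" using equiv_class_eq[OF eq] a(2) by blast
    qed
    show "?h ` Ix \<subseteq> A // r" using x by (auto intro: quotientI)
  qed
  have "P (SOME p. p \<in> ?h i) = P (x i)" if "i \<in> Ix" for i
  proof -
    have "x i \<in> ?h i" using equiv_class_self[OF eq x[OF that]] .
    then have "(SOME p. p \<in> ?h i) \<in> ?h i" by (rule someI)
    then show ?thesis using P by auto
  qed
  then show ?thesis
    unfolding im image_mset_mset_set[OF inj, symmetric]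
    by (auto simp: image_mset.compositionality fin intro!: image_mset_cong)
qed

context category
begin

lemma iso_hom_is_iso: "f \<in> iso_hom C X Y \<Longrightarrow> is_iso C f"
  by (simp add: iso_hom_def)

lemma arr_iso_iff:
  assumes "f \<in> Arr C" "g \<in> Arr C"
  shows "arr_iso C f g \<longleftrightarrow> (\<exists>\<sigma> \<in> iso_hom C (Dom C f) (Dom C g). \<exists>\<sigma>' \<in> iso_hom C (Cod C f) (Cod C g). \<sigma>' \<bullet> f = g \<bullet> \<sigma>)"
  unfolding arr_iso_def
proof (intro bex_cong refl)
  fix \<sigma> \<sigma>' assume s: "\<sigma> \<in> iso_hom C (Dom C f) (Dom C g)" "\<sigma>' \<in> iso_hom C (Cod C f) (Cod C g)"
  note [simp] = iso_homD[OF s(1)] iso_homD[OF s(2)] assms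
  show "f = inv_arr C \<sigma>' \<bullet> g \<bullet> \<sigma> \<longleftrightarrow> \<sigma>' \<bullet> f = g \<bullet> \<sigma>"
  proof
    assume e: "f = inv_arr C \<sigma>' \<bullet> g \<bullet> \<sigma>"
    show "\<sigma>' \<bullet> f = g \<bullet> \<sigma>" by (subst e) simp
  next
    assume e: "\<sigma>' \<bullet> f = g \<bullet> \<sigma>"
    have "inv_arr C \<sigma>' \<bullet> \<sigma>' \<bullet> f = f" by simp
    then show "f = inv_arr C \<sigma>' \<bullet> g \<bullet> \<sigma>" unfolding e by simp
  qed
qed

lemma arr_isoI:
  assumes "f \<in> Arr C" "g \<in> Arr C" "\<sigma> \<in> iso_hom C (Dom C f) (Dom C g)" "\<sigma>' \<in> iso_hom C (Cod C f) (Cod C g)"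
    "\<sigma>' \<bullet> f = g \<bullet> \<sigma>"
  shows "arr_iso C f g"
  using assms arr_iso_iff by blast

lemma arr_iso_refl: "f \<in> Arr C \<Longrightarrow> arr_iso C f f"
  by (rule arr_isoI[of f f "Ide C (Dom C f)" "Ide C (Cod C f)"]) (simp_all add: ide_iso_hom)

lemma arr_iso_sym:
  assumes "f \<in> Arr C" "g \<in> Arr C" "arr_iso C f g"
  shows "arr_iso C g f"
proof -
  obtain \<sigma> \<sigma>' where s: "\<sigma> \<in> iso_hom C (Dom C f) (Dom C g)" "\<sigma>' \<in> iso_hom C (Cod C f) (Cod C g)"
    and e: "\<sigma>' \<bullet> f = g \<bullet> \<sigma>" using assms arr_iso_iff by blast
  note [simp] = iso_homD[OF s(1)] iso_homD[OF s(2)] assms(1,2)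
  have "inv_arr C \<sigma>' \<bullet> g = inv_arr C \<sigma>' \<bullet> (g \<bullet> \<sigma>) \<bullet> inv_arr C \<sigma>" by simp
  also have "\<dots> = f \<bullet> inv_arr C \<sigma>" unfolding e[symmetric] by simp
  finally show ?thesis by (intro arr_isoI[of g f "inv_arr C \<sigma>" "inv_arr C \<sigma>'"]) simp_all
qed

lemma arr_iso_trans:
  assumes "f \<in> Arr C" "g \<in> Arr C" "h \<in> Arr C" "arr_iso C f g" "arr_iso C g h"
  shows "arr_iso C f h"
proof -
  obtain \<sigma> \<sigma>' where s: "\<sigma> \<in> iso_hom C (Dom C f) (Dom C g)" "\<sigma>' \<in> iso_hom C (Cod C f) (Cod C g)"
    and e: "\<sigma>' \<bullet> f = g \<bullet> \<sigma>" using assms arr_iso_iff by blast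
  obtain \<tau> \<tau>' where t: "\<tau> \<in> iso_hom C (Dom C g) (Dom C h)" "\<tau>' \<in> iso_hom C (Cod C g) (Cod C h)"
    and e': "\<tau>' \<bullet> g = h \<bullet> \<tau>" using assms arr_iso_iff by blast
  note [simp] = iso_homD[OF s(1)] iso_homD[OF s(2)] iso_homD[OF t(1)] iso_homD[OF t(2)] assms(1-3)
  have "(\<tau>' \<bullet> \<sigma>') \<bullet> f = \<tau>' \<bullet> (\<sigma>' \<bullet> f)" by simp
  also have "\<dots> = (\<tau>' \<bullet> g) \<bullet> \<sigma>" unfolding e by simp
  also have "\<dots> = h \<bullet> (\<tau> \<bullet> \<sigma>)" unfolding e' by simp
  finally show ?thesis
    using comp_iso_hom[OF s(1) t(1)] comp_iso_hom[OF s(2) t(2)] assms(1,3)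
    by (intro arr_isoI[of f h "\<tau> \<bullet> \<sigma>" "\<tau>' \<bullet> \<sigma>'"])
qed

lemma class_self: "f \<in> Arr C \<Longrightarrow> f \<in> arr_class C f"
  by (simp add: arr_class_def arr_iso_refl)

lemma class_eq_iff:
  assumes "f \<in> Arr C" "g \<in> Arr C"
  shows "arr_class C f = arr_class C g \<longleftrightarrow> arr_iso C f g"
proof
  assume "arr_class C f = arr_class C g"
  then have "g \<in> arr_class C f" using class_self[OF assms(2)] by simp
  then show "arr_iso C f g" by (simp add: arr_class_def)
next
  assume i: "arr_iso C f g"
  show "arr_class C f = arr_class C g"
    unfolding arr_class_def
    using arr_iso_trans[OF assms _ i] arr_iso_trans[OF assms(2,1) _ arr_iso_sym[OF assms i]] by blast
qed

lemma class_eqI: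
  assumes "f \<in> Arr C" "g \<in> Arr C" "\<sigma> \<in> iso_hom C (Dom C f) (Dom C g)" "\<sigma>' \<in> iso_hom C (Cod C f) (Cod C g)"
    "\<sigma>' \<bullet> f = g \<bullet> \<sigma>"
  shows "arr_class C f = arr_class C g"
  using arr_isoI[OF assms] class_eq_iff[OF assms(1,2)] by blast

lemma class_some:
  assumes "f \<in> Arr C"
  shows "(SOME g. g \<in> arr_class C f) \<in> Arr C" "arr_class C (SOME g. g \<in> arr_class C f) = arr_class C f"
    "arr_iso C f (SOME g. g \<in> arr_class C f)"
proof -
  have "(SOME g. g \<in> arr_class C f) \<in> arr_class C f" using class_self[OF assms] by (rule someI)
  then show g: "(SOME g. g \<in> arr_class C f) \<in> Arr C" and i: "arr_iso C f (SOME g. g \<in> arr_class C f)"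
    by (auto simp: arr_class_def)
  show "arr_class C (SOME g. g \<in> arr_class C f) = arr_class C f"
    using class_eq_iff[OF assms g] i by simp
qed

definition identity_classes :: "'m set set" where
  "identity_classes = {c. \<exists>X \<in> Obj C. c = arr_class C (Ide C X)}"

lemma class_identity_iff:
  assumes "f \<in> Arr C"
  shows "arr_class C f \<in> identity_classes \<longleftrightarrow> is_iso C f"
proof
  assume "arr_class C f \<in> identity_classes"
  then obtain X where X: "X \<in> Obj C" "arr_iso C f (Ide C X)"
    using class_eq_iff[OF assms] by (auto simp: identity_classes_def)
  then obtain \<sigma> \<sigma>' where s: "\<sigma> \<in> iso_hom C (Dom C f) X" "\<sigma>' \<in> iso_hom C (Cod C f) X"
    and e: "\<sigma>' \<bullet> f = Ide C X \<bullet> \<sigma>" using arr_iso_iff[OF assms, of "Ide C X"] by auto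
  note [simp] = iso_homD[OF s(1)] iso_homD[OF s(2)] assms
  have "f = inv_arr C \<sigma>' \<bullet> \<sigma>' \<bullet> f" by simp
  also have "\<dots> = inv_arr C \<sigma>' \<bullet> \<sigma>" unfolding e by simp

  finally have fe: "f = inv_arr C \<sigma>' \<bullet> \<sigma>" .
  have "f \<in> iso_hom C (Dom C f) (Cod C f)"
    using comp_iso_hom[OF s(1) iso_homD(11)[OF s(2)]] unfolding fe[symmetric] .
  then show "is_iso C f" by (rule iso_hom_is_iso)
next
  assume "is_iso C f"
  then have i: "f \<in> iso_hom C (Dom C f) (Cod C f)" by (simp add: is_iso_iff)
  have "arr_class C f = arr_class C (Ide C (Cod C f))"
    using i assms by (intro class_eqI[of _ _ f "Ide C (Cod C f)"]) (simp_all add: ide_iso_hom)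
  then show "arr_class C f \<in> identity_classes" using assms by (auto simp: identity_classes_def)
qed

subsection \<open>Factorizations\<close>

abbreviation "facs \<equiv> factorizations C"
abbreviation "frel \<equiv> factorization_rel C"

lemma factD:
  assumes "(a, b) \<in> facs \<phi>"
  shows "a \<in> Arr C" "b \<in> Arr C" "Cod C b = Dom C a" "a \<bullet> b = \<phi>" "Dom C b = Dom C \<phi>" "Cod C a = Cod C \<phi>" "\<phi> \<in> Arr C"
  using assms by (auto simp: factorizations_def)

lemma frel_iff:
  "((a, b), (a', b')) \<in> frel \<phi> \<longleftrightarrow> (a, b) \<in> facs \<phi> \<and> (a', b') \<in> facs \<phi> \<and>
     (\<exists>\<sigma> \<in> iso_hom C (Cod C b) (Cod C b'). a' \<bullet> \<sigma> = a \<and> b' = \<sigma> \<bullet> b)"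
proof (cases "(a, b) \<in> facs \<phi> \<and> (a', b') \<in> facs \<phi>")
  case True
  then have f: "(a, b) \<in> facs \<phi>" "(a', b') \<in> facs \<phi>" by auto
  have "a' = a \<bullet> inv_arr C \<sigma> \<longleftrightarrow> a' \<bullet> \<sigma> = a" if s: "\<sigma> \<in> iso_hom C (Cod C b) (Cod C b')" for \<sigma>
  proof -
    note [simp] = iso_homD[OF s] factD(1-3)[OF f(1)] factD(1-3)[OF f(2)]
    show ?thesis
    proof
      assume e: "a' = a \<bullet> inv_arr C \<sigma>"
      show "a' \<bullet> \<sigma> = a" by (subst e) simp
    next
      assume e: "a' \<bullet> \<sigma> = a"
      show "a' = a \<bullet> inv_arr C \<sigma>" by (subst e[symmetric]) simp
    qed
  qed
  then show ?thesis using True by (auto simp: factorization_rel_def)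
next
  case False
  then show ?thesis by (auto simp: factorization_rel_def)
qed

lemma frelI:
  assumes "(a, b) \<in> facs \<phi>" "(a', b') \<in> facs \<phi>" "\<sigma> \<in> iso_hom C (Cod C b) (Cod C b')" "a' \<bullet> \<sigma> = a" "\<sigma> \<bullet> b = b'"
  shows "((a, b), (a', b')) \<in> frel \<phi>"
  unfolding frel_iff using assms by blast

lemma frel_equiv: "equiv (facs \<phi>) (frel \<phi>)"
proof (rule equivI)
  show "frel \<phi> \<subseteq> facs \<phi> \<times> facs \<phi>" by (auto simp: factorization_rel_def)
  show "refl_on (facs \<phi>) (frel \<phi>)"
  proof (rule refl_onI)
    fix p assume p: "p \<in> facs \<phi>"
    obtain a b where ab: "p = (a, b)" by (cases p)
    note f = factD[OF p[unfolded ab]]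
    show "(p, p) \<in> frel \<phi>" unfolding ab frel_iff
      using p f by (auto simp: ab intro!: bexI[of _ "Ide C (Cod C b)"] ide_iso_hom)
  qed
  show "sym (frel \<phi>)"
  proof (rule symI)
    fix p q assume pq: "(p, q) \<in> frel \<phi>"
    obtain a b a' b' where ab: "p = (a, b)" "q = (a', b')" by (cases p, cases q)
    obtain \<sigma> where f: "(a, b) \<in> facs \<phi>" "(a', b') \<in> facs \<phi>" and s: "\<sigma> \<in> iso_hom C (Cod C b) (Cod C b')"
      and e: "a' \<bullet> \<sigma> = a" "b' = \<sigma> \<bullet> b" using pq unfolding ab frel_iff by blast
    note [simp] = iso_homD[OF s] factD(1-3)[OF f(1)] factD(1-3)[OF f(2)]
    have "a \<bullet> inv_arr C \<sigma> = a'" unfolding e(1)[symmetric] by simp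
    moreover have "b = inv_arr C \<sigma> \<bullet> b'" unfolding e(2) by simp
    ultimately show "(q, p) \<in> frel \<phi>" unfolding ab frel_iff using f iso_homD(11)[OF s] by blast
  qed
  show "trans (frel \<phi>)"
  proof (rule transI)
    fix p q r assume pq: "(p, q) \<in> frel \<phi>" "(q, r) \<in> frel \<phi>"
    obtain a b a' b' a'' b'' where ab: "p = (a, b)" "q = (a', b')" "r = (a'', b'')" by (cases p, cases q, cases r)
    obtain \<sigma> where f: "(a, b) \<in> facs \<phi>" "(a', b') \<in> facs \<phi>" and s: "\<sigma> \<in> iso_hom C (Cod C b) (Cod C b')"
      and e: "a' \<bullet> \<sigma> = a" "b' = \<sigma> \<bullet> b" using pq(1) unfolding ab frel_iff by blast
    obtain \<tau> where g: "(a'', b'') \<in> facs \<phi>" and t: "\<tau> \<in> iso_hom C (Cod C b') (Cod C b'')"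
      and e': "a'' \<bullet> \<tau> = a'" "b'' = \<tau> \<bullet> b'" using pq(2) unfolding ab frel_iff by blast
    note [simp] = iso_homD[OF s] iso_homD[OF t] factD(1-3)[OF f(1)] factD(1-3)[OF f(2)] factD(1-3)[OF g]
    have "a'' \<bullet> (\<tau> \<bullet> \<sigma>) = (a'' \<bullet> \<tau>) \<bullet> \<sigma>" by simp
    also have "\<dots> = a" unfolding e' e ..
    finally have "a'' \<bullet> (\<tau> \<bullet> \<sigma>) = a" .
    moreover have "b'' = (\<tau> \<bullet> \<sigma>) \<bullet> b" unfolding e'(2) e(2) by simp
    ultimately show "(p, r) \<in> frel \<phi>" unfolding ab frel_iff using f g comp_iso_hom[OF s t] by blast
  qed
qed

definition class_pair :: "'m \<times> 'm \<Rightarrow> 'm set \<times> 'm set" where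
  "class_pair p = (arr_class C (fst p), arr_class C (snd p))"

lemma class_pair_frel: "(p, q) \<in> frel \<phi> \<Longrightarrow> class_pair p = class_pair q"
proof -
  assume pq: "(p, q) \<in> frel \<phi>"
  obtain a b a' b' where ab: "p = (a, b)" "q = (a', b')" by (cases p, cases q)
  obtain \<sigma> where f: "(a, b) \<in> facs \<phi>" "(a', b') \<in> facs \<phi>" and s: "\<sigma> \<in> iso_hom C (Cod C b) (Cod C b')"
    and e: "a' \<bullet> \<sigma> = a" "b' = \<sigma> \<bullet> b" using pq unfolding ab frel_iff by blast
  note f1 = factD[OF f(1)] and f2 = factD[OF f(2)]
  have "arr_class C a = arr_class C a'"
    by (rule class_eqI[of _ _ \<sigma> "Ide C (Cod C \<phi>)"]) (use s e f1 f2 in \<open>simp_all add: ide_iso_hom\<close>)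
  moreover have "arr_class C b = arr_class C b'"
    by (rule class_eqI[of _ _ "Ide C (Dom C \<phi>)" \<sigma>]) (use s e f1 f2 in \<open>simp_all add: ide_iso_hom\<close>)
  ultimately show ?thesis by (simp add: ab class_pair_def)
qed

text \<open>
  The terms of the co-product of the class of \<open>\<phi>\<close>.
\<close>
definition fact_classes :: "'m \<Rightarrow> ('m set \<times> 'm set) multiset" where
  "fact_classes \<phi> = image_mset (\<lambda>k. class_pair (SOME p. p \<in> k)) (mset_set (facs \<phi> // frel \<phi>))"

lemma fact_classes_transversal:
  assumes "finite Ix" "\<And>i. i \<in> Ix \<Longrightarrow> x i \<in> facs \<phi>"
    "\<And>a b. (a, b) \<in> facs \<phi> \<Longrightarrow> \<exists>i\<in>Ix. (x i, (a, b)) \<in> frel \<phi>"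
    "\<And>i j. i \<in> Ix \<Longrightarrow> j \<in> Ix \<Longrightarrow> (x i, x j) \<in> frel \<phi> \<Longrightarrow> i = j"
  shows "fact_classes \<phi> = image_mset (\<lambda>i. class_pair (x i)) (mset_set Ix)"
  unfolding fact_classes_def
  by (rule image_quotient_transversal[OF frel_equiv assms(1,2) _ assms(4) class_pair_frel]) (use assms(3) in auto)

lemma some_in_class:
  assumes "k \<in> facs \<phi> // frel \<phi>"
  shows "(SOME p. p \<in> k) \<in> facs \<phi>" "k = frel \<phi> `` {SOME p. p \<in> k}"
proof -
  obtain p where p: "p \<in> facs \<phi>" "k = frel \<phi> `` {p}" using assms by (auto elim: quotientE)
  define q where "q = (SOME p. p \<in> k)"
  have "p \<in> k" using equiv_class_self[OF frel_equiv p(1)] p(2) by simp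
  then have "q \<in> k" unfolding q_def by (rule someI)
  then have q: "(p, q) \<in> frel \<phi>" unfolding p(2) by simp
  show "(SOME p. p \<in> k) \<in> facs \<phi>" using q unfolding q_def[symmetric] by (auto simp: factorization_rel_def)
  show "k = frel \<phi> `` {SOME p. p \<in> k}" using equiv_class_eq[OF frel_equiv q] p(2) unfolding q_def[symmetric] by simp
qed

text \<open>
  Every factorization is equivalent to one through the chosen object of the isomorphism class of its
  intermediate object.
\<close>
lemma finite_fact_classes:
  assumes fin: "factorization_finite C" and \<phi>: "\<phi> \<in> Arr C"
  shows "finite (facs \<phi> // frel \<phi>)"
proof -
  let ?O = "{obj_class C (Cod C b) | a b. (a, b) \<in> facs \<phi>}"
  let ?Q = "\<lambda>Y. {(a, b) \<in> facs \<phi>. Cod C b = Y} // frel \<phi>"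
  have fO: "finite ?O" and fQ: "\<And>Y. Y \<in> Obj C \<Longrightarrow> finite (?Q Y)"
    using fin \<phi> by (auto simp: factorization_finite_def)
  have "facs \<phi> // frel \<phi> \<subseteq> (\<Union>c\<in>?O. ?Q (SOME Y. Y \<in> c))"
  proof
    fix k assume "k \<in> facs \<phi> // frel \<phi>"
    then obtain p where p: "p \<in> facs \<phi>" "k = frel \<phi> `` {p}" by (auto elim: quotientE)
    obtain a b where ab: "p = (a, b)" by (cases p)
    note f = factD[OF p(1)[unfolded ab]]
    let ?c = "obj_class C (Cod C b)"
    have "Cod C b \<in> ?c" using f(2) ide_iso_hom[of "Cod C b"] by (auto simp: obj_class_def)
    then have "(SOME Y. Y \<in> ?c) \<in> ?c" by (rule someI)
    then obtain \<sigma> where s: "\<sigma> \<in> iso_hom C (Cod C b) (SOME Y. Y \<in> ?c)" by (auto simp: obj_class_def)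
    note [simp] = iso_homD[OF s] f(1-3)
    have q: "(a \<bullet> inv_arr C \<sigma>, \<sigma> \<bullet> b) \<in> facs \<phi>"
      using f(4) by (simp add: factorizations_def)
    have "((a, b), (a \<bullet> inv_arr C \<sigma>, \<sigma> \<bullet> b)) \<in> frel \<phi>"
    proof (rule frelI[OF p(1)[unfolded ab] q])
      have "Cod C (\<sigma> \<bullet> b) = (SOME Y. Y \<in> ?c)" by simp
      then show "\<sigma> \<in> iso_hom C (Cod C b) (Cod C (\<sigma> \<bullet> b))" using s by (simp only:)
    qed simp_all
    then have "k = frel \<phi> `` {(a \<bullet> inv_arr C \<sigma>, \<sigma> \<bullet> b)}"
      using equiv_class_eq[OF frel_equiv] p(2) ab by blast
    moreover have "(a \<bullet> inv_arr C \<sigma>, \<sigma> \<bullet> b) \<in> {(a, b) \<in> facs \<phi>. Cod C b = (SOME Y. Y \<in> ?c)}"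
      using q by simp
    ultimately have "k \<in> ?Q (SOME Y. Y \<in> ?c)" by (auto intro: quotientI)
    then show "k \<in> (\<Union>c\<in>?O. ?Q (SOME Y. Y \<in> c))" using p(1) ab by blast
  qed
  moreover have "finite (\<Union>c\<in>?O. ?Q (SOME Y. Y \<in> c))"
  proof (rule finite_UN_I[OF fO])
    fix c assume "c \<in> ?O"
    then obtain a b where ab: "(a, b) \<in> facs \<phi>" "c = obj_class C (Cod C b)" by blast
    then have "Cod C b \<in> c" using factD[OF ab(1)] ide_iso_hom[of "Cod C b"] by (auto simp: obj_class_def)
    then have "(SOME Y. Y \<in> c) \<in> c" by (rule someI)
    then have "(SOME Y. Y \<in> c) \<in> Obj C" using ab(2) by (simp add: obj_class_def)
    then show "finite (?Q (SOME Y. Y \<in> c))" by (rule fQ)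
  qed
  ultimately show ?thesis by (rule finite_subset)
qed

lemma frel_classes_eq:
  assumes "k \<in> facs \<phi> // frel \<phi>" "l \<in> facs \<phi> // frel \<phi>" "((SOME p. p \<in> k), (SOME p. p \<in> l)) \<in> frel \<phi>"
  shows "k = l"
  using some_in_class(2)[OF assms(1)] some_in_class(2)[OF assms(2)] equiv_class_eq[OF frel_equiv assms(3)] by simp

text \<open>
  Isomorphisms of the outer objects transport a transversal for \<open>\<phi>\<close> to one for \<open>\<phi>'\<close>.
\<close>
lemma fact_classes_iso:
  assumes fin: "factorization_finite C" and f: "\<phi> \<in> Arr C" "\<phi>' \<in> Arr C" and i: "arr_iso C \<phi> \<phi>'"
  shows "fact_classes \<phi> = fact_classes \<phi>'"
proof -
  obtain \<sigma> \<sigma>' where s: "\<sigma> \<in> iso_hom C (Dom C \<phi>) (Dom C \<phi>')" "\<sigma>' \<in> iso_hom C (Cod C \<phi>) (Cod C \<phi>')"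
    and e: "\<sigma>' \<bullet> \<phi> = \<phi>' \<bullet> \<sigma>" using i arr_iso_iff[OF f] by blast
  note [simp] = iso_homD[OF s(1)] iso_homD[OF s(2)] f
  let ?t = "\<lambda>p. (\<sigma>' \<bullet> fst p, snd p \<bullet> inv_arr C \<sigma>)"
  have t: "?t p \<in> facs \<phi>'" if "p \<in> facs \<phi>" for p
  proof -
    obtain a b where ab: "p = (a, b)" by (cases p)
    note [simp] = factD(1-3,5,6)[OF that[unfolded ab]]
    have "\<sigma>' \<bullet> a \<bullet> b \<bullet> inv_arr C \<sigma> = (\<sigma>' \<bullet> (a \<bullet> b)) \<bullet> inv_arr C \<sigma>" by simp
    also have "\<dots> = \<phi>'" unfolding factD(4)[OF that[unfolded ab]] e by simp
    finally show ?thesis by (simp add: ab factorizations_def)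
  qed
  have trel: "(?t p, ?t q) \<in> frel \<phi>'" if "(p, q) \<in> frel \<phi>" for p q
  proof -
    obtain a b a' b' where ab: "p = (a, b)" "q = (a', b')" by (cases p, cases q)
    from that obtain \<tau> where g: "(a, b) \<in> facs \<phi>" "(a', b') \<in> facs \<phi>" and u: "\<tau> \<in> iso_hom C (Cod C b) (Cod C b')"
      and e: "a' \<bullet> \<tau> = a" "b' = \<tau> \<bullet> b" unfolding ab frel_iff by blast
    note [simp] = iso_homD[OF u] factD(1-3,5,6)[OF g(1)] factD(1-3,5,6)[OF g(2)]
    have "(\<sigma>' \<bullet> a') \<bullet> \<tau> = \<sigma>' \<bullet> a" unfolding e(1)[symmetric] by simp
    moreover have "\<tau> \<bullet> (b \<bullet> inv_arr C \<sigma>) = b' \<bullet> inv_arr C \<sigma>" unfolding e(2) by simp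
    moreover have "\<tau> \<in> iso_hom C (Cod C (b \<bullet> inv_arr C \<sigma>)) (Cod C (b' \<bullet> inv_arr C \<sigma>))"
      using u by simp
    ultimately show ?thesis using t[OF g(1)] t[OF g(2)] unfolding ab fst_conv snd_conv by (intro frelI) assumption+
  qed
  have tinj: "(p, q) \<in> frel \<phi>" if pq: "p \<in> facs \<phi>" "q \<in> facs \<phi>" and r: "(?t p, ?t q) \<in> frel \<phi>'" for p q
  proof -
    obtain a b a' b' where ab: "p = (a, b)" "q = (a', b')" by (cases p, cases q)
    note g = pq[unfolded ab]
    note [simp] = factD(1-3,5,6)[OF g(1)] factD(1-3,5,6)[OF g(2)]
    from r obtain \<tau> where u: "\<tau> \<in> iso_hom C (Cod C b) (Cod C b')"
      and e: "(\<sigma>' \<bullet> a') \<bullet> \<tau> = \<sigma>' \<bullet> a" "b' \<bullet> inv_arr C \<sigma> = \<tau> \<bullet> (b \<bullet> inv_arr C \<sigma>)" unfolding ab frel_iff by auto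
    note [simp] = iso_homD[OF u]
    have "a' \<bullet> \<tau> = inv_arr C \<sigma>' \<bullet> ((\<sigma>' \<bullet> a') \<bullet> \<tau>)" by simp
    also have "\<dots> = a" unfolding e(1) by simp
    finally have 1: "a' \<bullet> \<tau> = a" .
    have "b' = (b' \<bullet> inv_arr C \<sigma>) \<bullet> \<sigma>" by simp
    also have "\<dots> = \<tau> \<bullet> b" unfolding e(2) by simp
    finally show ?thesis using 1 u g unfolding ab frel_iff by blast
  qed
  have ex: "\<exists>p\<in>facs \<phi>. ?t p = (a, b)" if ab: "(a, b) \<in> facs \<phi>'" for a b
  proof (rule bexI)
    note [simp] = factD(1-3,5,6)[OF ab]
    have "inv_arr C \<sigma>' \<bullet> a \<bullet> b \<bullet> \<sigma> = inv_arr C \<sigma>' \<bullet> (a \<bullet> b) \<bullet> \<sigma>" by simp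
    also have "\<dots> = inv_arr C \<sigma>' \<bullet> (\<sigma>' \<bullet> \<phi>)" unfolding factD(4)[OF ab] e ..
    also have "\<dots> = \<phi>" by simp
    finally show "(inv_arr C \<sigma>' \<bullet> a, b \<bullet> \<sigma>) \<in> facs \<phi>" by (simp add: factorizations_def)
    show "?t (inv_arr C \<sigma>' \<bullet> a, b \<bullet> \<sigma>) = (a, b)" by simp
  qed
  let ?Q = "facs \<phi> // frel \<phi>" and ?r = "\<lambda>k. SOME p. p \<in> k"
  have "fact_classes \<phi>' = image_mset (\<lambda>k. class_pair (?t (?r k))) (mset_set ?Q)"
  proof (rule fact_classes_transversal[OF finite_fact_classes[OF fin f(1)]])
    show "k \<in> ?Q \<Longrightarrow> ?t (?r k) \<in> facs \<phi>'" for k using t some_in_class(1) by blast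
    show "\<exists>k\<in>?Q. (?t (?r k), (a, b)) \<in> frel \<phi>'" if ab: "(a, b) \<in> facs \<phi>'" for a b
    proof -
      obtain p where p: "p \<in> facs \<phi>" "?t p = (a, b)" using ex[OF ab] by blast
      let ?k = "frel \<phi> `` {p}"
      have k: "?k \<in> ?Q" using p(1) by (rule quotientI)
      have "p \<in> ?k" using equiv_class_self[OF frel_equiv p(1)] .
      then have "(?r ?k, p) \<in> frel \<phi>" using some_in_class(2)[OF k] by blast
      from trel[OF this] show ?thesis using k unfolding p(2) by blast
    qed
    show "k = l" if "k \<in> ?Q" "l \<in> ?Q" "(?t (?r k), ?t (?r l)) \<in> frel \<phi>'" for k l
      using frel_classes_eq[OF that(1,2)] tinj[OF some_in_class(1) some_in_class(1) that(3)] that by blast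
  qed
  also have "\<dots> = fact_classes \<phi>"
    unfolding fact_classes_def
  proof (intro image_mset_cong)
    fix k assume "k \<in># mset_set ?Q"
    then have k: "?r k \<in> facs \<phi>" using some_in_class(1) by (metis elem_mset_set finite_fact_classes[OF fin f(1)])
    obtain a b where ab: "?r k = (a, b)" by (cases "?r k")
    note [simp] = factD(1-3,5,6)[OF k[unfolded ab]]
    have "arr_class C (\<sigma>' \<bullet> a) = arr_class C a"
      by (rule class_eqI[of _ _ "Ide C (Dom C a)" "inv_arr C \<sigma>'"]) (simp_all add: ide_iso_hom)
    moreover have "arr_class C (b \<bullet> inv_arr C \<sigma>) = arr_class C b"
      by (rule class_eqI[of _ _ "inv_arr C \<sigma>" "Ide C (Cod C b)"]) (simp_all add: ide_iso_hom)
    ultimately show "class_pair (?t (?r k)) = class_pair (?r k)" by (simp add: ab class_pair_def)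
  qed
  finally show ?thesis ..
qed

text \<open>
  A factorization whose right factor is an isomorphism is equivalent to the trivial one
  \<open>\<phi> = \<phi> \<circ> id\<close>, and similarly on the left, so exactly one term of the co-product survives.
\<close>
lemma fact_classes_counit:
  assumes fin: "factorization_finite C" and f: "\<phi> \<in> Arr C"
  shows "image_mset fst (filter_mset (\<lambda>p. snd p \<in> identity_classes) (fact_classes \<phi>)) = {#arr_class C \<phi>#}"
    "image_mset snd (filter_mset (\<lambda>p. fst p \<in> identity_classes) (fact_classes \<phi>)) = {#arr_class C \<phi>#}"
proof -
  let ?Q = "facs \<phi> // frel \<phi>" and ?r = "\<lambda>k. SOME p. p \<in> k"
  note fQ = finite_fact_classes[OF fin f]
  have key: "image_mset p (filter_mset (\<lambda>x. q x \<in> identity_classes) (fact_classes \<phi>)) = {#p (class_pair t)#}"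
    if t: "t \<in> facs \<phi>" "q (class_pair t) \<in> identity_classes"
      and u: "\<And>s. s \<in> facs \<phi> \<Longrightarrow> q (class_pair s) \<in> identity_classes \<Longrightarrow> (t, s) \<in> frel \<phi>"
    for p q :: "'m set \<times> 'm set \<Rightarrow> 'm set" and t
  proof -
    let ?k = "frel \<phi> `` {t}"
    have k: "?k \<in> ?Q" using t(1) by (rule quotientI)
    have rk: "(t, ?r ?k) \<in> frel \<phi>"
      using equiv_class_self[OF frel_equiv t(1)] some_in_class(2)[OF k] by (metis Image_singleton_iff someI)
    have "{k \<in> ?Q. q (class_pair (?r k)) \<in> identity_classes} = {?k}"
    proof
      show "{k \<in> ?Q. q (class_pair (?r k)) \<in> identity_classes} \<subseteq> {?k}"
      proof
        fix l assume "l \<in> {k \<in> ?Q. q (class_pair (?r k)) \<in> identity_classes}"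
        then have l: "l \<in> ?Q" "(t, ?r l) \<in> frel \<phi>" using u some_in_class(1) by auto
        then show "l \<in> {?k}" using some_in_class(2)[OF l(1)] equiv_class_eq[OF frel_equiv l(2)] by simp
      qed
      show "{?k} \<subseteq> {k \<in> ?Q. q (class_pair (?r k)) \<in> identity_classes}"
        using k class_pair_frel[OF rk] t(2) by simp
    qed
    then have "filter_mset (\<lambda>k. q (class_pair (?r k)) \<in> identity_classes) (mset_set ?Q) = {#?k#}"
      by (simp add: filter_mset_mset_set fQ)
    then show ?thesis using class_pair_frel[OF rk]
      by (simp add: fact_classes_def filter_mset_image_mset comp_def)
  qed
  show "image_mset fst (filter_mset (\<lambda>p. snd p \<in> identity_classes) (fact_classes \<phi>)) = {#arr_class C \<phi>#}"
  proof -
    let ?t = "(\<phi>, Ide C (Dom C \<phi>))"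
    have t: "?t \<in> facs \<phi>" using f by (simp add: factorizations_def)
    have "(?t, s) \<in> frel \<phi>" if s: "s \<in> facs \<phi>" "snd (class_pair s) \<in> identity_classes" for s
    proof -
      obtain a b where ab: "s = (a, b)" by (cases s)
      note g = s(1)[unfolded ab] note [simp] = factD(1-3,5,6)[OF g]
      have "is_iso C b" using s(2) class_identity_iff[of b] by (simp add: ab class_pair_def)
      then have b: "b \<in> iso_hom C (Dom C b) (Cod C b)" using is_iso_iff by blast
      show ?thesis unfolding ab
        by (rule frelI[OF t g, of b]) (use b f factD(4)[OF g] in simp_all)
    qed
    moreover have "snd (class_pair ?t) \<in> identity_classes"
      using f by (auto simp: class_pair_def identity_classes_def)
    ultimately show ?thesis using key[OF t, of snd fst] by (simp add: class_pair_def)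
  qed
  show "image_mset snd (filter_mset (\<lambda>p. fst p \<in> identity_classes) (fact_classes \<phi>)) = {#arr_class C \<phi>#}"
  proof -
    let ?t = "(Ide C (Cod C \<phi>), \<phi>)"
    have t: "?t \<in> facs \<phi>" using f by (simp add: factorizations_def)
    have "(?t, s) \<in> frel \<phi>" if s: "s \<in> facs \<phi>" "fst (class_pair s) \<in> identity_classes" for s
    proof -
      obtain a b where ab: "s = (a, b)" by (cases s)
      note g = s(1)[unfolded ab] note [simp] = factD(1-3,5,6)[OF g]
      have "is_iso C a" using s(2) class_identity_iff[of a] by (simp add: ab class_pair_def)
      then have a: "a \<in> iso_hom C (Dom C a) (Cod C a)" using is_iso_iff by blast
      have "(s, ?t) \<in> frel \<phi>" unfolding ab
        by (rule frelI[OF g t, of a]) (use a f factD(4)[OF g] in simp_all)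
      then show ?thesis using frel_equiv by (meson equivE symD)
    qed
    moreover have "fst (class_pair ?t) \<in> identity_classes"
      using f by (auto simp: class_pair_def identity_classes_def)
    ultimately show ?thesis using key[OF t, of fst snd] by (simp add: class_pair_def)
  qed
qed

lemma fact_classes_ide:
  assumes agl: "almost_group_like_identities C" and X: "X \<in> Obj C"
  shows "fact_classes (Ide C X) = {#(arr_class C (Ide C X), arr_class C (Ide C X))#}"
proof -
  let ?t = "(Ide C X, Ide C X)"
  have t: "?t \<in> facs (Ide C X)" using X by (simp add: factorizations_def)
  have "(?t, (a, b)) \<in> frel (Ide C X)" if g: "(a, b) \<in> facs (Ide C X)" for a b
  proof -
    note [simp] = factD(1-3,5,6)[OF g]
    have "is_iso C b" using agl X g by (auto simp: almost_group_like_identities_def)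
    then have b: "b \<in> iso_hom C X (Cod C b)" using is_iso_iff[of b] X by simp
    show ?thesis
      by (rule frelI[OF t g, of b]) (use b X factD(4)[OF g] in simp_all)
  qed
  then have "fact_classes (Ide C X) = image_mset (\<lambda>i. class_pair ?t) (mset_set {()})"
    using t by (intro fact_classes_transversal) auto
  then show ?thesis by (simp add: class_pair_def)
qed

end

section \<open>Multiplicativity of the co-product\<close>

context monoidal_category
begin

abbreviation "cl \<equiv> arr_class C"

lemma ten_arr_iso:
  assumes "f \<in> Arr C" "f' \<in> Arr C" "g \<in> Arr C" "g' \<in> Arr C" "arr_iso C f f'" "arr_iso C g g'"
  shows "arr_iso C (f \<boxtimes> g) (f' \<boxtimes> g')"
proof -
  obtain \<sigma> \<sigma>' where s: "\<sigma> \<in> iso_hom C (Dom C f) (Dom C f')" "\<sigma>' \<in> iso_hom C (Cod C f) (Cod C f')"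
    and e: "\<sigma>' \<bullet> f = f' \<bullet> \<sigma>" using assms arr_iso_iff by blast
  obtain \<tau> \<tau>' where t: "\<tau> \<in> iso_hom C (Dom C g) (Dom C g')" "\<tau>' \<in> iso_hom C (Cod C g) (Cod C g')"
    and e': "\<tau>' \<bullet> g = g' \<bullet> \<tau>" using assms arr_iso_iff by blast
  note [simp] = iso_homD[OF s(1)] iso_homD[OF s(2)] iso_homD[OF t(1)] iso_homD[OF t(2)] assms(1-4)
  show ?thesis
    using ten_iso_hom[OF s(1) t(1)] ten_iso_hom[OF s(2) t(2)] e e'
    by (intro arr_isoI[of _ _ "\<sigma> \<boxtimes> \<tau>" "\<sigma>' \<boxtimes> \<tau>'"]) simp_all
qed

lemma class_mult_class:
  assumes "f \<in> Arr C" "g \<in> Arr C"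
  shows "class_mult C (cl f) (cl g) = cl (f \<boxtimes> g)"
proof -
  have e: "cl (f' \<boxtimes> g') = cl (f \<boxtimes> g)" if "f' \<in> cl f" "g' \<in> cl g" for f' g'
  proof -
    have "f' \<in> Arr C" "g' \<in> Arr C" "arr_iso C f f'" "arr_iso C g g'" using that by (auto simp: arr_class_def)
    then show ?thesis using ten_arr_iso[of f f' g g'] assms class_eq_iff[of "f \<boxtimes> g" "f' \<boxtimes> g'"] by simp
  qed
  have "class_mult C (cl f) (cl g) = (\<Union>f' \<in> cl f. \<Union>g' \<in> cl g. cl (f \<boxtimes> g))"
    unfolding class_mult_def by (intro SUP_cong refl e)
  also have "\<dots> = cl (f \<boxtimes> g)"
    using class_self[OF assms(1)] class_self[OF assms(2)] by blast
  finally show ?thesis .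
qed

lemma class_assoc:
  assumes "f \<in> Arr C" "g \<in> Arr C" "h \<in> Arr C"
  shows "cl ((f \<boxtimes> g) \<boxtimes> h) = cl (f \<boxtimes> (g \<boxtimes> h))"
proof -
  let ?a = "assoc C (Dom C f) (Dom C g) (Dom C h)" and ?b = "assoc C (Cod C f) (Cod C g) (Cod C h)"
  have a: "?a \<in> iso_hom C ((Dom C f \<odot> Dom C g) \<odot> Dom C h) (Dom C f \<odot> (Dom C g \<odot> Dom C h))"
    and b: "?b \<in> iso_hom C ((Cod C f \<odot> Cod C g) \<odot> Cod C h) (Cod C f \<odot> (Cod C g \<odot> Cod C h))"
    using assms by (auto intro: assoc_iso)
  have "?b \<bullet> ((f \<boxtimes> g) \<boxtimes> h) = (f \<boxtimes> (g \<boxtimes> h)) \<bullet> ?a" by (rule assoc_nat) (use assms in \<open>auto intro: HomI\<close>)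
  then show ?thesis using a b assms by (intro class_eqI[of _ _ ?a ?b]) simp_all
qed

lemma class_unit:
  assumes "f \<in> Arr C"
  shows "cl (Ide C (unitO C) \<boxtimes> f) = cl f" "cl (f \<boxtimes> Ide C (unitO C)) = cl f"
proof -
  have "lunit C (Cod C f) \<bullet> (Ide C (unitO C) \<boxtimes> f) = f \<bullet> lunit C (Dom C f)"
    by (rule lunit_nat) (use assms in \<open>auto intro: HomI\<close>)
  then show "cl (Ide C (unitO C) \<boxtimes> f) = cl f"
    using assms lunit_iso[of "Dom C f"] lunit_iso[of "Cod C f"]
    by (intro class_eqI[of _ _ "lunit C (Dom C f)" "lunit C (Cod C f)"]) simp_all
  have "runit C (Cod C f) \<bullet> (f \<boxtimes> Ide C (unitO C)) = f \<bullet> runit C (Dom C f)"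
    by (rule runit_nat) (use assms in \<open>auto intro: HomI\<close>)
  then show "cl (f \<boxtimes> Ide C (unitO C)) = cl f"
    using assms runit_iso[of "Dom C f"] runit_iso[of "Cod C f"]
    by (intro class_eqI[of _ _ "runit C (Dom C f)" "runit C (Cod C f)"]) simp_all
qed

end

context tensor_splitting
begin

abbreviation ten_pair :: "'m \<times> 'm \<Rightarrow> 'm \<times> 'm \<Rightarrow> 'm \<times> 'm" where
  "ten_pair p q \<equiv> (fst p \<boxtimes> fst q, snd p \<boxtimes> snd q)"

lemma ten_fact:
  assumes "p \<in> facs \<phi>" "q \<in> facs \<psi>"
  shows "ten_pair p q \<in> facs (\<phi> \<boxtimes> \<psi>)"
proof -
  obtain a b a' b' where pq: "p = (a, b)" "q = (a', b')" by (cases p, cases q)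
  note f = factD[OF assms(1)[unfolded pq]] and g = factD[OF assms(2)[unfolded pq]]
  have "(a \<boxtimes> a') \<bullet> (b \<boxtimes> b') = \<phi> \<boxtimes> \<psi>" using f(1-4) g(1-4) by simp
  then show ?thesis using f(1-3) g(1-3) by (simp add: pq factorizations_def)
qed

lemma ten_frel:
  assumes "(p, p') \<in> frel \<phi>" "(q, q') \<in> frel \<psi>"
  shows "(ten_pair p q, ten_pair p' q') \<in> frel (\<phi> \<boxtimes> \<psi>)"
proof -
  obtain a b a' b' c d c' d' where pq: "p = (a, b)" "p' = (a', b')" "q = (c, d)" "q' = (c', d')"
    by (cases p, cases p', cases q, cases q')
  obtain \<sigma> where f: "(a, b) \<in> facs \<phi>" "(a', b') \<in> facs \<phi>" and s: "\<sigma> \<in> iso_hom F (Cod F b) (Cod F b')"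
    and e: "a' \<bullet> \<sigma> = a" "b' = \<sigma> \<bullet> b" using assms(1) unfolding pq frel_iff by blast
  obtain \<tau> where g: "(c, d) \<in> facs \<psi>" "(c', d') \<in> facs \<psi>" and t: "\<tau> \<in> iso_hom F (Cod F d) (Cod F d')"
    and e': "c' \<bullet> \<tau> = c" "d' = \<tau> \<bullet> d" using assms(2) unfolding pq frel_iff by blast
  note [simp] = iso_homD[OF s] iso_homD[OF t] factD(1-3)[OF f(1)] factD(1-3)[OF f(2)] factD(1-3)[OF g(1)] factD(1-3)[OF g(2)]
  have "\<sigma> \<boxtimes> \<tau> \<in> iso_hom F (Cod F (b \<boxtimes> d)) (Cod F (b' \<boxtimes> d'))" using ten_iso_hom[OF s t] by simp
  moreover have "(a' \<boxtimes> c') \<bullet> (\<sigma> \<boxtimes> \<tau>) = a \<boxtimes> c" unfolding e(1)[symmetric] e'(1)[symmetric] by simp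
  moreover have "(\<sigma> \<boxtimes> \<tau>) \<bullet> (b \<boxtimes> d) = b' \<boxtimes> d'" unfolding e(2) e'(2) by simp
  ultimately show ?thesis
    using ten_fact[OF f(1) g(1)] ten_fact[OF f(2) g(2)] unfolding pq fst_conv snd_conv by (intro frelI) assumption+
qed

text \<open>
  The isomorphism of intermediate objects splits because the left factors do.  The right factors
  then agree as tensor products, and they agree separately because an identity only splits into
  identities.
\<close>
lemma ten_frel_inject:
  assumes p: "p \<in> facs \<phi>" "p' \<in> facs \<phi>" and q: "q \<in> facs \<psi>" "q' \<in> facs \<psi>"
    and r: "(ten_pair p q, ten_pair p' q') \<in> frel (\<phi> \<boxtimes> \<psi>)"
  shows "(p, p') \<in> frel \<phi>" "(q, q') \<in> frel \<psi>"
proof -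
  obtain a b a' b' c d c' d' where pq: "p = (a, b)" "p' = (a', b')" "q = (c, d)" "q' = (c', d')"
    by (cases p, cases p', cases q, cases q')
  note f = p[unfolded pq] and g = q[unfolded pq]
  note [simp] = factD(1-3,5,6)[OF f(1)] factD(1-3,5,6)[OF f(2)] factD(1-3,5,6)[OF g(1)] factD(1-3,5,6)[OF g(2)]
  from r obtain \<sigma> where s: "\<sigma> \<in> iso_hom F (Cod F b \<odot> Cod F d) (Cod F b' \<odot> Cod F d')"
    and e: "(a' \<boxtimes> c') \<bullet> \<sigma> = a \<boxtimes> c" "b' \<boxtimes> d' = \<sigma> \<bullet> (b \<boxtimes> d)" unfolding pq frel_iff by auto
  have h: "a \<in> Hom F (Cod F b) (Cod F \<phi>)" "c \<in> Hom F (Cod F d) (Cod F \<psi>)"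
    "a' \<in> Hom F (Cod F b') (Cod F \<phi>)" "c' \<in> Hom F (Cod F d') (Cod F \<psi>)" by (auto intro: HomI)
  obtain \<sigma>1 \<sigma>2 where s1: "\<sigma>1 \<in> iso_hom F (Cod F b) (Cod F b')" and s2: "\<sigma>2 \<in> iso_hom F (Cod F d) (Cod F d')"
    and se: "\<sigma> = \<sigma>1 \<boxtimes> \<sigma>2" "a' \<bullet> \<sigma>1 = a" "c' \<bullet> \<sigma>2 = c" using split_unique[OF h s e(1)] by blast
  note sD = iso_homD[OF s1] iso_homD[OF s2]
  have bh: "\<sigma>1 \<bullet> b \<in> Hom F (Dom F b) (Cod F b')" "\<sigma>2 \<bullet> d \<in> Hom F (Dom F d) (Cod F d')"
    "b' \<in> Hom F (Dom F b) (Cod F b')" "d' \<in> Hom F (Dom F d) (Cod F d')" using sD by (auto intro!: HomI)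
  have "(b' \<boxtimes> d') \<bullet> Ide F (Dom F b \<odot> Dom F d) = (\<sigma>1 \<bullet> b) \<boxtimes> (\<sigma>2 \<bullet> d)" using e(2) se(1) sD by simp
  moreover have "Ide F (Dom F b \<odot> Dom F d) \<in> iso_hom F (Dom F b \<odot> Dom F d) (Dom F b \<odot> Dom F d)"
    by (rule ide_iso_hom) (simp add: factD(7)[OF f(1)] factD(7)[OF g(1)])
  ultimately obtain \<tau>1 \<tau>2 where t: "\<tau>1 \<in> iso_hom F (Dom F b) (Dom F b)" "\<tau>2 \<in> iso_hom F (Dom F d) (Dom F d)"
    and te: "Ide F (Dom F b \<odot> Dom F d) = \<tau>1 \<boxtimes> \<tau>2" "b' \<bullet> \<tau>1 = \<sigma>1 \<bullet> b" "d' \<bullet> \<tau>2 = \<sigma>2 \<bullet> d"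
    using split_unique[OF bh] by blast
  have "\<tau>1 = Ide F (Dom F b)" "\<tau>2 = Ide F (Dom F d)" using ten_ide_cancel[OF t te(1)[symmetric]] by auto
  then have bd: "\<sigma>1 \<bullet> b = b'" "\<sigma>2 \<bullet> d = d'" using te(2,3) by simp_all
  show "(p, p') \<in> frel \<phi>" "(q, q') \<in> frel \<psi>" unfolding pq
    by (rule frelI[OF f(1,2) s1 se(2) bd(1)], rule frelI[OF g(1,2) s2 se(3) bd(2)])
qed

text \<open>
  Splitting \<open>\<Phi>0\<close> splits the intermediate object up to an isomorphism \<open>\<sigma>\<close>, then \<open>\<sigma> \<bullet> \<Phi>1\<close> splits up to
  an isomorphism \<open>\<tau>\<close> of the source.  The composite presents \<open>\<phi> \<otimes> \<psi>\<close> up to \<open>\<tau>\<close>, so uniqueness of the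
  splitting splits \<open>\<tau>\<close> and recovers \<open>\<phi>\<close> and \<open>\<psi>\<close>.
\<close>
lemma ten_frel_surj:
  assumes \<phi>: "\<phi> \<in> Arr F" and \<psi>: "\<psi> \<in> Arr F" and r: "(\<Phi>0, \<Phi>1) \<in> facs (\<phi> \<boxtimes> \<psi>)"
  shows "\<exists>p\<in>facs \<phi>. \<exists>q\<in>facs \<psi>. (ten_pair p q, (\<Phi>0, \<Phi>1)) \<in> frel (\<phi> \<boxtimes> \<psi>)"
proof -
  note [simp] = factD(1-3,5,6)[OF r] \<phi> \<psi>
  have "\<Phi>0 \<in> Hom F (Dom F \<Phi>0) (Cod F \<phi> \<odot> Cod F \<psi>)" by (auto intro!: HomI)
  then obtain Z1 Z2 \<alpha> \<gamma> \<sigma> where a: "\<alpha> \<in> Hom F Z1 (Cod F \<phi>)" "\<gamma> \<in> Hom F Z2 (Cod F \<psi>)"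
    and s: "\<sigma> \<in> iso_hom F (Dom F \<Phi>0) (Z1 \<odot> Z2)" and e0: "\<Phi>0 = (\<alpha> \<boxtimes> \<gamma>) \<bullet> \<sigma>"
    using split[of \<Phi>0 "Dom F \<Phi>0" "Cod F \<phi>" "Cod F \<psi>"] by auto
  note [simp] = a[unfolded Hom_def, simplified] iso_homD[OF s]
  have Z: "Z1 \<in> Obj F" "Z2 \<in> Obj F" using hom_obj[OF a(1)] hom_obj[OF a(2)] by auto
  have "\<sigma> \<bullet> \<Phi>1 \<in> Hom F (Dom F \<phi> \<odot> Dom F \<psi>) (Z1 \<odot> Z2)" by (auto intro!: HomI)
  then obtain W1 W2 \<delta> \<epsilon> \<tau> where d: "\<delta> \<in> Hom F W1 Z1" "\<epsilon> \<in> Hom F W2 Z2"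
    and t: "\<tau> \<in> iso_hom F (Dom F \<phi> \<odot> Dom F \<psi>) (W1 \<odot> W2)" and e1: "\<sigma> \<bullet> \<Phi>1 = (\<delta> \<boxtimes> \<epsilon>) \<bullet> \<tau>"
    using split[OF _ Z] by blast
  note [simp] = d[unfolded Hom_def, simplified] iso_homD[OF t]
  have "\<phi> \<boxtimes> \<psi> = ((\<alpha> \<boxtimes> \<gamma>) \<bullet> \<sigma>) \<bullet> \<Phi>1" unfolding e0[symmetric] using factD(4)[OF r] by simp
  also have "\<dots> = (\<alpha> \<boxtimes> \<gamma>) \<bullet> (\<sigma> \<bullet> \<Phi>1)" by simp
  also have "\<dots> = ((\<alpha> \<bullet> \<delta>) \<boxtimes> (\<gamma> \<bullet> \<epsilon>)) \<bullet> \<tau>" unfolding e1 by simp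
  finally have e: "((\<alpha> \<bullet> \<delta>) \<boxtimes> (\<gamma> \<bullet> \<epsilon>)) \<bullet> \<tau> = \<phi> \<boxtimes> \<psi>" ..
  have h: "\<phi> \<in> Hom F (Dom F \<phi>) (Cod F \<phi>)" "\<psi> \<in> Hom F (Dom F \<psi>) (Cod F \<psi>)"
    "\<alpha> \<bullet> \<delta> \<in> Hom F W1 (Cod F \<phi>)" "\<gamma> \<bullet> \<epsilon> \<in> Hom F W2 (Cod F \<psi>)" by (auto intro!: HomI)
  obtain \<tau>1 \<tau>2 where t1: "\<tau>1 \<in> iso_hom F (Dom F \<phi>) W1" and t2: "\<tau>2 \<in> iso_hom F (Dom F \<psi>) W2"
    and te: "\<tau> = \<tau>1 \<boxtimes> \<tau>2" "(\<alpha> \<bullet> \<delta>) \<bullet> \<tau>1 = \<phi>" "(\<gamma> \<bullet> \<epsilon>) \<bullet> \<tau>2 = \<psi>" using split_unique[OF h t e] by blast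
  note [simp] = iso_homD[OF t1] iso_homD[OF t2]
  have p: "(\<alpha>, \<delta> \<bullet> \<tau>1) \<in> facs \<phi>" "(\<gamma>, \<epsilon> \<bullet> \<tau>2) \<in> facs \<psi>" using te(2,3) by (auto simp: factorizations_def)
  have "(ten_pair (\<alpha>, \<delta> \<bullet> \<tau>1) (\<gamma>, \<epsilon> \<bullet> \<tau>2), (\<Phi>0, \<Phi>1)) \<in> frel (\<phi> \<boxtimes> \<psi>)"
    unfolding fst_conv snd_conv
  proof (rule frelI[OF ten_fact[OF p, unfolded fst_conv snd_conv] r])
    show "inv_arr F \<sigma> \<in> iso_hom F (Cod F ((\<delta> \<bullet> \<tau>1) \<boxtimes> (\<epsilon> \<bullet> \<tau>2))) (Cod F \<Phi>1)"
      using iso_homD(11)[OF s] by simp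
    have "((\<alpha> \<boxtimes> \<gamma>) \<bullet> \<sigma>) \<bullet> inv_arr F \<sigma> = \<alpha> \<boxtimes> \<gamma>" by simp
    then show "\<Phi>0 \<bullet> inv_arr F \<sigma> = \<alpha> \<boxtimes> \<gamma>" unfolding e0[symmetric] .
    have "inv_arr F \<sigma> \<bullet> ((\<delta> \<bullet> \<tau>1) \<boxtimes> (\<epsilon> \<bullet> \<tau>2)) = inv_arr F \<sigma> \<bullet> ((\<delta> \<boxtimes> \<epsilon>) \<bullet> \<tau>)" unfolding te(1) by simp
    also have "\<dots> = \<Phi>1" unfolding e1[symmetric] by simp
    finally show "inv_arr F \<sigma> \<bullet> ((\<delta> \<bullet> \<tau>1) \<boxtimes> (\<epsilon> \<bullet> \<tau>2)) = \<Phi>1" .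
  qed
  then show ?thesis using p by blast
qed

lemma fact_classes_ten:
  assumes fin: "factorization_finite F" and \<phi>: "\<phi> \<in> Arr F" and \<psi>: "\<psi> \<in> Arr F"
  shows "fact_classes (\<phi> \<boxtimes> \<psi>) = (\<Sum>p\<in>#fact_classes \<phi>.
    image_mset (\<lambda>q. (class_mult F (fst p) (fst q), class_mult F (snd p) (snd q))) (fact_classes \<psi>))"
proof -
  let ?Q = "facs \<phi> // frel \<phi>" and ?R = "facs \<psi> // frel \<psi>" and ?r = "\<lambda>k. SOME p. p \<in> k"
  note fQ = finite_fact_classes[OF fin \<phi>] and fR = finite_fact_classes[OF fin \<psi>]
  let ?x = "\<lambda>i. ten_pair (?r (fst i)) (?r (snd i))"
  have "fact_classes (\<phi> \<boxtimes> \<psi>) = image_mset (\<lambda>i. class_pair (?x i)) (mset_set (?Q \<times> ?R))"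
  proof (rule fact_classes_transversal)
    show "finite (?Q \<times> ?R)" using fQ fR by simp
    show "?x i \<in> facs (\<phi> \<boxtimes> \<psi>)" if "i \<in> ?Q \<times> ?R" for i
      by (rule ten_fact) (use that some_in_class(1) in auto)
    show "\<exists>i\<in>?Q \<times> ?R. (?x i, (a, b)) \<in> frel (\<phi> \<boxtimes> \<psi>)" if ab: "(a, b) \<in> facs (\<phi> \<boxtimes> \<psi>)" for a b
    proof -
      obtain p q where p: "p \<in> facs \<phi>" and q: "q \<in> facs \<psi>" and pq: "(ten_pair p q, (a, b)) \<in> frel (\<phi> \<boxtimes> \<psi>)"
        using ten_frel_surj[OF \<phi> \<psi> ab] by blast
      let ?k = "frel \<phi> `` {p}" and ?l = "frel \<psi> `` {q}"
      have k: "?k \<in> ?Q" using p by (rule quotientI)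
      have l: "?l \<in> ?R" using q by (rule quotientI)
      have "p \<in> ?k" "q \<in> ?l" using equiv_class_self[OF frel_equiv p] equiv_class_self[OF frel_equiv q] .
      then have "(?r ?k, p) \<in> frel \<phi>" "(?r ?l, q) \<in> frel \<psi>"
        using some_in_class(2)[OF k] some_in_class(2)[OF l] by blast+
      from ten_frel[OF this] have "(?x (?k, ?l), ten_pair p q) \<in> frel (\<phi> \<boxtimes> \<psi>)" by simp
      then have "(?x (?k, ?l), (a, b)) \<in> frel (\<phi> \<boxtimes> \<psi>)"
        using pq frel_equiv by (meson equivE transE)
      then show ?thesis using k l by blast
    qed
    show "i = j" if ij: "i \<in> ?Q \<times> ?R" "j \<in> ?Q \<times> ?R" and r: "(?x i, ?x j) \<in> frel (\<phi> \<boxtimes> \<psi>)" for i j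
    proof -
      have i: "fst i \<in> ?Q" "snd i \<in> ?R" and j: "fst j \<in> ?Q" "snd j \<in> ?R" using ij by auto
      note m = some_in_class(1)[OF i(1)] some_in_class(1)[OF j(1)] some_in_class(1)[OF i(2)] some_in_class(1)[OF j(2)]
      show ?thesis
        using frel_classes_eq[OF i(1) j(1) ten_frel_inject(1)[OF m r]] frel_classes_eq[OF i(2) j(2) ten_frel_inject(2)[OF m r]]
        by (rule prod_eqI)
    qed
  qed
  also have "\<dots> = (\<Sum>k\<in>#mset_set ?Q. image_mset (\<lambda>l. class_pair (?x (k, l))) (mset_set ?R))"
  proof -
    have "image_mset h (mset_set (A \<times> B)) = (\<Sum>k\<in>#mset_set A. image_mset (\<lambda>l. h (k, l)) (mset_set B))"
      if "finite A" "finite B" for A :: "('m \<times> 'm) set set" and B :: "('m \<times> 'm) set set" and h :: "_ \<Rightarrow> 'm set \<times> 'm set"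
      using that(1)
    proof (induction A rule: finite_induct)
      case (insert x A)
      have "insert x A \<times> B = Pair x ` B \<union> A \<times> B" by auto
      moreover have "mset_set (Pair x ` B \<union> A \<times> B) = mset_set (Pair x ` B) + mset_set (A \<times> B)"
        using insert that(2) by (intro mset_set_Union) auto
      moreover have "mset_set (Pair x ` B) = image_mset (Pair x) (mset_set B)"
        by (rule image_mset_mset_set[symmetric]) (simp add: inj_on_def)
      ultimately show ?case using insert by (simp add: image_mset.compositionality comp_def)
    qed simp
    then show ?thesis using fQ fR by simp
  qed
  also have "\<dots> = (\<Sum>k\<in>#mset_set ?Q. image_mset (\<lambda>l. (class_mult F (fst (class_pair (?r k))) (fst (class_pair (?r l))),
      class_mult F (snd (class_pair (?r k))) (snd (class_pair (?r l))))) (mset_set ?R))"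
  proof (intro arg_cong[of _ _ sum_mset] image_mset_cong)
    fix k l assume "k \<in># mset_set ?Q" "l \<in># mset_set ?R"
    then have kl: "k \<in> ?Q" "l \<in> ?R" using fQ fR by auto
    obtain a b c d where ab: "?r k = (a, b)" "?r l = (c, d)" by (cases "?r k", cases "?r l")
    have "(a, b) \<in> facs \<phi>" "(c, d) \<in> facs \<psi>" using some_in_class(1)[OF kl(1)] some_in_class(1)[OF kl(2)] ab by auto
    from factD(1,2)[OF this(1)] factD(1,2)[OF this(2)]
    show "class_pair (?x (k, l)) = (class_mult F (fst (class_pair (?r k))) (fst (class_pair (?r l))),
      class_mult F (snd (class_pair (?r k))) (snd (class_pair (?r l))))"
      by (simp add: ab class_pair_def class_mult_class)
  qed
  finally show ?thesis by (simp add: fact_classes_def image_mset.compositionality comp_def)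
qed

text \<open>
  Splitting the inverse of \<open>\<phi> \<otimes> \<psi>\<close> exhibits \<open>\<phi>\<close> and \<open>\<psi>\<close> as left factors of identities.
\<close>
lemma ten_iso_iff:
  assumes agl: "almost_group_like_identities F" and \<phi>: "\<phi> \<in> Arr F" and \<psi>: "\<psi> \<in> Arr F"
  shows "is_iso F (\<phi> \<boxtimes> \<psi>) \<longleftrightarrow> is_iso F \<phi> \<and> is_iso F \<psi>"
proof
  assume "is_iso F \<phi> \<and> is_iso F \<psi>"
  then show "is_iso F (\<phi> \<boxtimes> \<psi>)" using ten_iso_hom is_iso_iff iso_hom_is_iso by blast
next
  assume i: "is_iso F (\<phi> \<boxtimes> \<psi>)"
  let ?X = "Dom F \<phi>" and ?X' = "Dom F \<psi>" and ?Y = "Cod F \<phi>" and ?Y' = "Cod F \<psi>"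
  have i: "\<phi> \<boxtimes> \<psi> \<in> iso_hom F (?X \<odot> ?X') (?Y \<odot> ?Y')" using i \<phi> \<psi> is_iso_iff[of "\<phi> \<boxtimes> \<psi>"] by simp
  let ?\<chi> = "inv_arr F (\<phi> \<boxtimes> \<psi>)"
  note [simp] = \<phi> \<psi> iso_homD[OF i]
  have "?\<chi> \<in> Hom F (?Y \<odot> ?Y') (?X \<odot> ?X')" by (auto intro!: HomI)
  then obtain Z1 Z2 \<alpha> \<gamma> \<sigma> where a: "\<alpha> \<in> Hom F Z1 ?X" "\<gamma> \<in> Hom F Z2 ?X'"
    and s: "\<sigma> \<in> iso_hom F (?Y \<odot> ?Y') (Z1 \<odot> Z2)" and e: "?\<chi> = (\<alpha> \<boxtimes> \<gamma>) \<bullet> \<sigma>"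
    using split[of ?\<chi> "?Y \<odot> ?Y'" ?X ?X'] by auto
  note [simp] = a[unfolded Hom_def, simplified] iso_homD[OF s]
  have "((\<phi> \<bullet> \<alpha>) \<boxtimes> (\<psi> \<bullet> \<gamma>)) \<bullet> \<sigma> = (\<phi> \<boxtimes> \<psi>) \<bullet> ?\<chi>" unfolding e by simp
  then have e': "((\<phi> \<bullet> \<alpha>) \<boxtimes> (\<psi> \<bullet> \<gamma>)) \<bullet> \<sigma> = Ide F ?Y \<boxtimes> Ide F ?Y'" by simp
  have h: "Ide F ?Y \<in> Hom F ?Y ?Y" "Ide F ?Y' \<in> Hom F ?Y' ?Y'" "\<phi> \<bullet> \<alpha> \<in> Hom F Z1 ?Y" "\<psi> \<bullet> \<gamma> \<in> Hom F Z2 ?Y'"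
    by (auto intro!: HomI)
  obtain \<sigma>1 \<sigma>2 where s1: "\<sigma>1 \<in> iso_hom F ?Y Z1" and s2: "\<sigma>2 \<in> iso_hom F ?Y' Z2"
    and se: "(\<phi> \<bullet> \<alpha>) \<bullet> \<sigma>1 = Ide F ?Y" "(\<psi> \<bullet> \<gamma>) \<bullet> \<sigma>2 = Ide F ?Y'" using split_unique[OF h s e'] by blast
  note [simp] = iso_homD[OF s1] iso_homD[OF s2]
  have "(\<phi>, \<alpha> \<bullet> \<sigma>1) \<in> facs (Ide F ?Y)" "(\<psi>, \<gamma> \<bullet> \<sigma>2) \<in> facs (Ide F ?Y')"
    using se by (auto simp: factorizations_def)
  then show "is_iso F \<phi> \<and> is_iso F \<psi>"
    using agl cod_obj[OF \<phi>] cod_obj[OF \<psi>] unfolding almost_group_like_identities_def by blast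
qed

end

section \<open>The Hopf property\<close>

locale graded_splitting = tensor_splitting F for F :: "('o, 'm) moncat" (structure) +
  fixes deg :: "'m \<Rightarrow> int"
  assumes fin: "factorization_finite F" and agl: "almost_group_like_identities F"
    and deg: "degree_function F deg" and definite: "definite_degree F deg"
begin

text \<open>
  All degrees have the same sign, so their absolute values are additive as well.
\<close>
definition class_deg :: "'m set \<Rightarrow> nat" where
  "class_deg c = nat \<bar>deg (SOME f. f \<in> c)\<bar>"

lemma deg_comp: "f \<in> Arr F \<Longrightarrow> g \<in> Arr F \<Longrightarrow> Cod F f = Dom F g \<Longrightarrow> deg (g \<bullet> f) = deg g + deg f"
  and deg_ten: "f \<in> Arr F \<Longrightarrow> g \<in> Arr F \<Longrightarrow> deg (f \<boxtimes> g) = deg f + deg g"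
  and deg_iso: "is_iso F f \<Longrightarrow> deg f = 0"
  using deg by (auto simp: degree_function_def)

lemma deg_arr_iso:
  assumes "f \<in> Arr F" "g \<in> Arr F" "arr_iso F f g"
  shows "deg f = deg g"
proof -
  obtain \<sigma> \<sigma>' where s: "\<sigma> \<in> iso_hom F (Dom F f) (Dom F g)" "\<sigma>' \<in> iso_hom F (Cod F f) (Cod F g)"
    and e: "\<sigma>' \<bullet> f = g \<bullet> \<sigma>" using assms arr_iso_iff by blast
  have "deg (\<sigma>' \<bullet> f) = deg f" "deg (g \<bullet> \<sigma>) = deg g"
    using assms iso_homD[OF s(1)] iso_homD[OF s(2)] deg_iso[OF iso_hom_is_iso[OF s(1)]] deg_iso[OF iso_hom_is_iso[OF s(2)]]
    by (simp_all add: deg_comp)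
  then show ?thesis using e by simp
qed

lemma class_deg_class: "f \<in> Arr F \<Longrightarrow> class_deg (cl f) = nat \<bar>deg f\<bar>"
  using deg_arr_iso[OF _ class_some(1) class_some(3)] by (simp add: class_deg_def)

lemma abs_deg_add: "f \<in> Arr F \<Longrightarrow> g \<in> Arr F \<Longrightarrow> nat \<bar>deg f + deg g\<bar> = nat \<bar>deg f\<bar> + nat \<bar>deg g\<bar>"
proof -
  assume "f \<in> Arr F" "g \<in> Arr F"
  then have "(deg f \<ge> 0 \<and> deg g \<ge> 0) \<or> (deg f \<le> 0 \<and> deg g \<le> 0)" using definite by (auto simp: definite_degree_def)
  then show ?thesis by linarith
qed

abbreviation "KF \<equiv> cl ` Arr F"
definition DeltaF :: "'m set \<Rightarrow> ('m set \<times> 'm set) multiset" where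
  "DeltaF c = fact_classes (SOME f. f \<in> c)"

lemma DeltaF_class: "f \<in> Arr F \<Longrightarrow> DeltaF (cl f) = fact_classes f"
  unfolding DeltaF_def using fact_classes_iso[OF fin _ _ class_some(3)] class_some(1) by metis

lemma fact_classes_mem:
  assumes "p \<in># fact_classes f" "f \<in> Arr F"
  obtains a b where "(a, b) \<in> facs f" "p = (cl a, cl b)"
proof -
  obtain k where k: "k \<in> facs f // frel f" "p = class_pair (SOME p. p \<in> k)"
    using assms finite_fact_classes[OF fin assms(2)] by (auto simp: fact_classes_def)
  then show ?thesis using that some_in_class(1)[OF k(1)]
    by (cases "SOME p. p \<in> k") (simp add: class_pair_def)
qed

lemma ide_ten_iso: "\<phi> \<in> Arr F \<Longrightarrow> \<psi> \<in> Arr F \<Longrightarrow> X \<in> Obj F \<Longrightarrow>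
    is_iso F (\<phi> \<boxtimes> (Ide F X \<boxtimes> \<psi>)) \<longleftrightarrow> is_iso F (\<phi> \<boxtimes> \<psi>)"
  using ten_iso_iff[OF agl] iso_hom_is_iso[OF ide_iso_hom] by simp

sublocale classes: class_bialgebra_tensor KF "class_mult F" "cl (Ide F (unitO F))" identity_classes DeltaF class_deg "class_coproduct F"
proof (unfold_locales; (elim imageE)?; hypsubst?)
  fix f g h assume f: "f \<in> Arr F" and g: "g \<in> Arr F"
  show "class_mult F (cl f) (cl g) \<in> KF" using f g by (simp add: class_mult_class)
  show "class_deg (class_mult F (cl f) (cl g)) = class_deg (cl f) + class_deg (cl g)"
    using f g by (simp add: class_mult_class class_deg_class deg_ten abs_deg_add)
  show "DeltaF (class_mult F (cl f) (cl g)) = (\<Sum>p\<in>#DeltaF (cl f). image_mset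
      (\<lambda>q. (class_mult F (fst p) (fst q), class_mult F (snd p) (snd q))) (DeltaF (cl g)))"
    using f g fact_classes_ten[OF fin f g] by (simp add: class_mult_class DeltaF_class)
  show "class_mult F (class_mult F (cl f) (cl g)) (cl h) = class_mult F (cl f) (class_mult F (cl g) (cl h))" if "h \<in> Arr F"
    using f g that by (simp add: class_mult_class class_assoc)
  show "class_mult F (cl f) (class_mult F x (cl g)) \<in> identity_classes \<longleftrightarrow> class_mult F (cl f) (cl g) \<in> identity_classes"
    if "x \<in> identity_classes" for x
  proof -
    from that obtain X where X: "X \<in> Obj F" "x = cl (Ide F X)" by (auto simp: identity_classes_def)
    then show ?thesis using f g by (simp add: class_mult_class class_identity_iff ide_ten_iso)
  qed
next
  fix f assume f: "f \<in> Arr F"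
  show "class_mult F (cl (Ide F (unitO F))) (cl f) = cl f" "class_mult F (cl f) (cl (Ide F (unitO F))) = cl f"
    using f by (simp_all add: class_mult_class class_unit)
  show "fst p \<in> KF \<and> snd p \<in> KF" "class_deg (cl f) = class_deg (fst p) + class_deg (snd p)" if p: "p \<in># DeltaF (cl f)" for p
  proof -
    obtain a b where ab: "(a, b) \<in> facs f" "p = (cl a, cl b)"
      using fact_classes_mem[of p f] p f by (auto simp: DeltaF_class)
    note [simp] = factD(1-3)[OF ab(1)]
    show "fst p \<in> KF \<and> snd p \<in> KF" using ab by simp
    show "class_deg (cl f) = class_deg (fst p) + class_deg (snd p)"
      using ab factD(4)[OF ab(1)] deg_comp[of b a] abs_deg_add[of a b] f by (simp add: class_deg_class)
  qed
  show "image_mset fst (filter_mset (\<lambda>p. snd p \<in> identity_classes) (DeltaF (cl f))) = {#cl f#}"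
    "image_mset snd (filter_mset (\<lambda>p. fst p \<in> identity_classes) (DeltaF (cl f))) = {#cl f#}"
    using fact_classes_counit[OF fin f] f by (simp_all add: DeltaF_class)
  show "class_coproduct F (cl f) = (\<Sum>p\<in>#DeltaF (cl f). frag_of [frag_of (fst p), frag_of (snd p)])"
    by (simp add: class_coproduct_def DeltaF_def fact_classes_def sum_unfold_sum_mset image_mset.compositionality
        comp_def Let_def class_pair_def case_prod_beta)
next
  show "identity_classes \<subseteq> KF" by (auto simp: identity_classes_def)
  show "cl (Ide F (unitO F)) \<in> identity_classes" by (auto simp: identity_classes_def)
  fix x assume "x \<in> identity_classes"
  then obtain X where X: "X \<in> Obj F" "x = cl (Ide F X)" by (auto simp: identity_classes_def)
  then show "DeltaF x = {#(x, x)#}" using fact_classes_ide[OF agl X(1)] by (simp add: DeltaF_class)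
  show "class_deg x = 0" using X deg_iso[OF iso_hom_is_iso[OF ide_iso_hom]] by (simp add: class_deg_class)
qed

lemma B_iso_eq: "B_iso F = classes.BR KF"
  by (simp add: B_iso_def class_span_def classes.BR_def classes.mul_def fun_eq_iff)

lemma B0_iso_eq: "B0_iso F deg = classes.BR {c \<in> KF. class_deg c = 0}"
proof -
  have "cl ` {\<phi> \<in> Arr F. deg \<phi> = 0} = {c \<in> KF. class_deg c = 0}" by (auto simp: class_deg_class)
  then show ?thesis
    by (simp add: B0_iso_def class_span_def classes.BR_def classes.mul_def fun_eq_iff)
qed

lemma id_ideal_eq: "id_ideal F = classes.I"
proof -
  have "{frag_of (cl (Ide F X)) - frag_of (cl (Ide F Y)) | X Y. X \<in> Obj F \<and> Y \<in> Obj F}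
      = {frag_of x - frag_of y | x y. x \<in> identity_classes \<and> y \<in> identity_classes}"
    unfolding identity_classes_def by blast
  then show ?thesis unfolding id_ideal_def B_iso_eq classes.I_eq_genideal[symmetric] by simp
qed

lemma epsilon_eq: "epsilon_iso F = classes.eps"
proof
  show "epsilon_iso F x = classes.eps x" for x
    unfolding epsilon_iso_def classes.eps_def by (simp add: identity_classes_def)
qed

theorem hopf:
  assumes co: "coassociative (B_iso F) (Delta_iso F)"
    and con: "connected_coalgebra (B0_iso F deg Quot id_ideal0 F deg)
       (quot_coproduct (B0_iso F deg) (id_ideal0 F deg) (Delta_iso F)) (quot_counit (epsilon_iso F))"
  shows "hopf_feynman F"
proof -
  have I0: "id_ideal0 F deg = classes.I0"
    by (simp add: id_ideal0_def classes.I0_def id_ideal_eq B0_iso_eq)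
  show ?thesis
    using classes.antipode_exists[OF co[unfolded B_iso_eq Delta_iso_def] con[unfolded I0 B0_iso_eq epsilon_eq Delta_iso_def]]
      fin agl
    unfolding hopf_feynman_def B_iso_eq id_ideal_eq epsilon_eq Delta_iso_def by blast
qed

end

theorem theorem1p37:
  fixes V :: "('v, 'a) cat" and F :: "('o, 'm) moncat"
    and \<iota> :: "('v, 'a, 'o, 'm) ftor" and deg :: "'m \<Rightarrow> int"
  assumes feynman: "(\<exists>\<beta>. feynman_category TYPE('u) V F \<beta> \<iota>) \<or>
      nonsigma_feynman_category TYPE('u) V F \<iota>"
    and bialgebra_coassoc: "coassociative (B_iso F) (Delta_iso F)"
    and deg: "degree_function F deg" "definite_degree F deg"
    and connected: "almost_connected F deg"
  shows "hopf_feynman F"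
proof -
  have "graded_splitting F deg"
    using feynman_splitting[OF feynman] deg connected
    by (simp add: graded_splitting_def graded_splitting_axioms_def almost_connected_def)
  then show ?thesis
    using graded_splitting.hopf[of F deg] bialgebra_coassoc connected by (simp add: almost_connected_def)
qed

end
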